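(* Let $K$ be a commutative ring, $P=K[x_a]_a$ a polynomial ring, $I\subseteq P$ an ideal, $A=P/I$, and let $\{f_b\}_b\subseteq I$ be polynomials whose classes generate $I/I^2$. Let $\mathcal T^{(2)}$ be the second stage of the Tate model of the multiplication map $A^{\mathrm{ev}}=A\otimes_KA\to A$ with generators $\mathbf dx_a$ in degree $1$ and $\mathbf df_b$ in degree $2$, constructed from finite presentations $f_b(\mathbf x)=\sum_{\mathbf a=(a_1,\dots,a_k)}\alpha_{\mathbf a}x_{a_1}\cdots x_{a_k}\in P$, $\alpha_{\mathbf a}\in K$, as sums of ordered monomials. Then the algebra homomorphism $\Phi^{(2)}:\mathcal T^{(2)}\to\mathcal T^{(2)}\otimes_A\mathcal T^{(2)}$ that extends $\Phi^{(1)}$ by means of $$\Phi_2(\mathbf df_b)=\mathbf df_b'+\mathbf df_b''-\sum_{\mathbf a=(a_1,\dots,a_k)}\ \sum_{1\le\kappa<\lambda\le k}\alpha_{\mathbf a}\,x'_{a_1}\cdots x'_{a_{\kappa-1}}\,\mathbf dx'_{a_\kappa}\,x_{a_{\kappa+1}}\cdots x_{a_{\lambda-1}}\,\mathbf dx''_{a_\lambda}\,x''_{a_{\lambda+1}}\cdots x''_{a_k}$$ defines a co-unital diagonal approximation.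
   Context: Construction of $\mathcal T^{(2)}$: write $x'=x\otimes1$ and $x''=1\otimes x$ in $A^{\mathrm{ev}}$. Let $F_1$ be the free $A^{\mathrm{ev}}$-module on symbols $\mathbf dx_a$ (degree $1$) and $F_2$ the free $A^{\mathrm{ev}}$-module on symbols $\mathbf df_b$ (degree $2$). Then $\mathcal T^{(1)}=\bigwedge_{A^{\mathrm{ev}}}F_1$ and $\mathcal T^{(2)}=\bigwedge_{A^{\mathrm{ev}}}F_1\otimes_{A^{\mathrm{ev}}}\Gamma_{A^{\mathrm{ev}}}F_2$ ($\Gamma$ the divided power algebra), with the $A^{\mathrm{ev}}$-linear algebra differential compatible with divided powers determined by $\partial\mathbf dx_a=x''_a-x'_a$ and $$\partial(\mathbf df_b)=\sum_{\mathbf a}\sum_{\kappa=1}^k\alpha_{\mathbf a}x'_{a_1}\cdots x'_{a_{\kappa-1}}\,\mathbf dx_{a_\kappa}\,x''_{a_{\kappa+1}}\cdots x''_{a_k},$$ using the chosen presentation of $f_b$. The augmentation $\epsilon:\mathcal T^{(2)}\to A$ is the multiplication map in degree $0$ and zero in positive degrees. Tensor product: $\mathcal T^{(2)}\otimes_A\mathcal T^{(2)}$ (right structure of the first factor, left structure of the second) is a strictly graded commutative DG algebra with divided powers, with degree zero part $A^{\otimes3}=A\otimes_KA\otimes_KA$. In it, $\mathbf dx'_a=\mathbf dx_a\otimes1$, $\mathbf dx''_a=1\otimes\mathbf dx_a$, $\mathbf df'_b=\mathbf df_b\otimes1$, $\mathbf df''_b=1\otimes\mathbf df_b$, and $x'=x\otimes1\otimes1$,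 $x=1\otimes x\otimes1$, $x''=1\otimes1\otimes x$ in $A^{\otimes3}$. It is an $A^{\mathrm{ev}}$-complex through the outer structures, i.e. via $\Phi^{(0)}:A^{\mathrm{ev}}\to A^{\otimes3}$, $\Phi^{(0)}(a\otimes b)=a\otimes1\otimes b$. $\Phi^{(1)}:\mathcal T^{(1)}\to\mathcal T^{(1)}\otimes_A\mathcal T^{(1)}$ is the homomorphism of graded algebras with $\Phi^{(1)}(a\otimes b)=a\otimes1\otimes b$ and $\Phi^{(1)}(\mathbf dx_a)=\mathbf dx'_a+\mathbf dx''_a$. Algebra homomorphisms are homomorphisms of strictly graded commutative algebras with divided powers; $\Phi^{(2)}$ is the one restricting to $\Phi^{(1)}$ on $\mathcal T^{(1)}$ and to $\Phi_2$ on the basis of $F_2$. Co-unital diagonal approximation: for an $A^{\mathrm{ev}}$-complex $\mathcal A$ with augmentation $\epsilon:\mathcal A\to A$, a morphism of $A^{\mathrm{ev}}$-complexes $\Phi:\mathcal A\to\mathcal A\otimes_A\mathcal A$ with $(\epsilon\otimes\mathcal A)\Phi=\mathrm{id}=(\mathcal A\otimes\epsilon)\Phi$, identifying $A\otimes_A\mathcal A\cong\mathcal A\cong\mathcal A\otimes_AA$. *)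

theory Defs
  imports "HOL-Algebra.QuotRing" "HOL-Algebra.Ideal_Product" "HOL-Algebra.Free_Abelian_Groups" "HOL-Library.Multiset"
begin

section \<open>Algebras with a basis\<close>

definition coeff_support :: "('r, 'c) ring_scheme \<Rightarrow> ('m \<Rightarrow> 'r) \<Rightarrow> 'm set" where
  "coeff_support R p = {m. p m \<noteq> \<zero>\<^bsub>R\<^esub>}"

text \<open>The free \<open>R\<close>-module with basis \<open>M\<close>, its elements being the finitely supported coefficient
  functions, with the multiplication determined on the basis by
  \<open>u \<cdot> v = c u v \<cdot> (mul u v)\<close> for an integer \<open>c u v\<close>.\<close>

definition basis_algebra ::
    "('r, 'c) ring_scheme \<Rightarrow> 'm set \<Rightarrow> ('m \<Rightarrow> 'm \<Rightarrow> 'm) \<Rightarrow> 'm \<Rightarrow> ('m \<Rightarrow> 'm \<Rightarrow> int) \<Rightarrow> ('m \<Rightarrow> 'r) ring" where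
  "basis_algebra R M mul e c =
    \<lparr>carrier = {p. finite (coeff_support R p) \<and> coeff_support R p \<subseteq> M \<and> range p \<subseteq> carrier R},
     monoid.mult = (\<lambda>p q w. \<Oplus>\<^bsub>R\<^esub>uv\<in>{(u, v). u \<in> coeff_support R p \<and> v \<in> coeff_support R q \<and> mul u v = w}.
                       add_pow R (c (fst uv) (snd uv)) (p (fst uv) \<otimes>\<^bsub>R\<^esub> q (snd uv))),
     one = (\<lambda>u. if u = e then \<one>\<^bsub>R\<^esub> else \<zero>\<^bsub>R\<^esub>),
     ring.zero = (\<lambda>u. \<zero>\<^bsub>R\<^esub>),
     add = (\<lambda>p q u. p u \<oplus>\<^bsub>R\<^esub> q u)\<rparr>"

definition basis_term :: "('r, 'c) ring_scheme \<Rightarrow> 'm \<Rightarrow> 'r \<Rightarrow> ('m \<Rightarrow> 'r)" where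
  "basis_term R m r = (\<lambda>u. if u = m then r else \<zero>\<^bsub>R\<^esub>)"

definition mpoly_ring :: "('k, 'c) ring_scheme \<Rightarrow> 'x set \<Rightarrow> ('x multiset \<Rightarrow> 'k) ring" where
  "mpoly_ring K X = basis_algebra K {m. set_mset m \<subseteq> X} (+) {#} (\<lambda>_ _. 1)"

text \<open>The product \<open>x a\<^sub>1 \<cdots> x a\<^sub>k\<close>, in this order, along a word \<open>[a\<^sub>1, \<dots>, a\<^sub>k]\<close>.\<close>

definition word_prod :: "('s, 'c) monoid_scheme \<Rightarrow> ('x \<Rightarrow> 's) \<Rightarrow> 'x list \<Rightarrow> 's" where
  "word_prod S x w = foldr (\<lambda>a y. x a \<otimes>\<^bsub>S\<^esub> y) w \<one>\<^bsub>S\<^esub>"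

text \<open>The conormal module \<open>I/I\<^sup>2\<close> is the ideal \<open>I/I\<^sup>2\<close> of the ring \<open>R/I\<^sup>2\<close>.\<close>

definition classes_generate_conormal :: "('r, 'c) ring_scheme \<Rightarrow> 'r set \<Rightarrow> 'r set \<Rightarrow> bool" where
  "classes_generate_conormal R I F \<longleftrightarrow>
    genideal (R Quot ideal_prod R I I) ((\<lambda>g. ideal_prod R I I +>\<^bsub>R\<^esub> g) ` F)
      = (\<lambda>g. ideal_prod R I I +>\<^bsub>R\<^esub> g) ` I"


section \<open>The exterior algebra tensored with the divided power algebra\<close>

text \<open>A total order on the indices is needed only to write down a basis of an exterior algebra.\<close>

definition index_less :: "'x \<Rightarrow> 'x \<Rightarrow> bool" where
  "index_less a c \<longleftrightarrow> (a, c) \<in> (SOME r. well_order_on UNIV r) \<and> a \<noteq> c"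

text \<open>The algebra \<open>\<And>\<^sub>R F\<^sub>1 \<otimes>\<^sub>R \<Gamma>\<^sub>R F\<^sub>2\<close> for the free modules \<open>F\<^sub>1\<close>, \<open>F\<^sub>2\<close> on symbols \<open>dx\<^sub>a\<close>
  (\<open>a \<in> X\<close>) and \<open>df\<^sub>b\<close> (\<open>b \<in> B\<close>) is free over \<open>R\<close> on the elements
  \<open>dx\<^sub>s\<^sub>1 \<cdots> dx\<^sub>s\<^sub>r \<cdot> \<Prod>\<^sub>b df\<^sub>b\<^sup>(\<^sup>n\<^sup>b\<^sup>)\<close> with \<open>s\<^sub>1 < \<dots> < s\<^sub>r\<close>. Such an element is encoded
  by the set \<open>{s\<^sub>1, \<dots>, s\<^sub>r}\<close> and the multiset containing each \<open>b\<close> exactly \<open>n\<^sub>b\<close> times. The sign is that of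
  the shuffle sorting a product of two exterior monomials, and the binomial coefficients come from
  \<open>df\<^sup>(\<^sup>m\<^sup>) df\<^sup>(\<^sup>n\<^sup>) = (m + n choose m) df\<^sup>(\<^sup>m\<^sup>+\<^sup>n\<^sup>)\<close>.\<close>

definition tate_coeff :: "'x set \<times> 'b multiset \<Rightarrow> 'x set \<times> 'b multiset \<Rightarrow> int" where
  "tate_coeff u v =
    (if fst u \<inter> fst v = {}
     then (-1) ^ card {(a, c). a \<in> fst u \<and> c \<in> fst v \<and> index_less c a}
          * int (\<Prod>b\<in>set_mset (snd u). (count (snd u) b + count (snd v) b) choose count (snd u) b)
     else 0)"

definition tate_algebra ::
    "('r, 'c) ring_scheme \<Rightarrow> 'x set \<Rightarrow> 'b set \<Rightarrow> ('x set \<times> 'b multiset \<Rightarrow> 'r) ring" where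
  "tate_algebra R X B =
    basis_algebra R {(S, \<nu>). finite S \<and> S \<subseteq> X \<and> set_mset \<nu> \<subseteq> B}
      (\<lambda>u v. (fst u \<union> fst v, snd u + snd v)) ({}, {#}) tate_coeff"

definition tate_degree :: "'x set \<times> 'b multiset \<Rightarrow> nat" where
  "tate_degree m = card (fst m) + 2 * size (snd m)"


section \<open>Tensor products\<close>

text \<open>\<open>S \<otimes>\<^sub>C T\<close> for rings \<open>S\<close>, \<open>T\<close> that are regarded as a right, respectively left, \<open>C\<close>-module
  through maps \<open>\<phi> : C \<rightarrow> S\<close> and \<open>\<psi> : C \<rightarrow> T\<close>: the free abelian group on all pairs modulo the
  subgroup generated by the bilinearity and balancing relations.\<close>

definition tensor_relations ::
    "('c, 'i) ring_scheme \<Rightarrow> ('c \<Rightarrow> 's) \<Rightarrow> ('s, 'j) ring_scheme \<Rightarrow> ('c \<Rightarrow> 't) \<Rightarrow> ('t, 'l) ring_scheme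
      \<Rightarrow> ('s \<times> 't \<Rightarrow>\<^sub>0 int) set" where
  "tensor_relations C \<phi> S \<psi> T =
     {frag_of (s \<oplus>\<^bsub>S\<^esub> s', t) - frag_of (s, t) - frag_of (s', t) | s s' t.
        s \<in> carrier S \<and> s' \<in> carrier S \<and> t \<in> carrier T}
   \<union> {frag_of (s, t \<oplus>\<^bsub>T\<^esub> t') - frag_of (s, t) - frag_of (s, t') | s t t'.
        s \<in> carrier S \<and> t \<in> carrier T \<and> t' \<in> carrier T}
   \<union> {frag_of (s \<otimes>\<^bsub>S\<^esub> \<phi> c, t) - frag_of (s, \<psi> c \<otimes>\<^bsub>T\<^esub> t) | s c t.
        s \<in> carrier S \<and> c \<in> carrier C \<and> t \<in> carrier T}"

definition tensor_kernel ::
    "('c, 'i) ring_scheme \<Rightarrow> ('c \<Rightarrow> 's) \<Rightarrow> ('s, 'j) ring_scheme \<Rightarrow> ('c \<Rightarrow> 't) \<Rightarrow> ('t, 'l) ring_scheme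
      \<Rightarrow> ('s \<times> 't \<Rightarrow>\<^sub>0 int) set" where
  "tensor_kernel C \<phi> S \<psi> T =
    generate (free_Abelian_group (carrier S \<times> carrier T)) (tensor_relations C \<phi> S \<psi> T)"

definition tensor_class ::
    "('c, 'i) ring_scheme \<Rightarrow> ('c \<Rightarrow> 's) \<Rightarrow> ('s, 'j) ring_scheme \<Rightarrow> ('c \<Rightarrow> 't) \<Rightarrow> ('t, 'l) ring_scheme
      \<Rightarrow> ('s \<times> 't \<Rightarrow>\<^sub>0 int) \<Rightarrow> ('s \<times> 't \<Rightarrow>\<^sub>0 int) set" where
  "tensor_class C \<phi> S \<psi> T z =
    tensor_kernel C \<phi> S \<psi> T #>\<^bsub>free_Abelian_group (carrier S \<times> carrier T)\<^esub> z"

definition tensor_group ::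
    "('c, 'i) ring_scheme \<Rightarrow> ('c \<Rightarrow> 's) \<Rightarrow> ('s, 'j) ring_scheme \<Rightarrow> ('c \<Rightarrow> 't) \<Rightarrow> ('t, 'l) ring_scheme
      \<Rightarrow> ('s \<times> 't \<Rightarrow>\<^sub>0 int) set monoid" where
  "tensor_group C \<phi> S \<psi> T =
    free_Abelian_group (carrier S \<times> carrier T) Mod tensor_kernel C \<phi> S \<psi> T"

text \<open>For a balanced biadditive \<open>f\<close> with values in the abelian group \<open>H\<close> (written multiplicatively),
  \<open>tensor_lift H f\<close> is the homomorphism from the tensor product to \<open>H\<close> with
  \<open>s \<otimes> t \<mapsto> f (s, t)\<close>.\<close>

definition frag_eval :: "('h, 'i) monoid_scheme \<Rightarrow> ('a \<Rightarrow> 'h) \<Rightarrow> ('a \<Rightarrow>\<^sub>0 int) \<Rightarrow> 'h" where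
  "frag_eval H f z =
    (\<Otimes>\<^bsub>H\<^esub>k\<in>Poly_Mapping.keys z. f k [^]\<^bsub>H\<^esub> Poly_Mapping.lookup z k)"

definition tensor_lift :: "('h, 'i) monoid_scheme \<Rightarrow> ('a \<Rightarrow> 'h) \<Rightarrow> ('a \<Rightarrow>\<^sub>0 int) set \<Rightarrow> 'h" where
  "tensor_lift H f Z = the_elem (frag_eval H f ` Z)"

text \<open>The ring structure on \<open>S \<otimes>\<^sub>C T\<close> in which the product of the pure tensors \<open>p\<close> and \<open>q\<close> is the
  class of \<open>\<mu> p q\<close>.\<close>

definition tensor_ring ::
    "('c, 'i) ring_scheme \<Rightarrow> ('c \<Rightarrow> 's) \<Rightarrow> ('s, 'j) ring_scheme \<Rightarrow> ('c \<Rightarrow> 't) \<Rightarrow> ('t, 'l) ring_scheme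
      \<Rightarrow> ('s \<times> 't \<Rightarrow> 's \<times> 't \<Rightarrow> ('s \<times> 't \<Rightarrow>\<^sub>0 int)) \<Rightarrow> ('s \<times> 't \<Rightarrow>\<^sub>0 int) set ring" where
  "tensor_ring C \<phi> S \<psi> T \<mu> =
    \<lparr>carrier = carrier (tensor_group C \<phi> S \<psi> T),
     monoid.mult = (\<lambda>Y Z. tensor_lift (tensor_group C \<phi> S \<psi> T)
               (\<lambda>p. tensor_lift (tensor_group C \<phi> S \<psi> T)
                 (\<lambda>q. tensor_class C \<phi> S \<psi> T (\<mu> p q)) Z) Y),
     one = tensor_class C \<phi> S \<psi> T (frag_of (\<one>\<^bsub>S\<^esub>, \<one>\<^bsub>T\<^esub>)),
     ring.zero = \<one>\<^bsub>tensor_group C \<phi> S \<psi> T\<^esub>,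
     add = monoid.mult (tensor_group C \<phi> S \<psi> T)\<rparr>"


section \<open>Divided powers\<close>

text \<open>Divided powers \<open>\<gamma> n u = u\<^sup>(\<^sup>n\<^sup>)\<close> on a strictly graded commutative algebra \<open>S\<close> with homogeneous
  components \<open>gr n\<close>. They are defined on homogeneous elements of positive even degree only; no
  condition is imposed on the other values of \<open>\<gamma>\<close>.\<close>

definition divided_powers ::
    "('s, 'c) ring_scheme \<Rightarrow> (nat \<Rightarrow> 's set) \<Rightarrow> (nat \<Rightarrow> 's \<Rightarrow> 's) \<Rightarrow> bool" where
  "divided_powers S gr \<gamma> \<longleftrightarrow>
    (\<forall>i>0. \<forall>u\<in>gr (2 * i).
       (\<forall>n. \<gamma> n u \<in> gr (2 * i * n)) \<and> \<gamma> 0 u = \<one>\<^bsub>S\<^esub> \<and> \<gamma> 1 u = u \<and>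
       (\<forall>m n. \<gamma> m u \<otimes>\<^bsub>S\<^esub> \<gamma> n u = add_pow S ((m + n) choose m) (\<gamma> (m + n) u)) \<and>
       (\<forall>m. \<forall>n>0. \<gamma> m (\<gamma> n u) = add_pow S (fact (m * n) div (fact m * fact n ^ m) :: nat) (\<gamma> (m * n) u)) \<and>
       (\<forall>v\<in>gr (2 * i). \<forall>n. \<gamma> n (u \<oplus>\<^bsub>S\<^esub> v) = (\<Oplus>\<^bsub>S\<^esub>j\<in>{..n}. \<gamma> j u \<otimes>\<^bsub>S\<^esub> \<gamma> (n - j) v)) \<and>
       (\<forall>j. \<forall>v\<in>gr (2 * j). \<forall>n. \<gamma> n (v \<otimes>\<^bsub>S\<^esub> u) = (v [^]\<^bsub>S\<^esub> n) \<otimes>\<^bsub>S\<^esub> \<gamma> n u)) \<and>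
    (\<forall>i j. \<forall>u\<in>gr (2 * i + 1). \<forall>v\<in>gr (2 * j + 1). \<forall>n\<ge>2. \<gamma> n (u \<otimes>\<^bsub>S\<^esub> v) = \<zero>\<^bsub>S\<^esub>)"

definition divided_power_hom ::
    "('s, 'c) ring_scheme \<Rightarrow> (nat \<Rightarrow> 's set) \<Rightarrow> (nat \<Rightarrow> 's \<Rightarrow> 's) \<Rightarrow>
     ('t, 'd) ring_scheme \<Rightarrow> (nat \<Rightarrow> 't set) \<Rightarrow> (nat \<Rightarrow> 't \<Rightarrow> 't) \<Rightarrow> ('s \<Rightarrow> 't) \<Rightarrow> bool" where
  "divided_power_hom S gr \<gamma> T gr' \<gamma>' h \<longleftrightarrow>
    h \<in> ring_hom S T \<and> (\<forall>n. h ` gr n \<subseteq> gr' n) \<and>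
    (\<forall>i>0. \<forall>u\<in>gr (2 * i). \<forall>n. h (\<gamma> n u) = \<gamma>' n (h u))"


section \<open>The second stage of the Tate model\<close>

text \<open>\<open>\<alpha> b w\<close> is the coefficient of the ordered monomial \<open>x\<^sub>a\<^sub>1 \<cdots> x\<^sub>a\<^sub>k\<close>, \<open>w = [a\<^sub>1, \<dots>, a\<^sub>k]\<close>, in the
  chosen presentation of \<open>f\<^sub>b\<close>.\<close>

locale tate_data =
  fixes K :: "('k, 'm) ring_scheme" and X :: "'x set" and I :: "('x multiset \<Rightarrow> 'k) set"
    and B :: "'b set" and \<alpha> :: "'b \<Rightarrow> 'x list \<Rightarrow> 'k"
begin

definition words :: "'b \<Rightarrow> 'x list set" where
  "words b = {w. \<alpha> b w \<noteq> \<zero>\<^bsub>K\<^esub>}"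

definition P where
  "P = mpoly_ring K X"

definition const :: "'k \<Rightarrow> 'x multiset \<Rightarrow> 'k" where
  "const k = basis_term K {#} k"

definition var :: "'x \<Rightarrow> 'x multiset \<Rightarrow> 'k" where
  "var a = basis_term K {#a#} \<one>\<^bsub>K\<^esub>"

definition presented_poly :: "'b \<Rightarrow> 'x multiset \<Rightarrow> 'k" where
  "presented_poly b = (\<Oplus>\<^bsub>P\<^esub>w\<in>words b. const (\<alpha> b w) \<otimes>\<^bsub>P\<^esub> word_prod P var w)"

definition A where
  "A = P Quot I"

definition scalA where
  "scalA k = I +>\<^bsub>P\<^esub> const k"

definition varA where
  "varA a = I +>\<^bsub>P\<^esub> var a"

definition Aev where
  "Aev = tensor_ring K scalA A scalA A
           (\<lambda>p q. frag_of (fst p \<otimes>\<^bsub>A\<^esub> fst q, snd p \<otimes>\<^bsub>A\<^esub> snd q))"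

definition tensA where
  "tensA a c = tensor_class K scalA A scalA A (frag_of (a, c))"

definition multA where
  "multA = tensor_lift (add_monoid A) (\<lambda>p. fst p \<otimes>\<^bsub>A\<^esub> snd p)"

definition T where
  "T = tate_algebra Aev X B"

definition scalT where
  "scalT r = basis_term Aev ({}, {#}) r"

definition leftT where
  "leftT a = scalT (tensA a \<one>\<^bsub>A\<^esub>)"

definition rightT where
  "rightT a = scalT (tensA \<one>\<^bsub>A\<^esub> a)"

definition dx where
  "dx a = basis_term Aev ({a}, {#}) \<one>\<^bsub>Aev\<^esub>"

definition df_pow where
  "df_pow b n = basis_term Aev ({}, replicate_mset n b) \<one>\<^bsub>Aev\<^esub>"

definition df where
  "df b = df_pow b 1"

definition grT where
  "grT n = {u \<in> carrier T. \<forall>m\<in>coeff_support Aev u. tate_degree m = n}"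

definition evenT where
  "evenT u = (\<lambda>m. if even (tate_degree m) then u m else \<zero>\<^bsub>Aev\<^esub>)"

definition oddT where
  "oddT u = (\<lambda>m. if odd (tate_degree m) then u m else \<zero>\<^bsub>Aev\<^esub>)"

text \<open>The involution acting by \<open>(-1)\<^sup>n\<close> in degree \<open>n\<close>.\<close>

definition signT where
  "signT u = evenT u \<ominus>\<^bsub>T\<^esub> oddT u"

definition diff_df where
  "diff_df b = (\<Oplus>\<^bsub>T\<^esub>w\<in>words b. \<Oplus>\<^bsub>T\<^esub>\<kappa>\<in>{..<length w}.
      leftT (scalA (\<alpha> b w)) \<otimes>\<^bsub>T\<^esub> word_prod T (\<lambda>a. leftT (varA a)) (take \<kappa> w) \<otimes>\<^bsub>T\<^esub>
      dx (w ! \<kappa>) \<otimes>\<^bsub>T\<^esub> word_prod T (\<lambda>a. rightT (varA a)) (drop (Suc \<kappa>) w))"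

text \<open>The derivation extending \<open>dx\<^sub>a \<mapsto> x''\<^sub>a - x'\<^sub>a\<close> and \<open>diff_df\<close> compatibly with divided powers,
  that is, with \<open>\<partial>(df\<^sup>(\<^sup>n\<^sup>)) = \<partial>(df) df\<^sup>(\<^sup>n\<^sup>-\<^sup>1\<^sup>)\<close>, written out on the basis and extended \<open>A\<^sup>e\<^sup>v\<close>-linearly.\<close>

definition diff_basis where
  "diff_basis m =
     (\<Oplus>\<^bsub>T\<^esub>a\<in>fst m. add_pow T ((-1) ^ card {c \<in> fst m. index_less c a} :: int)
        ((rightT (varA a) \<ominus>\<^bsub>T\<^esub> leftT (varA a)) \<otimes>\<^bsub>T\<^esub> basis_term Aev (fst m - {a}, snd m) \<one>\<^bsub>Aev\<^esub>))
     \<oplus>\<^bsub>T\<^esub>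
     (\<Oplus>\<^bsub>T\<^esub>b\<in>set_mset (snd m). add_pow T ((-1) ^ card (fst m) :: int)
        (basis_term Aev (fst m, {#}) \<one>\<^bsub>Aev\<^esub> \<otimes>\<^bsub>T\<^esub> diff_df b \<otimes>\<^bsub>T\<^esub>
         basis_term Aev ({}, snd m - {#b#}) \<one>\<^bsub>Aev\<^esub>))"

definition diffT where
  "diffT u = (\<Oplus>\<^bsub>T\<^esub>m\<in>coeff_support Aev u. scalT (u m) \<otimes>\<^bsub>T\<^esub> diff_basis m)"

definition augT where
  "augT u = multA (u ({}, {#}))"

text \<open>The axioms and the values on the \<open>df\<^sub>b\<close> determine the divided powers of the model on all
  homogeneous elements of positive even degree.\<close>

definition tate_divided_powers where
  "tate_divided_powers \<gamma> \<longleftrightarrow>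
    divided_powers T grT \<gamma> \<and> (\<forall>b\<in>B. \<forall>n. \<gamma> n (df b) = df_pow b n)"

definition dpT where
  "dpT = (SOME \<gamma>. tate_divided_powers \<gamma>)"


subsection \<open>The tensor product over \<open>A\<close> of the model with itself\<close>

text \<open>The product is \<open>(s \<otimes> t) (s' \<otimes> t') = (-1)\<^bsup>|t| |s'|\<^esup> s s' \<otimes> t t'\<close>; the summands below are the
  contributions of the even and the odd part of \<open>s'\<close>.\<close>

definition TT where
  "TT = tensor_ring A rightT T leftT T
          (\<lambda>p q. frag_of (fst p \<otimes>\<^bsub>T\<^esub> evenT (fst q), snd p \<otimes>\<^bsub>T\<^esub> snd q)
               + frag_of (fst p \<otimes>\<^bsub>T\<^esub> oddT (fst q), signT (snd p) \<otimes>\<^bsub>T\<^esub> snd q))"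

definition tensT where
  "tensT s t = tensor_class A rightT T leftT T (frag_of (s, t))"

definition fst_incl where
  "fst_incl s = tensT s \<one>\<^bsub>T\<^esub>"

definition snd_incl where
  "snd_incl t = tensT \<one>\<^bsub>T\<^esub> t"

definition grTT where
  "grTT n = generate (add_monoid TT) {tensT s t | s t i j. s \<in> grT i \<and> t \<in> grT j \<and> i + j = n}"

definition diffTT where
  "diffTT = tensor_lift (add_monoid TT)
     (\<lambda>p. tensT (diffT (fst p)) (snd p) \<oplus>\<^bsub>TT\<^esub> tensT (signT (fst p)) (diffT (snd p)))"

text \<open>The divided powers of the tensor product are those for which both inclusions of \<open>T\<close> preserve
  divided powers. Again this determines them in positive even degree.\<close>

definition tensor_divided_powers where
  "tensor_divided_powers \<gamma> \<longleftrightarrow>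
    divided_powers TT grTT \<gamma> \<and>
    divided_power_hom T grT dpT TT grTT \<gamma> fst_incl \<and>
    divided_power_hom T grT dpT TT grTT \<gamma> snd_incl"

definition dpTT where
  "dpTT = (SOME \<gamma>. tensor_divided_powers \<gamma>)"

text \<open>\<open>\<Phi>\<^sup>(\<^sup>0\<^sup>)\<close>, through which the outer structures make the tensor product an \<open>A\<^sup>e\<^sup>v\<close>-module. The
  degree zero part of the tensor product is \<open>A\<^sup>e\<^sup>v \<otimes>\<^sub>A A\<^sup>e\<^sup>v = A \<otimes>\<^sub>K A \<otimes>\<^sub>K A\<close>, with
  \<open>a \<otimes> c \<otimes> a' = (a \<otimes> c) \<otimes> (1 \<otimes> a')\<close>.\<close>

definition outer where
  "outer = tensor_lift (add_monoid TT) (\<lambda>p. tensT (leftT (fst p)) (rightT (snd p)))"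

text \<open>\<open>\<epsilon> \<otimes> T\<close> and \<open>T \<otimes> \<epsilon>\<close>, followed by the identifications \<open>A \<otimes>\<^sub>A T = T\<close>, \<open>a \<otimes> t = a \<cdot> t\<close>, and
  \<open>T \<otimes>\<^sub>A A = T\<close>, \<open>s \<otimes> a = s \<cdot> a\<close>.\<close>

definition aug_left where
  "aug_left = tensor_lift (add_monoid T) (\<lambda>p. leftT (augT (fst p)) \<otimes>\<^bsub>T\<^esub> snd p)"

definition aug_right where
  "aug_right = tensor_lift (add_monoid T) (\<lambda>p. fst p \<otimes>\<^bsub>T\<^esub> rightT (augT (snd p)))"

definition counital_diagonal_approximation where
  "counital_diagonal_approximation \<Phi> \<longleftrightarrow>
    \<Phi> \<in> carrier T \<rightarrow> carrier TT \<and>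
    (\<forall>u\<in>carrier T. \<forall>v\<in>carrier T. \<Phi> (u \<oplus>\<^bsub>T\<^esub> v) = \<Phi> u \<oplus>\<^bsub>TT\<^esub> \<Phi> v) \<and>
    (\<forall>r\<in>carrier Aev. \<forall>u\<in>carrier T. \<Phi> (scalT r \<otimes>\<^bsub>T\<^esub> u) = outer r \<otimes>\<^bsub>TT\<^esub> \<Phi> u) \<and>
    (\<forall>n. \<Phi> ` grT n \<subseteq> grTT n) \<and>
    (\<forall>u\<in>carrier T. \<Phi> (diffT u) = diffTT (\<Phi> u)) \<and>
    (\<forall>u\<in>carrier T. aug_left (\<Phi> u) = u) \<and>
    (\<forall>u\<in>carrier T. aug_right (\<Phi> u) = u)"

definition Phi_df where
  "Phi_df b =
     (fst_incl (df b) \<oplus>\<^bsub>TT\<^esub> snd_incl (df b)) \<ominus>\<^bsub>TT\<^esub>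
     (\<Oplus>\<^bsub>TT\<^esub>w\<in>words b. \<Oplus>\<^bsub>TT\<^esub>l\<in>{..<length w}. \<Oplus>\<^bsub>TT\<^esub>\<kappa>\<in>{..<l}.
        fst_incl (leftT (scalA (\<alpha> b w))) \<otimes>\<^bsub>TT\<^esub>
        word_prod TT (\<lambda>a. fst_incl (leftT (varA a))) (take \<kappa> w) \<otimes>\<^bsub>TT\<^esub>
        fst_incl (dx (w ! \<kappa>)) \<otimes>\<^bsub>TT\<^esub>
        word_prod TT (\<lambda>a. fst_incl (rightT (varA a))) (take (l - Suc \<kappa>) (drop (Suc \<kappa>) w)) \<otimes>\<^bsub>TT\<^esub>
        snd_incl (dx (w ! l)) \<otimes>\<^bsub>TT\<^esub>
        word_prod TT (\<lambda>a. snd_incl (rightT (varA a))) (drop (Suc l) w))"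

text \<open>The first two value conditions say that \<open>\<Phi>\<close> restricts to \<open>\<Phi>\<^sup>(\<^sup>1\<^sup>)\<close> on the subalgebra generated
  by \<open>A\<^sup>e\<^sup>v\<close> and the \<open>dx\<^sub>a\<close>.\<close>

definition is_Phi where
  "is_Phi \<Phi> \<longleftrightarrow>
    divided_power_hom T grT dpT TT grTT dpTT \<Phi> \<and>
    (\<forall>a\<in>carrier A. \<forall>c\<in>carrier A. \<Phi> (scalT (tensA a c)) = tensT (leftT a) (rightT c)) \<and>
    (\<forall>a\<in>X. \<Phi> (dx a) = fst_incl (dx a) \<oplus>\<^bsub>TT\<^esub> snd_incl (dx a)) \<and>
    (\<forall>b\<in>B. \<Phi> (df b) = Phi_df b)"

end

end

theory Submission
  imports Defs "HOL-Algebra.IntRing"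
begin

text \<open>\<open>T\<close> is free among the strictly graded commutative algebras with divided powers under \<open>A\<^sup>e\<^sup>v\<close>, so
  \<open>\<Phi>\<close> exists and is unique once \<open>T\<close> and \<open>T \<otimes>\<^sub>A T\<close> carry divided powers. Both algebras are free over
  their degree zero parts on the usual monomials, hence quotients of such an algebra over a torsion
  free ring, where \<open>(n + 1) u\<^sup>(\<^sup>n\<^sup>+\<^sup>1\<^sup>) = u u\<^sup>(\<^sup>n\<^sup>)\<close> determines the divided powers, and the divided powers
  descend along the quotient map.

  Compatibility with the differentials and the counits may be checked on the generators. The term
  subtracted in \<open>\<Phi>\<^sub>2(df\<^sub>b)\<close> is a sum of products of an odd element of the first factor with an odd
  element of the second one. The higher divided powers of such a product vanish and both
  augmentations annihilate it, so it does not contribute to the counits, and \<open>\<partial>(u\<^sup>(\<^sup>n\<^sup>+\<^sup>1\<^sup>)) = u\<^sup>(\<^sup>n\<^sup>) \<partial>u\<close> holds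
  for \<open>u = \<Phi>\<^sub>2(df\<^sub>b)\<close>, as it holds for the summands. What remains is \<open>\<partial>\<Phi>\<^sub>2(df\<^sub>b) = \<Phi>(\<partial>df\<^sub>b)\<close>, where the sums over
  the positions in a word telescope; this is an induction along the word.\<close>

text \<open>\<open>K\<close> may have torsion, so divided powers cannot be defined as u^n / n!.
  Moreover \<open>dpT\<close> and \<open>dpTT\<close> are arbitrary solutions of the axioms, and
  nothing can be said about them before a solution is known to exist. The torsion free cover is the
  algebra on the same monomials over the integral monoid ring of the multiplicative monoid of degree
  zero elements. Freeness over the degree zero part is what makes divided powers descend: an element
  of the kernel has all its coefficients in the kernel, and the n-th divided power of a coefficient
  times a monomial carries the n-th power of that coefficient.

  In the tensor product this freeness has to be shown although \<open>A\<close> need not have a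
  basis over \<open>K\<close>. The coefficient at a pair of monomials is therefore extracted by a
  balanced map whose values lie in the degree zero part of the tensor product itself.

  The divided power axioms speak of homogeneous elements only, whereas maps and products are defined
  on all elements. Signs are therefore expressed through the parity involution, and the identities
  are checked on homogeneous elements and extended additively.\<close>

abbreviation int_mult :: "('a, 'm) ring_scheme \<Rightarrow> int \<Rightarrow> 'a \<Rightarrow> 'a" where
  "int_mult R k x \<equiv> add_pow R k x"

notation int_mult (infixr \<open>\<odot>\<index>\<close> 75)

section \<open>Integer multiples and additive maps\<close>

context abelian_group begin

lemma int_mult_closed [simp, intro]: "x \<in> carrier G \<Longrightarrow> (k::int) \<odot> x \<in> carrier G"
  unfolding add_pow_def using group.int_pow_closed[OF a_group, of x k] by simp

lemma int_mult_0 [simp]: "(0::int) \<odot> x = \<zero>"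
  unfolding add_pow_def by (simp add: int_pow_def2)

lemma int_mult_add_left: "x \<in> carrier G \<Longrightarrow> (k + l :: int) \<odot> x = k \<odot> x \<oplus> l \<odot> x"
  unfolding add_pow_def using group.int_pow_mult[OF a_group, of x k l] by simp

lemma int_mult_mult: "x \<in> carrier G \<Longrightarrow> (k * l :: int) \<odot> x = k \<odot> (l \<odot> x)"
  unfolding add_pow_def using group.int_pow_pow[OF a_group, of x l k] by (simp add: mult.commute)

lemma int_mult_add_right:
  "\<lbrakk>x \<in> carrier G; y \<in> carrier G\<rbrakk> \<Longrightarrow> (k::int) \<odot> (x \<oplus> y) = k \<odot> x \<oplus> k \<odot> y"
  unfolding add_pow_def using comm_group.int_pow_distrib[OF a_comm_group, of x y k] by simp

lemma int_mult_uminus: "x \<in> carrier G \<Longrightarrow> (- k :: int) \<odot> x = \<ominus> (k \<odot> x)"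
  unfolding add_pow_def a_inv_def using group.int_pow_neg[OF a_group, of x k] by simp

lemma int_mult_minus_1 [simp]: "x \<in> carrier G \<Longrightarrow> (- 1 :: int) \<odot> x = \<ominus> x"
  using int_mult_uminus[of x 1] by simp

lemma int_mult_minus: "x \<in> carrier G \<Longrightarrow> (k::int) \<odot> (\<ominus> x) = \<ominus> (k \<odot> x)"
  unfolding add_pow_def a_inv_def using group.int_pow_inv[OF a_group, of x k] by simp

text \<open>The coefficients in \<open>divided_powers\<close> are natural multiples, the structure
  constants of \<open>basis_algebra\<close> are integral ones; this passes between the two.\<close>

lemma int_mult_nat: "int n \<odot> x = add_pow G n x"
  unfolding add_pow_def by (simp add: int_pow_int)

lemma finsum_mono_neutral:
  assumes "finite B" "A \<subseteq> B" "\<And>i. i \<in> B - A \<Longrightarrow> f i = \<zero>" "f \<in> A \<rightarrow> carrier G"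
  shows "finsum G f A = finsum G f B"
  using assms by (intro add.finprod_mono_neutral_cong_left) (auto simp: Pi_def, metis DiffI zero_closed)

lemma finsum_int_mult:
  assumes "f \<in> A \<rightarrow> carrier G"
  shows "(k::int) \<odot> finsum G f A = (\<Oplus>i\<in>A. k \<odot> f i)"
  using assms by (induction A rule: infinite_finite_induct)
    (simp_all add: Pi_def int_mult_add_right)

lemma finsum_delta:
  assumes "finite A" "a \<in> A" "f a \<in> carrier G" "\<And>i. i \<in> A \<Longrightarrow> i \<noteq> a \<Longrightarrow> f i = \<zero>"
  shows "finsum G f A = f a"
proof -
  have "finsum G f {a} = finsum G f A"
    using assms by (intro finsum_mono_neutral) auto
  then show ?thesis using assms by simp
qed

end

text \<open>Differentials and coefficient maps are additive without being multiplicative. They are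
  handled as homomorphisms of additive monoids, and ring homomorphisms are reduced to this case by
  \<open>ring_hom_additive\<close>.\<close>

lemma additive_add:
  "\<lbrakk>h \<in> hom (add_monoid R) (add_monoid S); x \<in> carrier R; y \<in> carrier R\<rbrakk>
    \<Longrightarrow> h (x \<oplus>\<^bsub>R\<^esub> y) = h x \<oplus>\<^bsub>S\<^esub> h y"
  by (simp add: hom_def)

lemma additive_closed: "\<lbrakk>h \<in> hom (add_monoid R) (add_monoid S); x \<in> carrier R\<rbrakk> \<Longrightarrow> h x \<in> carrier S"
  by (auto simp: hom_def)

lemma additiveI:
  assumes "\<And>x. x \<in> carrier R \<Longrightarrow> h x \<in> carrier S"
    and "\<And>x y. \<lbrakk>x \<in> carrier R; y \<in> carrier R\<rbrakk> \<Longrightarrow> h (x \<oplus>\<^bsub>R\<^esub> y) = h x \<oplus>\<^bsub>S\<^esub> h y"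
  shows "h \<in> hom (add_monoid R) (add_monoid S)"
  using assms by (auto simp: hom_def)

lemma additive_compose:
  "\<lbrakk>h \<in> hom (add_monoid R) (add_monoid S); k \<in> hom (add_monoid S) (add_monoid U)\<rbrakk>
    \<Longrightarrow> (\<lambda>x. k (h x)) \<in> hom (add_monoid R) (add_monoid U)"
  by (rule additiveI) (simp_all add: additive_closed additive_add)

context
  fixes R S h
  assumes R: "abelian_group R" and S: "abelian_group S" and h: "h \<in> hom (add_monoid R) (add_monoid S)"
begin

interpretation R: abelian_group R by (rule R)
interpretation S: abelian_group S by (rule S)

lemma additive_zero: "h \<zero>\<^bsub>R\<^esub> = \<zero>\<^bsub>S\<^esub>"
  using hom_one[OF h R.a_group S.a_group] by simp

lemma additive_uminus: "x \<in> carrier R \<Longrightarrow> h (\<ominus>\<^bsub>R\<^esub> x) = \<ominus>\<^bsub>S\<^esub> h x"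
  using group_hom.hom_inv[of "add_monoid R" "add_monoid S" h x] h R.a_group S.a_group
  by (simp add: group_hom_def group_hom_axioms_def a_inv_def)

lemma additive_minus:
  "\<lbrakk>x \<in> carrier R; y \<in> carrier R\<rbrakk> \<Longrightarrow> h (x \<ominus>\<^bsub>R\<^esub> y) = h x \<ominus>\<^bsub>S\<^esub> h y"
  by (simp add: a_minus_def additive_add[OF h] additive_uminus)

lemma additive_int_mult: "x \<in> carrier R \<Longrightarrow> h (add_pow R (k::int) x) = add_pow S k (h x)"
  using hom_int_pow[OF h _ R.a_group S.a_group, of x k] by (simp add: add_pow_def)

lemma additive_finsum:
  assumes "f \<in> A \<rightarrow> carrier R"
  shows "h (finsum R f A) = finsum S (\<lambda>i. h (f i)) A"
  using assms additive_closed[OF h]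
  by (induction A rule: infinite_finite_induct)
    (simp_all add: Pi_def additive_zero additive_add[OF h])

end

lemma ring_hom_additive: "h \<in> ring_hom R S \<Longrightarrow> h \<in> hom (add_monoid R) (add_monoid S)"
  by (auto simp: ring_hom_def hom_def)

section \<open>Algebras with a basis\<close>

lemma coeff_support_iff: "u \<in> coeff_support R p \<longleftrightarrow> p u \<noteq> \<zero>\<^bsub>R\<^esub>"
  by (simp add: coeff_support_def)

text \<open>A monoid algebra twisted by integral structure constants; \<open>c_assoc\<close> is the
  cocycle condition equivalent to associativity on basis elements. The constants may vanish, as they
  do for exterior monomials with a common index. The instances are the polynomial ring, the integral
  monoid ring of a degree zero part, and the Tate algebra.\<close>

locale basis_alg = cring R for R (structure) +
  fixes M :: "'m set" and mul :: "'m \<Rightarrow> 'm \<Rightarrow> 'm" and e :: 'm and c :: "'m \<Rightarrow> 'm \<Rightarrow> int"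
  assumes e_in [simp]: "e \<in> M"
    and mul_in [simp]: "\<lbrakk>u \<in> M; v \<in> M\<rbrakk> \<Longrightarrow> mul u v \<in> M"
    and mul_assoc: "\<lbrakk>u \<in> M; v \<in> M; w \<in> M\<rbrakk> \<Longrightarrow> mul (mul u v) w = mul u (mul v w)"
    and mul_e [simp]: "u \<in> M \<Longrightarrow> mul e u = u" "u \<in> M \<Longrightarrow> mul u e = u"
    and c_assoc: "\<lbrakk>u \<in> M; v \<in> M; w \<in> M\<rbrakk> \<Longrightarrow> c u v * c (mul u v) w = c v w * c u (mul v w)"
    and c_e: "u \<in> M \<Longrightarrow> c e u = 1" "u \<in> M \<Longrightarrow> c u e = 1"
begin

abbreviation BA where "BA \<equiv> basis_algebra R M mul e c"
abbreviation bt where "bt \<equiv> basis_term R"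

lemma BA_carrier:
  "p \<in> carrier BA \<longleftrightarrow> finite (coeff_support R p) \<and> coeff_support R p \<subseteq> M \<and> (\<forall>u. p u \<in> carrier R)"
  by (auto simp: basis_algebra_def)

lemma BA_coeff_closed [simp]: "p \<in> carrier BA \<Longrightarrow> p u \<in> carrier R"
  by (simp add: BA_carrier)

lemma BA_supp_M: "p \<in> carrier BA \<Longrightarrow> coeff_support R p \<subseteq> M"
  by (simp add: BA_carrier)

lemma BA_outside: "p \<in> carrier BA \<Longrightarrow> u \<notin> M \<Longrightarrow> p u = \<zero>"
  by (auto simp: BA_carrier coeff_support_def)

lemma BA_zero_apply: "\<zero>\<^bsub>BA\<^esub> u = \<zero>"
  by (simp add: basis_algebra_def)

lemma BA_add_apply: "(p \<oplus>\<^bsub>BA\<^esub> q) u = p u \<oplus> q u"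
  by (simp add: basis_algebra_def)

lemma BA_one: "\<one>\<^bsub>BA\<^esub> = bt e \<one>"
  by (simp add: basis_algebra_def basis_term_def)

lemma BA_add_closed: "\<lbrakk>p \<in> carrier BA; q \<in> carrier BA\<rbrakk> \<Longrightarrow> p \<oplus>\<^bsub>BA\<^esub> q \<in> carrier BA"
proof -
  assume a: "p \<in> carrier BA" "q \<in> carrier BA"
  have "coeff_support R (p \<oplus>\<^bsub>BA\<^esub> q) \<subseteq> coeff_support R p \<union> coeff_support R q"
    using a by (auto simp: coeff_support_def BA_add_apply)
  moreover have "finite (coeff_support R p \<union> coeff_support R q)" "coeff_support R p \<union> coeff_support R q \<subseteq> M"
    using a unfolding BA_carrier by auto
  ultimately show ?thesis using a unfolding BA_carrier
    by (auto simp: BA_add_apply intro: finite_subset)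
qed

lemma bt_apply: "bt m r u = (if u = m then r else \<zero>)"
  by (simp add: basis_term_def)

lemma supp_bt: "coeff_support R (bt m r) = (if r = \<zero> then {} else {m})"
  by (auto simp: coeff_support_def bt_apply)

lemma bt_closed [simp]: "\<lbrakk>m \<in> M; r \<in> carrier R\<rbrakk> \<Longrightarrow> bt m r \<in> carrier BA"
  unfolding BA_carrier by (auto simp: supp_bt bt_apply)

lemma BA_abelian_group: "abelian_group BA"
proof (rule abelian_groupI)
  fix p assume p: "p \<in> carrier BA"
  have "coeff_support R (\<lambda>u. \<ominus> p u) = coeff_support R p"
    using p BA_coeff_closed[OF p] by (auto simp: coeff_support_def)
  then have "(\<lambda>u. \<ominus> p u) \<in> carrier BA"
    using p unfolding BA_carrier by auto
  moreover have "(\<lambda>u. \<ominus> p u) \<oplus>\<^bsub>BA\<^esub> p = \<zero>\<^bsub>BA\<^esub>"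
    using p by (auto simp: l_neg BA_add_apply BA_zero_apply)
  ultimately show "\<exists>q\<in>carrier BA. q \<oplus>\<^bsub>BA\<^esub> p = \<zero>\<^bsub>BA\<^esub>" by blast
next
  show "\<zero>\<^bsub>BA\<^esub> \<in> carrier BA" unfolding BA_carrier by (auto simp: coeff_support_def BA_zero_apply)
qed (auto simp: BA_add_closed a_ac BA_add_apply BA_zero_apply fun_eq_iff)

sublocale BA: abelian_group BA by (rule BA_abelian_group)

lemma BA_uminus_apply: "p \<in> carrier BA \<Longrightarrow> (\<ominus>\<^bsub>BA\<^esub> p) u = \<ominus> p u"
proof -
  assume p: "p \<in> carrier BA"
  have "(p \<oplus>\<^bsub>BA\<^esub> (\<ominus>\<^bsub>BA\<^esub> p)) u = \<zero>" using p by (simp add: BA.r_neg BA_zero_apply)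
  then have "p u \<oplus> (\<ominus>\<^bsub>BA\<^esub> p) u = \<zero>" by (simp add: BA_add_apply)
  then show ?thesis using p by (metis BA.a_inv_closed BA_coeff_closed a_comm minus_equality)
qed

lemma BA_finsum_apply:
  assumes "f \<in> A \<rightarrow> carrier BA"
  shows "finsum BA f A u = (\<Oplus>i\<in>A. f i u)"
  using assms by (induction A rule: infinite_finite_induct) (auto simp: Pi_def BA_add_apply BA_zero_apply)

lemma BA_coeff_additive: "(\<lambda>p. p u) \<in> hom (add_monoid BA) (add_monoid R)"
  by (rule additiveI) (auto simp: BA_add_apply)

lemma BA_int_mult_apply: "p \<in> carrier BA \<Longrightarrow> (add_pow BA (k::int) p) u = k \<odot> p u"
  by (rule additive_int_mult[OF BA_abelian_group abelian_group_axioms BA_coeff_additive])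

lemma bt_add: "\<lbrakk>r \<in> carrier R; s \<in> carrier R\<rbrakk> \<Longrightarrow> bt m (r \<oplus> s) = bt m r \<oplus>\<^bsub>BA\<^esub> bt m s"
  by (auto simp: bt_apply BA_add_apply fun_eq_iff)

lemma bt_zero [simp]: "bt m \<zero> = \<zero>\<^bsub>BA\<^esub>"
  by (auto simp: bt_apply BA_zero_apply fun_eq_iff)

lemma bt_additive: "m \<in> M \<Longrightarrow> bt m \<in> hom (add_monoid R) (add_monoid BA)"
  by (rule additiveI) (simp_all add: bt_add)

lemma bt_int_mult: "\<lbrakk>m \<in> M; r \<in> carrier R\<rbrakk> \<Longrightarrow> bt m ((k::int) \<odot> r) = add_pow BA k (bt m r)"
  by (rule additive_int_mult[OF abelian_group_axioms BA_abelian_group bt_additive])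

lemma BA_decomp:
  assumes p: "p \<in> carrier BA"
  shows "p = (\<Oplus>\<^bsub>BA\<^esub>m\<in>coeff_support R p. bt m (p m))"
proof
  fix u
  have f: "finite (coeff_support R p)" using p by (simp add: BA_carrier)
  have c: "(\<lambda>m. bt m (p m)) \<in> coeff_support R p \<rightarrow> carrier BA"
    using p unfolding BA_carrier[of p] by (auto intro!: bt_closed)
  have "(\<Oplus>m\<in>coeff_support R p. bt m (p m) u) = p u"
  proof (cases "p u = \<zero>")
    case True
    then have "\<And>m. m \<in> coeff_support R p \<Longrightarrow> bt m (p m) u = \<zero>"
      by (auto simp: bt_apply coeff_support_def)
    then show ?thesis using True by (simp add: add.finprod_one_eqI)
  next
    case False
    then have "(\<Oplus>m\<in>coeff_support R p. bt m (p m) u) = bt u (p u) u"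
      using p f by (intro finsum_delta) (auto simp: bt_apply coeff_support_def)
    then show ?thesis by (simp add: bt_apply)
  qed
  then show "p u = (\<Oplus>\<^bsub>BA\<^esub>m\<in>coeff_support R p. bt m (p m)) u"
    using BA_finsum_apply[OF c] by simp
qed

text \<open>The set \<open>N\<close> limits the basis elements that occur: the same rule serves for
  all elements and, with the monomials of one degree as \<open>N\<close>, for homogeneous
  ones.\<close>

lemma BA_induct [consumes 2, case_names zero add basis]:
  assumes p: "p \<in> carrier BA" "coeff_support R p \<subseteq> N"
    and 0: "P \<zero>\<^bsub>BA\<^esub>"
    and add: "\<And>p q. \<lbrakk>p \<in> carrier BA; q \<in> carrier BA; P p; P q\<rbrakk> \<Longrightarrow> P (p \<oplus>\<^bsub>BA\<^esub> q)"
    and bas: "\<And>m r. \<lbrakk>m \<in> M; m \<in> N; r \<in> carrier R\<rbrakk> \<Longrightarrow> P (bt m r)"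
  shows "P p"
proof -
  have "finite A \<Longrightarrow> A \<subseteq> M \<inter> N \<Longrightarrow> P (\<Oplus>\<^bsub>BA\<^esub>m\<in>A. bt m (p m))" for A
  proof (induction A rule: finite_induct)
    case (insert a A)
    have "(\<lambda>m. bt m (p m)) \<in> A \<rightarrow> carrier BA" using insert p by (auto intro!: bt_closed)
    then show ?case using insert p by (auto intro!: add bas BA.finsum_closed)
  qed (simp add: 0)
  from this[of "coeff_support R p"] show ?thesis
    using p BA_decomp[OF p(1)] unfolding BA_carrier[of p] by simp
qed

text \<open>Supports are replaced by larger finite sets so that products with different factors
  become sums over one index set. This is used for distributivity, and for basis terms whose
  coefficient may be zero and whose support is then empty.\<close>

lemma BA_mult_expand:
  assumes p: "p \<in> carrier BA" and q: "q \<in> carrier BA"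
    and U: "finite U" "coeff_support R p \<subseteq> U" and V: "finite V" "coeff_support R q \<subseteq> V"
  shows "(p \<otimes>\<^bsub>BA\<^esub> q) w
    = (\<Oplus>uv\<in>{(u, v). u \<in> U \<and> v \<in> V \<and> mul u v = w}. c (fst uv) (snd uv) \<odot> (p (fst uv) \<otimes> q (snd uv)))"
proof -
  have fin: "finite {(u, v). u \<in> U \<and> v \<in> V \<and> mul u v = w}"
    by (rule finite_subset[of _ "U \<times> V"]) (use U V in auto)
  have "(p \<otimes>\<^bsub>BA\<^esub> q) w = (\<Oplus>uv\<in>{(u, v). u \<in> coeff_support R p \<and> v \<in> coeff_support R q \<and> mul u v = w}.
      c (fst uv) (snd uv) \<odot> (p (fst uv) \<otimes> q (snd uv)))"
    by (simp add: basis_algebra_def)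
  also have "\<dots> = (\<Oplus>uv\<in>{(u, v). u \<in> U \<and> v \<in> V \<and> mul u v = w}. c (fst uv) (snd uv) \<odot> (p (fst uv) \<otimes> q (snd uv)))"
    using fin U V p q by (intro finsum_mono_neutral) (auto simp: coeff_support_iff)
  finally show ?thesis .
qed

lemma BA_mult_closed:
  assumes p: "p \<in> carrier BA" and q: "q \<in> carrier BA"
  shows "p \<otimes>\<^bsub>BA\<^esub> q \<in> carrier BA"
proof -
  let ?I = "\<lambda>w. {(u, v). u \<in> coeff_support R p \<and> v \<in> coeff_support R q \<and> mul u v = w}"
  note eq = BA_mult_expand[OF p q _ subset_refl _ subset_refl]
  have f: "finite (coeff_support R p)" "finite (coeff_support R q)" using p q by (auto simp: BA_carrier)
  have "coeff_support R (p \<otimes>\<^bsub>BA\<^esub> q) \<subseteq> (\<lambda>(u, v). mul u v) ` (coeff_support R p \<times> coeff_support R q)"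
  proof
    fix w assume "w \<in> coeff_support R (p \<otimes>\<^bsub>BA\<^esub> q)"
    then have "?I w \<noteq> {}" using eq[OF f, of w] unfolding coeff_support_iff by (intro notI) simp
    then show "w \<in> (\<lambda>(u, v). mul u v) ` (coeff_support R p \<times> coeff_support R q)" by auto
  qed
  moreover have "(\<lambda>(u, v). mul u v) ` (coeff_support R p \<times> coeff_support R q) \<subseteq> M"
    using BA_supp_M[OF p] BA_supp_M[OF q] by (auto intro!: mul_in simp: subset_iff)
  moreover have "(p \<otimes>\<^bsub>BA\<^esub> q) w \<in> carrier R" for w
    using p q eq[OF f, of w] by (auto intro!: finsum_closed)
  ultimately show ?thesis
    using f unfolding BA_carrier by (meson finite_SigmaI finite_imageI finite_subset subset_trans)
qed

lemma BA_l_distr: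
  assumes p: "p \<in> carrier BA" and q: "q \<in> carrier BA" and r: "r \<in> carrier BA"
  shows "(p \<oplus>\<^bsub>BA\<^esub> q) \<otimes>\<^bsub>BA\<^esub> r = p \<otimes>\<^bsub>BA\<^esub> r \<oplus>\<^bsub>BA\<^esub> q \<otimes>\<^bsub>BA\<^esub> r"
proof
  fix w
  let ?U = "coeff_support R p \<union> coeff_support R q" let ?V = "coeff_support R r"
  have f: "finite ?U" "finite ?V" "coeff_support R (p \<oplus>\<^bsub>BA\<^esub> q) \<subseteq> ?U"
    using p q r by (auto simp: BA_carrier coeff_support_def BA_add_apply)
  let ?I = "{(u, v). u \<in> ?U \<and> v \<in> ?V \<and> mul u v = w}"
  have "((p \<oplus>\<^bsub>BA\<^esub> q) \<otimes>\<^bsub>BA\<^esub> r) w = (\<Oplus>uv\<in>?I. c (fst uv) (snd uv) \<odot> ((p \<oplus>\<^bsub>BA\<^esub> q) (fst uv) \<otimes> r (snd uv)))"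
    using p q r f by (intro BA_mult_expand) (auto simp: BA_add_closed)
  also have "\<dots> = (\<Oplus>uv\<in>?I. c (fst uv) (snd uv) \<odot> (p (fst uv) \<otimes> r (snd uv)) \<oplus> c (fst uv) (snd uv) \<odot> (q (fst uv) \<otimes> r (snd uv)))"
    using p q r by (intro finsum_cong') (auto simp: BA_add_apply l_distr int_mult_add_right)
  also have "\<dots> = (p \<otimes>\<^bsub>BA\<^esub> r \<oplus>\<^bsub>BA\<^esub> q \<otimes>\<^bsub>BA\<^esub> r) w"
    unfolding BA_add_apply using p q r f
    by (simp add: BA_mult_expand[where U = ?U and V = ?V] finsum_addf Pi_def)
  finally show "((p \<oplus>\<^bsub>BA\<^esub> q) \<otimes>\<^bsub>BA\<^esub> r) w = (p \<otimes>\<^bsub>BA\<^esub> r \<oplus>\<^bsub>BA\<^esub> q \<otimes>\<^bsub>BA\<^esub> r) w" .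
qed

lemma BA_r_distr:
  assumes p: "p \<in> carrier BA" and q: "q \<in> carrier BA" and r: "r \<in> carrier BA"
  shows "r \<otimes>\<^bsub>BA\<^esub> (p \<oplus>\<^bsub>BA\<^esub> q) = r \<otimes>\<^bsub>BA\<^esub> p \<oplus>\<^bsub>BA\<^esub> r \<otimes>\<^bsub>BA\<^esub> q"
proof
  fix w
  let ?V = "coeff_support R p \<union> coeff_support R q" let ?U = "coeff_support R r"
  have f: "finite ?U" "finite ?V" "coeff_support R (p \<oplus>\<^bsub>BA\<^esub> q) \<subseteq> ?V"
    using p q r by (auto simp: BA_carrier coeff_support_def BA_add_apply)
  let ?I = "{(u, v). u \<in> ?U \<and> v \<in> ?V \<and> mul u v = w}"
  have "(r \<otimes>\<^bsub>BA\<^esub> (p \<oplus>\<^bsub>BA\<^esub> q)) w = (\<Oplus>uv\<in>?I. c (fst uv) (snd uv) \<odot> (r (fst uv) \<otimes> (p \<oplus>\<^bsub>BA\<^esub> q) (snd uv)))"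
    using p q r f by (intro BA_mult_expand) (auto simp: BA_add_closed)
  also have "\<dots> = (\<Oplus>uv\<in>?I. c (fst uv) (snd uv) \<odot> (r (fst uv) \<otimes> p (snd uv)) \<oplus> c (fst uv) (snd uv) \<odot> (r (fst uv) \<otimes> q (snd uv)))"
    using p q r by (intro finsum_cong') (auto simp: BA_add_apply r_distr int_mult_add_right)
  also have "\<dots> = (r \<otimes>\<^bsub>BA\<^esub> p \<oplus>\<^bsub>BA\<^esub> r \<otimes>\<^bsub>BA\<^esub> q) w"
    unfolding BA_add_apply using p q r f
    by (simp add: BA_mult_expand[where U = ?U and V = ?V] finsum_addf Pi_def)
  finally show "(r \<otimes>\<^bsub>BA\<^esub> (p \<oplus>\<^bsub>BA\<^esub> q)) w = (r \<otimes>\<^bsub>BA\<^esub> p \<oplus>\<^bsub>BA\<^esub> r \<otimes>\<^bsub>BA\<^esub> q) w" .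
qed

lemma bt_mult:
  assumes u: "u \<in> M" and v: "v \<in> M" and r: "r \<in> carrier R" and s: "s \<in> carrier R"
  shows "bt u r \<otimes>\<^bsub>BA\<^esub> bt v s = bt (mul u v) (c u v \<odot> (r \<otimes> s))"
proof
  fix w
  have "(bt u r \<otimes>\<^bsub>BA\<^esub> bt v s) w
    = (\<Oplus>uv\<in>{(u', v'). u' \<in> {u} \<and> v' \<in> {v} \<and> mul u' v' = w}.
        c (fst uv) (snd uv) \<odot> (bt u r (fst uv) \<otimes> bt v s (snd uv)))"
    using assms by (intro BA_mult_expand) (auto simp: supp_bt)
  also have "{(u', v'). u' \<in> {u} \<and> v' \<in> {v} \<and> mul u' v' = w} = (if mul u v = w then {(u, v)} else {})"
    by auto
  finally show "(bt u r \<otimes>\<^bsub>BA\<^esub> bt v s) w = bt (mul u v) (c u v \<odot> (r \<otimes> s)) w"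
    using r s by (auto simp: bt_apply[of _ _ w] bt_apply[of u _ u] bt_apply[of v _ v])
qed

lemma BA_zero_mult:
  assumes "p \<in> carrier BA" shows "\<zero>\<^bsub>BA\<^esub> \<otimes>\<^bsub>BA\<^esub> p = \<zero>\<^bsub>BA\<^esub>" "p \<otimes>\<^bsub>BA\<^esub> \<zero>\<^bsub>BA\<^esub> = \<zero>\<^bsub>BA\<^esub>"
  by (auto simp: basis_algebra_def coeff_support_def)

lemma BA_ring: "ring BA"
proof (rule ringI)
  show "monoid BA"
  proof (rule monoidI)
    show "\<one>\<^bsub>BA\<^esub> \<in> carrier BA" by (simp add: BA_one)
  next
    fix p assume p: "p \<in> carrier BA"
    show "\<one>\<^bsub>BA\<^esub> \<otimes>\<^bsub>BA\<^esub> p = p"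
      using p BA_supp_M[OF p]
      by (induction rule: BA_induct) (auto simp: BA_r_distr BA_zero_mult BA_one bt_mult c_e)
    show "p \<otimes>\<^bsub>BA\<^esub> \<one>\<^bsub>BA\<^esub> = p"
      using p BA_supp_M[OF p]
      by (induction rule: BA_induct) (auto simp: BA_l_distr BA_zero_mult BA_one bt_mult c_e)
  next
    fix p q r assume pqr: "p \<in> carrier BA" "q \<in> carrier BA" "r \<in> carrier BA"
    \<comment> \<open>On basis terms the two bracketings differ only in the structure constants,
      which agree by the cocycle condition. The facts 2 and 3 then replace one basis term at a time
      by a general element.\<close>
    have 1: "bt u a \<otimes>\<^bsub>BA\<^esub> bt v b \<otimes>\<^bsub>BA\<^esub> bt w d = bt u a \<otimes>\<^bsub>BA\<^esub> (bt v b \<otimes>\<^bsub>BA\<^esub> bt w d)"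
      if "u \<in> M" "v \<in> M" "w \<in> M" "a \<in> carrier R" "b \<in> carrier R" "d \<in> carrier R" for u v w a b d
    proof -
      have "c (mul u v) w \<odot> (c u v \<odot> (a \<otimes> b) \<otimes> d) = (c u v * c (mul u v) w) \<odot> (a \<otimes> (b \<otimes> d))"
        using that by (simp add: add_pow_ldistr_int m_assoc mult.commute flip: int_mult_mult)
      moreover have "c u (mul v w) \<odot> (a \<otimes> c v w \<odot> (b \<otimes> d)) = (c v w * c u (mul v w)) \<odot> (a \<otimes> (b \<otimes> d))"
        using that by (simp add: add_pow_rdistr_int mult.commute flip: int_mult_mult)
      ultimately show ?thesis using that by (simp add: bt_mult mul_assoc c_assoc)
    qed
    have 2: "bt u a \<otimes>\<^bsub>BA\<^esub> bt v b \<otimes>\<^bsub>BA\<^esub> r = bt u a \<otimes>\<^bsub>BA\<^esub> (bt v b \<otimes>\<^bsub>BA\<^esub> r)"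
      if "u \<in> M" "v \<in> M" "a \<in> carrier R" "b \<in> carrier R" for u v a b
      using pqr(3) BA_supp_M[OF pqr(3)]
      by (induction rule: BA_induct) (use that in \<open>auto simp: BA_r_distr BA_zero_mult 1 BA_mult_closed\<close>)
    have 3: "bt u a \<otimes>\<^bsub>BA\<^esub> q \<otimes>\<^bsub>BA\<^esub> r = bt u a \<otimes>\<^bsub>BA\<^esub> (q \<otimes>\<^bsub>BA\<^esub> r)"
      if "u \<in> M" "a \<in> carrier R" for u a
      using pqr(2) BA_supp_M[OF pqr(2)]
      by (induction rule: BA_induct)
        (use that pqr in \<open>auto simp: BA_r_distr BA_l_distr BA_zero_mult 2 BA_mult_closed\<close>)
    show "p \<otimes>\<^bsub>BA\<^esub> q \<otimes>\<^bsub>BA\<^esub> r = p \<otimes>\<^bsub>BA\<^esub> (q \<otimes>\<^bsub>BA\<^esub> r)"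
      using pqr(1) BA_supp_M[OF pqr(1)]
      by (induction rule: BA_induct)
        (use pqr in \<open>auto simp: BA_r_distr BA_l_distr BA_zero_mult 3 BA_mult_closed\<close>)
  qed (rule BA_mult_closed)
qed (simp_all add: BA_abelian_group BA_l_distr BA_r_distr)

sublocale BA: ring BA by (rule BA_ring)

lemma BA_cring:
  assumes mc: "\<And>u v. \<lbrakk>u \<in> M; v \<in> M\<rbrakk> \<Longrightarrow> mul u v = mul v u" "\<And>u v. \<lbrakk>u \<in> M; v \<in> M\<rbrakk> \<Longrightarrow> c u v = c v u"
  shows "cring BA"
proof -
  have "p \<otimes>\<^bsub>BA\<^esub> q = q \<otimes>\<^bsub>BA\<^esub> p" if pq: "p \<in> carrier BA" "q \<in> carrier BA" for p q
  proof -
    have 1: "bt u a \<otimes>\<^bsub>BA\<^esub> q = q \<otimes>\<^bsub>BA\<^esub> bt u a" if "u \<in> M" "a \<in> carrier R" for u a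
      using pq(2) BA_supp_M[OF pq(2)]
      by (induction rule: BA_induct)
        (use that mc in \<open>auto simp: BA_r_distr BA_l_distr BA_zero_mult bt_mult m_comm\<close>)
    show ?thesis using pq(1) BA_supp_M[OF pq(1)]
      by (induction rule: BA_induct) (use 1 pq in \<open>auto simp: BA_r_distr BA_l_distr BA_zero_mult\<close>)
  qed
  then show ?thesis
    by (intro cring.intro BA_ring comm_monoid.intro comm_monoid_axioms.intro BA.is_monoid)
qed

definition linear_ext where
  "linear_ext S \<rho> \<phi> p = (\<Oplus>\<^bsub>S\<^esub>u\<in>coeff_support R p. \<rho> (p u) \<otimes>\<^bsub>S\<^esub> \<phi> u)"

context
  fixes S \<rho> \<phi>
  assumes S: "ring S" and \<rho>: "\<rho> \<in> hom (add_monoid R) (add_monoid S)"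
    and \<phi>: "\<And>u. u \<in> M \<Longrightarrow> \<phi> u \<in> carrier S"
begin

interpretation S: ring S by (rule S)

lemma linear_ext_expand:
  assumes "p \<in> carrier BA" "finite U" "coeff_support R p \<subseteq> U" "U \<subseteq> M"
  shows "linear_ext S \<rho> \<phi> p = (\<Oplus>\<^bsub>S\<^esub>u\<in>U. \<rho> (p u) \<otimes>\<^bsub>S\<^esub> \<phi> u)"
  unfolding linear_ext_def using assms additive_closed[OF \<rho>] \<phi> additive_zero[OF abelian_group_axioms S.abelian_group_axioms \<rho>]
  by (intro S.finsum_mono_neutral) (auto simp: coeff_support_iff subset_iff)

lemma linear_ext_additive: "linear_ext S \<rho> \<phi> \<in> hom (add_monoid BA) (add_monoid S)"
proof (rule additiveI)
  fix p assume p: "p \<in> carrier BA"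
  then show "linear_ext S \<rho> \<phi> p \<in> carrier S"
    unfolding linear_ext_def using additive_closed[OF \<rho>] \<phi> BA_supp_M[OF p]
    by (auto intro!: S.finsum_closed)
next
  fix p q assume pq: "p \<in> carrier BA" "q \<in> carrier BA"
  let ?U = "coeff_support R p \<union> coeff_support R q"
  have f: "finite ?U" "coeff_support R (p \<oplus>\<^bsub>BA\<^esub> q) \<subseteq> ?U" "?U \<subseteq> M"
    using pq unfolding BA_carrier by (auto simp: coeff_support_def BA_add_apply)
  have m: "u \<in> coeff_support R p \<Longrightarrow> u \<in> M" "u \<in> coeff_support R q \<Longrightarrow> u \<in> M" for u using f by auto
  have "linear_ext S \<rho> \<phi> (p \<oplus>\<^bsub>BA\<^esub> q) = (\<Oplus>\<^bsub>S\<^esub>u\<in>?U. \<rho> ((p \<oplus>\<^bsub>BA\<^esub> q) u) \<otimes>\<^bsub>S\<^esub> \<phi> u)"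
    using pq f by (intro linear_ext_expand) (auto simp: BA_add_closed)
  also have "\<dots> = (\<Oplus>\<^bsub>S\<^esub>u\<in>?U. \<rho> (p u) \<otimes>\<^bsub>S\<^esub> \<phi> u \<oplus>\<^bsub>S\<^esub> \<rho> (q u) \<otimes>\<^bsub>S\<^esub> \<phi> u)"
    using pq m additive_closed[OF \<rho>] \<phi>
    by (intro S.finsum_cong') (auto simp: BA_add_apply additive_add[OF \<rho>] S.l_distr)
  also have "\<dots> = linear_ext S \<rho> \<phi> p \<oplus>\<^bsub>S\<^esub> linear_ext S \<rho> \<phi> q"
    using pq f m additive_closed[OF \<rho>] \<phi>
    by (simp add: linear_ext_expand[where U = ?U] S.finsum_addf Pi_def)
  finally show "linear_ext S \<rho> \<phi> (p \<oplus>\<^bsub>BA\<^esub> q) = linear_ext S \<rho> \<phi> p \<oplus>\<^bsub>S\<^esub> linear_ext S \<rho> \<phi> q" .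
qed

lemma linear_ext_bt:
  assumes "m \<in> M" "r \<in> carrier R"
  shows "linear_ext S \<rho> \<phi> (bt m r) = \<rho> r \<otimes>\<^bsub>S\<^esub> \<phi> m"
  using assms additive_closed[OF \<rho>] \<phi> linear_ext_expand[of "bt m r" "{m}"]
  by (auto simp: supp_bt bt_apply)

end

text \<open>The target need not be commutative. In the image of a product the coefficient of the
  second factor has to move past the basis element of the first one, which is what
  \<open>comm\<close> allows.\<close>

lemma linear_ext_ring_hom:
  assumes S: "ring S" and \<rho>: "\<rho> \<in> ring_hom R S"
    and \<phi>: "\<And>u. u \<in> M \<Longrightarrow> \<phi> u \<in> carrier S"
    and comm: "\<And>r u. \<lbrakk>r \<in> carrier R; u \<in> M\<rbrakk> \<Longrightarrow> \<rho> r \<otimes>\<^bsub>S\<^esub> \<phi> u = \<phi> u \<otimes>\<^bsub>S\<^esub> \<rho> r"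
    and \<phi>e: "\<phi> e = \<one>\<^bsub>S\<^esub>"
    and \<phi>m: "\<And>u v. \<lbrakk>u \<in> M; v \<in> M\<rbrakk> \<Longrightarrow> \<phi> u \<otimes>\<^bsub>S\<^esub> \<phi> v = add_pow S (c u v) (\<phi> (mul u v))"
  shows "linear_ext S \<rho> \<phi> \<in> ring_hom BA S"
proof -
  interpret S: ring S by (rule S)
  note \<rho>a = ring_hom_additive[OF \<rho>]
  note add = linear_ext_additive[OF S \<rho>a \<phi>] and h_bt = linear_ext_bt[OF S \<rho>a \<phi>]
  note [simp] = additive_closed[OF add] additive_closed[OF \<rho>a] \<phi>
    additive_zero[OF BA_abelian_group S.abelian_group_axioms add]
    additive_add[OF add]
  let ?h = "linear_ext S \<rho> \<phi>"
  have 1: "?h (bt u a \<otimes>\<^bsub>BA\<^esub> bt v b) = ?h (bt u a) \<otimes>\<^bsub>S\<^esub> ?h (bt v b)"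
    if uv: "u \<in> M" "v \<in> M" "a \<in> carrier R" "b \<in> carrier R" for u v a b
  proof -
    have "?h (bt u a \<otimes>\<^bsub>BA\<^esub> bt v b) = add_pow S (c u v) (\<rho> (a \<otimes> b)) \<otimes>\<^bsub>S\<^esub> \<phi> (mul u v)"
      using uv by (simp add: bt_mult h_bt additive_int_mult[OF abelian_group_axioms S.abelian_group_axioms \<rho>a])
    also have "\<dots> = \<rho> (a \<otimes> b) \<otimes>\<^bsub>S\<^esub> (\<phi> u \<otimes>\<^bsub>S\<^esub> \<phi> v)"
      using uv by (simp add: S.add_pow_ldistr_int S.add_pow_rdistr_int \<phi>m)
    also have "\<dots> = \<rho> a \<otimes>\<^bsub>S\<^esub> (\<rho> b \<otimes>\<^bsub>S\<^esub> \<phi> u) \<otimes>\<^bsub>S\<^esub> \<phi> v"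
      using uv by (simp add: ring_hom_mult[OF \<rho>] S.m_assoc)
    also have "\<dots> = \<rho> a \<otimes>\<^bsub>S\<^esub> (\<phi> u \<otimes>\<^bsub>S\<^esub> \<rho> b) \<otimes>\<^bsub>S\<^esub> \<phi> v"
      using uv by (simp only: comm)
    also have "\<dots> = ?h (bt u a) \<otimes>\<^bsub>S\<^esub> ?h (bt v b)"
      using uv by (simp add: h_bt S.m_assoc)
    finally show ?thesis .
  qed
  have 2: "?h (bt u a \<otimes>\<^bsub>BA\<^esub> q) = ?h (bt u a) \<otimes>\<^bsub>S\<^esub> ?h q"
    if "u \<in> M" "a \<in> carrier R" "q \<in> carrier BA" for u a q
    using that(3) BA_supp_M[OF that(3)]
    by (induction rule: BA_induct) (use that in \<open>auto simp: BA.r_distr S.r_distr 1\<close>)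
  have 3: "?h (p \<otimes>\<^bsub>BA\<^esub> q) = ?h p \<otimes>\<^bsub>S\<^esub> ?h q"
    if "p \<in> carrier BA" "q \<in> carrier BA" for p q
    using that(1) BA_supp_M[OF that(1)]
    by (induction rule: BA_induct) (use that in \<open>auto simp: BA.l_distr S.l_distr 2\<close>)
  show ?thesis
    by (rule ring_hom_memI) (simp_all add: 3 BA_one h_bt \<phi>e ring_hom_one[OF \<rho>])
qed

end

section \<open>The order on the indices and ordered products\<close>

text \<open>By the well-ordering theorem the choice in \<open>index_less\<close> yields a
  well-order; removing its diagonal leaves a strict linear order that is well-founded.\<close>

lemma
  fixes index_less :: "'x \<Rightarrow> 'x \<Rightarrow> bool"
  defines "index_less \<equiv> Defs.index_less"
  shows index_order: "strict_linear_order_on UNIV {(a, c). index_less a c}" (is ?lin)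
    and index_wf: "wf {(a, c). index_less a c}"
proof -
  define r where "r = (SOME r :: 'x rel. well_order_on UNIV r)"
  have "well_order_on UNIV r" unfolding r_def by (rule someI_ex[OF well_order_on])
  then have l: "linear_order_on UNIV r" and w: "wf (r - Id)" by (auto simp: well_order_on_def)
  have eq: "{(a, c). index_less a c} = r - Id" by (auto simp: index_less_def Defs.index_less_def r_def)
  show ?lin unfolding eq by (rule strict_linear_order_on_diff_Id[OF l])
  show "wf {(a, c). index_less a c}" unfolding eq by (rule w)
qed

lemma index_less_irrefl [simp]: "\<not> index_less a a"
  by (simp add: index_less_def)

lemma index_less_trans: "index_less a b \<Longrightarrow> index_less b c \<Longrightarrow> index_less a c"
  using transD[of "{(a, c). index_less a c}" a b c] index_order by (auto simp: strict_linear_order_on_def)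

lemma index_less_total: "a \<noteq> c \<Longrightarrow> index_less a c \<or> index_less c a"
  using index_order by (auto simp: strict_linear_order_on_def total_on_def)

lemma index_less_asym: "index_less a c \<Longrightarrow> \<not> index_less c a"
  using index_less_trans[of a c a] by auto

lemma ex_index_min: "A \<noteq> {} \<Longrightarrow> \<exists>a\<in>A. \<forall>c\<in>A - {a}. index_less a c"
proof -
  assume "A \<noteq> {}"
  then obtain a where "a \<in> A" "\<And>c. (c, a) \<in> {(a, c). index_less a c} \<Longrightarrow> c \<notin> A"
    using wfE_min'[OF index_wf, of A] by blast
  then have "index_less a c" if "c \<in> A - {a}" for c
    using that index_less_total[of a c] by auto
  then show ?thesis using \<open>a \<in> A\<close> by blast
qed

text \<open>Elements are inserted from the largest down, so the new index is always the smallest. An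
  ordered product then grows by one factor on the left, and multiplying a monomial by the new
  generator produces no sign.\<close>

lemma finite_index_induct [consumes 1, case_names empty insert]:
  assumes "finite A" and "P {}"
    and step: "\<And>a A. \<lbrakk>finite A; a \<notin> A; \<And>c. c \<in> A \<Longrightarrow> index_less a c; P A\<rbrakk> \<Longrightarrow> P (insert a A)"
  shows "P A"
  using assms(1)
proof (induction A rule: finite_psubset_induct)
  case (psubset A)
  show ?case
  proof (cases "A = {}")
    case False
    then obtain a where a: "a \<in> A" "\<forall>c\<in>A - {a}. index_less a c" using ex_index_min[of A] by blast
    moreover have "P (A - {a})" using a by (intro psubset.IH) auto
    ultimately have "P (insert a (A - {a}))"
      using psubset.hyps by (intro step) auto
    then show ?thesis using a by (simp add: insert_absorb)
  qed (simp add: assms(2))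
qed

definition index_min where
  "index_min A = (SOME a. a \<in> A \<and> (\<forall>c\<in>A - {a}. index_less a c))"

lemma index_min_in: "A \<noteq> {} \<Longrightarrow> index_min A \<in> A"
  unfolding index_min_def using someI_ex[of "\<lambda>a. a \<in> A \<and> (\<forall>c\<in>A - {a}. index_less a c)"] ex_index_min[of A]
  by blast

lemma index_min_insert: "(\<And>c. c \<in> A \<Longrightarrow> index_less a c) \<Longrightarrow> index_min (insert a A) = a"
  unfolding index_min_def
  by (rule some_equality) (auto dest: index_less_asym)

text \<open>The factors may anticommute, so a product over a finite set is taken in increasing order
  of the indices. The even factors \<open>df_pow b n\<close> are multiplied by the same function,
  since the surrounding ring is not commutative.\<close>

function ext_prod :: "('s, 'm) monoid_scheme \<Rightarrow> ('x \<Rightarrow> 's) \<Rightarrow> 'x set \<Rightarrow> 's" where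
  "ext_prod S g A =
    (if finite A \<and> A \<noteq> {} then g (index_min A) \<otimes>\<^bsub>S\<^esub> ext_prod S g (A - {index_min A}) else \<one>\<^bsub>S\<^esub>)"
  by pat_completeness auto
termination
proof (relation "measure (\<lambda>(S, g, A). card A)")
  fix S :: "('s, 'm) monoid_scheme" and g :: "'x \<Rightarrow> 's" and A :: "'x set"
  assume A: "finite A \<and> A \<noteq> {}"
  then have "index_min A \<in> A" by (simp add: index_min_in)
  then show "((S, g, A - {index_min A}), (S, g, A)) \<in> measure (\<lambda>(S, g, A). card A)"
    using A by (simp add: card_gt_0_iff)
qed simp

declare ext_prod.simps [simp del]

lemma ext_prod_empty [simp]: "ext_prod S g {} = \<one>\<^bsub>S\<^esub>"
  by (simp add: ext_prod.simps)

lemma ext_prod_insert: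
  assumes "finite A" "\<And>c. c \<in> A \<Longrightarrow> index_less a c"
  shows "ext_prod S g (insert a A) = g a \<otimes>\<^bsub>S\<^esub> ext_prod S g A"
proof -
  have "a \<notin> A" using assms(2)[of a] by auto
  then show ?thesis
    using assms(1) index_min_insert[of A a] assms(2) by (simp add: ext_prod.simps[of S g "insert a A"])
qed

context monoid begin

lemma ext_prod_closed [simp]:
  assumes "finite A" "g \<in> A \<rightarrow> carrier G" shows "ext_prod G g A \<in> carrier G"
  using assms by (induction A rule: finite_index_induct) (auto simp: ext_prod_insert)

lemma ext_prod_cong:
  assumes "finite A" "\<And>a. a \<in> A \<Longrightarrow> g a = h a" shows "ext_prod G g A = ext_prod G h A"
  using assms by (induction A rule: finite_index_induct) (auto simp: ext_prod_insert)

lemma ext_prod_mono_neutral: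
  assumes "finite D" "A \<subseteq> D" "\<And>b. b \<in> D - A \<Longrightarrow> g b = \<one>" "g \<in> D \<rightarrow> carrier G"
  shows "ext_prod G g A = ext_prod G g D"
  using assms
proof (induction D arbitrary: A rule: finite_index_induct)
  case (insert a D)
  have A: "ext_prod G g (A - {a}) = ext_prod G g D"
    using insert by (intro insert.IH) auto
  show ?case
  proof (cases "a \<in> A")
    case True
    have "finite (A - {a})" using insert by (auto intro: finite_subset)
    then have "ext_prod G g (insert a (A - {a})) = g a \<otimes> ext_prod G g (A - {a})"
      using insert by (intro ext_prod_insert) auto
    then show ?thesis using A True insert by (simp add: ext_prod_insert insert_absorb)
  next
    case False
    then show ?thesis using A insert by (simp add: ext_prod_insert)
  qed
qed simp

lemma ext_prod_commute:
  assumes "finite A" "x \<in> carrier G" "g \<in> A \<rightarrow> carrier G" "\<And>a. a \<in> A \<Longrightarrow> x \<otimes> g a = g a \<otimes> x"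
  shows "x \<otimes> ext_prod G g A = ext_prod G g A \<otimes> x"
  using assms
proof (induction A rule: finite_index_induct)
  case (insert a A)
  then have c: "g a \<in> carrier G" "ext_prod G g A \<in> carrier G" by auto
  have xa: "x \<otimes> g a = g a \<otimes> x" using insert by blast
  have xE: "x \<otimes> ext_prod G g A = ext_prod G g A \<otimes> x" using insert by (intro insert.IH) auto
  have "x \<otimes> (g a \<otimes> ext_prod G g A) = (x \<otimes> g a) \<otimes> ext_prod G g A" using c insert.prems(1) by (simp add: m_assoc)
  also have "\<dots> = g a \<otimes> (x \<otimes> ext_prod G g A)" unfolding xa using c insert.prems(1) by (simp add: m_assoc)
  also have "\<dots> = (g a \<otimes> ext_prod G g A) \<otimes> x" unfolding xE using c insert.prems(1) by (simp add: m_assoc)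
  finally show ?case using insert by (simp add: ext_prod_insert)
qed simp

lemma ext_prod_mult:
  assumes "finite A" "g \<in> A \<rightarrow> carrier G" "h \<in> A \<rightarrow> carrier G"
    "\<And>a b. \<lbrakk>a \<in> A; b \<in> A\<rbrakk> \<Longrightarrow> g a \<otimes> h b = h b \<otimes> g a"
  shows "ext_prod G g A \<otimes> ext_prod G h A = ext_prod G (\<lambda>a. g a \<otimes> h a) A"
  using assms
proof (induction A rule: finite_index_induct)
  case (insert a A)
  then have c: "g a \<in> carrier G" "ext_prod G g A \<in> carrier G" "h a \<in> carrier G" "ext_prod G h A \<in> carrier G"
    by auto
  have "h a \<otimes> ext_prod G g A = ext_prod G g A \<otimes> h a"
    using insert by (intro ext_prod_commute) (auto simp: eq_commute)
  then have "(g a \<otimes> ext_prod G g A) \<otimes> (h a \<otimes> ext_prod G h A)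
      = g a \<otimes> (h a \<otimes> ext_prod G g A) \<otimes> ext_prod G h A"
    using c by (simp add: m_assoc)
  also have "\<dots> = (g a \<otimes> h a) \<otimes> (ext_prod G g A \<otimes> ext_prod G h A)" using c by (simp add: m_assoc)
  finally show ?case using insert by (simp add: ext_prod_insert)
qed simp

end

section \<open>Strictly graded commutative rings\<close>

text \<open>The vanishing of odd squares is a separate axiom, because \<open>gr_comm\<close> only
  gives that twice the square is zero. Directness of the sum of the \<open>gr n\<close> is not
  assumed; where it matters it comes from freeness, in \<open>direct_of_free\<close>.\<close>

locale graded_comm = ring S for S (structure) +
  fixes gr :: "nat \<Rightarrow> 'a set"
  assumes gr_sub: "gr n \<subseteq> carrier S"
    and gr_zero [simp]: "\<zero> \<in> gr n"
    and gr_add: "\<lbrakk>u \<in> gr n; v \<in> gr n\<rbrakk> \<Longrightarrow> u \<oplus> v \<in> gr n"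
    and gr_uminus: "u \<in> gr n \<Longrightarrow> \<ominus> u \<in> gr n"
    and gr_one [simp]: "\<one> \<in> gr 0"
    and gr_mult: "\<lbrakk>u \<in> gr i; v \<in> gr j\<rbrakk> \<Longrightarrow> u \<otimes> v \<in> gr (i + j)"
    and gr_comm: "\<lbrakk>u \<in> gr i; v \<in> gr j\<rbrakk> \<Longrightarrow> u \<otimes> v = (-1) ^ (i * j) \<odot> (v \<otimes> u)"
    and gr_sq: "\<lbrakk>u \<in> gr i; odd i\<rbrakk> \<Longrightarrow> u \<otimes> u = \<zero>"
begin

lemma gr_carrier: "u \<in> gr n \<Longrightarrow> u \<in> carrier S" using gr_sub by blast

lemma gr_minus: "\<lbrakk>u \<in> gr n; v \<in> gr n\<rbrakk> \<Longrightarrow> u \<ominus> v \<in> gr n"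
  by (simp add: a_minus_def gr_add gr_uminus)

lemma gr_finsum: "(\<And>i. i \<in> A \<Longrightarrow> f i \<in> gr n) \<Longrightarrow> finsum S f A \<in> gr n"
proof (induction A rule: infinite_finite_induct)
  case (insert x F)
  then have "f \<in> F \<rightarrow> carrier S" "f x \<in> carrier S" using gr_carrier by blast+
  then show ?case using insert by (simp add: gr_add)
qed simp_all

lemma gr_int_mult: "u \<in> gr n \<Longrightarrow> (k::int) \<odot> u \<in> gr n"
proof -
  assume u: "u \<in> gr n"
  have n: "int m \<odot> u \<in> gr n" for m :: nat
    by (induction m) (use u in \<open>auto simp: int_mult_add_left gr_carrier gr_add\<close>)
  then show ?thesis using u gr_uminus[of _ n]
    by (cases k rule: int_cases2) (auto simp: int_mult_uminus gr_carrier)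
qed

lemma gr_comm_even: "\<lbrakk>u \<in> gr i; v \<in> gr j; even i \<or> even j\<rbrakk> \<Longrightarrow> u \<otimes> v = v \<otimes> u"
  using gr_comm[of u i v j] gr_carrier by auto

lemma gr_comm_odd: "\<lbrakk>u \<in> gr i; v \<in> gr j; odd i; odd j\<rbrakk> \<Longrightarrow> u \<otimes> v = \<ominus> (v \<otimes> u)"
  using gr_comm[of u i v j] gr_carrier by (simp add: uminus_power_if)

lemma gr_pow: "u \<in> gr n \<Longrightarrow> u [^] (k::nat) \<in> gr (n * k)"
proof (induction k)
  case (Suc k)
  then show ?case using gr_mult[of "u [^] k" "n * k" u n] by (simp add: add.commute)
qed simp

lemma gr_ext_prod:
  assumes "finite A" "\<And>a. a \<in> A \<Longrightarrow> g a \<in> gr (d a)"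
  shows "ext_prod S g A \<in> gr (sum d A)"
  using assms
proof (induction A rule: finite_index_induct)
  case (insert a A)
  then show ?case using gr_mult[of "g a" "d a" "ext_prod S g A" "sum d A"]
    by (simp add: ext_prod_insert)
qed simp

end

section \<open>Signs and binomial coefficients in products of monomials\<close>

definition inversions :: "'x set \<Rightarrow> 'x set \<Rightarrow> nat" where
  "inversions S S' = card {(a, c). a \<in> S \<and> c \<in> S' \<and> index_less c a}"

lemma inversions_fin: "\<lbrakk>finite S; finite S'\<rbrakk> \<Longrightarrow> finite {(a, c). a \<in> S \<and> c \<in> S' \<and> index_less c a}"
  by (rule finite_subset[of _ "S \<times> S'"]) auto

lemma inversions_Un_left:
  "\<lbrakk>finite S; finite T; finite U; S \<inter> T = {}\<rbrakk> \<Longrightarrow> inversions (S \<union> T) U = inversions S U + inversions T U"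
  unfolding inversions_def
  by (subst card_Un_disjoint[symmetric]) (auto simp: inversions_fin intro!: arg_cong[where f = card])

lemma inversions_Un_right:
  "\<lbrakk>finite S; finite T; finite U; T \<inter> U = {}\<rbrakk> \<Longrightarrow> inversions S (T \<union> U) = inversions S T + inversions S U"
  unfolding inversions_def
  by (subst card_Un_disjoint[symmetric]) (auto simp: inversions_fin intro!: arg_cong[where f = card])

lemma inversions_empty [simp]: "inversions {} S = 0" "inversions S {} = 0"
  by (simp_all add: inversions_def)

lemma inversions_min: "(\<And>c. c \<in> S \<Longrightarrow> index_less a c) \<Longrightarrow> inversions {a} S = 0"
  unfolding inversions_def by (auto simp: card_eq_0_iff dest: index_less_asym)

lemma inversions_singleton: "inversions {a} S = card {c \<in> S. index_less c a}"
  unfolding inversions_def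
  by (rule bij_betw_same_card[of snd]) (auto simp: bij_betw_def inj_on_def image_iff)

text \<open>Every pair from two disjoint sets is ordered in exactly one of the two ways. Modulo 2
  this is the sign rule for interchanging exterior monomials.\<close>

lemma inversions_swap:
  assumes "finite S" "finite T" "S \<inter> T = {}"
  shows "inversions S T + inversions T S = card S * card T"
proof -
  have "inversions T S = card {(a, c). a \<in> S \<and> c \<in> T \<and> index_less a c}"
    unfolding inversions_def
    by (rule bij_betw_same_card[of prod.swap]) (auto simp: bij_betw_def inj_on_def image_iff)
  then have "inversions S T + inversions T S
      = card ({(a, c). a \<in> S \<and> c \<in> T \<and> index_less c a} \<union> {(a, c). a \<in> S \<and> c \<in> T \<and> index_less a c})"
    unfolding inversions_def using assms
    by (subst card_Un_disjoint) (auto simp: inversions_fin dest: index_less_asym intro: finite_subset[of _ "S \<times> T"])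
  also have "{(a, c). a \<in> S \<and> c \<in> T \<and> index_less c a} \<union> {(a, c). a \<in> S \<and> c \<in> T \<and> index_less a c} = S \<times> T"
    using assms(3) by (auto dest: index_less_total[of _ _]) (metis IntI empty_iff index_less_total)
  finally show ?thesis by (simp add: card_cartesian_product)
qed

definition multichoose :: "'b multiset \<Rightarrow> 'b multiset \<Rightarrow> nat" where
  "multichoose \<mu> \<nu> = (\<Prod>b\<in>set_mset \<mu>. (count \<mu> b + count \<nu> b) choose count \<mu> b)"

lemma multichoose_expand:
  "\<lbrakk>finite D; set_mset \<mu> \<subseteq> D\<rbrakk> \<Longrightarrow> multichoose \<mu> \<nu> = (\<Prod>b\<in>D. (count \<mu> b + count \<nu> b) choose count \<mu> b)"
  unfolding multichoose_def by (rule prod.mono_neutral_left) (auto simp: not_in_iff)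

lemma multichoose_commute: "multichoose \<mu> \<nu> = multichoose \<nu> \<mu>"
proof -
  have "((m + n) choose m) = ((n + m) choose n)" for m n :: nat
    using binomial_symmetric[of m "m + n"] by (simp add: add.commute)
  then show ?thesis
  unfolding multichoose_expand[of "set_mset \<mu> \<union> set_mset \<nu>" \<mu>, simplified]
    multichoose_expand[of "set_mset \<mu> \<union> set_mset \<nu>" \<nu>, simplified]
  by (intro prod.cong refl)
qed

text \<open>For each \<open>b\<close> both sides are the trinomial coefficient of the three counts.
  Elements occurring only in the third multiset contribute a factor 1, so the product runs over the
  first two supports.\<close>

lemma multichoose_assoc:
  "multichoose \<mu> \<nu> * multichoose (\<mu> + \<nu>) \<rho> = multichoose \<nu> \<rho> * multichoose \<mu> (\<nu> + \<rho>)"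
proof -
  let ?D = "set_mset \<mu> \<union> set_mset \<nu>"
  have "((m + n) choose m) * ((m + n + p) choose (m + n)) = ((n + p) choose n) * ((m + (n + p)) choose m)"
    for m n p :: nat
    using choose_mult[of m "m + n" "m + n + p"] by (simp add: mult.commute add.assoc)
  then show ?thesis
    by (simp add: multichoose_expand[of ?D] flip: prod.distrib)
qed

lemma multichoose_empty [simp]: "multichoose {#} \<nu> = 1" "multichoose \<nu> {#} = 1"
  by (simp_all add: multichoose_def)

lemma multichoose_disjoint: "set_mset \<mu> \<inter> set_mset \<nu> = {} \<Longrightarrow> multichoose \<mu> \<nu> = 1"
  unfolding multichoose_def by (rule prod.neutral) (auto simp: not_in_iff disjoint_iff)

lemma tate_coeff_eq:
  "tate_coeff u v = (if fst u \<inter> fst v = {}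
     then (-1) ^ inversions (fst u) (fst v) * int (multichoose (snd u) (snd v)) else 0)"
  by (simp add: tate_coeff_def inversions_def multichoose_def)

abbreviation tate_monomials :: "'x set \<Rightarrow> 'b set \<Rightarrow> ('x set \<times> 'b multiset) set" where
  "tate_monomials X B \<equiv> {(S, \<nu>). finite S \<and> S \<subseteq> X \<and> set_mset \<nu> \<subseteq> B}"

section \<open>The algebra of exterior and divided power monomials over a commutative ring\<close>

locale tate_alg = cring R for R (structure) +
  fixes X :: "'x set" and B :: "'b set"
begin

text \<open>If the three index sets are pairwise disjoint, the inversion numbers in the cocycle
  condition add up to the same total, and the binomial coefficients match by
  \<open>multichoose_assoc\<close>. If two of the sets meet, both sides are zero.\<close>

lemma tate_basis_alg:
  "basis_alg R (tate_monomials X B) (\<lambda>u v. (fst u \<union> fst v, snd u + snd v)) ({}, {#}) tate_coeff"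
proof (intro basis_alg.intro basis_alg_axioms.intro)
  fix u v w assume *: "u \<in> tate_monomials X B" "v \<in> tate_monomials X B" "w \<in> tate_monomials X B"
  obtain S \<mu> where u: "u = (S, \<mu>)" by (cases u)
  obtain T \<nu> where v: "v = (T, \<nu>)" by (cases v)
  obtain U \<rho> where w: "w = (U, \<rho>)" by (cases w)
  have "int (multichoose \<mu> \<nu>) * int (multichoose (\<mu> + \<nu>) \<rho>) = int (multichoose \<nu> \<rho>) * int (multichoose \<mu> (\<nu> + \<rho>))"
    using multichoose_assoc[of \<mu> \<nu> \<rho>] by (metis of_nat_mult)
  then show "tate_coeff u v * tate_coeff (fst u \<union> fst v, snd u + snd v) w
      = tate_coeff v w * tate_coeff u (fst v \<union> fst w, snd v + snd w)"
    using * by (auto simp: u v w tate_coeff_eq inversions_Un_left inversions_Un_right power_add)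
qed (auto simp: tate_coeff_eq is_cring)

sublocale basis_alg R "tate_monomials X B" "\<lambda>u v. (fst u \<union> fst v, snd u + snd v)" "({}, {#})" tate_coeff
  rewrites "basis_algebra R (tate_monomials X B) (\<lambda>u v. (fst u \<union> fst v, snd u + snd v)) ({}, {#}) tate_coeff
    = tate_algebra R X B"
  by (rule tate_basis_alg) (simp add: tate_algebra_def)

abbreviation TA where "TA \<equiv> tate_algebra R X B"
abbreviation scal where "scal \<equiv> bt ({}, {#})"
abbreviation gen1 where "gen1 a \<equiv> bt ({a}, {#}) \<one>"
abbreviation gen2 where "gen2 b n \<equiv> bt ({}, replicate_mset n b) \<one>"

definition tgr where
  "tgr n = {u \<in> carrier TA. \<forall>m\<in>coeff_support R u. tate_degree m = n}"

lemma TA_one: "\<one>\<^bsub>TA\<^esub> = scal \<one>" by (rule BA_one)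

lemma scal_mult:
  "\<lbrakk>r \<in> carrier R; s \<in> carrier R; m \<in> tate_monomials X B\<rbrakk> \<Longrightarrow> scal r \<otimes>\<^bsub>TA\<^esub> bt m s = bt m (r \<otimes> s)"
  "\<lbrakk>r \<in> carrier R; s \<in> carrier R; m \<in> tate_monomials X B\<rbrakk> \<Longrightarrow> bt m s \<otimes>\<^bsub>TA\<^esub> scal r = bt m (r \<otimes> s)"
  by (auto simp: bt_mult tate_coeff_eq m_comm)

lemma scal_hom: "scal \<in> ring_hom R TA"
  by (rule ring_hom_memI) (auto simp: bt_add TA_one scal_mult(1))

lemma gen1_mult:
  assumes "a \<in> X" "(S, \<nu>) \<in> tate_monomials X B" "r \<in> carrier R"
  shows "gen1 a \<otimes>\<^bsub>TA\<^esub> bt (S, \<nu>) r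
    = (if a \<in> S then \<zero>\<^bsub>TA\<^esub> else (-1) ^ card {c \<in> S. index_less c a} \<odot>\<^bsub>TA\<^esub> bt (insert a S, \<nu>) r)"
  using assms by (auto simp: bt_mult tate_coeff_eq inversions_singleton bt_int_mult[symmetric] bt_zero)

lemma gen1_mult_min:
  assumes "a \<in> X" "(S, \<nu>) \<in> tate_monomials X B" "r \<in> carrier R" "\<And>c. c \<in> S \<Longrightarrow> index_less a c"
  shows "gen1 a \<otimes>\<^bsub>TA\<^esub> bt (S, \<nu>) r = bt (insert a S, \<nu>) r"
proof -
  have "a \<notin> S" using assms(4)[of a] by auto
  then show ?thesis using assms inversions_min[OF assms(4)]
    by (auto simp: bt_mult tate_coeff_eq)
qed

lemma gen2_mult:
  assumes "b \<in> B" "(S, \<nu>) \<in> tate_monomials X B" "r \<in> carrier R"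
  shows "gen2 b n \<otimes>\<^bsub>TA\<^esub> bt (S, \<nu>) r
    = int ((n + count \<nu> b) choose n) \<odot>\<^bsub>TA\<^esub> bt (S, replicate_mset n b + \<nu>) r"
  using assms
  by (auto simp: bt_mult tate_coeff_eq multichoose_def bt_int_mult[symmetric])

lemma gen2_mult_disjoint:
  assumes "b \<in> B" "(S, \<nu>) \<in> tate_monomials X B" "r \<in> carrier R" "b \<notin># \<nu>"
  shows "gen2 b n \<otimes>\<^bsub>TA\<^esub> bt (S, \<nu>) r = bt (S, replicate_mset n b + \<nu>) r"
  using gen2_mult[OF assms(1-3)] assms by (simp add: not_in_iff)

text \<open>A monomial is a product of generators with coefficient 1 if the exterior indices are
  taken in increasing order and each \<open>b\<close> is taken with its full multiplicity. All the
  \<open>gen2 b n\<close> count as generators, since over a ring with torsion they need not be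
  polynomials in \<open>gen2 b 1\<close>.\<close>

lemma TA_induct [consumes 1, case_names zero add one scal gen1 gen2]:
  assumes u: "u \<in> carrier TA"
    and P0: "P \<zero>\<^bsub>TA\<^esub>"
    and Padd: "\<And>u v. \<lbrakk>u \<in> carrier TA; v \<in> carrier TA; P u; P v\<rbrakk> \<Longrightarrow> P (u \<oplus>\<^bsub>TA\<^esub> v)"
    and P1: "P \<one>\<^bsub>TA\<^esub>"
    and Pscal: "\<And>r u. \<lbrakk>r \<in> carrier R; u \<in> carrier TA; P u\<rbrakk> \<Longrightarrow> P (scal r \<otimes>\<^bsub>TA\<^esub> u)"
    and Pg1: "\<And>a u. \<lbrakk>a \<in> X; u \<in> carrier TA; P u\<rbrakk> \<Longrightarrow> P (gen1 a \<otimes>\<^bsub>TA\<^esub> u)"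
    and Pg2: "\<And>b n u. \<lbrakk>b \<in> B; u \<in> carrier TA; P u\<rbrakk> \<Longrightarrow> P (gen2 b n \<otimes>\<^bsub>TA\<^esub> u)"
  shows "P u"
proof -
  have P2: "P (bt ({}, \<nu>) \<one>)" if "set_mset \<nu> \<subseteq> B" for \<nu>
  proof -
    have "finite D \<Longrightarrow> set_mset \<nu> = D \<Longrightarrow> D \<subseteq> B \<Longrightarrow> P (bt ({}, \<nu>) \<one>)" for D
    proof (induction D arbitrary: \<nu> rule: finite_induct)
      case empty
      then show ?case using P1 by (simp add: TA_one)
    next
      case (insert b D)
      \<comment> \<open>All copies of \<open>b\<close> are split off at once: the two factors then
        have disjoint supports and no binomial coefficient appears.\<close>
      let ?\<nu> = "filter_mset (\<lambda>c. c \<noteq> b) \<nu>"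
      have \<nu>: "\<nu> = replicate_mset (count \<nu> b) b + ?\<nu>"
        by (rule multiset_eqI) auto
      have s: "set_mset ?\<nu> = D" using insert by auto
      have "P (gen2 b (count \<nu> b) \<otimes>\<^bsub>TA\<^esub> bt ({}, ?\<nu>) \<one>)"
        using insert s by (intro Pg2 insert.IH bt_closed) auto
      also have "gen2 b (count \<nu> b) \<otimes>\<^bsub>TA\<^esub> bt ({}, ?\<nu>) \<one> = bt ({}, \<nu>) \<one>"
        using insert s by (subst (3) \<nu>) (intro gen2_mult_disjoint, auto)
      finally show ?case .
    qed
    then show ?thesis using that by blast
  qed
  have P3: "P (bt (S, \<nu>) \<one>)" if "finite S" "S \<subseteq> X" "set_mset \<nu> \<subseteq> B" for S \<nu>
    using that
  proof (induction S rule: finite_index_induct)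
    case (insert a S)
    then show ?case using Pg1[of a "bt (S, \<nu>) \<one>"] by (auto simp: gen1_mult_min)
  qed (simp add: P2)
  have P4: "P (bt m r)" if "m \<in> tate_monomials X B" "r \<in> carrier R" for m r
    using that Pscal[of r "bt m \<one>"] P3 by (cases m) (auto simp: scal_mult)
  show ?thesis
    using u BA_supp_M[OF u] by (induction rule: BA_induct) (auto intro: P0 Padd P4)
qed

lemma tgr_bt: "\<lbrakk>m \<in> tate_monomials X B; r \<in> carrier R; tate_degree m = n\<rbrakk> \<Longrightarrow> bt m r \<in> tgr n"
  by (auto simp: tgr_def supp_bt)

lemma tgr_induct [consumes 1, case_names zero add basis]:
  assumes "u \<in> tgr n" and "P \<zero>\<^bsub>TA\<^esub>"
    and "\<And>u v. \<lbrakk>u \<in> carrier TA; v \<in> carrier TA; P u; P v\<rbrakk> \<Longrightarrow> P (u \<oplus>\<^bsub>TA\<^esub> v)"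
    and "\<And>m r. \<lbrakk>m \<in> tate_monomials X B; tate_degree m = n; r \<in> carrier R\<rbrakk> \<Longrightarrow> P (bt m r)"
  shows "P u"
proof -
  have "u \<in> carrier TA" "coeff_support R u \<subseteq> {m. tate_degree m = n}"
    using assms(1) by (auto simp: tgr_def)
  then show ?thesis by (induction rule: BA_induct) (use assms in auto)
qed

lemma tgr_carrier: "u \<in> tgr n \<Longrightarrow> u \<in> carrier TA" by (simp add: tgr_def)

lemma tgr_zero [simp]: "\<zero>\<^bsub>TA\<^esub> \<in> tgr n"
  by (auto simp: tgr_def coeff_support_iff BA_zero_apply)

lemma tgr_add: "\<lbrakk>u \<in> tgr n; v \<in> tgr n\<rbrakk> \<Longrightarrow> u \<oplus>\<^bsub>TA\<^esub> v \<in> tgr n"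
  unfolding tgr_def by (fastforce simp: BA_add_closed BA_add_apply coeff_support_iff)

lemma tgr_uminus: "u \<in> tgr n \<Longrightarrow> \<ominus>\<^bsub>TA\<^esub> u \<in> tgr n"
  unfolding tgr_def by (fastforce simp: BA_uminus_apply coeff_support_iff)

lemma tate_degree_mult:
  "\<lbrakk>finite S; finite S'; S \<inter> S' = {}\<rbrakk> \<Longrightarrow>
    tate_degree (S \<union> S', \<mu> + \<nu>) = tate_degree (S, \<mu>) + tate_degree (S', \<nu>)"
  by (simp add: tate_degree_def card_Un_disjoint)

lemma tgr_mult_bt:
  assumes "m \<in> tate_monomials X B" "m' \<in> tate_monomials X B" "r \<in> carrier R" "r' \<in> carrier R"
  shows "bt m r \<otimes>\<^bsub>TA\<^esub> bt m' r' \<in> tgr (tate_degree m + tate_degree m')"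
proof (cases "fst m \<inter> fst m' = {}")
  case True
  then show ?thesis using assms
    by (auto simp: bt_mult tate_degree_mult intro!: tgr_bt)
next
  case False
  then show ?thesis using assms by (auto simp: bt_mult tate_coeff_eq)
qed

lemma tgr_mult: assumes u: "u \<in> tgr i" and v: "v \<in> tgr j" shows "u \<otimes>\<^bsub>TA\<^esub> v \<in> tgr (i + j)"
proof -
  have 1: "bt m r \<otimes>\<^bsub>TA\<^esub> v \<in> tgr (i + j)"
    if "m \<in> tate_monomials X B" "r \<in> carrier R" "tate_degree m = i" for m r
    using v
  proof (induction rule: tgr_induct)
    case (basis m' r')
    then show ?case using that tgr_mult_bt[of m m' r r'] by simp
  qed (use that in \<open>auto simp: BA.r_distr intro!: tgr_add\<close>)
  show ?thesis using u
    by (induction rule: tgr_induct) (use 1 tgr_carrier[OF v] in \<open>auto simp: BA.l_distr intro!: tgr_add\<close>)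
qed

lemma TA_comm_bt:
  assumes "m \<in> tate_monomials X B" "m' \<in> tate_monomials X B" "r \<in> carrier R" "r' \<in> carrier R"
  shows "bt m r \<otimes>\<^bsub>TA\<^esub> bt m' r' = (-1) ^ (tate_degree m * tate_degree m') \<odot>\<^bsub>TA\<^esub> (bt m' r' \<otimes>\<^bsub>TA\<^esub> bt m r)"
proof -
  obtain S \<mu> where m: "m = (S, \<mu>)" by (cases m)
  obtain S' \<nu> where m': "m' = (S', \<nu>)" by (cases m')
  have fin: "finite S" "finite S'" using assms by (auto simp: m m')
  \<comment> \<open>Divided powers have even degree, so modulo 2 a degree is the size of the
    exterior part.\<close>
  have par: "(-1::int) ^ (tate_degree m * tate_degree m') = (-1) ^ (card S * card S')"
    by (simp add: minus_one_power_iff m m' tate_degree_def)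
  have "tate_coeff m m' = (-1) ^ (tate_degree m * tate_degree m') * tate_coeff m' m"
  proof (cases "S \<inter> S' = {}")
    case True
    have "(-1::int) ^ inversions S S' = (-1) ^ (card S * card S') * (-1) ^ inversions S' S"
      using inversions_swap[OF fin True] by (auto simp: minus_one_power_iff) (metis even_add even_mult_iff)+
    then show ?thesis using True unfolding par
      by (simp add: m m' tate_coeff_eq Int_commute multichoose_commute[of \<mu>])
  next
    case False
    then show ?thesis by (simp add: m m' tate_coeff_eq Int_commute)
  qed
  then show ?thesis using assms
    by (auto simp: bt_mult m_comm[of r] Un_commute add.commute int_mult_mult simp flip: bt_int_mult)
qed

lemma TA_graded: "graded_comm TA tgr"
proof (intro graded_comm.intro graded_comm_axioms.intro)
  show "u \<otimes>\<^bsub>TA\<^esub> v = (-1) ^ (i * j) \<odot>\<^bsub>TA\<^esub> (v \<otimes>\<^bsub>TA\<^esub> u)" if u: "u \<in> tgr i" and v: "v \<in> tgr j" for u v i j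
  proof -
    have 1: "bt m r \<otimes>\<^bsub>TA\<^esub> v = (-1) ^ (i * j) \<odot>\<^bsub>TA\<^esub> (v \<otimes>\<^bsub>TA\<^esub> bt m r)"
      if "m \<in> tate_monomials X B" "r \<in> carrier R" "tate_degree m = i" for m r
      using v
    proof (induction rule: tgr_induct)
      case (basis m' r')
      then show ?case using that TA_comm_bt[of m m' r r'] by simp
    qed (use that in \<open>auto simp: BA.r_distr BA.l_distr BA.int_mult_add_right\<close>)
    show ?thesis using u
      by (induction rule: tgr_induct)
        (use 1 tgr_carrier[OF v] in \<open>auto simp: BA.r_distr BA.l_distr BA.int_mult_add_right\<close>)
  qed
  note comm = this
  show "u \<otimes>\<^bsub>TA\<^esub> u = \<zero>\<^bsub>TA\<^esub>" if u: "u \<in> tgr i" and i: "odd i" for u i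
  proof -
    \<comment> \<open>Membership is carried along because, in the square of a sum, the mixed terms
      cancel only for summands of odd degree. On a basis element the exterior part is nonempty and
      meets itself, so the structure constant is zero.\<close>
    have "u \<in> tgr i \<and> u \<otimes>\<^bsub>TA\<^esub> u = \<zero>\<^bsub>TA\<^esub>" using u
    proof (induction rule: tgr_induct)
      case (add u v)
      then have c: "u \<otimes>\<^bsub>TA\<^esub> v = \<ominus>\<^bsub>TA\<^esub> (v \<otimes>\<^bsub>TA\<^esub> u)" "u \<otimes>\<^bsub>TA\<^esub> u = \<zero>\<^bsub>TA\<^esub>" "v \<otimes>\<^bsub>TA\<^esub> v = \<zero>\<^bsub>TA\<^esub>"
        using comm[of u i v i] i by (simp_all add: uminus_power_if)
      have "(u \<oplus>\<^bsub>TA\<^esub> v) \<otimes>\<^bsub>TA\<^esub> (u \<oplus>\<^bsub>TA\<^esub> v) = (u \<otimes>\<^bsub>TA\<^esub> u \<oplus>\<^bsub>TA\<^esub> v \<otimes>\<^bsub>TA\<^esub> v) \<oplus>\<^bsub>TA\<^esub> (u \<otimes>\<^bsub>TA\<^esub> v \<oplus>\<^bsub>TA\<^esub> v \<otimes>\<^bsub>TA\<^esub> u)"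
        using add by (simp add: BA.l_distr BA.r_distr BA.a_ac)
      also have "\<dots> = \<zero>\<^bsub>TA\<^esub>" unfolding c using add by (simp add: BA.l_neg)
      finally show ?case using add by (simp add: tgr_add)
    next
      case (basis m r)
      then have "fst m \<noteq> {}" using i by (auto simp: tate_degree_def)
      then show ?case using basis by (auto simp: tgr_bt bt_mult tate_coeff_eq)
    qed simp
    then show ?thesis ..
  qed
qed (auto simp: tgr_add tgr_uminus tgr_mult BA_ring tgr_carrier TA_one intro!: tgr_bt simp: tate_degree_def)

sublocale TA: graded_comm TA tgr by (rule TA_graded)

end

section \<open>The universal property of the exterior algebra with divided powers\<close>

lemma (in ring) ext_prod_int_mult:
  assumes "finite A" "h \<in> A \<rightarrow> carrier R"
  shows "ext_prod R (\<lambda>a. k a \<odot> h a) A = (\<Prod>a\<in>A. k a) \<odot> ext_prod R h A"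
  using assms
proof (induction A rule: finite_index_induct)
  case (insert a A)
  then have c: "h a \<in> carrier R" "ext_prod R h A \<in> carrier R" by auto
  then have "k a \<odot> h a \<otimes> (prod k A \<odot> ext_prod R h A) = (k a * prod k A) \<odot> (h a \<otimes> ext_prod R h A)"
    by (simp add: add_pow_ldistr_int add_pow_rdistr_int mult.commute flip: int_mult_mult)
  then show ?case using insert by (simp add: ext_prod_insert)
qed simp

text \<open>The data of an algebra map out of the Tate algebra. The sequence \<open>y b\<close>
  stands for the divided powers of an element of degree 2, but only its multiplication rule is asked
  for; thus the locale applies before \<open>S\<close> is known to carry divided powers.\<close>

locale tate_target = graded_comm S gr for S (structure) and gr +
  fixes X :: "'x set" and B :: "'b set" and g :: "'x \<Rightarrow> 'a" and y :: "'b \<Rightarrow> nat \<Rightarrow> 'a"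
  assumes g_in: "a \<in> X \<Longrightarrow> g a \<in> gr 1"
    and y_in: "b \<in> B \<Longrightarrow> y b n \<in> gr (2 * n)"
    and y_0: "b \<in> B \<Longrightarrow> y b 0 = \<one>"
    and y_mult: "b \<in> B \<Longrightarrow> y b m \<otimes> y b n = int ((m + n) choose m) \<odot> y b (m + n)"
begin

definition ymon where
  "ymon \<nu> = ext_prod S (\<lambda>b. y b (count \<nu> b)) (set_mset \<nu>)"

definition tmon where
  "tmon m = ext_prod S g (fst m) \<otimes> ymon (snd m)"

lemma g_closed: "a \<in> X \<Longrightarrow> g a \<in> carrier S" using g_in gr_carrier by blast
lemma y_closed: "b \<in> B \<Longrightarrow> y b n \<in> carrier S" using y_in gr_carrier by blast

lemma ext_g_in: "\<lbrakk>finite A; A \<subseteq> X\<rbrakk> \<Longrightarrow> ext_prod S g A \<in> gr (card A)"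
  using gr_ext_prod[of A g "\<lambda>_. 1"] g_in by auto

lemma ext_g_closed: "\<lbrakk>finite A; A \<subseteq> X\<rbrakk> \<Longrightarrow> ext_prod S g A \<in> carrier S"
  using ext_g_in gr_carrier by blast

lemma ymon_in: "set_mset \<nu> \<subseteq> B \<Longrightarrow> ymon \<nu> \<in> gr (2 * size \<nu>)"
  unfolding ymon_def size_multiset_overloaded_eq sum_distrib_left
  by (rule gr_ext_prod) (auto intro: y_in)

lemma ymon_closed: "set_mset \<nu> \<subseteq> B \<Longrightarrow> ymon \<nu> \<in> carrier S"
  using ymon_in gr_carrier by blast

lemma tmon_in: "m \<in> tate_monomials X B \<Longrightarrow> tmon m \<in> gr (tate_degree m)"
  unfolding tmon_def tate_degree_def by (auto intro!: gr_mult ext_g_in ymon_in)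

lemma tmon_closed: "m \<in> tate_monomials X B \<Longrightarrow> tmon m \<in> carrier S"
  using tmon_in gr_carrier by blast

text \<open>The factor \<open>g a\<close> moves to its place past the smaller factors, with one sign
  for each. If it meets itself on the way, strictness gives zero.\<close>

lemma g_ext_mult:
  assumes "a \<in> X" "finite A" "A \<subseteq> X"
  shows "g a \<otimes> ext_prod S g A
    = (if a \<in> A then \<zero> else (-1) ^ card {c \<in> A. index_less c a} \<odot> ext_prod S g (insert a A))"
  using assms(2,3)
proof (induction A rule: finite_index_induct)
  case empty
  then show ?case using assms ext_prod_insert[of "{}" a S g] by (simp add: g_closed)
next
  case (insert m A)
  note [simp] = g_closed ext_g_closed
  have m: "m \<in> X" "A \<subseteq> X" "finite A" using insert by auto
  have E: "ext_prod S g (insert m A) = g m \<otimes> ext_prod S g A"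
    using insert by (simp add: ext_prod_insert)
  consider "a = m" | "index_less a m" | "a \<noteq> m" "index_less m a" using index_less_total[of a m] by auto
  then show ?case
  proof cases
    case 1
    have "g m \<otimes> (g m \<otimes> ext_prod S g A) = (g m \<otimes> g m) \<otimes> ext_prod S g A"
      using m by (simp add: m_assoc)
    then show ?thesis using 1 m gr_sq[OF g_in[of m]] by (simp add: E)
  next
    case 2
    have l: "index_less a c" if "c \<in> insert m A" for c
      using that 2 insert.hyps(3)[of c] index_less_trans[of a m c] by auto
    have e: "{c \<in> insert m A. index_less c a} = {}" using l index_less_asym[of a] by blast
    have "a \<notin> insert m A" using l[of a] by auto
    then show ?thesis unfolding e
      using m assms(1) l ext_prod_insert[of "insert m A" a S g] by (simp del: insert_iff)
  next
    case 3
    have k: "card {c \<in> insert m A. index_less c a} = Suc (card {c \<in> A. index_less c a})"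
    proof -
      have "{c \<in> insert m A. index_less c a} = insert m {c \<in> A. index_less c a}" using 3 by auto
      then show ?thesis using insert.hyps by simp
    qed
    have "g a \<otimes> (g m \<otimes> ext_prod S g A) = (g a \<otimes> g m) \<otimes> ext_prod S g A"
      using m assms(1) by (simp add: m_assoc)
    also have "g a \<otimes> g m = \<ominus> (g m \<otimes> g a)"
      using gr_comm_odd[OF g_in[of a] g_in[of m]] m assms(1) by simp
    also have "\<ominus> (g m \<otimes> g a) \<otimes> ext_prod S g A = \<ominus> (g m \<otimes> (g a \<otimes> ext_prod S g A))"
      using m assms(1) by (simp add: m_assoc l_minus)
    finally have *: "g a \<otimes> ext_prod S g (insert m A) = \<ominus> (g m \<otimes> (g a \<otimes> ext_prod S g A))"
      by (simp add: E)
    show ?thesis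
    proof (cases "a \<in> A")
      case True
      then show ?thesis using * insert.IH m by simp
    next
      case False
      have "ext_prod S g (insert m (insert a A)) = g m \<otimes> ext_prod S g (insert a A)"
        using insert.hyps 3 by (intro ext_prod_insert) auto
      then show ?thesis
        using * insert.IH m False 3 k assms(1)
        by (simp add: add_pow_rdistr_int int_mult_uminus insert_commute)
    qed
  qed
qed

lemma ext_g_mult:
  assumes "finite A" "A \<subseteq> X" "finite A'" "A' \<subseteq> X"
  shows "ext_prod S g A \<otimes> ext_prod S g A'
    = (if A \<inter> A' = {} then (-1) ^ inversions A A' \<odot> ext_prod S g (A \<union> A') else \<zero>)"
  using assms(1,2)
proof (induction A rule: finite_index_induct)
  case (insert m A)
  note [simp] = g_closed ext_g_closed
  have m: "m \<in> X" "A \<subseteq> X" "finite A" "m \<notin> A" using insert by auto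
  have *: "ext_prod S g (insert m A) \<otimes> ext_prod S g A' = g m \<otimes> (ext_prod S g A \<otimes> ext_prod S g A')"
    using m assms insert by (simp add: ext_prod_insert m_assoc)
  show ?case
  proof (cases "A \<inter> A' = {}")
    case False
    then show ?thesis using * insert.IH m by auto
  next
    case True
    \<comment> \<open>\<open>m\<close> is smaller than every element of \<open>A\<close>, so only
      inversions with \<open>A'\<close> are counted.\<close>
    have c: "{c \<in> A \<union> A'. index_less c m} = {c \<in> A'. index_less c m}"
      using insert.hyps(3) index_less_asym[of m] by blast
    have "g m \<otimes> ext_prod S g (A \<union> A') = (if m \<in> A' then \<zero>
        else (-1) ^ inversions {m} A' \<odot> ext_prod S g (insert m (A \<union> A')))"
      using g_ext_mult[of m "A \<union> A'"] m assms unfolding c inversions_singleton by simp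
    moreover have "inversions (insert m A) A' = inversions {m} A' + inversions A A'"
      using inversions_Un_left[of "{m}" A A'] m assms by simp
    ultimately show ?thesis using * insert.IH m assms True
      by (simp add: add_pow_rdistr_int int_mult_mult[symmetric] power_add mult.commute)
  qed
qed (simp add: ext_g_closed assms)

lemma ymon_expand:
  "\<lbrakk>finite D; set_mset \<nu> \<subseteq> D; D \<subseteq> B\<rbrakk> \<Longrightarrow> ymon \<nu> = ext_prod S (\<lambda>b. y b (count \<nu> b)) D"
  unfolding ymon_def
  by (rule ext_prod_mono_neutral) (auto simp: not_in_iff y_0 subset_iff intro!: y_closed)

lemma y_commute: "\<lbrakk>b \<in> B; u \<in> gr i\<rbrakk> \<Longrightarrow> y b n \<otimes> u = u \<otimes> y b n"
  using gr_comm_even[OF y_in[of b n], of u i] by simp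

lemma ymon_mult:
  assumes "set_mset \<mu> \<subseteq> B" "set_mset \<nu> \<subseteq> B"
  shows "ymon \<mu> \<otimes> ymon \<nu> = int (multichoose \<mu> \<nu>) \<odot> ymon (\<mu> + \<nu>)"
proof -
  let ?D = "set_mset \<mu> \<union> set_mset \<nu>"
  have D: "finite ?D" "?D \<subseteq> B" using assms by auto
  have "ymon \<mu> \<otimes> ymon \<nu> = ext_prod S (\<lambda>b. y b (count \<mu> b) \<otimes> y b (count \<nu> b)) ?D"
    using D by (subst (1 2) ymon_expand[of ?D])
      (auto intro!: ext_prod_mult y_closed y_commute[OF _ y_in])
  also have "\<dots> = ext_prod S (\<lambda>b. int ((count \<mu> b + count \<nu> b) choose count \<mu> b) \<odot> y b (count (\<mu> + \<nu>) b)) ?D"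
    using D by (intro ext_prod_cong) (auto simp: y_mult)
  also have "\<dots> = (\<Prod>b\<in>?D. int ((count \<mu> b + count \<nu> b) choose count \<mu> b)) \<odot> ext_prod S (\<lambda>b. y b (count (\<mu> + \<nu>) b)) ?D"
    using D by (intro ext_prod_int_mult) (auto intro!: y_closed)
  also have "\<dots> = int (multichoose \<mu> \<nu>) \<odot> ymon (\<mu> + \<nu>)"
    using D by (simp add: ymon_expand[of ?D] multichoose_expand[of ?D])
  finally show ?thesis .
qed

text \<open>The images of the monomials multiply with the structure constants of the Tate algebra,
  as \<open>linear_ext_ring_hom\<close> demands. The two factors in the middle can be interchanged
  because \<open>ymon\<close> has even degree.\<close>

lemma tmon_mult:
  assumes "u \<in> tate_monomials X B" "v \<in> tate_monomials X B"
  shows "tmon u \<otimes> tmon v = tate_coeff u v \<odot> tmon (fst u \<union> fst v, snd u + snd v)"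
proof -
  obtain A \<mu> A' \<nu> where u: "u = (A, \<mu>)" and v: "v = (A', \<nu>)" by (cases u, cases v)
  have c: "finite A" "finite A'" "A \<subseteq> X" "A' \<subseteq> X" "set_mset \<mu> \<subseteq> B" "set_mset \<nu> \<subseteq> B"
    using assms by (auto simp: u v)
  let ?E = "ext_prod S g A" let ?E' = "ext_prod S g A'"
  note [simp] = ext_g_closed ymon_closed
  have comm: "ymon \<mu> \<otimes> ?E' = ?E' \<otimes> ymon \<mu>"
    using c by (intro gr_comm_even[OF ymon_in ext_g_in]) auto
  have "?E \<otimes> ymon \<mu> \<otimes> (?E' \<otimes> ymon \<nu>) = ?E \<otimes> (ymon \<mu> \<otimes> ?E') \<otimes> ymon \<nu>"
    using c by (simp add: m_assoc)
  also have "\<dots> = (?E \<otimes> ?E') \<otimes> (ymon \<mu> \<otimes> ymon \<nu>)"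
    unfolding comm using c by (simp add: m_assoc)
  also have "\<dots> = tate_coeff u v \<odot> (ext_prod S g (A \<union> A') \<otimes> ymon (\<mu> + \<nu>))"
    using c by (simp add: ext_g_mult ymon_mult u v tate_coeff_eq add_pow_ldistr_int add_pow_rdistr_int mult.commute
      flip: int_mult_mult)
  finally show ?thesis by (simp add: tmon_def u v)
qed

lemma tmon_empty [simp]: "tmon ({}, {#}) = \<one>"
  by (simp add: tmon_def ymon_def)

lemma tmon_g: "a \<in> X \<Longrightarrow> tmon ({a}, {#}) = g a"
  using ext_prod_insert[of "{}" a S g] by (simp add: tmon_def ymon_def g_closed)

lemma tmon_y: "b \<in> B \<Longrightarrow> tmon ({}, replicate_mset n b) = y b n"
  using ext_prod_insert[of "{}" b S "\<lambda>b'. y b' (count (replicate_mset n b) b')"]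
  by (cases "n = 0") (simp_all add: tmon_def ymon_def y_closed y_0)

text \<open>Coefficients go to degree zero, hence commute with homogeneous elements. The formula for
  arbitrary \<open>p\<close> is also exported, because the kernel of \<open>h\<close> is later read
  off from it.\<close>

lemma tate_lift:
  assumes R: "cring R" and \<rho>: "\<rho> \<in> ring_hom R S" and \<rho>0: "\<And>r. r \<in> carrier R \<Longrightarrow> \<rho> r \<in> gr 0"
  obtains h where "h \<in> ring_hom (tate_algebra R X B) S"
    and "\<And>p. h p = (\<Oplus>m\<in>coeff_support R p. \<rho> (p m) \<otimes> tmon m)"
    and "\<And>m r. \<lbrakk>m \<in> tate_monomials X B; r \<in> carrier R\<rbrakk> \<Longrightarrow> h (basis_term R m r) = \<rho> r \<otimes> tmon m"
    and "\<And>n. h ` tate_alg.tgr R X B n \<subseteq> gr n"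
proof -
  interpret T: tate_alg R X B using R by (rule tate_alg.intro)
  let ?h = "T.linear_ext S \<rho> tmon"
  have hom: "?h \<in> ring_hom (tate_algebra R X B) S"
  proof (rule T.linear_ext_ring_hom[OF ring_axioms \<rho>])
    show "\<rho> r \<otimes> tmon u = tmon u \<otimes> \<rho> r" if "r \<in> carrier R" "u \<in> tate_monomials X B" for r u
      using gr_comm_even[OF \<rho>0[OF that(1)] tmon_in[OF that(2)]] by simp
  qed (auto simp: tmon_mult intro: tmon_closed)
  have bt: "?h (basis_term R m r) = \<rho> r \<otimes> tmon m" if "m \<in> tate_monomials X B" "r \<in> carrier R" for m r
    by (rule T.linear_ext_bt[OF ring_axioms ring_hom_additive[OF \<rho>] tmon_closed that])
  have "?h ` T.tgr n \<subseteq> gr n" for n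
  proof safe
    fix p assume p: "p \<in> T.tgr n"
    have "\<rho> (p m) \<otimes> tmon m \<in> gr n" if "m \<in> coeff_support R p" for m
    proof -
      have "m \<in> tate_monomials X B" using that T.BA_supp_M[OF T.tgr_carrier[OF p]] by blast
      moreover have "tate_degree m = n" using p that by (auto simp: T.tgr_def)
      moreover have "\<rho> (p m) \<in> gr 0" using \<rho>0 T.BA_coeff_closed[OF T.tgr_carrier[OF p]] by blast
      ultimately show ?thesis using gr_mult[of "\<rho> (p m)" 0 "tmon m" n] tmon_in[of m] by simp
    qed
    then show "?h p \<in> gr n" unfolding T.linear_ext_def by (rule gr_finsum)
  qed
  with hom bt show thesis by (intro that[of ?h]) (auto simp: T.linear_ext_def)
qed

end

section \<open>Existence of divided powers\<close>

text \<open>\<open>dp_quot n k = (k n)! / (n! (k!)\<^sup>n)\<close> as a product of integers.\<close>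

definition dp_quot :: "nat \<Rightarrow> nat \<Rightarrow> nat" where
  "dp_quot n k = (\<Prod>j<n. (k * Suc j - 1) choose (k - 1))"

lemma dp_quot_0 [simp]: "dp_quot 0 k = 1" by (simp add: dp_quot_def)

text \<open>This is the identity between constants behind \<open>dp_seq_compose\<close>: one more
  factor \<open>a k\<close> is multiplied to \<open>a (n * k)\<close>.\<close>

lemma dp_quot_Suc:
  assumes "k > 0"
  shows "Suc n * dp_quot (Suc n) k = dp_quot n k * ((k + n * k) choose k)"
proof -
  obtain j where k: "k = Suc j" using assms by (cases k) auto
  \<comment> \<open>The absorption identity for binomial coefficients; a factor \<open>k\<close> is
    cancelled afterwards.\<close>
  have "k * ((k * Suc n) choose k) = (k * Suc n) * ((k * Suc n - 1) choose (k - 1))"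
    unfolding k using binomial_absorption[of j "Suc j * Suc n"] by simp
  then have "((k * Suc n) choose k) = Suc n * ((k * Suc n - 1) choose (k - 1))"
    using assms by (metis mult.assoc mult_cancel1 nat_neq_iff)
  moreover have "k * Suc n = k + n * k" by simp
  ultimately show ?thesis by (simp add: dp_quot_def algebra_simps)
qed

lemma dp_quot_fact:
  assumes "k > 0"
  shows "dp_quot n k * (fact n * fact k ^ n) = fact (n * k)"
proof (induction n)
  case (Suc n)
  have "dp_quot (Suc n) k * (fact (Suc n) * fact k ^ Suc n)
    = (Suc n * dp_quot (Suc n) k) * (fact k * (fact n * fact k ^ n))"
    by (simp add: algebra_simps)
  also have "\<dots> = ((k + n * k) choose k) * fact k * (dp_quot n k * (fact n * fact k ^ n))"
    unfolding dp_quot_Suc[OF assms] by (simp add: algebra_simps)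
  also have "\<dots> = fact k * fact (n * k) * ((k + n * k) choose k)"
    unfolding Suc by (simp add: algebra_simps)
  also have "\<dots> = fact (k + n * k)"
    using binomial_fact_lemma[of k "k + n * k"] by simp
  finally show ?case by simp
qed simp

text \<open>In particular the division in the axiom for iterated divided powers is exact.\<close>

lemma dp_quot_eq: "k > 0 \<Longrightarrow> fact (n * k) div (fact n * fact k ^ n) = dp_quot n k"
  using dp_quot_fact[of k n] by (metis fact_nonzero mult_eq_0_iff nonzero_mult_div_cancel_right power_not_zero)

section \<open>Solutions of the recursion for divided powers\<close>

context graded_comm
begin

text \<open>In a torsion free ring this recursion has at most one solution, the divided powers of \<open>u\<close>.\<close>

definition dp_seq :: "'a \<Rightarrow> (nat \<Rightarrow> 'a) \<Rightarrow> bool" where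
  "dp_seq u a \<longleftrightarrow> a 0 = \<one> \<and> (\<forall>n. a n \<in> carrier S) \<and> (\<forall>n. int (Suc n) \<odot> a (Suc n) = u \<otimes> a n)"

text \<open>The factor n + 1 is split as j + (n + 1 - j) in the summand with index j; the two parts
  lower the index of \<open>a\<close> and of \<open>b\<close> by one, producing a factor
  \<open>u\<close> and a factor \<open>v\<close>.\<close>

lemma dp_seq_add:
  assumes u: "u \<in> gr (2 * i)" and v: "v \<in> gr (2 * j)" and a: "dp_seq u a" and b: "dp_seq v b"
    and a_gr: "\<And>n. a n \<in> gr (k * n)"
  shows "dp_seq (u \<oplus> v) (\<lambda>n. \<Oplus>j\<in>{..n}. a j \<otimes> b (n - j))"
proof -
  have [simp]: "u \<in> carrier S" "v \<in> carrier S" "a n \<in> carrier S" "b n \<in> carrier S" for n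
    using u v a b by (auto simp: dp_seq_def gr_carrier)
  have ra: "int (Suc n) \<odot> a (Suc n) = u \<otimes> a n" and rb: "int (Suc n) \<odot> b (Suc n) = v \<otimes> b n" for n
    using a b by (auto simp: dp_seq_def)
  \<comment> \<open>The factor \<open>v\<close> comes out between \<open>a j\<close> and
    \<open>b (n - j)\<close>; homogeneity of the \<open>a n\<close> lets it move to the
    front.\<close>
  have va: "v \<otimes> a n = a n \<otimes> v" for n using gr_comm_even[OF v a_gr] by simp
  have "int (Suc n) \<odot> (\<Oplus>j\<in>{..Suc n}. a j \<otimes> b (Suc n - j)) = (u \<oplus> v) \<otimes> (\<Oplus>j\<in>{..n}. a j \<otimes> b (n - j))" for n
  proof -
    have "int (Suc n) \<odot> (\<Oplus>j\<in>{..Suc n}. a j \<otimes> b (Suc n - j))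
      = (\<Oplus>j\<in>{..Suc n}. int (Suc n) \<odot> (a j \<otimes> b (Suc n - j)))"
      by (intro finsum_int_mult) auto
    also have "\<dots> = (\<Oplus>j\<in>{..Suc n}. int j \<odot> (a j \<otimes> b (Suc n - j)) \<oplus> int (Suc n - j) \<odot> (a j \<otimes> b (Suc n - j)))"
    proof (intro finsum_cong')
      fix j assume "j \<in> {..Suc n}"
      then have "int (Suc n) = int j + int (Suc n - j)" by auto
      then show "int (Suc n) \<odot> (a j \<otimes> b (Suc n - j)) = int j \<odot> (a j \<otimes> b (Suc n - j)) \<oplus> int (Suc n - j) \<odot> (a j \<otimes> b (Suc n - j))"
        by (simp only: int_mult_add_left m_closed \<open>a _ \<in> carrier S\<close> \<open>b _ \<in> carrier S\<close>)
    qed auto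
    also have "\<dots> = (\<Oplus>j\<in>{..Suc n}. int j \<odot> (a j \<otimes> b (Suc n - j))) \<oplus> (\<Oplus>j\<in>{..Suc n}. int (Suc n - j) \<odot> (a j \<otimes> b (Suc n - j)))"
      by (intro finsum_addf) auto
    also have "(\<Oplus>j\<in>{..Suc n}. int j \<odot> (a j \<otimes> b (Suc n - j))) = (\<Oplus>j\<in>{..n}. int (Suc j) \<odot> (a (Suc j) \<otimes> b (n - j)))"
      by (subst finsum_Suc2) (auto simp del: of_nat_Suc)
    also have "\<dots> = (\<Oplus>j\<in>{..n}. u \<otimes> (a j \<otimes> b (n - j)))"
      by (intro finsum_cong') (auto simp: ra m_assoc simp flip: add_pow_ldistr_int simp del: of_nat_Suc)
    also have "\<dots> = u \<otimes> (\<Oplus>j\<in>{..n}. a j \<otimes> b (n - j))"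
      by (rule finsum_rdistr[symmetric]) auto
    also have "(\<Oplus>j\<in>{..Suc n}. int (Suc n - j) \<odot> (a j \<otimes> b (Suc n - j))) = (\<Oplus>j\<in>{..n}. int (Suc n - j) \<odot> (a j \<otimes> b (Suc n - j)))"
      by (subst finsum_Suc) auto
    also have "\<dots> = (\<Oplus>j\<in>{..n}. v \<otimes> (a j \<otimes> b (n - j)))"
    proof (intro finsum_cong')
      fix j assume "j \<in> {..n}"
      then have "int (Suc n - j) \<odot> (a j \<otimes> b (Suc n - j)) = a j \<otimes> (int (Suc (n - j)) \<odot> b (Suc (n - j)))"
        by (simp add: add_pow_rdistr_int Suc_diff_le)
      also have "\<dots> = (v \<otimes> a j) \<otimes> b (n - j)"
        unfolding rb va by (simp add: m_assoc)
      finally show "int (Suc n - j) \<odot> (a j \<otimes> b (Suc n - j)) = v \<otimes> (a j \<otimes> b (n - j))"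
        by (simp add: m_assoc)
    qed auto
    also have "\<dots> = v \<otimes> (\<Oplus>j\<in>{..n}. a j \<otimes> b (n - j))"
      by (rule finsum_rdistr[symmetric]) auto
    finally show ?thesis by (simp add: l_distr)
  qed
  moreover have "(\<Oplus>j\<in>{..0}. a j \<otimes> b (0 - j)) = \<one>"
    using a b by (simp add: dp_seq_def)
  ultimately show ?thesis unfolding dp_seq_def by (auto intro!: finsum_closed)
qed

lemma dp_seq_mult:
  assumes v: "v \<in> gr (2 * j)" and u: "u \<in> gr i" and a: "dp_seq u a"
  shows "dp_seq (v \<otimes> u) (\<lambda>n. v [^] n \<otimes> a n)"
proof -
  have [simp]: "u \<in> carrier S" "v \<in> carrier S" "a n \<in> carrier S" for n
    using u v a by (auto simp: dp_seq_def gr_carrier)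
  have ra: "int (Suc n) \<odot> a (Suc n) = u \<otimes> a n" for n
    using a by (auto simp: dp_seq_def)
  have uv: "u \<otimes> v [^] (n::nat) = v [^] n \<otimes> u" for n
    using gr_comm_even[OF u gr_pow[OF v]] by simp
  have "int (Suc n) \<odot> (v [^] Suc n \<otimes> a (Suc n)) = v \<otimes> u \<otimes> (v [^] n \<otimes> a n)" for n
  proof -
    have "int (Suc n) \<odot> (v [^] Suc n \<otimes> a (Suc n)) = v [^] Suc n \<otimes> (u \<otimes> a n)"
      unfolding ra[symmetric] by (intro add_pow_rdistr_int[symmetric]) auto
    also have "\<dots> = v \<otimes> (v [^] n \<otimes> u) \<otimes> a n"
      unfolding nat_pow_Suc2[OF \<open>v \<in> carrier S\<close>] by (simp add: m_assoc)
    also have "\<dots> = v \<otimes> u \<otimes> (v [^] n \<otimes> a n)" unfolding uv[symmetric] by (simp add: m_assoc)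
    finally show ?thesis .
  qed
  then show ?thesis using a unfolding dp_seq_def by auto
qed

text \<open>Because u times u is zero, the sequence can be continued by zero from index 2
  on.\<close>

lemma dp_seq_square_zero:
  assumes "u \<in> carrier S" "u \<otimes> u = \<zero>"
  shows "dp_seq u (\<lambda>n. if n = 0 then \<one> else if n = 1 then u else \<zero>)"
  using assms unfolding dp_seq_def by auto

text \<open>Only the multiplication rule of \<open>a\<close> enters, so divided powers of
  \<open>a k\<close> are obtained from any such sequence, with the constants controlled by
  \<open>dp_quot_Suc\<close>.\<close>

lemma dp_seq_compose:
  assumes a: "\<And>m n. a m \<otimes> a n = int ((m + n) choose m) \<odot> a (m + n)" "\<And>n. a n \<in> carrier S" "a 0 = \<one>"
    and k: "k > 0"
  shows "dp_seq (a k) (\<lambda>n. int (dp_quot n k) \<odot> a (n * k))"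
proof -
  have "int (Suc n) \<odot> (int (dp_quot (Suc n) k) \<odot> a (Suc n * k)) = a k \<otimes> (int (dp_quot n k) \<odot> a (n * k))" for n
  proof -
    have "int (Suc n) \<odot> (int (dp_quot (Suc n) k) \<odot> a (Suc n * k)) = int (Suc n * dp_quot (Suc n) k) \<odot> a (Suc n * k)"
      unfolding of_nat_mult by (rule int_mult_mult[symmetric]) (rule a)
    also have "\<dots> = int (dp_quot n k) \<odot> (int ((k + n * k) choose k) \<odot> a (k + n * k))"
      unfolding dp_quot_Suc[OF k] of_nat_mult using a by (simp add: int_mult_mult)
    finally show ?thesis using a by (simp add: add_pow_rdistr_int)
  qed
  then show ?thesis unfolding dp_seq_def using a by (auto simp del: of_nat_Suc mult_Suc One_nat_def)
qed

end

text \<open>Torsion freeness yields uniqueness only. In a polynomial ring over the integers with a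
  variable of degree 2 the recursion has no solution, so existence is a second axiom.\<close>

locale torsion_free_graded = graded_comm S gr for S (structure) and gr +
  assumes torsion_free: "\<lbrakk>x \<in> carrier S; n > 0; int n \<odot> x = \<zero>\<rbrakk> \<Longrightarrow> x = \<zero>"
    and dp_ex: "\<lbrakk>i > 0; u \<in> gr (2 * i)\<rbrakk> \<Longrightarrow> \<exists>a. dp_seq u a \<and> (\<forall>n. a n \<in> gr (2 * i * n))"
begin

lemma int_mult_cancel:
  assumes "x \<in> carrier S" "y \<in> carrier S" "n > 0" "int n \<odot> x = int n \<odot> y"
  shows "x = y"
proof -
  have "int n \<odot> (x \<ominus> y) = int n \<odot> x \<ominus> int n \<odot> y"
    using assms(1,2) by (simp add: a_minus_def int_mult_add_right int_mult_minus)
  also have "\<dots> = \<zero>" unfolding assms(4) using assms(2) by (simp add: a_minus_def r_neg)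
  finally have "x \<ominus> y = \<zero>" using torsion_free[of "x \<ominus> y" n] assms(1-3) by blast
  moreover have "x = (x \<ominus> y) \<oplus> y" using assms(1,2) by (simp add: a_minus_def a_assoc l_neg)
  ultimately show ?thesis using assms(2) by simp
qed

lemma dp_seq_unique:
  assumes "dp_seq u a" "dp_seq u b"
  shows "a n = b n"
proof (induction n)
  case (Suc n)
  have "int (Suc n) \<odot> a (Suc n) = u \<otimes> a n" "int (Suc n) \<odot> b (Suc n) = u \<otimes> b n"
    using assms unfolding dp_seq_def by blast+
  then have "int (Suc n) \<odot> a (Suc n) = int (Suc n) \<odot> b (Suc n)" using Suc by (simp only:)
  moreover have "a (Suc n) \<in> carrier S" "b (Suc n) \<in> carrier S"
    using assms unfolding dp_seq_def by blast+
  ultimately show ?case using int_mult_cancel zero_less_Suc by blast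
qed (use assms in \<open>simp add: dp_seq_def\<close>)

definition dp where "dp n u = (SOME a. dp_seq u a) n"

lemma dp_eq: "dp_seq u a \<Longrightarrow> dp n u = a n"
  unfolding dp_def by (rule dp_seq_unique[of u]) (rule someI[of "dp_seq u"])

context
  fixes i u assumes i: "i > 0" and u: "u \<in> gr (2 * i)"
begin

lemma dp_in: "dp n u \<in> gr (2 * i * n)" and dp_dp_seq: "dp_seq u (\<lambda>n. dp n u)"
proof -
  obtain a where a: "dp_seq u a" "\<And>n. a n \<in> gr (2 * i * n)" using dp_ex[OF i u] by blast
  have "(\<lambda>n. dp n u) = a" using dp_eq[OF a(1)] by auto
  then show "dp n u \<in> gr (2 * i * n)" "dp_seq u (\<lambda>n. dp n u)" using a by auto
qed

lemma dp_closed: "dp n u \<in> carrier S" using dp_in gr_carrier by blast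

lemma dp_0: "dp 0 u = \<one>" using dp_dp_seq by (simp add: dp_seq_def)

lemma dp_1: "dp 1 u = u"
proof -
  have "int (Suc 0) \<odot> dp (Suc 0) u = u \<otimes> dp 0 u" using dp_dp_seq unfolding dp_seq_def by blast
  then show ?thesis using dp_closed dp_0 gr_carrier[OF u] by simp
qed

lemma dp_fact: "int (fact n) \<odot> dp n u = u [^] n"
proof (induction n)
  case (Suc n)
  have r: "int (Suc n) \<odot> dp (Suc n) u = u \<otimes> dp n u" using dp_dp_seq unfolding dp_seq_def by blast
  have "int (fact (Suc n)) \<odot> dp (Suc n) u = int (fact n) \<odot> (int (Suc n) \<odot> dp (Suc n) u)"
    using dp_closed by (simp add: int_mult_mult[symmetric] algebra_simps)
  also have "\<dots> = u \<otimes> (int (fact n) \<odot> dp n u)"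
    unfolding r using dp_closed gr_carrier[OF u] by (simp add: add_pow_rdistr_int)
  also have "\<dots> = u [^] Suc n" unfolding Suc using gr_carrier[OF u] by (rule nat_pow_Suc2[symmetric])
  finally show ?case .
qed (use dp_0 in simp)

text \<open>After multiplication by m! n! both sides equal the (m + n)-th power of \<open>u\<close>,
  and torsion freeness cancels the factor.\<close>

lemma dp_mult: "dp m u \<otimes> dp n u = int ((m + n) choose m) \<odot> dp (m + n) u"
proof (rule int_mult_cancel[of _ _ "fact m * fact n"])
  have "fact m * fact n * ((m + n) choose m) = (fact (m + n) :: nat)"
    using binomial_fact_lemma[of m "m + n"] by simp
  then have "int (fact m * fact n) \<odot> (int ((m + n) choose m) \<odot> dp (m + n) u) = int (fact (m + n)) \<odot> dp (m + n) u"
    using dp_closed by (metis int_mult_mult of_nat_mult)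
  also have "\<dots> = (int (fact m) \<odot> dp m u) \<otimes> (int (fact n) \<odot> dp n u)"
    unfolding dp_fact using gr_carrier[OF u] by (simp add: nat_pow_mult)
  also have "\<dots> = int (fact m * fact n) \<odot> (dp m u \<otimes> dp n u)"
    using dp_closed by (simp add: add_pow_ldistr_int add_pow_rdistr_int mult.commute flip: int_mult_mult)
  finally show "int (fact m * fact n) \<odot> (dp m u \<otimes> dp n u) = int (fact m * fact n) \<odot> (int ((m + n) choose m) \<odot> dp (m + n) u)"
    by simp
qed (use dp_closed in auto)

end

text \<open>Apart from the product rule, which is \<open>dp_mult\<close>, the identities follow from
  uniqueness: the right-hand side is recognised as a solution of the recursion that belongs to the
  argument of \<open>dp\<close> on the left.\<close>

lemma dp_divided_powers: "divided_powers S gr dp"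
  unfolding divided_powers_def
proof (intro conjI allI impI ballI)
  fix i u n assume i: "(0::nat) < i" and u: "u \<in> gr (2 * i)"
  note dpu = dp_closed[OF i u]
  show "dp n u \<in> gr (2 * i * n)" "dp 0 u = \<one>" "dp 1 u = u"
    by (rule dp_in[OF i u] dp_0[OF i u] dp_1[OF i u])+
  show "dp m u \<otimes> dp n u = add_pow S ((m + n) choose m) (dp (m + n) u)" for m
    using dp_mult[OF i u] by (simp add: int_mult_nat)
  show "dp m (dp n u) = add_pow S (fact (m * n) div (fact m * fact n ^ m) :: nat) (dp (m * n) u)"
    if "n > 0" for m
    using dp_eq[OF dp_seq_compose[OF dp_mult[OF i u] dpu dp_0[OF i u] that], of m] that
    by (simp add: dp_quot_eq int_mult_nat)
  show "dp n (u \<oplus> v) = (\<Oplus>j\<in>{..n}. dp j u \<otimes> dp (n - j) v)" if v: "v \<in> gr (2 * i)" for v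
    using dp_eq[OF dp_seq_add[OF u v dp_dp_seq[OF i u] dp_dp_seq[OF i v] dp_in[OF i u]], of n] .
  show "dp n (v \<otimes> u) = v [^] n \<otimes> dp n u" if v: "v \<in> gr (2 * j)" for j v
    using dp_eq[OF dp_seq_mult[OF v u dp_dp_seq[OF i u]], of n] .
next
  fix i j u v n assume u: "u \<in> gr (2 * i + 1)" and v: "v \<in> gr (2 * j + 1)" and n: "2 \<le> (n::nat)"
  have c: "u \<in> carrier S" "v \<in> carrier S" using u v gr_carrier by auto
  \<comment> \<open>A product of two odd elements has square zero, so its recursion is solved by a
    sequence that vanishes from index 2 on.\<close>
  have "(u \<otimes> v) \<otimes> (u \<otimes> v) = u \<otimes> (v \<otimes> u) \<otimes> v" using c by (simp add: m_assoc)
  also have "\<dots> = \<ominus> ((u \<otimes> u) \<otimes> (v \<otimes> v))"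
    using c gr_comm_odd[OF v u] by (simp add: m_assoc l_minus r_minus)
  also have "\<dots> = \<zero>" using c gr_sq[OF u] by simp
  finally have "dp_seq (u \<otimes> v) (\<lambda>n. if n = 0 then \<one> else if n = 1 then u \<otimes> v else \<zero>)"
    using c by (intro dp_seq_square_zero) auto
  then show "dp n (u \<otimes> v) = \<zero>" using dp_eq n by fastforce
qed

lemma dp_add:
  "\<lbrakk>i > 0; u \<in> gr (2 * i); v \<in> gr (2 * i)\<rbrakk> \<Longrightarrow> dp n (u \<oplus> v) = (\<Oplus>j\<in>{..n}. dp j u \<otimes> dp (n - j) v)"
  using dp_divided_powers unfolding divided_powers_def by blast

lemma dp_scale:
  "\<lbrakk>i > 0; u \<in> gr (2 * i); v \<in> gr (2 * j)\<rbrakk> \<Longrightarrow> dp n (v \<otimes> u) = v [^] n \<otimes> dp n u"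
  using dp_divided_powers unfolding divided_powers_def by blast

lemma dp_odd: "\<lbrakk>u \<in> gr (2 * i + 1); v \<in> gr (2 * j + 1); 2 \<le> n\<rbrakk> \<Longrightarrow> dp n (u \<otimes> v) = \<zero>"
  using dp_divided_powers[unfolded divided_powers_def, THEN conjunct2] by blast

text \<open>Two lifts of one element differ by some d in the kernel of \<pi>. In the expansion of
  the n-th divided power of u + d every term with a positive divided power of d dies by
  \<open>ker\<close>, so the value does not depend on the lift. By \<open>direct\<close>, all lifts
  of a nonzero element have the same degree, which makes d homogeneous.\<close>

lemma dp_descend:
  assumes S': "graded_comm S' gr'" and \<pi>: "\<pi> \<in> ring_hom S S'" and surj: "\<And>n. gr' n = \<pi> ` gr n"
    and direct: "\<And>u i j. \<lbrakk>u \<in> gr' i; u \<in> gr' j; i \<noteq> j\<rbrakk> \<Longrightarrow> u = \<zero>\<^bsub>S'\<^esub>"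
    and ker: "\<And>i u n. \<lbrakk>i > 0; u \<in> gr (2 * i); \<pi> u = \<zero>\<^bsub>S'\<^esub>; n > 0\<rbrakk> \<Longrightarrow> \<pi> (dp n u) = \<zero>\<^bsub>S'\<^esub>"
  obtains \<gamma> where "divided_powers S' gr' \<gamma>"
    and "\<And>i u n. \<lbrakk>i > 0; u \<in> gr (2 * i)\<rbrakk> \<Longrightarrow> \<gamma> n (\<pi> u) = \<pi> (dp n u)"
proof -
  interpret S': graded_comm S' gr' by (rule S')
  note add = ring_hom_additive[OF \<pi>]
  note [simp] = ring_hom_closed[OF \<pi>]
  note pi_zero = additive_zero[OF abelian_group_axioms S'.abelian_group_axioms add]
  define lift where "lift u' = (SOME u. (\<exists>i>0. u \<in> gr (2 * i)) \<and> \<pi> u = u')" for u'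
  \<comment> \<open>Zero lies in every component, so a lift of it has no determined degree; its
    divided powers are fixed by hand.\<close>
  define \<gamma> where "\<gamma> n u' = (if u' = \<zero>\<^bsub>S'\<^esub> then if n = 0 then \<one>\<^bsub>S'\<^esub> else \<zero>\<^bsub>S'\<^esub> else \<pi> (dp n (lift u')))" for n u'
  have key: "\<gamma> n (\<pi> u) = \<pi> (dp n u)" if i: "i > 0" and u: "u \<in> gr (2 * i)" for n i u
  proof (cases "\<pi> u = \<zero>\<^bsub>S'\<^esub>")
    case True
    then show ?thesis
      using ker[OF i u True, of n] dp_0[OF i u] ring_hom_one[OF \<pi>] by (simp add: \<gamma>_def)
  next
    case False
    have "\<exists>w. (\<exists>i>0. w \<in> gr (2 * i)) \<and> \<pi> w = \<pi> u" using i u by blast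
    then have "(\<exists>i>0. lift (\<pi> u) \<in> gr (2 * i)) \<and> \<pi> (lift (\<pi> u)) = \<pi> u"
      unfolding lift_def by (rule someI_ex)
    then obtain j where j: "j > 0" "lift (\<pi> u) \<in> gr (2 * j)" "\<pi> (lift (\<pi> u)) = \<pi> u" by blast
    have "\<pi> u \<in> gr' (2 * i)" "\<pi> u \<in> gr' (2 * j)" using u j surj by (metis imageI)+
    then have "i = j" using direct[of "\<pi> u" "2 * i" "2 * j"] False by auto
    with j have w: "lift (\<pi> u) \<in> gr (2 * i)" by simp
    let ?d = "lift (\<pi> u) \<ominus> u"
    have d: "?d \<in> gr (2 * i)" using gr_minus w u by blast
    have "\<pi> ?d = \<zero>\<^bsub>S'\<^esub>"
      using additive_minus[OF abelian_group_axioms S'.abelian_group_axioms add, of "lift (\<pi> u)" u]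
        j(3) gr_carrier[OF w] gr_carrier[OF u] by (simp add: S'.r_neg a_minus_def)
    then have kz: "\<pi> (dp k ?d) = \<zero>\<^bsub>S'\<^esub>" if "k > 0" for k using ker[OF i d] that by blast
    have eq: "u \<oplus> ?d = lift (\<pi> u)"
      using gr_carrier[OF w] gr_carrier[OF u] by (simp add: a_minus_def a_ac r_neg1 r_neg2 r_neg)
    have "\<pi> (dp n (lift (\<pi> u))) = \<pi> (\<Oplus>k\<in>{..n}. dp k u \<otimes> dp (n - k) ?d)"
      using dp_add[OF i u d, of n] eq by simp
    also have "\<dots> = (\<Oplus>\<^bsub>S'\<^esub>k\<in>{..n}. \<pi> (dp k u \<otimes> dp (n - k) ?d))"
      using dp_closed[OF i u] dp_closed[OF i d]
      by (intro additive_finsum[OF abelian_group_axioms S'.abelian_group_axioms add]) auto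
    also have "\<dots> = \<pi> (dp n u \<otimes> dp (n - n) ?d)"
      using dp_closed[OF i u] dp_closed[OF i d] kz
      by (intro S'.finsum_delta) (auto simp: ring_hom_mult[OF \<pi>])
    also have "\<dots> = \<pi> (dp n u)" using dp_closed[OF i u] by (simp add: dp_0[OF i d])
    finally show ?thesis using False by (simp add: \<gamma>_def)
  qed
  have lft: "\<exists>u\<in>gr n. u' = \<pi> u" if "u' \<in> gr' n" for u' n using that surj by auto
  have npow: "\<pi> (v [^] n) = \<pi> v [^]\<^bsub>S'\<^esub> (n::nat)" if "v \<in> carrier S" for v n
    by (induction n) (use that in \<open>simp_all add: ring_hom_one[OF \<pi>] ring_hom_mult[OF \<pi>]\<close>)
  have addpow: "\<pi> (add_pow S (n::nat) x) = add_pow S' n (\<pi> x)" if "x \<in> carrier S" for n x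
    using additive_int_mult[OF abelian_group_axioms S'.abelian_group_axioms add that, of "int n"]
    by (simp add: int_mult_nat S'.int_mult_nat)
  have "divided_powers S' gr' \<gamma>"
    unfolding divided_powers_def
  proof (intro conjI allI impI ballI)
    fix i u' n assume i: "(0::nat) < i" and "u' \<in> gr' (2 * i)"
    then obtain u where u: "u \<in> gr (2 * i)" and u': "u' = \<pi> u" using lft by blast
    note [simp] = dp_closed[OF i u]
    show "\<gamma> n u' \<in> gr' (2 * i * n)"
      unfolding u' key[OF i u] surj using dp_in[OF i u] by blast
    show "\<gamma> 0 u' = \<one>\<^bsub>S'\<^esub>" "\<gamma> 1 u' = u'"
      unfolding u' key[OF i u] dp_0[OF i u] dp_1[OF i u] by (simp_all add: ring_hom_one[OF \<pi>])
    show "\<gamma> m u' \<otimes>\<^bsub>S'\<^esub> \<gamma> n u' = add_pow S' ((m + n) choose m) (\<gamma> (m + n) u')" for m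
      unfolding u' key[OF i u]
      by (simp add: ring_hom_mult[OF \<pi>, symmetric] dp_mult[OF i u] int_mult_nat addpow)
    show "\<gamma> m (\<gamma> n u') = add_pow S' (fact (m * n) div (fact m * fact n ^ m) :: nat) (\<gamma> (m * n) u')"
      if n: "n > 0" for m
    proof -
      have "dp n u \<in> gr (2 * (i * n))" using dp_in[OF i u, of n] by (simp add: mult.assoc)
      then have "\<gamma> m (\<gamma> n u') = \<pi> (dp m (dp n u))"
        unfolding u' key[OF i u] using i n by (intro key[of "i * n"]) auto
      also have "dp m (dp n u) = add_pow S (fact (m * n) div (fact m * fact n ^ m) :: nat) (dp (m * n) u)"
        using dp_divided_powers i u n unfolding divided_powers_def by blast
      finally show ?thesis unfolding u' key[OF i u] by (simp add: addpow)
    qed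
    show "\<gamma> n (u' \<oplus>\<^bsub>S'\<^esub> v') = (\<Oplus>\<^bsub>S'\<^esub>j\<in>{..n}. \<gamma> j u' \<otimes>\<^bsub>S'\<^esub> \<gamma> (n - j) v')" if v'_in: "v' \<in> gr' (2 * i)" for v'
    proof -
      obtain v where v: "v \<in> gr (2 * i)" and v': "v' = \<pi> v" using lft[OF v'_in] by blast
      note [simp] = dp_closed[OF i v]
      have "\<gamma> n (u' \<oplus>\<^bsub>S'\<^esub> v') = \<gamma> n (\<pi> (u \<oplus> v))"
        using gr_carrier[OF u] gr_carrier[OF v] by (simp add: u' v' additive_add[OF add])
      also have "\<dots> = \<pi> (\<Oplus>j\<in>{..n}. dp j u \<otimes> dp (n - j) v)"
        unfolding key[OF i gr_add[OF u v]] dp_add[OF i u v] ..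
      also have "\<dots> = (\<Oplus>\<^bsub>S'\<^esub>j\<in>{..n}. \<pi> (dp j u \<otimes> dp (n - j) v))"
        by (intro additive_finsum[OF abelian_group_axioms S'.abelian_group_axioms add]) auto
      finally show ?thesis unfolding u' v' key[OF i u] key[OF i v] by (simp add: ring_hom_mult[OF \<pi>])
    qed
    show "\<gamma> n (v' \<otimes>\<^bsub>S'\<^esub> u') = v' [^]\<^bsub>S'\<^esub> n \<otimes>\<^bsub>S'\<^esub> \<gamma> n u'" if v'_in: "v' \<in> gr' (2 * j)" for j v'
    proof -
      obtain v where v: "v \<in> gr (2 * j)" and v': "v' = \<pi> v" using lft[OF v'_in] by blast
      note [simp] = gr_carrier[OF v] gr_carrier[OF u]
      have "v \<otimes> u \<in> gr (2 * (j + i))" using gr_mult[OF v u] by (simp add: algebra_simps)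
      then have "\<gamma> n (\<pi> (v \<otimes> u)) = \<pi> (dp n (v \<otimes> u))" using i by (intro key[of "j + i"]) auto
      then show ?thesis
        unfolding u' v' key[OF i u] by (simp add: ring_hom_mult[OF \<pi>] dp_scale[OF i u v] npow)
    qed
  next
    fix i j u' v' n
    assume u': "u' \<in> gr' (2 * i + 1)" and v': "v' \<in> gr' (2 * j + 1)" and n: "2 \<le> (n::nat)"
    obtain u where u: "u \<in> gr (2 * i + 1)" "u' = \<pi> u" using lft[OF u'] by blast
    obtain v where v: "v \<in> gr (2 * j + 1)" "v' = \<pi> v" using lft[OF v'] by blast
    have "u \<otimes> v \<in> gr (2 * (i + j + 1))" using gr_mult[OF u(1) v(1)] by (simp add: algebra_simps)
    then have "\<gamma> n (\<pi> (u \<otimes> v)) = \<pi> (dp n (u \<otimes> v))" by (intro key[of "i + j + 1"]) auto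
    also have "dp n (u \<otimes> v) = \<zero>" by (rule dp_odd[OF u(1) v(1) n])
    finally show "\<gamma> n (u' \<otimes>\<^bsub>S'\<^esub> v') = \<zero>\<^bsub>S'\<^esub>"
      using u v gr_carrier[OF u(1)] gr_carrier[OF v(1)] by (simp add: ring_hom_mult[OF \<pi>] pi_zero)
  qed
  then show thesis using key by (rule that)
qed

end

section \<open>Divided powers on the algebra of monomials\<close>

context tate_alg
begin

lemma replicate_mset_plus: "replicate_mset m b + replicate_mset n b = replicate_mset (m + n) b"
  by (rule multiset_eqI) auto

lemma gen2_in: "b \<in> B \<Longrightarrow> gen2 b n \<in> tgr (2 * n)"
  by (rule tgr_bt) (auto simp: tate_degree_def)

lemma gen1_in: "a \<in> X \<Longrightarrow> gen1 a \<in> tgr 1"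
  by (rule tgr_bt) (auto simp: tate_degree_def)

lemma scal_in: "r \<in> carrier R \<Longrightarrow> scal r \<in> tgr 0"
  by (rule tgr_bt) (auto simp: tate_degree_def)

lemma gen2_gen2:
  "b \<in> B \<Longrightarrow> gen2 b m \<otimes>\<^bsub>TA\<^esub> gen2 b n = int ((m + n) choose m) \<odot>\<^bsub>TA\<^esub> gen2 b (m + n)"
  using gen2_mult[of b "{}" "replicate_mset n b" \<one> m] by (auto simp: replicate_mset_plus)

lemma dp_seq_gen2: "\<lbrakk>b \<in> B; k > 0\<rbrakk> \<Longrightarrow> TA.dp_seq (gen2 b k) (\<lambda>n. int (dp_quot n k) \<odot>\<^bsub>TA\<^esub> gen2 b (n * k))"
  by (rule TA.dp_seq_compose) (auto simp: gen2_gen2 TA_one)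

text \<open>A monomial of positive even degree with an exterior factor is a product of two odd
  elements, whose higher divided powers vanish. Without one it is an even element times some
  \<open>gen2 b k\<close>, whose divided powers are explicit. All statements about divided powers on
  monomials are reduced to these two cases.\<close>

lemma even_basis_cases:
  assumes m: "m \<in> tate_monomials X B" and r: "r \<in> carrier R" and deg: "tate_degree m = 2 * i" "i > 0"
  obtains (odd) a j u where "a \<in> X" "u \<in> tgr (2 * j + 1)" "i = j + 1" "bt m r = gen1 a \<otimes>\<^bsub>TA\<^esub> u"
    | (even) b k j u where "b \<in> B" "k > 0" "u \<in> tgr (2 * j)" "i = j + k" "bt m r = u \<otimes>\<^bsub>TA\<^esub> gen2 b k"
proof -
  obtain S \<nu> where mS: "m = (S, \<nu>)" by (cases m)
  have c: "finite S" "S \<subseteq> X" "set_mset \<nu> \<subseteq> B" using m by (auto simp: mS)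
  show thesis
  proof (cases "S = {}")
    case False
    obtain a where a: "a \<in> S" "\<forall>c\<in>S - {a}. index_less a c" using ex_index_min[OF False] by blast
    have "bt m r = gen1 a \<otimes>\<^bsub>TA\<^esub> bt (S - {a}, \<nu>) r"
      using gen1_mult_min[of a "S - {a}" \<nu> r] a c r by (simp add: mS insert_absorb subset_iff)
    moreover have "card S = Suc (card (S - {a}))" using card_Suc_Diff1[of S a] a c by simp
    then have "tate_degree (S - {a}, \<nu>) = 2 * (i - 1) + 1"
      using deg by (simp add: mS tate_degree_def)
    then have "bt (S - {a}, \<nu>) r \<in> tgr (2 * (i - 1) + 1)" using c r by (intro tgr_bt) auto
    ultimately show thesis using odd[of a _ "i - 1"] a c deg by auto
  next
    case True
    then have "\<nu> \<noteq> {#}" using deg by (auto simp: mS tate_degree_def)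
    then obtain b where b: "b \<in># \<nu>" by blast
    let ?k = "count \<nu> b" let ?\<nu> = "filter_mset (\<lambda>c. c \<noteq> b) \<nu>"
    have \<nu>: "\<nu> = replicate_mset ?k b + ?\<nu>" by (rule multiset_eqI) auto
    have c': "set_mset ?\<nu> \<subseteq> B" "b \<in> B" using c b by auto
    have "bt m r = gen2 b ?k \<otimes>\<^bsub>TA\<^esub> bt ({}, ?\<nu>) r"
      using gen2_mult_disjoint[of b "{}" ?\<nu> r ?k] c' r True \<nu> by (simp add: mS)
    moreover have in0: "bt ({}, ?\<nu>) r \<in> tgr (2 * size ?\<nu>)"
      using c' r by (intro tgr_bt) (auto simp: tate_degree_def)
    moreover have "gen2 b ?k \<otimes>\<^bsub>TA\<^esub> bt ({}, ?\<nu>) r = bt ({}, ?\<nu>) r \<otimes>\<^bsub>TA\<^esub> gen2 b ?k"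
      using TA.gr_comm_even[OF gen2_in[OF c'(2)] in0] by simp
    moreover have "size \<nu> = ?k + size ?\<nu>" by (subst \<nu>) simp
    then have "i = size ?\<nu> + ?k" using deg True by (simp add: mS tate_degree_def)
    ultimately show thesis using even[of b ?k _ "size ?\<nu>"] b c' by (simp add: count_greater_zero_iff)
  qed
qed

text \<open>The solution is explicit on monomials by \<open>even_basis_cases\<close> and is extended
  by \<open>dp_seq_add\<close>. The homogeneity of \<open>u\<close> is part of the induction because
  that rule requires it of both summands.\<close>

lemma TA_dp_ex:
  assumes i: "i > 0" and u: "u \<in> tgr (2 * i)"
  shows "\<exists>a. TA.dp_seq u a \<and> (\<forall>n. a n \<in> tgr (2 * i * n))"
proof -
  have "u \<in> tgr (2 * i) \<and> (\<exists>a. TA.dp_seq u a \<and> (\<forall>n. a n \<in> tgr (2 * i * n)))" using u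
  proof (induction rule: tgr_induct)
    case zero
    then show ?case using TA.dp_seq_square_zero[of "\<zero>\<^bsub>TA\<^esub>"] i
      by (auto intro!: exI[of _ "\<lambda>n. if n = 0 then \<one>\<^bsub>TA\<^esub> else if n = 1 then \<zero>\<^bsub>TA\<^esub> else \<zero>\<^bsub>TA\<^esub>"])
  next
    case (add u v)
    then obtain a b where a: "TA.dp_seq u a" "\<And>n. a n \<in> tgr (2 * i * n)"
      and b: "TA.dp_seq v b" "\<And>n. b n \<in> tgr (2 * i * n)" by blast
    have "(\<Oplus>\<^bsub>TA\<^esub>j\<in>{..n}. a j \<otimes>\<^bsub>TA\<^esub> b (n - j)) \<in> tgr (2 * i * n)" for n
    proof (rule TA.gr_finsum)
      fix j assume "j \<in> {..n}"
      then have "2 * i * j + 2 * i * (n - j) = 2 * i * n" by (simp flip: distrib_left)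
      then show "a j \<otimes>\<^bsub>TA\<^esub> b (n - j) \<in> tgr (2 * i * n)" using TA.gr_mult[OF a(2)[of j] b(2)[of "n - j"]] by simp
    qed
    then show ?case using TA.dp_seq_add[of u i v i a b "2 * i"] a b add by (auto intro!: tgr_add)
  next
    case (basis m r)
    have bti: "bt m r \<in> tgr (2 * i)" using basis by (intro tgr_bt) auto
    show ?case
    proof (cases rule: even_basis_cases[OF basis(1,3,2) i])
      case (1 a j u)
      have "bt m r \<otimes>\<^bsub>TA\<^esub> bt m r = \<zero>\<^bsub>TA\<^esub>"
      proof -
        have g: "gen1 a \<in> carrier TA" "u \<in> carrier TA" using 1 tgr_carrier by auto
        have "gen1 a \<otimes>\<^bsub>TA\<^esub> u \<otimes>\<^bsub>TA\<^esub> (gen1 a \<otimes>\<^bsub>TA\<^esub> u) = gen1 a \<otimes>\<^bsub>TA\<^esub> (u \<otimes>\<^bsub>TA\<^esub> gen1 a) \<otimes>\<^bsub>TA\<^esub> u"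
          using g by (simp add: BA.m_assoc)
        also have "u \<otimes>\<^bsub>TA\<^esub> gen1 a = \<ominus>\<^bsub>TA\<^esub> (gen1 a \<otimes>\<^bsub>TA\<^esub> u)"
          using TA.gr_comm_odd[OF 1(2) gen1_in[OF 1(1)]] by simp
        also have "gen1 a \<otimes>\<^bsub>TA\<^esub> \<ominus>\<^bsub>TA\<^esub> (gen1 a \<otimes>\<^bsub>TA\<^esub> u) \<otimes>\<^bsub>TA\<^esub> u = \<ominus>\<^bsub>TA\<^esub> ((gen1 a \<otimes>\<^bsub>TA\<^esub> gen1 a) \<otimes>\<^bsub>TA\<^esub> (u \<otimes>\<^bsub>TA\<^esub> u))"
          using g by (simp add: BA.m_assoc BA.l_minus BA.r_minus)
        finally show ?thesis using g TA.gr_sq[OF 1(2)] by (simp add: 1(4))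
      qed
      then have "TA.dp_seq (bt m r) (\<lambda>n. if n = 0 then \<one>\<^bsub>TA\<^esub> else if n = 1 then bt m r else \<zero>\<^bsub>TA\<^esub>)"
        using basis by (intro TA.dp_seq_square_zero) auto
      then show ?thesis using bti by (auto intro!: exI)
    next
      case (2 b k j u)
      have "TA.dp_seq (bt m r) (\<lambda>n. u [^]\<^bsub>TA\<^esub> n \<otimes>\<^bsub>TA\<^esub> (int (dp_quot n k) \<odot>\<^bsub>TA\<^esub> gen2 b (n * k)))"
        unfolding 2(5) by (rule TA.dp_seq_mult[OF 2(3) gen2_in dp_seq_gen2]) (use 2 in auto)
      moreover have "u [^]\<^bsub>TA\<^esub> n \<otimes>\<^bsub>TA\<^esub> (int (dp_quot n k) \<odot>\<^bsub>TA\<^esub> gen2 b (n * k)) \<in> tgr (2 * i * n)" for n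
        using TA.gr_mult[OF TA.gr_pow[OF 2(3), of n] TA.gr_int_mult[OF gen2_in[OF 2(1), of "n * k"]]] 2(4)
        by (simp add: algebra_simps)
      ultimately show ?thesis using bti by blast
    qed
  qed
  then show ?thesis ..
qed

lemma TA_torsion_free:
  assumes tf: "\<And>x n. \<lbrakk>x \<in> carrier R; n > 0; int n \<odot> x = \<zero>\<rbrakk> \<Longrightarrow> x = \<zero>"
  shows "torsion_free_graded TA tgr"
proof (intro torsion_free_graded.intro torsion_free_graded_axioms.intro TA_graded TA_dp_ex)
  fix x n assume x: "x \<in> carrier TA" and n: "n > 0" and z: "int n \<odot>\<^bsub>TA\<^esub> x = \<zero>\<^bsub>TA\<^esub>"
  have "x m = \<zero>" for m
  proof (rule tf[OF _ n])
    show "int n \<odot> x m = \<zero>" using BA_int_mult_apply[OF x, of "int n" m] z by (simp add: BA_zero_apply)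
  qed (use x in auto)
  then show "x = \<zero>\<^bsub>TA\<^esub>" by (auto simp: BA_zero_apply)
qed auto

end

text \<open>A copy of the ring of integers without the rewrite rules attached to the library's
  interpretations.\<close>

definition int_cring :: "int ring" where "int_cring = int_ring"

lemma int_cring_simps [simp]:
  "carrier int_cring = UNIV" "x \<otimes>\<^bsub>int_cring\<^esub> z = x * z" "\<one>\<^bsub>int_cring\<^esub> = 1"
  "\<zero>\<^bsub>int_cring\<^esub> = 0" "x \<oplus>\<^bsub>int_cring\<^esub> z = x + z"
  by (simp_all add: int_cring_def)

lemma cring_int_cring: "cring int_cring"
  unfolding int_cring_def by (rule int_is_cring)

lemma int_cring_int_mult: "int n \<odot>\<^bsub>int_cring\<^esub> x = int n * x"
proof -
  interpret Z: cring int_cring by (rule cring_int_cring)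
  show ?thesis by (induction n) (simp_all add: Z.int_mult_add_left algebra_simps)
qed

section \<open>Divided powers on an algebra that is free over its degree zero part\<close>

context tate_target
begin

text \<open>Expansions of \<open>u\<close> in two different degrees involve disjoint sets of
  monomials, so their difference is a linear relation, and freeness makes every coefficient
  zero.\<close>

lemma direct_of_free:
  assumes span: "\<And>n u. u \<in> gr n \<Longrightarrow> \<exists>F r. finite F \<and> F \<subseteq> tate_monomials X B \<and>
      (\<forall>m\<in>F. tate_degree m = n \<and> r m \<in> gr 0) \<and> u = (\<Oplus>m\<in>F. r m \<otimes> tmon m)"
    and free: "\<And>F r. \<lbrakk>finite F; F \<subseteq> tate_monomials X B; \<forall>m\<in>F. r m \<in> gr 0; (\<Oplus>m\<in>F. r m \<otimes> tmon m) = \<zero>\<rbrakk>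
      \<Longrightarrow> \<forall>m\<in>F. r m = \<zero>"
    and u: "u \<in> gr i" "u \<in> gr j" "i \<noteq> j"
  shows "u = \<zero>"
proof -
  obtain F r where F: "finite F" "F \<subseteq> tate_monomials X B" "\<And>m. m \<in> F \<Longrightarrow> tate_degree m = i"
      "\<And>m. m \<in> F \<Longrightarrow> r m \<in> gr 0" "u = (\<Oplus>m\<in>F. r m \<otimes> tmon m)"
    using span[OF u(1)] by blast
  obtain F' r' where F': "finite F'" "F' \<subseteq> tate_monomials X B" "\<And>m. m \<in> F' \<Longrightarrow> tate_degree m = j"
      "\<And>m. m \<in> F' \<Longrightarrow> r' m \<in> gr 0" "u = (\<Oplus>m\<in>F'. r' m \<otimes> tmon m)"
    using span[OF u(2)] by blast
  have disj: "F \<inter> F' = {}" using F(3) F'(3) u(3) by (metis disjoint_iff)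
  have cl: "r m \<otimes> tmon m \<in> carrier S" if "m \<in> F" for m
    using F(4)[OF that] F(2) that gr_carrier[of "r m"] tmon_closed[of m] by auto
  have cl': "r' m \<otimes> tmon m \<in> carrier S" if "m \<in> F'" for m
    using F'(4)[OF that] F'(2) that gr_carrier[of "r' m"] tmon_closed[of m] by auto
  let ?q = "\<lambda>m. if m \<in> F then r m else \<ominus> r' m"
  have q': "?q m \<otimes> tmon m = \<ominus> (r' m \<otimes> tmon m)" if "m \<in> F'" for m
    using F'(4)[OF that] F'(2) disj that gr_carrier[of "r' m"] tmon_closed[of m] by (auto simp: l_minus)
  have "(\<Oplus>m\<in>F \<union> F'. ?q m \<otimes> tmon m) = (\<Oplus>m\<in>F. ?q m \<otimes> tmon m) \<oplus> (\<Oplus>m\<in>F'. ?q m \<otimes> tmon m)"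
    using F F' disj cl cl' q' by (intro finsum_Un_disjoint) auto
  also have "(\<Oplus>m\<in>F. ?q m \<otimes> tmon m) = u"
    unfolding F(5) using cl by (intro finsum_cong') auto
  also have "(\<Oplus>m\<in>F'. ?q m \<otimes> tmon m) = (\<Oplus>m\<in>F'. (-1) \<odot> (r' m \<otimes> tmon m))"
    using cl' q' by (intro finsum_cong') auto
  also have "\<dots> = \<ominus> u"
    using finsum_int_mult[of "\<lambda>m. r' m \<otimes> tmon m" F' "-1"] cl' F'(5) gr_carrier[OF u(2)] by simp
  finally have "(\<Oplus>m\<in>F \<union> F'. ?q m \<otimes> tmon m) = \<zero>" using gr_carrier[OF u(1)] by (simp add: r_neg)
  then have "\<forall>m\<in>F \<union> F'. ?q m = \<zero>"
    using F F' by (intro free) (auto intro: gr_uminus)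
  then have z: "r m = \<zero>" if "m \<in> F" for m using that by force
  have "(\<Oplus>m\<in>F. r m \<otimes> tmon m) = \<zero>"
    using F(2) z tmon_closed by (intro add.finprod_one_eqI) auto
  then show ?thesis using F(5) by simp
qed

text \<open>The divided powers are inherited from the Tate algebra over the monoid ring over the integers of
  the degree zero part: it is torsion free, so that divided powers are unique there.\<close>

lemma divided_powers_exist:
  assumes span: "\<And>n u. u \<in> gr n \<Longrightarrow> \<exists>F r. finite F \<and> F \<subseteq> tate_monomials X B \<and>
      (\<forall>m\<in>F. tate_degree m = n \<and> r m \<in> gr 0) \<and> u = (\<Oplus>m\<in>F. r m \<otimes> tmon m)"
    and free: "\<And>F r. \<lbrakk>finite F; F \<subseteq> tate_monomials X B; \<forall>m\<in>F. r m \<in> gr 0; (\<Oplus>m\<in>F. r m \<otimes> tmon m) = \<zero>\<rbrakk>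
      \<Longrightarrow> \<forall>m\<in>F. r m = \<zero>"
  obtains \<gamma> where "divided_powers S gr \<gamma>" and "\<And>b n. b \<in> B \<Longrightarrow> \<gamma> n (y b 1) = y b n"
proof -
  define Z where "Z = basis_algebra int_cring (gr 0) (\<otimes>) \<one> (\<lambda>_ _. 1)"
  have Z_basis: "basis_alg int_cring (gr 0) (\<otimes>) \<one> (\<lambda>_ _. 1)"
    using gr_mult[of _ 0 _ 0] gr_carrier
    by (intro basis_alg.intro cring_int_cring basis_alg_axioms.intro) (auto simp: m_assoc)
  interpret Z: basis_alg int_cring "gr 0" "(\<otimes>)" \<one> "\<lambda>_ _. 1"
    rewrites "basis_algebra int_cring (gr 0) (\<otimes>) \<one> (\<lambda>_ _. 1) = Z"
    by (rule Z_basis) (simp add: Z_def)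
  have gr0: "r \<in> carrier S" if "r \<in> gr 0" for r using gr_carrier[OF that] .
  have Zc: "cring Z"
  proof (rule Z.BA_cring)
    show "u \<otimes> v = v \<otimes> u" if "u \<in> gr 0" "v \<in> gr 0" for u v
      using gr_comm_even[OF that] by simp
  qed simp
  interpret T: tate_alg Z X B using Zc by (rule tate_alg.intro)
  define \<iota> where "\<iota> k = k \<odot> \<one>" for k :: int
  have \<iota>: "\<iota> \<in> ring_hom int_cring S"
    by (rule ring_hom_memI) (auto simp: \<iota>_def int_mult_add_left int_mult_mult add_pow_ldistr_int)
  \<comment> \<open>The linear extension of the inclusion of \<open>gr 0\<close>: a formal sum of
    degree zero elements is evaluated in \<open>S\<close>.\<close>
  define \<rho> where "\<rho> = Z.linear_ext S \<iota> (\<lambda>r. r)"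
  have \<rho>: "\<rho> \<in> ring_hom Z S"
    unfolding \<rho>_def
    by (rule Z.linear_ext_ring_hom[OF ring_axioms \<iota>])
      (auto simp: \<iota>_def add_pow_ldistr_int add_pow_rdistr_int gr0)
  have \<rho>_bt: "\<rho> (basis_term int_cring r 1) = r" if "r \<in> gr 0" for r
    unfolding \<rho>_def
    using Z.linear_ext_bt[OF ring_axioms ring_hom_additive[OF \<iota>] gr0 that, of "\<lambda>r. r" 1] gr0[OF that]
    by (simp add: \<iota>_def)
  have \<rho>0: "\<rho> p \<in> gr 0" if p: "p \<in> carrier Z" for p
  proof -
    have "\<iota> (p u) \<otimes> u \<in> gr 0" if "u \<in> coeff_support int_cring p" for u
    proof -
      have u: "u \<in> gr 0" using that Z.BA_supp_M[OF p] by blast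
      have "\<iota> (p u) \<in> gr 0" unfolding \<iota>_def by (intro gr_int_mult) simp
      then show ?thesis using gr_mult[OF _ u, of _ 0] by simp
    qed
    then show ?thesis unfolding \<rho>_def Z.linear_ext_def by (intro gr_finsum)
  qed
  have Z_tf: "x = \<zero>\<^bsub>Z\<^esub>" if x: "x \<in> carrier Z" and n: "n > 0" and z: "int n \<odot>\<^bsub>Z\<^esub> x = \<zero>\<^bsub>Z\<^esub>" for x n
  proof
    fix u
    have "int n * x u = 0"
      using Z.BA_int_mult_apply[OF x, of "int n" u] z by (simp add: Z.BA_zero_apply int_cring_int_mult)
    then show "x u = \<zero>\<^bsub>Z\<^esub> u" using n by (simp add: Z.BA_zero_apply)
  qed
  interpret C: torsion_free_graded T.TA T.tgr by (rule T.TA_torsion_free[OF Z_tf])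
  obtain \<pi> where \<pi>: "\<pi> \<in> ring_hom T.TA S"
    and \<pi>_eq: "\<And>p. \<pi> p = (\<Oplus>m\<in>coeff_support Z p. \<rho> (p m) \<otimes> tmon m)"
    and \<pi>_bt: "\<And>m r. \<lbrakk>m \<in> tate_monomials X B; r \<in> carrier Z\<rbrakk> \<Longrightarrow> \<pi> (basis_term Z m r) = \<rho> r \<otimes> tmon m"
    and \<pi>_gr: "\<And>n. \<pi> ` T.tgr n \<subseteq> gr n"
    by (rule tate_lift[OF Zc \<rho> \<rho>0]) auto
  note \<pi>_add = ring_hom_additive[OF \<pi>]
  note \<pi>_zero = additive_zero[OF T.BA_abelian_group abelian_group_axioms \<pi>_add]
  have surj: "gr n = \<pi> ` T.tgr n" for n
  proof
    show "gr n \<subseteq> \<pi> ` T.tgr n"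
    proof
      fix u assume "u \<in> gr n"
      from span[OF this] obtain F r where F: "finite F" "F \<subseteq> tate_monomials X B" "\<And>m. m \<in> F \<Longrightarrow> tate_degree m = n"
          "\<And>m. m \<in> F \<Longrightarrow> r m \<in> gr 0" "u = (\<Oplus>m\<in>F. r m \<otimes> tmon m)" by blast
      \<comment> \<open>A coefficient \<open>r m\<close> of degree zero is lifted to the basis
        element of the monoid ring that it labels.\<close>
      let ?f = "\<lambda>m. basis_term Z m (basis_term int_cring (r m) 1)"
      have f: "?f m \<in> T.tgr n" if "m \<in> F" for m
        using F that by (intro T.tgr_bt) auto
      have cl: "r m \<otimes> tmon m \<in> carrier S" if "m \<in> F" for m
        using F(4)[OF that] F(2) that gr_carrier[of "r m"] tmon_closed[of m] by auto
      have "\<pi> (?f m) = r m \<otimes> tmon m" if "m \<in> F" for m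
      proof -
        have "m \<in> tate_monomials X B" using F(2) that by blast
        moreover have "basis_term int_cring (r m) 1 \<in> carrier Z" using F(4)[OF that] by simp
        ultimately show ?thesis by (simp only: \<pi>_bt \<rho>_bt[OF F(4)[OF that]])
      qed
      note \<pi>f = this
      have "\<pi> (\<Oplus>\<^bsub>T.TA\<^esub>m\<in>F. ?f m) = (\<Oplus>m\<in>F. \<pi> (?f m))"
        using f T.tgr_carrier by (intro additive_finsum[OF T.BA_abelian_group abelian_group_axioms \<pi>_add]) auto
      also have "\<dots> = u"
        unfolding F(5) using cl \<pi>f by (intro finsum_cong') auto
      finally have "u = \<pi> (\<Oplus>\<^bsub>T.TA\<^esub>m\<in>F. ?f m)" by simp
      moreover have "(\<Oplus>\<^bsub>T.TA\<^esub>m\<in>F. ?f m) \<in> T.tgr n" using f by (rule T.TA.gr_finsum)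
      ultimately show "u \<in> \<pi> ` T.tgr n" by blast
    qed
  qed (rule \<pi>_gr)
  have ker: "\<pi> (C.dp n u) = \<zero>" if i: "i > 0" and u: "u \<in> T.tgr (2 * i)" and z: "\<pi> u = \<zero>" and n: "n > 0" for i u n
  proof -
    have uc: "u \<in> carrier T.TA" using u by (rule T.tgr_carrier)
    \<comment> \<open>Freeness turns the vanishing of \<open>\<pi> u\<close> into the vanishing of
      every coefficient under \<rho>, so the divided powers of \<open>u\<close> can be examined one
      monomial at a time.\<close>
    have "\<forall>m\<in>coeff_support Z u. \<rho> (u m) = \<zero>"
    proof (rule free)
      show "(\<Oplus>m\<in>coeff_support Z u. \<rho> (u m) \<otimes> tmon m) = \<zero>" using z \<pi>_eq by simp
      show "finite (coeff_support Z u)" "coeff_support Z u \<subseteq> tate_monomials X B"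
        using uc unfolding T.BA_carrier by blast+
      show "\<forall>m\<in>coeff_support Z u. \<rho> (u m) \<in> gr 0" using \<rho>0 T.BA_coeff_closed[OF uc] by blast
    qed
    then have \<rho>z: "\<rho> (u m) = \<zero>" if "m \<in> coeff_support Z u" for m using that by blast
    have "\<forall>n>0. (\<Oplus>\<^bsub>T.TA\<^esub>m\<in>A. basis_term Z m (u m)) \<in> T.tgr (2 * i)
        \<and> \<pi> (C.dp n (\<Oplus>\<^bsub>T.TA\<^esub>m\<in>A. basis_term Z m (u m))) = \<zero>"
      if "finite A" "A \<subseteq> coeff_support Z u" for A
      using that
    proof (induction A rule: finite_induct)
      case empty
      \<comment> \<open>Zero is written as zero times zero, and the scaling rule yields a positive
        power of zero.\<close>
      have "C.dp n \<zero>\<^bsub>T.TA\<^esub> = \<zero>\<^bsub>T.TA\<^esub>" if "n > 0" for n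
        using C.dp_scale[of i "\<zero>\<^bsub>T.TA\<^esub>" "\<zero>\<^bsub>T.TA\<^esub>" 0 n] that i C.dp_closed[of i "\<zero>\<^bsub>T.TA\<^esub>" n]
        by (simp add: T.BA.nat_pow_zero)
      then show ?case using \<pi>_zero by simp
    next
      case (insert m A)
      let ?s = "\<Oplus>\<^bsub>T.TA\<^esub>m\<in>A. basis_term Z m (u m)"
      have s: "?s \<in> T.tgr (2 * i)" "\<And>n. n > 0 \<Longrightarrow> \<pi> (C.dp n ?s) = \<zero>" using insert by auto
      have m: "m \<in> tate_monomials X B" "tate_degree m = 2 * i" "u m \<in> carrier Z"
        using insert.prems T.BA_supp_M[OF uc] u uc by (auto simp: T.tgr_def)
      have b1: "basis_term Z m \<one>\<^bsub>Z\<^esub> \<in> T.tgr (2 * i)" using m by (intro T.tgr_bt) auto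
      have b: "basis_term Z m (u m) \<in> T.tgr (2 * i)" using m by (intro T.tgr_bt) auto
      have beq: "basis_term Z m (u m) = T.scal (u m) \<otimes>\<^bsub>T.TA\<^esub> basis_term Z m \<one>\<^bsub>Z\<^esub>"
        using m by (simp add: T.scal_mult)
      \<comment> \<open>The k-th divided power contains the k-th power of the coefficient
        \<open>u m\<close>. As k is positive, at least one such factor is present, and it maps to
        zero.\<close>
      have dpb: "\<pi> (C.dp k (basis_term Z m (u m))) = \<zero>" if k: "k > 0" for k
      proof -
        have sc: "T.scal (u m) \<in> T.tgr (2 * 0)" using T.scal_in[OF m(3)] by simp
        have "C.dp k (basis_term Z m (u m)) = T.scal (u m) [^]\<^bsub>T.TA\<^esub> k \<otimes>\<^bsub>T.TA\<^esub> C.dp k (basis_term Z m \<one>\<^bsub>Z\<^esub>)"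
          unfolding beq by (rule C.dp_scale[OF i b1 sc])
        also obtain k' where k': "k = Suc k'" using k by (cases k) auto
        have "T.scal (u m) [^]\<^bsub>T.TA\<^esub> k = T.scal (u m) \<otimes>\<^bsub>T.TA\<^esub> T.scal (u m) [^]\<^bsub>T.TA\<^esub> k'"
          unfolding k' using m(3) by (intro T.BA.nat_pow_Suc2) auto
        finally have "C.dp k (basis_term Z m (u m)) = T.scal (u m) \<otimes>\<^bsub>T.TA\<^esub> (T.scal (u m) [^]\<^bsub>T.TA\<^esub> k' \<otimes>\<^bsub>T.TA\<^esub> C.dp k (basis_term Z m \<one>\<^bsub>Z\<^esub>))"
          using m(3) C.dp_closed[OF i b1] by (simp add: T.BA.m_assoc)
        moreover have "\<pi> (T.scal (u m)) = \<zero>" using \<pi>_bt[of "({}, {#})" "u m"] m(3) \<rho>z insert.prems by simp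
        ultimately show ?thesis
          using m(3) C.dp_closed[OF i b1] by (simp add: ring_hom_mult[OF \<pi>] ring_hom_closed[OF \<pi>])
      qed
      have sum_eq: "(\<Oplus>\<^bsub>T.TA\<^esub>m\<in>insert m A. basis_term Z m (u m)) = basis_term Z m (u m) \<oplus>\<^bsub>T.TA\<^esub> ?s"
      proof (rule T.BA.finsum_insert)
        show "(\<lambda>m. basis_term Z m (u m)) \<in> A \<rightarrow> carrier T.TA"
          using insert.prems T.BA_supp_M[OF uc] uc by (auto intro!: T.bt_closed)
      qed (use insert b T.tgr_carrier in auto)
      have "\<pi> (C.dp n (basis_term Z m (u m) \<oplus>\<^bsub>T.TA\<^esub> ?s)) = \<zero>" if n: "n > 0" for n
      proof -
        note c = C.dp_closed[OF i b] C.dp_closed[OF i s(1)]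
        have "\<pi> (C.dp n (basis_term Z m (u m) \<oplus>\<^bsub>T.TA\<^esub> ?s))
          = (\<Oplus>j\<in>{..n}. \<pi> (C.dp j (basis_term Z m (u m)) \<otimes>\<^bsub>T.TA\<^esub> C.dp (n - j) ?s))"
          unfolding C.dp_add[OF i b s(1)] using c
          by (intro additive_finsum[OF T.BA_abelian_group abelian_group_axioms \<pi>_add]) auto
        also have "\<dots> = \<zero>"
        proof (rule add.finprod_one_eqI)
          fix j assume "j \<in> {..n}"
          \<comment> \<open>In each summand at least one of the two divided powers has positive
            order and is therefore killed by \<pi>.\<close>
          then have "j > 0 \<or> n - j > 0" using n by auto
          then show "\<pi> (C.dp j (basis_term Z m (u m)) \<otimes>\<^bsub>T.TA\<^esub> C.dp (n - j) ?s) = \<zero>"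
            using dpb s(2) c by (auto simp: ring_hom_mult[OF \<pi>] ring_hom_closed[OF \<pi>])
        qed
        finally show ?thesis .
      qed
      then show ?case unfolding sum_eq using b s by (auto intro: T.tgr_add)
    qed
    from this[of "coeff_support Z u"] show ?thesis
      using n uc T.BA_decomp[OF uc] unfolding T.BA_carrier[of u] by simp
  qed
  obtain \<gamma> where \<gamma>: "divided_powers S gr \<gamma>"
    and \<gamma>_\<pi>: "\<And>i u n. \<lbrakk>i > 0; u \<in> T.tgr (2 * i)\<rbrakk> \<Longrightarrow> \<gamma> n (\<pi> u) = \<pi> (C.dp n u)"
    by (rule C.dp_descend[OF graded_comm_axioms \<pi> surj direct_of_free[OF span free] ker]) blast+
  have "\<gamma> n (y b 1) = y b n" if b: "b \<in> B" for b n
  proof -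
    have \<pi>y: "\<pi> (T.gen2 b k) = y b k" for k
      using \<pi>_bt[of "({}, replicate_mset k b)" "\<one>\<^bsub>Z\<^esub>"] b tmon_y[OF b] y_closed[OF b] ring_hom_one[OF \<rho>]
      by auto
    \<comment> \<open>For m = 1 the binomial coefficient in the product rule is n + 1, so the
      generators \<open>gen2 b n\<close> satisfy the recursion and by uniqueness are the divided
      powers of \<open>gen2 b 1\<close>.\<close>
    have "T.TA.dp_seq (T.gen2 b 1) (\<lambda>n. T.gen2 b n)"
      unfolding T.TA.dp_seq_def using b T.gen2_gen2[of b 1] by (auto simp: T.TA_one)
    then have "C.dp n (T.gen2 b 1) = T.gen2 b n" by (rule C.dp_eq)
    then show ?thesis using \<gamma>_\<pi>[of 1 "T.gen2 b 1" n] T.gen2_in[OF b, of 1] \<pi>y[of 1] \<pi>y[of n] by simp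
  qed
  with \<gamma> show thesis by (rule that)
qed

end

section \<open>Consequences of the divided power axioms, and maps that preserve divided
  powers\<close>

lemma
  assumes dp: "divided_powers S gr \<gamma>" and i: "i > 0" and u: "u \<in> gr (2 * i)"
  shows divided_powers_in: "\<gamma> n u \<in> gr (2 * i * n)"
    and divided_powers_0: "\<gamma> 0 u = \<one>\<^bsub>S\<^esub>"
    and divided_powers_1: "\<gamma> 1 u = u"
    and divided_powers_mult: "\<gamma> m u \<otimes>\<^bsub>S\<^esub> \<gamma> n u = add_pow S ((m + n) choose m) (\<gamma> (m + n) u)"
    and divided_powers_compose: "n > 0 \<Longrightarrow>
      \<gamma> m (\<gamma> n u) = add_pow S (fact (m * n) div (fact m * fact n ^ m) :: nat) (\<gamma> (m * n) u)"
    and divided_powers_add: "v \<in> gr (2 * i) \<Longrightarrow>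
      \<gamma> n (u \<oplus>\<^bsub>S\<^esub> v) = (\<Oplus>\<^bsub>S\<^esub>j\<in>{..n}. \<gamma> j u \<otimes>\<^bsub>S\<^esub> \<gamma> (n - j) v)"
    and divided_powers_scale: "v \<in> gr (2 * j) \<Longrightarrow> \<gamma> n (v \<otimes>\<^bsub>S\<^esub> u) = (v [^]\<^bsub>S\<^esub> n) \<otimes>\<^bsub>S\<^esub> \<gamma> n u"
proof -
  note H = dp[unfolded divided_powers_def, THEN conjunct1, THEN spec, THEN mp, OF i, THEN bspec, OF u]
  note H1 = H[THEN conjunct2] note H2 = H1[THEN conjunct2] note H3 = H2[THEN conjunct2]
  note H4 = H3[THEN conjunct2] note H5 = H4[THEN conjunct2] note H6 = H5[THEN conjunct2]
  show "\<gamma> n u \<in> gr (2 * i * n)" by (rule H[THEN conjunct1, THEN spec])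
  show "\<gamma> 0 u = \<one>\<^bsub>S\<^esub>" by (rule H1[THEN conjunct1])
  show "\<gamma> 1 u = u" by (rule H2[THEN conjunct1])
  show "\<gamma> m u \<otimes>\<^bsub>S\<^esub> \<gamma> n u = add_pow S ((m + n) choose m) (\<gamma> (m + n) u)"
    by (rule H3[THEN conjunct1, THEN spec, THEN spec])
  show "n > 0 \<Longrightarrow>
      \<gamma> m (\<gamma> n u) = add_pow S (fact (m * n) div (fact m * fact n ^ m) :: nat) (\<gamma> (m * n) u)"
    by (rule H4[THEN conjunct1, THEN spec, THEN spec, THEN mp])
  show "v \<in> gr (2 * i) \<Longrightarrow>
      \<gamma> n (u \<oplus>\<^bsub>S\<^esub> v) = (\<Oplus>\<^bsub>S\<^esub>j\<in>{..n}. \<gamma> j u \<otimes>\<^bsub>S\<^esub> \<gamma> (n - j) v)"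
    by (rule H5[THEN conjunct1, THEN bspec, THEN spec])
  show "v \<in> gr (2 * j) \<Longrightarrow> \<gamma> n (v \<otimes>\<^bsub>S\<^esub> u) = (v [^]\<^bsub>S\<^esub> n) \<otimes>\<^bsub>S\<^esub> \<gamma> n u"
    by (rule H6[THEN spec, THEN bspec, THEN spec])
qed

lemma divided_powers_odd:
  assumes "divided_powers S gr \<gamma>" "u \<in> gr (2 * i + 1)" "v \<in> gr (2 * j + 1)" "n \<ge> 2"
  shows "\<gamma> n (u \<otimes>\<^bsub>S\<^esub> v) = \<zero>\<^bsub>S\<^esub>"
  by (rule assms(1)[unfolded divided_powers_def, THEN conjunct2, THEN spec, THEN spec, THEN bspec, OF assms(2),
        THEN bspec, OF assms(3), THEN spec, THEN mp, OF assms(4)])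

lemma (in ring) zero_nat_pow: "(n::nat) > 0 \<Longrightarrow> \<zero> [^] n = \<zero>"
  by (cases n) auto

text \<open>Apply the scaling axiom to zero written as zero times zero.\<close>

lemma (in graded_comm) divided_powers_zero:
  assumes "divided_powers S gr \<gamma>" "n > 0" shows "\<gamma> n \<zero> = \<zero>"
proof -
  have "\<gamma> n \<zero> \<in> carrier S" using divided_powers_in[OF assms(1), of 1 \<zero> n] gr_carrier by auto
  then show ?thesis
    using divided_powers_scale[OF assms(1), of 1 \<zero> \<zero> 0 n] assms(2) by (simp add: zero_nat_pow)
qed

lemma ring_hom_nat_pow:
  assumes "ring S" "ring T" "h \<in> ring_hom S T" "x \<in> carrier S"
  shows "h (x [^]\<^bsub>S\<^esub> (n::nat)) = h x [^]\<^bsub>T\<^esub> n"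
proof -
  interpret S: ring S by fact
  interpret T: ring T by fact
  show ?thesis
    by (induction n) (use assms in \<open>simp_all add: ring_hom_one ring_hom_mult\<close>)
qed

text \<open>The axioms express the divided powers of sums, of even multiples, of products of odd
  elements and of divided powers themselves. Hence a ring homomorphism that is right on the
  \<open>gen2 b n\<close> is right everywhere.\<close>

lemma (in tate_alg) divided_power_homI:
  assumes \<gamma>: "divided_powers TA tgr \<gamma>" and \<gamma>_gen2: "\<And>b n. b \<in> B \<Longrightarrow> \<gamma> n (gen2 b 1) = gen2 b n"
    and S: "graded_comm S gr" and \<delta>: "divided_powers S gr \<delta>"
    and h: "h \<in> ring_hom TA S" and h_gr: "\<And>n. h ` tgr n \<subseteq> gr n"
    and h_gen2: "\<And>b n. b \<in> B \<Longrightarrow> h (gen2 b n) = \<delta> n (h (gen2 b 1))"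
  shows "divided_power_hom TA tgr \<gamma> S gr \<delta> h"
proof -
  interpret S: graded_comm S gr by (rule S)
  note h_add = ring_hom_additive[OF h]
  note h_zero = additive_zero[OF BA_abelian_group S.abelian_group_axioms h_add]
  have h_in: "u \<in> tgr n \<Longrightarrow> h u \<in> gr n" for u n using h_gr by blast
  have addpow: "h (add_pow TA (n::nat) x) = add_pow S n (h x)" if "x \<in> carrier TA" for n x
    using additive_int_mult[OF BA_abelian_group S.abelian_group_axioms h_add that, of "int n"]
    by (simp add: BA.int_mult_nat S.int_mult_nat)
  have "u \<in> tgr (2 * i) \<and> (\<forall>n. h (\<gamma> n u) = \<delta> n (h u))" if u: "u \<in> tgr (2 * i)" and i: "i > 0" for u i
    using u
  proof (induction rule: tgr_induct)
    case zero
    have "h (\<gamma> n \<zero>\<^bsub>TA\<^esub>) = \<delta> n (h \<zero>\<^bsub>TA\<^esub>)" for n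
      using TA.divided_powers_zero[OF \<gamma>, of n] S.divided_powers_zero[OF \<delta>, of n]
        divided_powers_0[OF \<gamma> i, of "\<zero>\<^bsub>TA\<^esub>"] divided_powers_0[OF \<delta> i, of "\<zero>\<^bsub>S\<^esub>"]
      by (cases "n = 0") (auto simp: h_zero ring_hom_one[OF h])
    then show ?case by simp
  next
    case (add u v)
    have c: "\<gamma> n u \<in> carrier TA" "\<gamma> n v \<in> carrier TA" for n
      using divided_powers_in[OF \<gamma> i] add tgr_carrier by blast+
    have "h (\<gamma> n (u \<oplus>\<^bsub>TA\<^esub> v)) = \<delta> n (h (u \<oplus>\<^bsub>TA\<^esub> v))" for n
    proof -
      have "h (\<gamma> n (u \<oplus>\<^bsub>TA\<^esub> v)) = h (\<Oplus>\<^bsub>TA\<^esub>j\<in>{..n}. \<gamma> j u \<otimes>\<^bsub>TA\<^esub> \<gamma> (n - j) v)"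
        using divided_powers_add[OF \<gamma> i] add by simp
      also have "\<dots> = (\<Oplus>\<^bsub>S\<^esub>j\<in>{..n}. h (\<gamma> j u \<otimes>\<^bsub>TA\<^esub> \<gamma> (n - j) v))"
        using c by (intro additive_finsum[OF BA_abelian_group S.abelian_group_axioms h_add]) auto
      also have "\<dots> = (\<Oplus>\<^bsub>S\<^esub>j\<in>{..n}. \<delta> j (h u) \<otimes>\<^bsub>S\<^esub> \<delta> (n - j) (h v))"
        using c add by (simp add: ring_hom_mult[OF h])
      also have "\<dots> = \<delta> n (h u \<oplus>\<^bsub>S\<^esub> h v)"
        using divided_powers_add[OF \<delta> i, of "h u" "h v" n] add h_in by simp
      finally show ?thesis using add tgr_carrier by (simp add: additive_add[OF h_add])
    qed
    then show ?case using add by (auto intro: tgr_add)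
  next
    case (basis m r)
    have bti: "bt m r \<in> tgr (2 * i)" using basis by (intro tgr_bt) auto
    have "h (\<gamma> n (bt m r)) = \<delta> n (h (bt m r))" for n
    proof (cases rule: even_basis_cases[OF basis(1,3,2) i])
      case (1 a j u)
      have g: "gen1 a \<in> tgr (2 * 0 + 1)" using gen1_in[OF 1(1)] by simp
      consider "n = 0" | "n = 1" | "n \<ge> 2" by linarith
      then show ?thesis
      proof cases
        case 1
        then show ?thesis
          using divided_powers_0[OF \<gamma> i bti] divided_powers_0[OF \<delta> i h_in[OF bti]] by (simp add: ring_hom_one[OF h])
      next
        case 2
        then show ?thesis
          using divided_powers_1[OF \<gamma> i bti] divided_powers_1[OF \<delta> i h_in[OF bti]] by simp
      next
        case 3
        then show ?thesis
          using divided_powers_odd[OF \<gamma> g 1(2)] divided_powers_odd[OF \<delta> h_in[OF g] h_in[OF 1(2)]]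
            tgr_carrier[OF g] tgr_carrier[OF 1(2)]
          by (simp add: 1(4) h_zero ring_hom_mult[OF h])
      qed
    next
      case (2 b k j u)
      have g1: "gen2 b 1 \<in> tgr (2 * 1)" and gk: "gen2 b k \<in> tgr (2 * k)"
        using gen2_in[OF 2(1), of 1] gen2_in[OF 2(1), of k] by auto
      have hg1: "h (gen2 b 1) \<in> gr (2 * 1)" and hgk: "h (gen2 b k) \<in> gr (2 * k)"
        using h_in g1 gk by blast+
      \<comment> \<open>\<open>gen2 b k\<close> is the k-th divided power of
        \<open>gen2 b 1\<close>, and so is its image; the axiom for iterated divided powers gives
        the same constant on both sides.\<close>
      let ?c = "fact (n * k) div (fact n * fact k ^ n) :: nat"
      have "\<gamma> n (gen2 b k) = add_pow TA ?c (gen2 b (n * k))"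
        using divided_powers_compose[OF \<gamma> _ g1 2(2), of n] \<gamma>_gen2[OF 2(1)] by simp
      moreover have "\<delta> n (h (gen2 b k)) = add_pow S ?c (h (gen2 b (n * k)))"
        using divided_powers_compose[OF \<delta> _ hg1 2(2), of n] h_gen2[OF 2(1)] by simp
      ultimately have eq: "h (\<gamma> n (gen2 b k)) = \<delta> n (h (gen2 b k))"
        using gen2_in[OF 2(1), of "n * k"] tgr_carrier by (simp add: addpow)
      have uc: "u \<in> carrier TA" "gen2 b k \<in> carrier TA" "\<gamma> n (gen2 b k) \<in> carrier TA"
        using tgr_carrier[OF 2(3)] tgr_carrier[OF gk] tgr_carrier[OF divided_powers_in[OF \<gamma> 2(2) gk]] by auto
      show ?thesis
        unfolding 2(5)
        using divided_powers_scale[OF \<gamma> 2(2) gk 2(3), of n] divided_powers_scale[OF \<delta> 2(2) hgk h_in[OF 2(3)], of n] uc eq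
        by (simp add: ring_hom_mult[OF h] ring_hom_nat_pow[OF BA_ring S.ring_axioms h])
    qed
    then show ?case using bti by blast
  qed
  then show ?thesis unfolding divided_power_hom_def using h h_gr by blast
qed

section \<open>Tensor products\<close>

text \<open>The targets below are additive groups of rings, whereas \<open>tensor_lift\<close>
  expects a group in multiplicative notation.\<close>

definition add_lift :: "('h, 'i) ring_scheme \<Rightarrow> ('a \<Rightarrow> 'h) \<Rightarrow> ('a \<Rightarrow>\<^sub>0 int) set \<Rightarrow> 'h" where
  "add_lift U f = tensor_lift (add_monoid U) f"

text \<open>Only the additive structure is treated here, with \<mu> arbitrary: the tensor square of
  \<open>A\<close> over \<open>K\<close> and that of the model over \<open>A\<close> share it, but
  their products differ by signs.\<close>

locale tensor_prod =
  fixes C :: "('c, 'i) ring_scheme" and \<phi> and S :: "('s, 'j) ring_scheme" and \<psi> and T :: "('t, 'l) ring_scheme"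
    and \<mu> :: "'s \<times> 't \<Rightarrow> 's \<times> 't \<Rightarrow> ('s \<times> 't \<Rightarrow>\<^sub>0 int)"
  assumes S: "ring S" and T: "ring T"
    and \<phi>: "c \<in> carrier C \<Longrightarrow> \<phi> c \<in> carrier S" and \<psi>: "c \<in> carrier C \<Longrightarrow> \<psi> c \<in> carrier T"
begin

sublocale S: ring S by (rule S)
sublocale T: ring T by (rule T)

abbreviation "FG \<equiv> free_Abelian_group (carrier S \<times> carrier T)"
abbreviation "TG \<equiv> tensor_group C \<phi> S \<psi> T"
abbreviation "TR \<equiv> tensor_ring C \<phi> S \<psi> T \<mu>"
abbreviation "ker \<equiv> tensor_kernel C \<phi> S \<psi> T"
abbreviation "cls \<equiv> tensor_class C \<phi> S \<psi> T"
abbreviation "tens s t \<equiv> cls (frag_of (s, t))"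

lemma FG_comm: "comm_group FG" by (rule abelian_free_Abelian_group)

lemma keys_add_sub:
  "\<lbrakk>Poly_Mapping.keys a \<subseteq> U; Poly_Mapping.keys b \<subseteq> U\<rbrakk> \<Longrightarrow> Poly_Mapping.keys (a + b :: _ \<Rightarrow>\<^sub>0 int) \<subseteq> U"
  by (rule order_trans[OF keys_add]) auto

lemma keys_diff_sub:
  "\<lbrakk>Poly_Mapping.keys a \<subseteq> U; Poly_Mapping.keys b \<subseteq> U\<rbrakk> \<Longrightarrow> Poly_Mapping.keys (a - b :: _ \<Rightarrow>\<^sub>0 int) \<subseteq> U"
  by (rule order_trans[OF keys_diff]) auto

lemma FG_diff: "\<lbrakk>x \<in> carrier FG; y \<in> carrier FG\<rbrakk> \<Longrightarrow> x - y \<in> carrier FG"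
  by (simp add: keys_diff_sub)

lemma relations_sub: "tensor_relations C \<phi> S \<psi> T \<subseteq> carrier FG"
  unfolding tensor_relations_def
  by (auto intro!: FG_diff simp: \<phi> \<psi> simp del: carrier_free_Abelian_group_iff)

lemma ker_subgroup: "subgroup ker FG"
  unfolding tensor_kernel_def by (rule group.generate_is_subgroup[OF group_free_Abelian_group relations_sub])

lemma ker_normal: "ker \<lhd> FG"
  by (rule comm_group.subgroup_imp_normal[OF FG_comm ker_subgroup])

lemma TG_comm: "comm_group TG"
  unfolding tensor_group_def by (rule comm_group.abelian_FactGroup[OF FG_comm ker_subgroup])

lemma add_monoid_TR: "add_monoid TR = TG"
  by (rule monoid.equality) (simp_all add: tensor_ring_def)

lemma TR_abelian: "abelian_group TR"
  by (rule comm_group_abelian_groupI, subst add_monoid_TR) (rule TG_comm)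

sublocale TR: abelian_group TR by (rule TR_abelian)

lemma TR_carrier: "carrier TR = cls ` carrier FG"
  by (simp add: tensor_ring_def tensor_group_def carrier_FactGroup tensor_class_def)

lemma cls_hom: "cls \<in> hom FG TG"
  unfolding tensor_class_def tensor_group_def by (rule normal.r_coset_hom_Mod[OF ker_normal])

lemma TR_add: "x \<oplus>\<^bsub>TR\<^esub> y = x \<otimes>\<^bsub>TG\<^esub> y" by (simp add: tensor_ring_def)

lemma cls_closed: "z \<in> carrier FG \<Longrightarrow> cls z \<in> carrier TR"
  unfolding TR_carrier by (rule imageI)

lemma cls_add: "\<lbrakk>x \<in> carrier FG; y \<in> carrier FG\<rbrakk> \<Longrightarrow> cls (x + y) = cls x \<oplus>\<^bsub>TR\<^esub> cls y"
  using hom_mult[OF cls_hom, of x y] by (simp add: TR_add)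

lemma cls_ker: "z \<in> ker \<Longrightarrow> cls z = \<zero>\<^bsub>TR\<^esub>"
  using group.coset_join2[OF group_free_Abelian_group _ ker_subgroup, of z] subgroup.mem_carrier[OF ker_subgroup, of z]
  by (simp add: tensor_class_def tensor_ring_def tensor_group_def)

lemma cls_diff: "\<lbrakk>x \<in> carrier FG; y \<in> carrier FG\<rbrakk> \<Longrightarrow> cls (x - y) = cls x \<ominus>\<^bsub>TR\<^esub> cls y"
proof -
  assume xy: "x \<in> carrier FG" "y \<in> carrier FG"
  then have d: "x - y \<in> carrier FG" by (simp add: keys_diff_sub)
  have "cls x = cls (x - y) \<oplus>\<^bsub>TR\<^esub> cls y" using cls_add[OF d xy(2)] by simp
  then show ?thesis
    using cls_closed[OF d] cls_closed[OF xy(2)] by (simp add: a_minus_def TR.a_assoc TR.r_neg)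
qed

lemma cls_eqI:
  assumes "x \<in> carrier FG" "y \<in> carrier FG" "x - y \<in> tensor_relations C \<phi> S \<psi> T"
  shows "cls x = cls y"
proof -
  have "x - y \<in> ker" unfolding tensor_kernel_def using assms(3) by (rule generate.incl)
  then have "cls ((x - y) + y) = \<zero>\<^bsub>TR\<^esub> \<oplus>\<^bsub>TR\<^esub> cls y"
    using assms subgroup.mem_carrier[OF ker_subgroup, of "x - y"]
    by (subst cls_add) (auto simp: cls_ker)
  then show ?thesis using cls_closed[OF assms(2)] by simp
qed

lemma tens_closed [simp, intro]: "\<lbrakk>s \<in> carrier S; t \<in> carrier T\<rbrakk> \<Longrightarrow> tens s t \<in> carrier TR"
  by (rule cls_closed) simp

lemma tens_add_left:
  assumes "s \<in> carrier S" "s' \<in> carrier S" "t \<in> carrier T"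
  shows "tens (s \<oplus>\<^bsub>S\<^esub> s') t = tens s t \<oplus>\<^bsub>TR\<^esub> tens s' t"
proof -
  have "tens (s \<oplus>\<^bsub>S\<^esub> s') t = cls (frag_of (s, t) + frag_of (s', t))"
  proof (rule cls_eqI)
    show "frag_of (s \<oplus>\<^bsub>S\<^esub> s', t) - (frag_of (s, t) + frag_of (s', t)) \<in> tensor_relations C \<phi> S \<psi> T"
      unfolding tensor_relations_def using assms by (intro UnI1) (auto simp: diff_diff_eq[symmetric])
  qed (use assms in \<open>simp_all add: keys_add_sub\<close>)
  then show ?thesis using assms by (simp add: cls_add)
qed

lemma tens_add_right:
  assumes "s \<in> carrier S" "t \<in> carrier T" "t' \<in> carrier T"
  shows "tens s (t \<oplus>\<^bsub>T\<^esub> t') = tens s t \<oplus>\<^bsub>TR\<^esub> tens s t'"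
proof -
  have "tens s (t \<oplus>\<^bsub>T\<^esub> t') = cls (frag_of (s, t) + frag_of (s, t'))"
  proof (rule cls_eqI)
    show "frag_of (s, t \<oplus>\<^bsub>T\<^esub> t') - (frag_of (s, t) + frag_of (s, t')) \<in> tensor_relations C \<phi> S \<psi> T"
      unfolding tensor_relations_def using assms by (intro UnI1 UnI2) (auto simp: diff_diff_eq[symmetric])
  qed (use assms in \<open>simp_all add: keys_add_sub\<close>)
  then show ?thesis using assms by (simp add: cls_add)
qed

lemma tens_balanced:
  assumes "s \<in> carrier S" "c \<in> carrier C" "t \<in> carrier T"
  shows "tens (s \<otimes>\<^bsub>S\<^esub> \<phi> c) t = tens s (\<psi> c \<otimes>\<^bsub>T\<^esub> t)"
proof (rule cls_eqI)
  show "frag_of (s \<otimes>\<^bsub>S\<^esub> \<phi> c, t) - frag_of (s, \<psi> c \<otimes>\<^bsub>T\<^esub> t) \<in> tensor_relations C \<phi> S \<psi> T"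
    unfolding tensor_relations_def using assms by (intro UnI2) auto
qed (use assms \<phi> \<psi> in simp_all)

lemma tens_additive_left: "t \<in> carrier T \<Longrightarrow> (\<lambda>s. tens s t) \<in> hom (add_monoid S) (add_monoid TR)"
  by (rule additiveI) (simp_all add: tens_add_left)

lemma tens_additive_right: "s \<in> carrier S \<Longrightarrow> (\<lambda>t. tens s t) \<in> hom (add_monoid T) (add_monoid TR)"
  by (rule additiveI) (simp_all add: tens_add_right)

lemma tens_zero [simp]:
  "t \<in> carrier T \<Longrightarrow> tens \<zero>\<^bsub>S\<^esub> t = \<zero>\<^bsub>TR\<^esub>" "s \<in> carrier S \<Longrightarrow> tens s \<zero>\<^bsub>T\<^esub> = \<zero>\<^bsub>TR\<^esub>"
  using additive_zero[OF S.is_abelian_group TR_abelian tens_additive_left]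
    additive_zero[OF T.is_abelian_group TR_abelian tens_additive_right] by blast+

lemma tens_uminus:
  "\<lbrakk>s \<in> carrier S; t \<in> carrier T\<rbrakk> \<Longrightarrow> tens (\<ominus>\<^bsub>S\<^esub> s) t = \<ominus>\<^bsub>TR\<^esub> tens s t"
  "\<lbrakk>s \<in> carrier S; t \<in> carrier T\<rbrakk> \<Longrightarrow> tens s (\<ominus>\<^bsub>T\<^esub> t) = \<ominus>\<^bsub>TR\<^esub> tens s t"
  using additive_uminus[OF S.is_abelian_group TR_abelian tens_additive_left]
    additive_uminus[OF T.is_abelian_group TR_abelian tens_additive_right] by blast+

lemma TR_induct [consumes 1, case_names zero add tens]:
  assumes z: "z \<in> carrier TR" and P0: "P \<zero>\<^bsub>TR\<^esub>"
    and Padd: "\<And>x y. \<lbrakk>x \<in> carrier TR; y \<in> carrier TR; P x; P y\<rbrakk> \<Longrightarrow> P (x \<oplus>\<^bsub>TR\<^esub> y)"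
    and Pt: "\<And>s t. \<lbrakk>s \<in> carrier S; t \<in> carrier T\<rbrakk> \<Longrightarrow> P (tens s t)"
  shows "P z"
proof -
  obtain w where w: "Poly_Mapping.keys w \<subseteq> carrier S \<times> carrier T" and zw: "z = cls w"
    using z unfolding TR_carrier by auto
  \<comment> \<open>The induction rule for free abelian groups has a step for differences, so the
    claim is carried for a class together with its negative. The negative of a pure tensor is again
    pure.\<close>
  have "Poly_Mapping.keys w \<subseteq> carrier S \<times> carrier T \<and> P (cls w) \<and> P (\<ominus>\<^bsub>TR\<^esub> cls w)" using w
  proof (induction rule: free_Abelian_group_induct[consumes 1])
    case 1
    have z: "cls 0 = \<zero>\<^bsub>TR\<^esub>" using subgroup.one_closed[OF ker_subgroup] by (intro cls_ker) simp
    have mz: "\<ominus>\<^bsub>TR\<^esub> cls 0 = \<zero>\<^bsub>TR\<^esub>" unfolding z by (rule TR.minus_equality) simp_all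
    show ?case unfolding mz unfolding z using P0 by simp
  next
    case (2 x y)
    then have c: "cls x \<in> carrier TR" "cls y \<in> carrier TR" by (auto intro!: cls_closed)
    have d: "cls (x - y) = cls x \<oplus>\<^bsub>TR\<^esub> (\<ominus>\<^bsub>TR\<^esub> cls y)"
      using 2 by (simp add: cls_diff a_minus_def)
    have "\<ominus>\<^bsub>TR\<^esub> cls (x - y) = (\<ominus>\<^bsub>TR\<^esub> cls x) \<oplus>\<^bsub>TR\<^esub> cls y"
      unfolding d using c by (simp add: TR.minus_add TR.minus_minus)
    then show ?case using 2 c by (auto simp: d keys_diff_sub intro!: Padd)
  next
    case (3 a)
    then show ?case using Pt[of "\<ominus>\<^bsub>S\<^esub> fst a" "snd a"] Pt[of "fst a" "snd a"] tens_uminus(1)[of "fst a" "snd a"]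
      by (auto simp: mem_Times_iff)
  qed
  then show ?thesis by (simp add: zw)
qed

definition balanced :: "('h, 'o) ring_scheme \<Rightarrow> ('s \<times> 't \<Rightarrow> 'h) \<Rightarrow> bool" where
  "balanced U f \<longleftrightarrow>
    (\<forall>s\<in>carrier S. \<forall>t\<in>carrier T. f (s, t) \<in> carrier U) \<and>
    (\<forall>s\<in>carrier S. \<forall>s'\<in>carrier S. \<forall>t\<in>carrier T. f (s \<oplus>\<^bsub>S\<^esub> s', t) = f (s, t) \<oplus>\<^bsub>U\<^esub> f (s', t)) \<and>
    (\<forall>s\<in>carrier S. \<forall>t\<in>carrier T. \<forall>t'\<in>carrier T. f (s, t \<oplus>\<^bsub>T\<^esub> t') = f (s, t) \<oplus>\<^bsub>U\<^esub> f (s, t')) \<and>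
    (\<forall>s\<in>carrier S. \<forall>c\<in>carrier C. \<forall>t\<in>carrier T. f (s \<otimes>\<^bsub>S\<^esub> \<phi> c, t) = f (s, \<psi> c \<otimes>\<^bsub>T\<^esub> t))"

context
  fixes U :: "('h, 'o) ring_scheme" and f
  assumes U: "abelian_group U" and f: "balanced U f"
begin

interpretation U: abelian_group U by (rule U)

lemma f_closed: "x \<in> carrier S \<times> carrier T \<Longrightarrow> f x \<in> carrier U"
  using f by (auto simp: balanced_def)

lemma frag_eval_expand:
  assumes "finite D" "Poly_Mapping.keys z \<subseteq> D" "D \<subseteq> carrier S \<times> carrier T"
  shows "frag_eval (add_monoid U) f z = (\<Oplus>\<^bsub>U\<^esub>k\<in>D. Poly_Mapping.lookup z k \<odot>\<^bsub>U\<^esub> f k)"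
proof -
  have "frag_eval (add_monoid U) f z = (\<Oplus>\<^bsub>U\<^esub>k\<in>Poly_Mapping.keys z. Poly_Mapping.lookup z k \<odot>\<^bsub>U\<^esub> f k)"
    by (simp add: frag_eval_def finsum_def add_pow_def)
  also have "\<dots> = (\<Oplus>\<^bsub>U\<^esub>k\<in>D. Poly_Mapping.lookup z k \<odot>\<^bsub>U\<^esub> f k)"
    using assms f_closed by (intro U.finsum_mono_neutral) (auto simp: in_keys_iff intro!: U.int_mult_closed)
  finally show ?thesis .
qed

lemma frag_eval_hom: "frag_eval (add_monoid U) f \<in> hom FG (add_monoid U)"
proof (rule homI)
  fix x assume x: "x \<in> carrier FG"
  then show "frag_eval (add_monoid U) f x \<in> carrier (add_monoid U)"
    using f_closed by (subst frag_eval_expand[of "Poly_Mapping.keys x"]) (auto intro!: U.finsum_closed U.int_mult_closed)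
next
  fix x y assume xy: "x \<in> carrier FG" "y \<in> carrier FG"
  let ?D = "Poly_Mapping.keys x \<union> Poly_Mapping.keys y"
  have D: "finite ?D" "Poly_Mapping.keys (x + y) \<subseteq> ?D" "?D \<subseteq> carrier S \<times> carrier T"
    using xy keys_add[of x y] by auto
  have fD: "k \<in> ?D \<Longrightarrow> f k \<in> carrier U" for k using D(3) f_closed by blast
  have "frag_eval (add_monoid U) f (x + y) = (\<Oplus>\<^bsub>U\<^esub>k\<in>?D. (Poly_Mapping.lookup x k + Poly_Mapping.lookup y k) \<odot>\<^bsub>U\<^esub> f k)"
    using D by (simp add: frag_eval_expand[of ?D] lookup_add)
  also have "\<dots> = (\<Oplus>\<^bsub>U\<^esub>k\<in>?D. Poly_Mapping.lookup x k \<odot>\<^bsub>U\<^esub> f k \<oplus>\<^bsub>U\<^esub> Poly_Mapping.lookup y k \<odot>\<^bsub>U\<^esub> f k)"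
    using fD by (intro U.finsum_cong') (simp_all add: U.int_mult_add_left)
  also have "\<dots> = frag_eval (add_monoid U) f x \<oplus>\<^bsub>U\<^esub> frag_eval (add_monoid U) f y"
    using D fD by (simp add: frag_eval_expand[of ?D] U.finsum_addf Pi_def)
  finally show "frag_eval (add_monoid U) f (x \<otimes>\<^bsub>FG\<^esub> y) = frag_eval (add_monoid U) f x \<otimes>\<^bsub>add_monoid U\<^esub> frag_eval (add_monoid U) f y"
    by simp
qed

lemma frag_eval_frag_of: "x \<in> carrier S \<times> carrier T \<Longrightarrow> frag_eval (add_monoid U) f (frag_of x) = f x"
  using frag_eval_expand[of "{x}" "frag_of x"] f_closed[of x] by simp

lemma frag_eval_group_hom: "group_hom FG (add_monoid U) (frag_eval (add_monoid U) f)"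
  by (intro group_hom.intro group_hom_axioms.intro group_free_Abelian_group U.a_group frag_eval_hom)

lemma frag_eval_add:
  "\<lbrakk>x \<in> carrier FG; y \<in> carrier FG\<rbrakk> \<Longrightarrow> frag_eval (add_monoid U) f (x + y) = frag_eval (add_monoid U) f x \<oplus>\<^bsub>U\<^esub> frag_eval (add_monoid U) f y"
  using hom_mult[OF frag_eval_hom, of x y] by simp

lemma frag_eval_diff:
  assumes "x \<in> carrier FG" "y \<in> carrier FG"
  shows "frag_eval (add_monoid U) f (x - y) = frag_eval (add_monoid U) f x \<ominus>\<^bsub>U\<^esub> frag_eval (add_monoid U) f y"
proof -
  have d: "x - y \<in> carrier FG" using assms by (simp add: keys_diff_sub)
  have cl: "frag_eval (add_monoid U) f z \<in> carrier U" if "z \<in> carrier FG" for z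
    using hom_in_carrier[OF frag_eval_hom that] by simp
  have "frag_eval (add_monoid U) f x = frag_eval (add_monoid U) f (x - y) \<oplus>\<^bsub>U\<^esub> frag_eval (add_monoid U) f y"
    using frag_eval_add[OF d assms(2)] by simp
  then show ?thesis using cl[OF d] cl[OF assms(2)] by (simp add: a_minus_def U.a_assoc U.r_neg)
qed

lemma relations_kernel: "tensor_relations C \<phi> S \<psi> T \<subseteq> kernel FG (add_monoid U) (frag_eval (add_monoid U) f)"
proof
  fix z assume z: "z \<in> tensor_relations C \<phi> S \<psi> T"
  have fr: "frag_of x \<in> carrier FG" if "x \<in> carrier S \<times> carrier T" for x using that by simp
  have dr: "x - y \<in> carrier FG" if "x \<in> carrier FG" "y \<in> carrier FG" for x y using that by (simp add: keys_diff_sub)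
  have diff0: "x \<ominus>\<^bsub>U\<^esub> x = \<zero>\<^bsub>U\<^esub>" if "x \<in> carrier U" for x using that by (simp add: a_minus_def U.r_neg)
  have sum0: "(x \<oplus>\<^bsub>U\<^esub> y) \<ominus>\<^bsub>U\<^esub> x \<ominus>\<^bsub>U\<^esub> y = \<zero>\<^bsub>U\<^esub>" if "x \<in> carrier U" "y \<in> carrier U" for x y
    using that by (simp add: a_minus_def U.a_comm[of x y] U.a_assoc U.r_neg)
  have "frag_eval (add_monoid U) f z = \<zero>\<^bsub>U\<^esub>"
    using z f unfolding tensor_relations_def
    by (elim UnE CollectE exE conjE)
      (simp_all add: frag_eval_diff frag_eval_frag_of dr \<phi> \<psi> f_closed balanced_def diff0 sum0
        del: carrier_free_Abelian_group_iff add: fr)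
  then show "z \<in> kernel FG (add_monoid U) (frag_eval (add_monoid U) f)"
    unfolding kernel_def using subsetD[OF relations_sub z] by simp
qed

lemma ker_kernel: "ker \<subseteq> kernel FG (add_monoid U) (frag_eval (add_monoid U) f)"
  unfolding tensor_kernel_def
  by (rule group.generate_subgroup_incl[OF group_free_Abelian_group relations_kernel
      group_hom.subgroup_kernel[OF frag_eval_group_hom]])

text \<open>\<open>frag_eval\<close> kills the relations and is therefore constant on each coset, so
  the image in \<open>tensor_lift\<close> is a singleton.\<close>

lemma tensor_lift_cls:
  assumes z: "z \<in> carrier FG"
  shows "add_lift U f (cls z) = frag_eval (add_monoid U) f z"
proof -
  have "frag_eval (add_monoid U) f (k + z) = frag_eval (add_monoid U) f z" if "k \<in> ker" for k
  proof -
    have k: "k \<in> carrier FG" "frag_eval (add_monoid U) f k = \<zero>\<^bsub>U\<^esub>"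
      using that ker_kernel by (auto simp: kernel_def)
    then show ?thesis using z hom_in_carrier[OF frag_eval_hom z] frag_eval_add[OF k(1) z] by simp
  qed
  moreover have "cls z = (\<lambda>k. k + z) ` ker"
    by (auto simp: tensor_class_def r_coset_def)
  moreover have "ker \<noteq> {}" using subgroup.one_closed[OF ker_subgroup] by blast
  ultimately have "frag_eval (add_monoid U) f ` cls z = {frag_eval (add_monoid U) f z}"
    by (auto simp: image_image)
  then show ?thesis by (simp add: add_lift_def tensor_lift_def)
qed

lemma tensor_lift_tens [simp]:
  "\<lbrakk>s \<in> carrier S; t \<in> carrier T\<rbrakk> \<Longrightarrow> add_lift U f (tens s t) = f (s, t)"
  by (simp add: tensor_lift_cls frag_eval_frag_of)

lemma tensor_lift_hom: "add_lift U f \<in> hom (add_monoid TR) (add_monoid U)"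
proof (rule additiveI)
  fix x assume "x \<in> carrier TR"
  then obtain z where "z \<in> carrier FG" "x = cls z" unfolding TR_carrier by blast
  then show "add_lift U f x \<in> carrier U"
    using tensor_lift_cls hom_in_carrier[OF frag_eval_hom] by simp
next
  fix x y assume "x \<in> carrier TR" "y \<in> carrier TR"
  then obtain z w where zw: "z \<in> carrier FG" "x = cls z" "w \<in> carrier FG" "y = cls w" unfolding TR_carrier by blast
  have s: "z + w \<in> carrier FG" using zw by (simp add: keys_add_sub)
  show "add_lift U f (x \<oplus>\<^bsub>TR\<^esub> y) = add_lift U f x \<oplus>\<^bsub>U\<^esub> add_lift U f y"
    unfolding zw(2,4) cls_add[OF zw(1,3), symmetric]
    by (simp only: tensor_lift_cls[OF s] tensor_lift_cls[OF zw(1)] tensor_lift_cls[OF zw(3)] frag_eval_add[OF zw(1,3)])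
qed

end

lemma balanced_add:
  assumes U: "abelian_group U" and f: "balanced U f" "balanced U g"
  shows "balanced U (\<lambda>x. f x \<oplus>\<^bsub>U\<^esub> g x)"
proof -
  interpret U: abelian_group U by (rule U)
  show ?thesis using f unfolding balanced_def by (auto simp: U.a_ac)
qed

lemma balanced_zero: "abelian_group U \<Longrightarrow> balanced U (\<lambda>x. \<zero>\<^bsub>U\<^esub>)"
  unfolding balanced_def using abelian_group.axioms(1) abelian_monoid.l_zero abelian_monoid.zero_closed by fastforce

lemma balanced_cong:
  "balanced U f \<Longrightarrow> (\<And>s t. \<lbrakk>s \<in> carrier S; t \<in> carrier T\<rbrakk> \<Longrightarrow> f (s, t) = g (s, t)) \<Longrightarrow> balanced U g"
  unfolding balanced_def by (auto simp: \<phi> \<psi>)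

end

text \<open>The product is a lift in \<open>q\<close> nested in a lift in \<open>p\<close>; it is
  well defined if \<mu> is balanced in each argument while the other one is a fixed pair.\<close>

locale tensor_prod_alg = tensor_prod +
  assumes \<mu>_right: "p \<in> carrier S \<times> carrier T \<Longrightarrow> balanced TR (\<lambda>q. cls (\<mu> p q))"
    and \<mu>_left: "q \<in> carrier S \<times> carrier T \<Longrightarrow> balanced TR (\<lambda>p. cls (\<mu> p q))"
begin

lemma TR_mult: "Y \<otimes>\<^bsub>TR\<^esub> Z = add_lift TR (\<lambda>p. add_lift TR (\<lambda>q. cls (\<mu> p q)) Z) Y"
  unfolding add_lift_def add_monoid_TR by (simp add: tensor_ring_def)

text \<open>For a pure tensor \<open>Z\<close> this is \<open>\<mu>_left\<close>. Sums in
  \<open>Z\<close> are covered because a sum of balanced functions is balanced.\<close>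

lemma inner_balanced:
  assumes Z: "Z \<in> carrier TR"
  shows "balanced TR (\<lambda>p. add_lift TR (\<lambda>q. cls (\<mu> p q)) Z)"
  using Z
proof (induction rule: TR_induct)
  case zero
  show ?case
  proof (rule balanced_cong[OF balanced_zero[OF TR_abelian]])
    fix s t assume "s \<in> carrier S" "t \<in> carrier T"
    then show "\<zero>\<^bsub>TR\<^esub> = add_lift TR (\<lambda>q. cls (\<mu> (s, t) q)) \<zero>\<^bsub>TR\<^esub>"
      using additive_zero[OF TR_abelian TR_abelian tensor_lift_hom[OF TR_abelian \<mu>_right[of "(s, t)"]]] by simp
  qed
next
  case (add x y)
  show ?case
  proof (rule balanced_cong[OF balanced_add[OF TR_abelian add(3,4)]])
    fix s t assume "s \<in> carrier S" "t \<in> carrier T"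
    then show "add_lift TR (\<lambda>q. cls (\<mu> (s, t) q)) x \<oplus>\<^bsub>TR\<^esub> add_lift TR (\<lambda>q. cls (\<mu> (s, t) q)) y
      = add_lift TR (\<lambda>q. cls (\<mu> (s, t) q)) (x \<oplus>\<^bsub>TR\<^esub> y)"
      using additive_add[OF tensor_lift_hom[OF TR_abelian \<mu>_right[of "(s, t)"]] add(1,2)] by simp
  qed
next
  case (tens s t)
  show ?case
    by (rule balanced_cong[OF \<mu>_left[of "(s, t)"]])
      (use tens in \<open>simp_all add: tensor_lift_tens[OF TR_abelian \<mu>_right]\<close>)
qed

lemma TR_mult_closed: "\<lbrakk>Y \<in> carrier TR; Z \<in> carrier TR\<rbrakk> \<Longrightarrow> Y \<otimes>\<^bsub>TR\<^esub> Z \<in> carrier TR"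
  unfolding TR_mult by (rule additive_closed[OF tensor_lift_hom[OF TR_abelian inner_balanced]])

lemma tens_mult:
  "\<lbrakk>s \<in> carrier S; t \<in> carrier T; s' \<in> carrier S; t' \<in> carrier T\<rbrakk> \<Longrightarrow>
    tens s t \<otimes>\<^bsub>TR\<^esub> tens s' t' = cls (\<mu> (s, t) (s', t'))"
  unfolding TR_mult by (simp add: tensor_lift_tens[OF TR_abelian inner_balanced] tensor_lift_tens[OF TR_abelian \<mu>_right])

lemma TR_l_distr:
  "\<lbrakk>X \<in> carrier TR; Y \<in> carrier TR; Z \<in> carrier TR\<rbrakk> \<Longrightarrow> (X \<oplus>\<^bsub>TR\<^esub> Y) \<otimes>\<^bsub>TR\<^esub> Z = X \<otimes>\<^bsub>TR\<^esub> Z \<oplus>\<^bsub>TR\<^esub> Y \<otimes>\<^bsub>TR\<^esub> Z"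
  unfolding TR_mult by (rule additive_add[OF tensor_lift_hom[OF TR_abelian inner_balanced]])

lemma tens_r_distr:
  assumes "s \<in> carrier S" "t \<in> carrier T" "X \<in> carrier TR" "Y \<in> carrier TR"
  shows "tens s t \<otimes>\<^bsub>TR\<^esub> (X \<oplus>\<^bsub>TR\<^esub> Y) = tens s t \<otimes>\<^bsub>TR\<^esub> X \<oplus>\<^bsub>TR\<^esub> tens s t \<otimes>\<^bsub>TR\<^esub> Y"
  unfolding TR_mult using assms
  by (simp add: tensor_lift_tens[OF TR_abelian inner_balanced] additive_add[OF tensor_lift_hom[OF TR_abelian \<mu>_right]])

lemma TR_l_zero: "Z \<in> carrier TR \<Longrightarrow> \<zero>\<^bsub>TR\<^esub> \<otimes>\<^bsub>TR\<^esub> Z = \<zero>\<^bsub>TR\<^esub>"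
  unfolding TR_mult by (rule additive_zero[OF TR_abelian TR_abelian tensor_lift_hom[OF TR_abelian inner_balanced]])

lemma TR_r_distr:
  assumes "X \<in> carrier TR" "Y \<in> carrier TR" "Z \<in> carrier TR"
  shows "Z \<otimes>\<^bsub>TR\<^esub> (X \<oplus>\<^bsub>TR\<^esub> Y) = Z \<otimes>\<^bsub>TR\<^esub> X \<oplus>\<^bsub>TR\<^esub> Z \<otimes>\<^bsub>TR\<^esub> Y"
  using assms(3)
  by (induction rule: TR_induct)
    (use assms in \<open>simp_all add: TR_l_zero TR_l_distr TR_mult_closed tens_r_distr TR.a_ac\<close>)

lemma TR_r_zero: "Z \<in> carrier TR \<Longrightarrow> Z \<otimes>\<^bsub>TR\<^esub> \<zero>\<^bsub>TR\<^esub> = \<zero>\<^bsub>TR\<^esub>"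
  by (rule additive_zero[OF TR_abelian TR_abelian, of "\<lambda>X. Z \<otimes>\<^bsub>TR\<^esub> X"])
    (rule additiveI, simp_all add: TR_mult_closed TR_r_distr)

lemma TR_one: "\<one>\<^bsub>TR\<^esub> = tens \<one>\<^bsub>S\<^esub> \<one>\<^bsub>T\<^esub>" by (simp add: tensor_ring_def)

lemma TR_ring:
  assumes assoc: "\<And>s t s' t' s'' t''. \<lbrakk>s \<in> carrier S; t \<in> carrier T; s' \<in> carrier S; t' \<in> carrier T; s'' \<in> carrier S; t'' \<in> carrier T\<rbrakk>
      \<Longrightarrow> tens s t \<otimes>\<^bsub>TR\<^esub> tens s' t' \<otimes>\<^bsub>TR\<^esub> tens s'' t'' = tens s t \<otimes>\<^bsub>TR\<^esub> (tens s' t' \<otimes>\<^bsub>TR\<^esub> tens s'' t'')"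
    and one: "\<And>s t. \<lbrakk>s \<in> carrier S; t \<in> carrier T\<rbrakk> \<Longrightarrow> tens \<one>\<^bsub>S\<^esub> \<one>\<^bsub>T\<^esub> \<otimes>\<^bsub>TR\<^esub> tens s t = tens s t"
      "\<And>s t. \<lbrakk>s \<in> carrier S; t \<in> carrier T\<rbrakk> \<Longrightarrow> tens s t \<otimes>\<^bsub>TR\<^esub> tens \<one>\<^bsub>S\<^esub> \<one>\<^bsub>T\<^esub> = tens s t"
  shows "ring TR"
proof (rule ringI[OF TR_abelian])
  show "monoid TR"
  proof (rule monoidI)
    fix x assume x: "x \<in> carrier TR"
    show "\<one>\<^bsub>TR\<^esub> \<otimes>\<^bsub>TR\<^esub> x = x"
      using x by (induction rule: TR_induct) (simp_all add: TR_one one TR_r_zero TR_r_distr)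
    show "x \<otimes>\<^bsub>TR\<^esub> \<one>\<^bsub>TR\<^esub> = x"
      using x by (induction rule: TR_induct) (simp_all add: TR_one one TR_l_zero TR_l_distr)
  next
    fix x y z assume xyz: "x \<in> carrier TR" "y \<in> carrier TR" "z \<in> carrier TR"
    have 1: "tens s t \<otimes>\<^bsub>TR\<^esub> tens s' t' \<otimes>\<^bsub>TR\<^esub> z = tens s t \<otimes>\<^bsub>TR\<^esub> (tens s' t' \<otimes>\<^bsub>TR\<^esub> z)"
      if "s \<in> carrier S" "t \<in> carrier T" "s' \<in> carrier S" "t' \<in> carrier T" for s t s' t'
      using xyz(3) by (induction rule: TR_induct) (use that in \<open>simp_all add: assoc TR_r_zero TR_r_distr TR_mult_closed\<close>)
    have 2: "tens s t \<otimes>\<^bsub>TR\<^esub> y \<otimes>\<^bsub>TR\<^esub> z = tens s t \<otimes>\<^bsub>TR\<^esub> (y \<otimes>\<^bsub>TR\<^esub> z)"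
      if "s \<in> carrier S" "t \<in> carrier T" for s t
      using xyz(2) by (induction rule: TR_induct)
        (use that xyz in \<open>simp_all add: 1 TR_r_zero TR_l_zero TR_r_distr TR_l_distr TR_mult_closed\<close>)
    show "x \<otimes>\<^bsub>TR\<^esub> y \<otimes>\<^bsub>TR\<^esub> z = x \<otimes>\<^bsub>TR\<^esub> (y \<otimes>\<^bsub>TR\<^esub> z)"
      using xyz(1) by (induction rule: TR_induct)
        (use xyz in \<open>simp_all add: 2 TR_r_zero TR_l_zero TR_r_distr TR_l_distr TR_mult_closed\<close>)
  qed (simp_all add: TR_mult_closed TR_one)
qed (simp_all add: TR_l_distr TR_r_distr)

end

section \<open>The tensor product of commutative algebras\<close>

locale tensor_cring = S: cring S + T: cring T + C: cring C
  for C :: "('c, 'i) ring_scheme" and \<phi> and S :: "('s, 'j) ring_scheme" and \<psi> and T :: "('t, 'l) ring_scheme" +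
  assumes \<phi>_hom: "\<phi> \<in> ring_hom C S" and \<psi>_hom: "\<psi> \<in> ring_hom C T"
begin

abbreviation "mu \<equiv> \<lambda>p q. frag_of (fst p \<otimes>\<^bsub>S\<^esub> fst q, snd p \<otimes>\<^bsub>T\<^esub> snd q)"

sublocale tensor_prod C \<phi> S \<psi> T mu
  by (intro tensor_prod.intro S.ring_axioms T.ring_axioms)
    (simp_all add: ring_hom_closed[OF \<phi>_hom] ring_hom_closed[OF \<psi>_hom])

lemma balanced_tens_mult:
  assumes "u \<in> carrier S" "v \<in> carrier T"
  shows "balanced TR (\<lambda>q. tens (u \<otimes>\<^bsub>S\<^esub> fst q) (v \<otimes>\<^bsub>T\<^esub> snd q))"
proof -
  have "tens (u \<otimes>\<^bsub>S\<^esub> (s \<otimes>\<^bsub>S\<^esub> \<phi> c)) (v \<otimes>\<^bsub>T\<^esub> t) = tens (u \<otimes>\<^bsub>S\<^esub> s) (v \<otimes>\<^bsub>T\<^esub> (\<psi> c \<otimes>\<^bsub>T\<^esub> t))"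
    if "s \<in> carrier S" "c \<in> carrier C" "t \<in> carrier T" for s c t
    using tens_balanced[of "u \<otimes>\<^bsub>S\<^esub> s" c "v \<otimes>\<^bsub>T\<^esub> t"] that assms \<phi> \<psi>
    by (simp add: S.m_assoc T.m_lcomm)
  then show ?thesis
    unfolding balanced_def using assms \<phi> \<psi>
    by (simp add: tens_add_left tens_add_right S.r_distr T.r_distr)
qed

sublocale tensor_prod_alg C \<phi> S \<psi> T mu
proof (intro tensor_prod_alg.intro tensor_prod_alg_axioms.intro tensor_prod_axioms)
  fix p assume p: "p \<in> carrier S \<times> carrier T"
  then show "balanced TR (\<lambda>q. cls (mu p q))" by (intro balanced_tens_mult) auto
  \<comment> \<open>By commutativity the product is symmetric in \<open>p\<close> and
    \<open>q\<close>, so one balancedness proof gives both.\<close>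
  have "balanced TR (\<lambda>q. tens (fst p \<otimes>\<^bsub>S\<^esub> fst q) (snd p \<otimes>\<^bsub>T\<^esub> snd q))"
    using p by (intro balanced_tens_mult) auto
  then show "balanced TR (\<lambda>q. cls (mu q p))"
    by (rule balanced_cong) (use p in \<open>auto simp: S.m_comm T.m_comm\<close>)
qed

lemma tens_tens:
  "\<lbrakk>s \<in> carrier S; t \<in> carrier T; s' \<in> carrier S; t' \<in> carrier T\<rbrakk> \<Longrightarrow>
    tens s t \<otimes>\<^bsub>TR\<^esub> tens s' t' = tens (s \<otimes>\<^bsub>S\<^esub> s') (t \<otimes>\<^bsub>T\<^esub> t')"
  by (simp add: tens_mult)

lemma TR_cring: "cring TR"
proof -
  interpret R: ring TR
    by (rule TR_ring) (simp_all add: tens_tens S.m_assoc T.m_assoc)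
  have "x \<otimes>\<^bsub>TR\<^esub> y = y \<otimes>\<^bsub>TR\<^esub> x" if xy: "x \<in> carrier TR" "y \<in> carrier TR" for x y
  proof -
    have 1: "tens s t \<otimes>\<^bsub>TR\<^esub> y = y \<otimes>\<^bsub>TR\<^esub> tens s t" if "s \<in> carrier S" "t \<in> carrier T" for s t
      using xy(2) by (induction rule: TR_induct)
        (use that in \<open>simp_all add: tens_tens S.m_comm T.m_comm R.l_distr R.r_distr\<close>)
    show ?thesis using xy(1)
      by (induction rule: TR_induct) (use xy 1 in \<open>simp_all add: R.l_distr R.r_distr\<close>)
  qed
  then show ?thesis
    by (intro cring.intro R.ring_axioms comm_monoid.intro comm_monoid_axioms.intro R.is_monoid)
qed

end

section \<open>The second stage of the Tate model\<close>

locale tate_setup = tate_data K X I B \<alpha>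
  for K :: "('k, 'm) ring_scheme" and X :: "'x set" and I :: "('x multiset \<Rightarrow> 'k) set"
    and B :: "'b set" and \<alpha> :: "'b \<Rightarrow> 'x list \<Rightarrow> 'k" +
  assumes K_cring: "cring K" and I_ideal: "ideal I (mpoly_ring K X)"
    and \<alpha>_closed: "b \<in> B \<Longrightarrow> \<alpha> b w \<in> carrier K"
    and words_finite: "b \<in> B \<Longrightarrow> finite (words b)"
    and words_lists: "b \<in> B \<Longrightarrow> words b \<subseteq> lists X"
begin

sublocale K: cring K by (rule K_cring)

lemma P_basis: "basis_alg K {m. set_mset m \<subseteq> X} (+) {#} (\<lambda>_ _. 1)"
  by (intro basis_alg.intro K_cring basis_alg_axioms.intro) (auto simp: add.assoc)

interpretation Pb: basis_alg K "{m. set_mset m \<subseteq> X}" "(+)" "{#}" "\<lambda>_ _. 1"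
  rewrites "basis_algebra K {m. set_mset m \<subseteq> X} (+) {#} (\<lambda>_ _. 1) = P"
  by (rule P_basis) (simp add: P_def mpoly_ring_def)

lemma P_cring: "cring P" by (rule Pb.BA_cring) (auto simp: add.commute)

lemma I_ideal_P: "ideal I P" using I_ideal by (simp add: P_def)

lemma A_cring: "cring A"
  unfolding A_def by (rule ideal.quotient_is_cring[OF I_ideal_P P_cring])

sublocale A: cring A by (rule A_cring)

lemma rcos_hom: "(+>\<^bsub>P\<^esub>) I \<in> ring_hom P A"
  unfolding A_def by (rule ideal.rcos_ring_hom[OF I_ideal_P])

lemma const_hom: "const \<in> ring_hom K P"
  by (rule ring_hom_memI) (simp_all add: const_def Pb.bt_add Pb.bt_mult Pb.BA_one)

lemma scalA_hom: "scalA \<in> ring_hom K A"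
proof -
  have "scalA = (+>\<^bsub>P\<^esub>) I \<circ> const" by (auto simp: scalA_def)
  then show ?thesis using ring_hom_trans[OF const_hom rcos_hom] by simp
qed

lemma varA_closed [simp]: "a \<in> X \<Longrightarrow> varA a \<in> carrier A"
  unfolding varA_def var_def by (rule ring_hom_closed[OF rcos_hom]) (rule Pb.bt_closed, simp_all)

lemma scalA_closed [simp]: "k \<in> carrier K \<Longrightarrow> scalA k \<in> carrier A"
  by (rule ring_hom_closed[OF scalA_hom])

sublocale Ae: tensor_cring K scalA A scalA A
  rewrites "tensor_ring K scalA A scalA A (\<lambda>p q. frag_of (fst p \<otimes>\<^bsub>A\<^esub> fst q, snd p \<otimes>\<^bsub>A\<^esub> snd q)) = Aev"
  by (intro tensor_cring.intro A_cring K_cring tensor_cring_axioms.intro scalA_hom) (simp add: Aev_def)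

lemma Aev_cring: "cring Aev" by (rule Ae.TR_cring)

sublocale Aev: cring Aev by (rule Aev_cring)

lemma tensA_eq: "tensA a c = Ae.tens a c" by (simp add: tensA_def)

lemma tensA_closed [simp]: "\<lbrakk>a \<in> carrier A; c \<in> carrier A\<rbrakk> \<Longrightarrow> tensA a c \<in> carrier Aev"
  by (simp add: tensA_eq)

lemma tensA_mult:
  "\<lbrakk>a \<in> carrier A; c \<in> carrier A; a' \<in> carrier A; c' \<in> carrier A\<rbrakk> \<Longrightarrow>
    tensA a c \<otimes>\<^bsub>Aev\<^esub> tensA a' c' = tensA (a \<otimes>\<^bsub>A\<^esub> a') (c \<otimes>\<^bsub>A\<^esub> c')"
  by (simp add: tensA_eq Ae.tens_tens)

lemma Aev_one: "\<one>\<^bsub>Aev\<^esub> = tensA \<one>\<^bsub>A\<^esub> \<one>\<^bsub>A\<^esub>" by (simp add: tensA_eq Ae.TR_one)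

text \<open>Scalars of \<open>K\<close> may sit on either side. This lets the coefficients
  \<open>\<alpha> b w\<close> be moved between the factors when the boundary of
  \<open>Phi_df\<close> is computed.\<close>

lemma tensA_scal: "k \<in> carrier K \<Longrightarrow> tensA (scalA k) \<one>\<^bsub>A\<^esub> = tensA \<one>\<^bsub>A\<^esub> (scalA k)"
  using Ae.tens_balanced[of "\<one>\<^bsub>A\<^esub>" k "\<one>\<^bsub>A\<^esub>"] by (simp add: tensA_eq)

lemma Aev_induct [consumes 1, case_names zero add tens]:
  assumes "r \<in> carrier Aev" and "Q \<zero>\<^bsub>Aev\<^esub>"
    and "\<And>x y. \<lbrakk>x \<in> carrier Aev; y \<in> carrier Aev; Q x; Q y\<rbrakk> \<Longrightarrow> Q (x \<oplus>\<^bsub>Aev\<^esub> y)"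
    and "\<And>a c. \<lbrakk>a \<in> carrier A; c \<in> carrier A\<rbrakk> \<Longrightarrow> Q (tensA a c)"
  shows "Q r"
  by (rule Ae.TR_induct[OF assms(1-3)]) (simp_all add: assms(4)[unfolded tensA_eq])

subsection \<open>The multiplication map\<close>

lemma multA_balanced: "Ae.balanced A (\<lambda>p. fst p \<otimes>\<^bsub>A\<^esub> snd p)"
  unfolding Ae.balanced_def by (simp add: A.l_distr A.r_distr A.m_assoc)

lemma multA_eq: "multA = add_lift A (\<lambda>p. fst p \<otimes>\<^bsub>A\<^esub> snd p)"
  by (simp only: multA_def add_lift_def)

lemma multA_tensA: "\<lbrakk>a \<in> carrier A; c \<in> carrier A\<rbrakk> \<Longrightarrow> multA (tensA a c) = a \<otimes>\<^bsub>A\<^esub> c"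
  unfolding multA_eq tensA_eq by (simp add: Ae.tensor_lift_tens[OF A.is_abelian_group multA_balanced])

lemma multA_additive: "multA \<in> hom (add_monoid Aev) (add_monoid A)"
  unfolding multA_eq by (rule Ae.tensor_lift_hom[OF A.is_abelian_group multA_balanced])

lemma multA_hom: "multA \<in> ring_hom Aev A"
proof (rule ring_hom_memI)
  note [simp] = additive_closed[OF multA_additive] additive_add[OF multA_additive]
    additive_zero[OF Aev.is_abelian_group A.is_abelian_group multA_additive]
  show "multA x \<in> carrier A" if "x \<in> carrier Aev" for x using that by simp
  show "multA (x \<oplus>\<^bsub>Aev\<^esub> y) = multA x \<oplus>\<^bsub>A\<^esub> multA y" if "x \<in> carrier Aev" "y \<in> carrier Aev" for x y
    using that by simp
  show "multA \<one>\<^bsub>Aev\<^esub> = \<one>\<^bsub>A\<^esub>" by (simp add: Aev_one multA_tensA)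
  show "multA (x \<otimes>\<^bsub>Aev\<^esub> y) = multA x \<otimes>\<^bsub>A\<^esub> multA y" if x: "x \<in> carrier Aev" and y: "y \<in> carrier Aev" for x y
  proof -
    have 1: "multA (tensA a c \<otimes>\<^bsub>Aev\<^esub> y) = multA (tensA a c) \<otimes>\<^bsub>A\<^esub> multA y"
      if "a \<in> carrier A" "c \<in> carrier A" for a c
      using y by (induction rule: Aev_induct)
        (use that in \<open>simp_all add: tensA_mult multA_tensA Aev.r_distr A.r_distr A.m_ac\<close>)
    show ?thesis using x
      by (induction rule: Aev_induct) (use y 1 in \<open>simp_all add: Aev.l_distr A.l_distr\<close>)
  qed
qed

subsection \<open>The algebra \<open>T\<close>\<close>

sublocale Ta: tate_alg Aev X B
  rewrites "tate_algebra Aev X B = T" and "tate_alg.tgr Aev X B = grT"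
proof -
  show "tate_alg Aev" by (rule tate_alg.intro[OF Aev_cring])
  then interpret tate_alg Aev X B .
  show "tate_algebra Aev X B = T" by (simp add: T_def)
  show "tgr = grT" by (rule ext) (simp add: tgr_def grT_def T_def)
qed

lemma scalT_eq: "scalT = basis_term Aev ({}, {#})" by (rule ext) (simp add: scalT_def)
lemma df_eq: "df b = df_pow b 1" by (simp add: df_def)

lemma scalT_hom: "scalT \<in> ring_hom Aev T" unfolding scalT_eq by (rule Ta.scal_hom)

lemma scalT_in: "r \<in> carrier Aev \<Longrightarrow> scalT r \<in> grT 0" unfolding scalT_eq by (rule Ta.scal_in)
lemma dx_in: "a \<in> X \<Longrightarrow> dx a \<in> grT 1" unfolding dx_def by (rule Ta.gen1_in)
lemma df_pow_in: "b \<in> B \<Longrightarrow> df_pow b n \<in> grT (2 * n)" unfolding df_pow_def by (rule Ta.gen2_in)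
lemma df_in: "b \<in> B \<Longrightarrow> df b \<in> grT 2" using df_pow_in[of b 1] by (simp add: df_eq)

lemma scalT_closed [simp]: "r \<in> carrier Aev \<Longrightarrow> scalT r \<in> carrier T" by (rule Ta.tgr_carrier[OF scalT_in])
lemma dx_closed [simp]: "a \<in> X \<Longrightarrow> dx a \<in> carrier T" by (rule Ta.tgr_carrier[OF dx_in])
lemma df_pow_closed [simp]: "b \<in> B \<Longrightarrow> df_pow b n \<in> carrier T" by (rule Ta.tgr_carrier[OF df_pow_in])
lemma df_closed [simp]: "b \<in> B \<Longrightarrow> df b \<in> carrier T" by (simp add: df_eq)

lemma T_central: "\<lbrakk>u \<in> grT 0; v \<in> carrier T\<rbrakk> \<Longrightarrow> u \<otimes>\<^bsub>T\<^esub> v = v \<otimes>\<^bsub>T\<^esub> u"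
proof -
  assume u: "u \<in> grT 0" and v: "v \<in> carrier T"
  show ?thesis using v Ta.BA_supp_M[OF v]
  proof (induction rule: Ta.BA_induct)
    case (basis m r)
    then show ?case using Ta.TA.gr_comm_even[OF u Ta.tgr_bt[of m r]] by auto
  qed (use Ta.tgr_carrier[OF u] in \<open>simp_all add: Ta.BA.l_distr Ta.BA.r_distr\<close>)
qed

lemma T_gr_induct [consumes 1, case_names zero add gr]:
  assumes u: "u \<in> carrier T" and "Q \<zero>\<^bsub>T\<^esub>"
    and "\<And>u v. \<lbrakk>u \<in> carrier T; v \<in> carrier T; Q u; Q v\<rbrakk> \<Longrightarrow> Q (u \<oplus>\<^bsub>T\<^esub> v)"
    and "\<And>n u. u \<in> grT n \<Longrightarrow> Q u"
  shows "Q u"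
  using u Ta.BA_supp_M[OF u]
  by (induction rule: Ta.BA_induct) (auto intro: assms Ta.tgr_bt)

lemma T_induct [consumes 1, case_names zero add one scal dx df]:
  assumes "u \<in> carrier T" and "Q \<zero>\<^bsub>T\<^esub>"
    and "\<And>u v. \<lbrakk>u \<in> carrier T; v \<in> carrier T; Q u; Q v\<rbrakk> \<Longrightarrow> Q (u \<oplus>\<^bsub>T\<^esub> v)"
    and "Q \<one>\<^bsub>T\<^esub>"
    and "\<And>r u. \<lbrakk>r \<in> carrier Aev; u \<in> carrier T; Q u\<rbrakk> \<Longrightarrow> Q (scalT r \<otimes>\<^bsub>T\<^esub> u)"
    and "\<And>a u. \<lbrakk>a \<in> X; u \<in> carrier T; Q u\<rbrakk> \<Longrightarrow> Q (dx a \<otimes>\<^bsub>T\<^esub> u)"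
    and "\<And>b n u. \<lbrakk>b \<in> B; u \<in> carrier T; Q u\<rbrakk> \<Longrightarrow> Q (df_pow b n \<otimes>\<^bsub>T\<^esub> u)"
  shows "Q u"
  by (rule Ta.TA_induct[OF assms(1-4)]) (simp_all add: assms(5-7)[unfolded scalT_eq dx_def df_pow_def])

lemma leftT_hom: "leftT \<in> ring_hom A T" and rightT_hom: "rightT \<in> ring_hom A T"
proof -
  have 1: "(\<lambda>a. tensA a \<one>\<^bsub>A\<^esub>) \<in> ring_hom A Aev"
    by (rule ring_hom_memI) (simp_all add: tensA_mult Aev_one, simp add: tensA_eq Ae.tens_add_left)
  have 2: "(\<lambda>a. tensA \<one>\<^bsub>A\<^esub> a) \<in> ring_hom A Aev"
    by (rule ring_hom_memI) (simp_all add: tensA_mult Aev_one, simp add: tensA_eq Ae.tens_add_right)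
  have l: "leftT = scalT \<circ> (\<lambda>a. tensA a \<one>\<^bsub>A\<^esub>)" and r: "rightT = scalT \<circ> (\<lambda>a. tensA \<one>\<^bsub>A\<^esub> a)"
    by (auto simp: leftT_def rightT_def)
  show "leftT \<in> ring_hom A T" unfolding l by (rule ring_hom_trans[OF 1 scalT_hom])
  show "rightT \<in> ring_hom A T" unfolding r by (rule ring_hom_trans[OF 2 scalT_hom])
qed

lemma leftT_in: "a \<in> carrier A \<Longrightarrow> leftT a \<in> grT 0" unfolding leftT_def by (rule scalT_in) simp
lemma rightT_in: "a \<in> carrier A \<Longrightarrow> rightT a \<in> grT 0" unfolding rightT_def by (rule scalT_in) simp
lemma leftT_closed [simp]: "a \<in> carrier A \<Longrightarrow> leftT a \<in> carrier T" by (rule Ta.tgr_carrier[OF leftT_in])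
lemma rightT_closed [simp]: "a \<in> carrier A \<Longrightarrow> rightT a \<in> carrier T" by (rule Ta.tgr_carrier[OF rightT_in])

lemma scalT_tensA: "\<lbrakk>a \<in> carrier A; c \<in> carrier A\<rbrakk> \<Longrightarrow> scalT (tensA a c) = leftT a \<otimes>\<^bsub>T\<^esub> rightT c"
  unfolding leftT_def rightT_def by (simp add: ring_hom_mult[OF scalT_hom, symmetric] tensA_mult)

lemma leftT_scalA: "k \<in> carrier K \<Longrightarrow> leftT (scalA k) = rightT (scalA k)"
  by (simp add: leftT_def rightT_def tensA_scal)

lemma scalT_coeff:
  assumes r: "r \<in> carrier Aev" and u: "u \<in> carrier T"
  shows "(scalT r \<otimes>\<^bsub>T\<^esub> u) m = r \<otimes>\<^bsub>Aev\<^esub> u m"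
  using u Ta.BA_supp_M[OF u]
  by (induction rule: Ta.BA_induct)
    (use r in \<open>auto simp: Ta.BA_zero_apply[of m] Ta.BA.r_distr Ta.BA_add_apply[of _ _ m] Aev.r_distr scalT_eq
        Ta.scal_mult(1) Ta.bt_apply[of _ _ m]\<close>)

subsection \<open>The augmentation\<close>

lemma augT_additive: "augT \<in> hom (add_monoid T) (add_monoid A)"
proof -
  have eq: "augT = (\<lambda>u. multA (u ({}, {#})))" by (auto simp: augT_def)
  show ?thesis unfolding eq by (rule additive_compose[OF Ta.BA_coeff_additive multA_additive])
qed

lemma augT_closed [simp]: "u \<in> carrier T \<Longrightarrow> augT u \<in> carrier A"
  by (rule additive_closed[OF augT_additive])

lemma augT_scal_mult:
  "\<lbrakk>r \<in> carrier Aev; u \<in> carrier T\<rbrakk> \<Longrightarrow> augT (scalT r \<otimes>\<^bsub>T\<^esub> u) = multA r \<otimes>\<^bsub>A\<^esub> augT u"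
  by (simp add: augT_def scalT_coeff ring_hom_mult[OF multA_hom])

lemma augT_one: "augT \<one>\<^bsub>T\<^esub> = \<one>\<^bsub>A\<^esub>"
  by (simp add: augT_def Ta.TA_one Ta.bt_apply ring_hom_one[OF multA_hom])

lemma augT_left: "a \<in> carrier A \<Longrightarrow> augT (leftT a) = a"
  and augT_right: "a \<in> carrier A \<Longrightarrow> augT (rightT a) = a"
  by (simp_all add: augT_def leftT_def rightT_def scalT_eq Ta.bt_apply multA_tensA)

lemma augT_pos: "\<lbrakk>u \<in> grT n; n > 0\<rbrakk> \<Longrightarrow> augT u = \<zero>\<^bsub>A\<^esub>"
proof -
  assume u: "u \<in> grT n" and n: "n > 0"
  have "u ({}, {#}) = \<zero>\<^bsub>Aev\<^esub>"
  proof (rule ccontr)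
    assume "u ({}, {#}) \<noteq> \<zero>\<^bsub>Aev\<^esub>"
    then have "tate_degree ({} :: 'x set, {#} :: 'b multiset) = n" using u unfolding grT_def coeff_support_def by blast
    then show False using n by (simp add: tate_degree_def)
  qed
  then show ?thesis
    using additive_zero[OF Aev.is_abelian_group A.is_abelian_group multA_additive] by (simp add: augT_def)
qed

text \<open>The elements of positive degree form an ideal killed by the augmentation, so only a
  scalar left factor remains to be treated.\<close>

lemma augT_mult:
  assumes u: "u \<in> carrier T" and v: "v \<in> carrier T"
  shows "augT (u \<otimes>\<^bsub>T\<^esub> v) = augT u \<otimes>\<^bsub>A\<^esub> augT v"
proof -
  note [simp] = additive_add[OF augT_additive]
    additive_zero[OF Ta.BA_abelian_group A.is_abelian_group augT_additive]
  have pos: "augT (u \<otimes>\<^bsub>T\<^esub> v) = \<zero>\<^bsub>A\<^esub>" if u: "u \<in> grT n" and n: "n > 0" for u n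
    using v
  proof (induction rule: T_gr_induct)
    case (gr j v)
    show ?case using augT_pos[OF Ta.TA.gr_mult[OF u gr]] n by simp
  qed (use Ta.tgr_carrier[OF u] in \<open>simp_all add: Ta.BA.r_distr\<close>)
  show ?thesis using u Ta.BA_supp_M[OF u]
  proof (induction rule: Ta.BA_induct)
    case (basis m r)
    show ?case
    proof (cases "m = ({}, {#})")
      case True
      have "augT (basis_term Aev m r) = multA r" by (simp add: augT_def True Ta.bt_apply)
      moreover have "basis_term Aev m r = scalT r" by (simp add: scalT_eq True)
      ultimately show ?thesis using augT_scal_mult[of r v] basis v by simp
    next
      case False
      then have "tate_degree m > 0" using basis(1) by (cases m) (auto simp: tate_degree_def card_gt_0_iff nonempty_has_size)
      moreover have "basis_term Aev m r \<in> grT (tate_degree m)" using basis by (intro Ta.tgr_bt) auto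
      ultimately show ?thesis using pos augT_pos v by simp
    qed
  qed (use v in \<open>simp_all add: Ta.BA.l_distr A.l_distr\<close>)
qed

subsection \<open>Signs\<close>

lemma parity_apply:
  "evenT u m = (if even (tate_degree m) then u m else \<zero>\<^bsub>Aev\<^esub>)"
  "oddT u m = (if odd (tate_degree m) then u m else \<zero>\<^bsub>Aev\<^esub>)"
  by (simp_all add: evenT_def oddT_def)

lemma parity_closed [simp]:
  assumes u: "u \<in> carrier T" shows "evenT u \<in> carrier T" "oddT u \<in> carrier T"
proof -
  have "coeff_support Aev (evenT u) \<subseteq> coeff_support Aev u" "coeff_support Aev (oddT u) \<subseteq> coeff_support Aev u"
    by (auto simp: coeff_support_def parity_apply)
  then show "evenT u \<in> carrier T" "oddT u \<in> carrier T"
    using u unfolding Ta.BA_carrier by (auto simp: parity_apply intro: finite_subset)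
qed

lemma evenT_additive: "evenT \<in> hom (add_monoid T) (add_monoid T)"
  and oddT_additive: "oddT \<in> hom (add_monoid T) (add_monoid T)"
  by (rule additiveI; simp add: fun_eq_iff parity_apply Ta.BA_add_apply)+

lemma evenT_gr: "u \<in> grT n \<Longrightarrow> evenT u = (if even n then u else \<zero>\<^bsub>T\<^esub>)"
  and oddT_gr: "u \<in> grT n \<Longrightarrow> oddT u = (if odd n then u else \<zero>\<^bsub>T\<^esub>)"
  by (auto simp: fun_eq_iff parity_apply grT_def coeff_support_def Ta.BA_zero_apply)

lemma signT_additive: "signT \<in> hom (add_monoid T) (add_monoid T)"
proof (rule additiveI)
  fix u v assume "u \<in> carrier T" "v \<in> carrier T"
  then show "signT (u \<oplus>\<^bsub>T\<^esub> v) = signT u \<oplus>\<^bsub>T\<^esub> signT v"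
    by (simp add: signT_def additive_add[OF evenT_additive] additive_add[OF oddT_additive]
        Ta.BA.minus_eq Ta.BA.minus_add Ta.BA.a_ac)
qed (simp add: signT_def)

lemma signT_closed [simp]: "u \<in> carrier T \<Longrightarrow> signT u \<in> carrier T"
  by (rule additive_closed[OF signT_additive])

lemma signT_gr: "u \<in> grT n \<Longrightarrow> signT u = (if even n then u else \<ominus>\<^bsub>T\<^esub> u)"
  using Ta.tgr_carrier[of u n] by (simp add: signT_def evenT_gr oddT_gr Ta.BA.minus_eq)

lemma T_zero_additive [simp]:
  "evenT \<zero>\<^bsub>T\<^esub> = \<zero>\<^bsub>T\<^esub>" "oddT \<zero>\<^bsub>T\<^esub> = \<zero>\<^bsub>T\<^esub>" "signT \<zero>\<^bsub>T\<^esub> = \<zero>\<^bsub>T\<^esub>"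
  using additive_zero[OF Ta.BA_abelian_group Ta.BA_abelian_group] evenT_additive oddT_additive signT_additive
  by blast+

lemma signT_signT: "u \<in> carrier T \<Longrightarrow> signT (signT u) = u"
proof (induction rule: T_gr_induct)
  case (gr n u)
  then have "signT u \<in> grT n" by (auto simp: signT_gr Ta.tgr_uminus)
  then show ?case using gr Ta.tgr_carrier[OF gr] by (auto simp: signT_gr)
qed (simp_all add: additive_add[OF signT_additive])

lemma signT_in: "u \<in> grT n \<Longrightarrow> signT u \<in> grT n" by (simp add: signT_gr Ta.tgr_uminus)

lemma signT_mult:
  assumes u: "u \<in> carrier T" and v: "v \<in> carrier T"
  shows "signT (u \<otimes>\<^bsub>T\<^esub> v) = signT u \<otimes>\<^bsub>T\<^esub> signT v"
proof -
  note [simp] = additive_add[OF signT_additive]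
  have 1: "signT (u \<otimes>\<^bsub>T\<^esub> v) = signT u \<otimes>\<^bsub>T\<^esub> signT v" if u: "u \<in> grT i" for u i
    using v
  proof (induction rule: T_gr_induct)
    case (gr j v)
    then show ?case using Ta.tgr_carrier[OF u] Ta.tgr_carrier[OF gr]
      by (simp add: signT_gr[OF u] signT_gr[OF gr] signT_gr[OF Ta.TA.gr_mult[OF u gr]] Ta.BA.l_minus Ta.BA.r_minus)
  qed (use Ta.tgr_carrier[OF u] in \<open>simp_all add: Ta.BA.r_distr\<close>)
  show ?thesis using u
    by (induction rule: T_gr_induct) (use v 1 in \<open>simp_all add: Ta.BA.l_distr\<close>)
qed

end

context tate_setup
begin

section \<open>The differential of \<open>T\<close> is a derivation\<close>

lemma word_prod_closed: "(\<And>a. a \<in> set w \<Longrightarrow> f a \<in> grT 0) \<Longrightarrow> word_prod T f w \<in> grT 0"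
  unfolding word_prod_def by (induction w) (auto intro: Ta.TA.gr_mult[of _ 0 _ 0, simplified])

lemma words_set: "\<lbrakk>b \<in> B; w \<in> words b\<rbrakk> \<Longrightarrow> set w \<subseteq> X"
  using words_lists by auto

text \<open>This is the boundary of \<open>dx a\<close>, as \<open>diffT_dx\<close> shows.\<close>

definition tv where "tv a = rightT (varA a) \<ominus>\<^bsub>T\<^esub> leftT (varA a)"

lemma tv_in: "a \<in> X \<Longrightarrow> tv a \<in> grT 0"
  unfolding tv_def by (intro Ta.TA.gr_minus leftT_in rightT_in) auto

lemma tv_closed [simp]: "a \<in> X \<Longrightarrow> tv a \<in> carrier T" by (rule Ta.tgr_carrier[OF tv_in])

lemma diff_df_in: assumes b: "b \<in> B" shows "diff_df b \<in> grT 1"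
  unfolding diff_df_def
proof (intro Ta.TA.gr_finsum)
  fix w \<kappa> assume w: "w \<in> words b" and \<kappa>: "\<kappa> \<in> {..<length w}"
  have X: "set w \<subseteq> X" using words_set[OF b w] .
  have 1: "leftT (scalA (\<alpha> b w)) \<in> grT 0" using \<alpha>_closed[OF b] by (intro leftT_in) simp
  have 2: "word_prod T (\<lambda>a. leftT (varA a)) (take \<kappa> w) \<in> grT 0"
    using X set_take_subset[of \<kappa> w] by (intro word_prod_closed leftT_in varA_closed) blast
  have 3: "word_prod T (\<lambda>a. rightT (varA a)) (drop (Suc \<kappa>) w) \<in> grT 0"
    using X set_drop_subset[of "Suc \<kappa>" w] by (intro word_prod_closed rightT_in varA_closed) blast
  have 4: "dx (w ! \<kappa>) \<in> grT 1" using X \<kappa> by (intro dx_in) auto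
  show "leftT (scalA (\<alpha> b w)) \<otimes>\<^bsub>T\<^esub> word_prod T (\<lambda>a. leftT (varA a)) (take \<kappa> w) \<otimes>\<^bsub>T\<^esub>
      dx (w ! \<kappa>) \<otimes>\<^bsub>T\<^esub> word_prod T (\<lambda>a. rightT (varA a)) (drop (Suc \<kappa>) w) \<in> grT 1"
    using Ta.TA.gr_mult[OF Ta.TA.gr_mult[OF Ta.TA.gr_mult[OF 1 2] 4] 3] by simp
qed

lemma diff_df_closed [simp]: "b \<in> B \<Longrightarrow> diff_df b \<in> carrier T" by (rule Ta.tgr_carrier[OF diff_df_in])

abbreviation bT where "bT S \<nu> \<equiv> basis_term Aev (S, \<nu>) \<one>\<^bsub>Aev\<^esub>"

lemma bT_closed [simp]: "\<lbrakk>finite S; S \<subseteq> X; set_mset \<nu> \<subseteq> B\<rbrakk> \<Longrightarrow> bT S \<nu> \<in> carrier T"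
  by (rule Ta.bt_closed) auto

lemma bT_in: "\<lbrakk>finite S; S \<subseteq> X; set_mset \<nu> \<subseteq> B\<rbrakk> \<Longrightarrow> bT S \<nu> \<in> grT (tate_degree (S, \<nu>))"
  by (rule Ta.tgr_bt) auto

lemma diff_basis_expand:
  "diff_basis (S, \<nu>) =
     (\<Oplus>\<^bsub>T\<^esub>a\<in>S. ((-1) ^ card {c \<in> S. index_less c a}) \<odot>\<^bsub>T\<^esub> (tv a \<otimes>\<^bsub>T\<^esub> bT (S - {a}) \<nu>))
     \<oplus>\<^bsub>T\<^esub>
     (\<Oplus>\<^bsub>T\<^esub>b\<in>set_mset \<nu>. ((-1) ^ card S) \<odot>\<^bsub>T\<^esub> (bT S {#} \<otimes>\<^bsub>T\<^esub> diff_df b \<otimes>\<^bsub>T\<^esub> bT {} (\<nu> - {#b#})))"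
  by (simp add: diff_basis_def tv_def)

lemma diff_sub: "set_mset (\<nu> - {#b#}) \<subseteq> set_mset \<nu>" by (meson diff_subset_eq_self set_mset_mono)

text \<open>Subtraction is truncated, so in degree zero the first claim only says that the boundary
  has degree zero; its vanishing is stated separately.\<close>

lemma diff_basis_gr:
  assumes m: "finite S" "S \<subseteq> X" "set_mset \<nu> \<subseteq> B"
  shows "diff_basis (S, \<nu>) \<in> grT (tate_degree (S, \<nu>) - 1)"
    and "tate_degree (S, \<nu>) = 0 \<Longrightarrow> diff_basis (S, \<nu>) = \<zero>\<^bsub>T\<^esub>"
proof -
  show "diff_basis (S, \<nu>) \<in> grT (tate_degree (S, \<nu>) - 1)"
    unfolding diff_basis_expand
  proof (intro Ta.TA.gr_add Ta.TA.gr_finsum Ta.TA.gr_int_mult)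
    fix a assume a: "a \<in> S"
    have "card S = Suc (card (S - {a}))" using card_Suc_Diff1[of S a] a m by simp
    then have d: "tate_degree (S - {a}, \<nu>) = tate_degree (S, \<nu>) - 1" by (simp add: tate_degree_def)
    have "bT (S - {a}) \<nu> \<in> grT (tate_degree (S - {a}, \<nu>))" using m by (intro bT_in) auto
    then show "tv a \<otimes>\<^bsub>T\<^esub> bT (S - {a}) \<nu> \<in> grT (tate_degree (S, \<nu>) - 1)"
      using Ta.TA.gr_mult[OF tv_in[of a]] a m d by fastforce
  next
    fix b assume b: "b \<in> set_mset \<nu>"
    have 1: "bT S {#} \<in> grT (card S)" using bT_in[of S "{#}"] m by (simp add: tate_degree_def)
    have 2: "bT {} (\<nu> - {#b#}) \<in> grT (2 * (size \<nu> - 1))"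
      using bT_in[of "{}" "\<nu> - {#b#}"] diff_sub[of \<nu> b] m b by (simp add: tate_degree_def size_Diff_singleton)
    have "size \<nu> > 0" using b by (auto simp: nonempty_has_size[symmetric])
    then have "card S + 1 + 2 * (size \<nu> - 1) = tate_degree (S, \<nu>) - 1" by (simp add: tate_degree_def)
    then show "bT S {#} \<otimes>\<^bsub>T\<^esub> diff_df b \<otimes>\<^bsub>T\<^esub> bT {} (\<nu> - {#b#}) \<in> grT (tate_degree (S, \<nu>) - 1)"
      using Ta.TA.gr_mult[OF Ta.TA.gr_mult[OF 1 diff_df_in] 2, of b] b m by auto
  qed
  show "diff_basis (S, \<nu>) = \<zero>\<^bsub>T\<^esub>" if "tate_degree (S, \<nu>) = 0"
    using that m by (auto simp: diff_basis_expand tate_degree_def)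
qed

lemma diff_basis_closed: "m \<in> tate_monomials X B \<Longrightarrow> diff_basis m \<in> carrier T"
  using diff_basis_gr(1) Ta.tgr_carrier by (cases m) auto

lemma diff_basis_closed' [simp]:
  "\<lbrakk>finite S; S \<subseteq> X; set_mset \<nu> \<subseteq> B\<rbrakk> \<Longrightarrow> diff_basis (S, \<nu>) \<in> carrier T"
  by (rule diff_basis_closed) auto

lemma diffT_eq: "diffT = Ta.linear_ext T scalT diff_basis"
  by (rule ext) (simp add: diffT_def Ta.linear_ext_def)

lemma diffT_additive: "diffT \<in> hom (add_monoid T) (add_monoid T)"
  unfolding diffT_eq
  by (rule Ta.linear_ext_additive[OF Ta.BA_ring ring_hom_additive[OF scalT_hom] diff_basis_closed])

lemma diffT_bt: "\<lbrakk>m \<in> tate_monomials X B; r \<in> carrier Aev\<rbrakk> \<Longrightarrow> diffT (basis_term Aev m r) = scalT r \<otimes>\<^bsub>T\<^esub> diff_basis m"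
  unfolding diffT_eq
  by (rule Ta.linear_ext_bt[OF Ta.BA_ring ring_hom_additive[OF scalT_hom] diff_basis_closed])

lemma diffT_bT: "\<lbrakk>finite S; S \<subseteq> X; set_mset \<nu> \<subseteq> B\<rbrakk> \<Longrightarrow> diffT (bT S \<nu>) = diff_basis (S, \<nu>)"
  by (simp add: diffT_bt ring_hom_one[OF scalT_hom])

lemma diffT_closed [simp]: "u \<in> carrier T \<Longrightarrow> diffT u \<in> carrier T"
  by (rule additive_closed[OF diffT_additive])

lemmas diffT_add = additive_add[OF diffT_additive]
lemmas diffT_zero [simp] = additive_zero[OF Ta.BA_abelian_group Ta.BA_abelian_group diffT_additive]
lemmas diffT_uminus = additive_uminus[OF Ta.BA_abelian_group Ta.BA_abelian_group diffT_additive]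
lemmas diffT_int_mult = additive_int_mult[OF Ta.BA_abelian_group Ta.BA_abelian_group diffT_additive]

lemma diffT_scal:
  assumes r: "r \<in> carrier Aev" and u: "u \<in> carrier T"
  shows "diffT (scalT r \<otimes>\<^bsub>T\<^esub> u) = scalT r \<otimes>\<^bsub>T\<^esub> diffT u"
  using u Ta.BA_supp_M[OF u]
proof (induction rule: Ta.BA_induct)
  case (basis m s)
  have "scalT r \<otimes>\<^bsub>T\<^esub> basis_term Aev m s = basis_term Aev m (r \<otimes>\<^bsub>Aev\<^esub> s)"
    unfolding scalT_eq using basis r by (intro Ta.scal_mult(1)) auto
  then show ?case
    using basis r diff_basis_closed[OF basis(1)]
    by (simp add: diffT_bt ring_hom_mult[OF scalT_hom] Ta.BA.m_assoc)
qed (use r in \<open>simp_all add: Ta.BA.r_distr diffT_add\<close>)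

lemma diffT_gr:
  assumes u: "u \<in> grT n" shows "diffT u \<in> grT (n - 1)" and "n = 0 \<Longrightarrow> diffT u = \<zero>\<^bsub>T\<^esub>"
proof -
  have "diffT u \<in> grT (n - 1) \<and> (n = 0 \<longrightarrow> diffT u = \<zero>\<^bsub>T\<^esub>)" using u
  proof (induction rule: Ta.tgr_induct)
    case (basis m r)
    obtain S \<nu> where m: "m = (S, \<nu>)" by (cases m)
    have c: "finite S" "S \<subseteq> X" "set_mset \<nu> \<subseteq> B" using basis by (auto simp: m)
    have "scalT r \<otimes>\<^bsub>T\<^esub> diff_basis m \<in> grT (n - 1)"
      using Ta.TA.gr_mult[OF scalT_in[OF basis(3)] diff_basis_gr(1)[OF c]] basis by (simp add: m)
    then show ?case using basis diff_basis_gr(2)[OF c] by (simp add: diffT_bt) (simp add: m)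
  qed (auto simp: diffT_add Ta.tgr_add)
  then show "diffT u \<in> grT (n - 1)" "n = 0 \<Longrightarrow> diffT u = \<zero>\<^bsub>T\<^esub>" by auto
qed

lemma bT_insert_min:
  assumes "a \<in> X" "finite S" "S \<subseteq> X" "set_mset \<nu> \<subseteq> B" "\<And>c. c \<in> S \<Longrightarrow> index_less a c"
  shows "bT (insert a S) \<nu> = dx a \<otimes>\<^bsub>T\<^esub> bT S \<nu>"
  unfolding dx_def using Ta.gen1_mult_min[of a S \<nu> "\<one>\<^bsub>Aev\<^esub>"] assms by simp

text \<open>For an index below all others the definition on the basis already is the Leibniz rule.
  Removing \<open>a\<close> itself gives the sign 1, and every other term acquires one more sign
  from the presence of \<open>a\<close>.\<close>

lemma diff_basis_insert_min:
  assumes a: "a \<in> X" and S: "finite S" "S \<subseteq> X" and \<nu>: "set_mset \<nu> \<subseteq> B"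
    and min: "\<And>c. c \<in> S \<Longrightarrow> index_less a c"
  shows "diff_basis (insert a S, \<nu>) = tv a \<otimes>\<^bsub>T\<^esub> bT S \<nu> \<ominus>\<^bsub>T\<^esub> dx a \<otimes>\<^bsub>T\<^esub> diff_basis (S, \<nu>)"
proof -
  have aS: "a \<notin> S" using min[of a] by auto
  have SX: "a' \<in> S \<Longrightarrow> a' \<in> X" for a' using S by auto
  have \<nu>B: "b \<in> set_mset \<nu> \<Longrightarrow> b \<in> B" "set_mset (\<nu> - {#b#}) \<subseteq> B" for b using \<nu> diff_sub[of \<nu> b] by auto
  let ?f = "\<lambda>S a'. ((-1) ^ card {c \<in> S. index_less c a'}) \<odot>\<^bsub>T\<^esub> (tv a' \<otimes>\<^bsub>T\<^esub> bT (S - {a'}) \<nu>)"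
  let ?g = "\<lambda>S b. ((-1) ^ card S) \<odot>\<^bsub>T\<^esub> (bT S {#} \<otimes>\<^bsub>T\<^esub> diff_df b \<otimes>\<^bsub>T\<^esub> bT {} (\<nu> - {#b#}))"
  have fcl: "?f S' a' \<in> carrier T" if "a' \<in> S'" "finite S'" "S' \<subseteq> X" for S' a'
    using that \<nu> by (auto intro!: Ta.BA.int_mult_closed Ta.BA.m_closed tv_closed bT_closed)
  have gcl: "?g S b \<in> carrier T" if "b \<in> set_mset \<nu>" for b
    using that S \<nu>B by (intro Ta.BA.int_mult_closed Ta.BA.m_closed bT_closed diff_df_closed) auto
  have f1: "?f (insert a S) a = tv a \<otimes>\<^bsub>T\<^esub> bT S \<nu>"
  proof -
    have "{c \<in> insert a S. index_less c a} = {}" using min index_less_asym[of a] by auto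
    then have k: "card {c \<in> insert a S. index_less c a} = 0" by (simp only: card.empty)
    show ?thesis unfolding k using aS a S \<nu> by simp
  qed
  \<comment> \<open>\<open>a\<close> is one additional index smaller than \<open>a'\<close>, which
    changes the sign of this summand.\<close>
  have f2: "?f (insert a S) a' = \<ominus>\<^bsub>T\<^esub> (dx a \<otimes>\<^bsub>T\<^esub> ?f S a')" if a': "a' \<in> S" for a'
  proof -
    have "{c \<in> insert a S. index_less c a'} = insert a {c \<in> S. index_less c a'}" using min[OF a'] by auto
    then have k: "card {c \<in> insert a S. index_less c a'} = Suc (card {c \<in> S. index_less c a'})" using aS S by simp
    have "insert a S - {a'} = insert a (S - {a'})" using aS a' by auto
    then have b: "bT (insert a S - {a'}) \<nu> = dx a \<otimes>\<^bsub>T\<^esub> bT (S - {a'}) \<nu>"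
      using bT_insert_min[of a "S - {a'}" \<nu>] a S \<nu> min by auto
    have c: "bT (S - {a'}) \<nu> \<in> carrier T" using S \<nu> by (intro bT_closed) auto
    have "tv a' \<otimes>\<^bsub>T\<^esub> (dx a \<otimes>\<^bsub>T\<^esub> bT (S - {a'}) \<nu>) = dx a \<otimes>\<^bsub>T\<^esub> (tv a' \<otimes>\<^bsub>T\<^esub> bT (S - {a'}) \<nu>)"
      using T_central[OF tv_in, of a' "dx a"] SX[OF a'] a c by (simp flip: Ta.BA.m_assoc)
    then show ?thesis unfolding k b using SX[OF a'] a c
      by (simp add: Ta.BA.int_mult_uminus Ta.BA.add_pow_rdistr_int)
  qed
  \<comment> \<open>Here the sign changes because the exterior part in front of
    \<open>diff_df b\<close> has one more factor.\<close>
  have g2: "?g (insert a S) b = \<ominus>\<^bsub>T\<^esub> (dx a \<otimes>\<^bsub>T\<^esub> ?g S b)" if b: "b \<in> set_mset \<nu>" for b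
    using bT_insert_min[of a S "{#}"] a S min aS \<nu>B[of b] b
    by (simp add: Ta.BA.int_mult_uminus Ta.BA.add_pow_rdistr_int Ta.BA.m_assoc)
  have s1: "(\<Oplus>\<^bsub>T\<^esub>a'\<in>S. ?f (insert a S) a') = \<ominus>\<^bsub>T\<^esub> (dx a \<otimes>\<^bsub>T\<^esub> (\<Oplus>\<^bsub>T\<^esub>a'\<in>S. ?f S a'))"
  proof -
    have "(\<Oplus>\<^bsub>T\<^esub>a'\<in>S. ?f (insert a S) a') = (\<Oplus>\<^bsub>T\<^esub>a'\<in>S. (-1) \<odot>\<^bsub>T\<^esub> (dx a \<otimes>\<^bsub>T\<^esub> ?f S a'))"
      using f2 fcl[OF _ S] a by (intro Ta.BA.finsum_cong') auto
    also have "\<dots> = (-1) \<odot>\<^bsub>T\<^esub> (\<Oplus>\<^bsub>T\<^esub>a'\<in>S. dx a \<otimes>\<^bsub>T\<^esub> ?f S a')"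
      using fcl[OF _ S] a by (intro Ta.BA.finsum_int_mult[symmetric]) auto
    also have "\<dots> = (-1) \<odot>\<^bsub>T\<^esub> (dx a \<otimes>\<^bsub>T\<^esub> (\<Oplus>\<^bsub>T\<^esub>a'\<in>S. ?f S a'))"
      using fcl[OF _ S] a S by (subst Ta.BA.finsum_rdistr) auto
    finally show ?thesis using fcl[OF _ S] a by (simp add: Ta.BA.finsum_closed Pi_def)
  qed
  have s2: "(\<Oplus>\<^bsub>T\<^esub>b\<in>set_mset \<nu>. ?g (insert a S) b) = \<ominus>\<^bsub>T\<^esub> (dx a \<otimes>\<^bsub>T\<^esub> (\<Oplus>\<^bsub>T\<^esub>b\<in>set_mset \<nu>. ?g S b))"
  proof -
    have "(\<Oplus>\<^bsub>T\<^esub>b\<in>set_mset \<nu>. ?g (insert a S) b) = (\<Oplus>\<^bsub>T\<^esub>b\<in>set_mset \<nu>. (-1) \<odot>\<^bsub>T\<^esub> (dx a \<otimes>\<^bsub>T\<^esub> ?g S b))"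
      using g2 gcl a by (intro Ta.BA.finsum_cong') auto
    also have "\<dots> = (-1) \<odot>\<^bsub>T\<^esub> (\<Oplus>\<^bsub>T\<^esub>b\<in>set_mset \<nu>. dx a \<otimes>\<^bsub>T\<^esub> ?g S b)"
      using gcl a by (intro Ta.BA.finsum_int_mult[symmetric]) auto
    also have "\<dots> = (-1) \<odot>\<^bsub>T\<^esub> (dx a \<otimes>\<^bsub>T\<^esub> (\<Oplus>\<^bsub>T\<^esub>b\<in>set_mset \<nu>. ?g S b))"
      using gcl a by (subst Ta.BA.finsum_rdistr) auto
    finally show ?thesis using gcl a by (simp add: Ta.BA.finsum_closed Pi_def)
  qed
  have s0: "(\<Oplus>\<^bsub>T\<^esub>a'\<in>insert a S. ?f (insert a S) a') = tv a \<otimes>\<^bsub>T\<^esub> bT S \<nu> \<oplus>\<^bsub>T\<^esub> (\<Oplus>\<^bsub>T\<^esub>a'\<in>S. ?f (insert a S) a')"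
  proof -
    have F: "?f (insert a S) a' \<in> carrier T" if "a' \<in> insert a S" for a'
      by (rule fcl[OF that]) (use S a in auto)
    show ?thesis
      unfolding f1[symmetric] by (rule Ta.BA.finsum_insert[OF S(1) aS]) (use F in blast)+
  qed
  have cl: "(\<Oplus>\<^bsub>T\<^esub>a'\<in>S. ?f S a') \<in> carrier T" "(\<Oplus>\<^bsub>T\<^esub>b\<in>set_mset \<nu>. ?g S b) \<in> carrier T"
    using fcl[OF _ S] gcl by (auto intro!: Ta.BA.finsum_closed)
  show ?thesis
    unfolding diff_basis_expand s0 s1 s2 using cl a S \<nu>
    by (simp add: Ta.BA.r_distr Ta.BA.minus_eq Ta.BA.minus_add Ta.BA.a_assoc)
qed

lemma bT_replicate:
  "\<lbrakk>b \<in> B; set_mset \<nu> \<subseteq> B; b \<notin># \<nu>\<rbrakk> \<Longrightarrow> bT {} (replicate_mset n b + \<nu>) = df_pow b n \<otimes>\<^bsub>T\<^esub> bT {} \<nu>"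
  unfolding df_pow_def using Ta.gen2_mult_disjoint[of b "{}" \<nu> "\<one>\<^bsub>Aev\<^esub>" n] by simp

lemma df_pow_commute: "\<lbrakk>b \<in> B; u \<in> carrier T\<rbrakk> \<Longrightarrow> df_pow b n \<otimes>\<^bsub>T\<^esub> u = u \<otimes>\<^bsub>T\<^esub> df_pow b n"
proof -
  assume b: "b \<in> B" and u: "u \<in> carrier T"
  show ?thesis using u
  proof (induction rule: T_gr_induct)
    case (gr j u)
    then show ?case using Ta.TA.gr_comm_even[OF df_pow_in[OF b] gr] by simp
  qed (use b in \<open>simp_all add: Ta.BA.l_distr Ta.BA.r_distr\<close>)
qed

lemma diff_basis_empty: "set_mset \<nu> \<subseteq> B \<Longrightarrow>
    diff_basis ({}, \<nu>) = (\<Oplus>\<^bsub>T\<^esub>b\<in>set_mset \<nu>. diff_df b \<otimes>\<^bsub>T\<^esub> bT {} (\<nu> - {#b#}))"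
proof -
  assume \<nu>: "set_mset \<nu> \<subseteq> B"
  have \<nu>B: "b \<in> set_mset \<nu> \<Longrightarrow> b \<in> B" "set_mset (\<nu> - {#b#}) \<subseteq> B" for b using \<nu> diff_sub[of \<nu> b] by auto
  have "(\<Oplus>\<^bsub>T\<^esub>b\<in>set_mset \<nu>. ((-1) ^ card {}) \<odot>\<^bsub>T\<^esub> (bT {} {#} \<otimes>\<^bsub>T\<^esub> diff_df b \<otimes>\<^bsub>T\<^esub> bT {} (\<nu> - {#b#})))
    = (\<Oplus>\<^bsub>T\<^esub>b\<in>set_mset \<nu>. diff_df b \<otimes>\<^bsub>T\<^esub> bT {} (\<nu> - {#b#}))"
    using \<nu>B by (intro Ta.BA.finsum_cong') (auto simp: Ta.TA_one[symmetric])
  moreover have "(\<Oplus>\<^bsub>T\<^esub>b\<in>set_mset \<nu>. diff_df b \<otimes>\<^bsub>T\<^esub> bT {} (\<nu> - {#b#})) \<in> carrier T"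
    using \<nu>B by (intro Ta.BA.finsum_closed) auto
  ultimately show ?thesis unfolding diff_basis_expand by simp
qed

text \<open>If \<open>b\<close> does not occur in \<nu>, removing one copy of \<open>b\<close>
  lowers the exponent of \<open>df_pow\<close>, and removing another element leaves that power
  alone. This is the Leibniz rule for a divided power times a monomial free of
  \<open>b\<close>.\<close>

lemma diff_basis_replicate:
  assumes b: "b \<in> B" and \<nu>: "set_mset \<nu> \<subseteq> B" and nb: "b \<notin># \<nu>"
  shows "diff_basis ({}, replicate_mset (Suc n) b + \<nu>)
    = df_pow b n \<otimes>\<^bsub>T\<^esub> diff_df b \<otimes>\<^bsub>T\<^esub> bT {} \<nu> \<oplus>\<^bsub>T\<^esub> df_pow b (Suc n) \<otimes>\<^bsub>T\<^esub> diff_basis ({}, \<nu>)"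
proof -
  let ?\<mu> = "replicate_mset (Suc n) b + \<nu>"
  have \<nu>B: "c \<in> set_mset \<nu> \<Longrightarrow> c \<in> B" "set_mset (\<nu> - {#c#}) \<subseteq> B" for c using \<nu> diff_sub[of \<nu> c] by auto
  have cl: "diff_df c \<otimes>\<^bsub>T\<^esub> bT {} (\<nu> - {#c#}) \<in> carrier T" if "c \<in># \<nu>" for c using \<nu>B that by auto
  have 1: "diff_df b \<otimes>\<^bsub>T\<^esub> bT {} (?\<mu> - {#b#}) = df_pow b n \<otimes>\<^bsub>T\<^esub> diff_df b \<otimes>\<^bsub>T\<^esub> bT {} \<nu>"
  proof -
    have "?\<mu> - {#b#} = replicate_mset n b + \<nu>" by simp
    then have "diff_df b \<otimes>\<^bsub>T\<^esub> bT {} (?\<mu> - {#b#}) = diff_df b \<otimes>\<^bsub>T\<^esub> df_pow b n \<otimes>\<^bsub>T\<^esub> bT {} \<nu>"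
      using b \<nu> nb by (simp add: bT_replicate Ta.BA.m_assoc)
    then show ?thesis using df_pow_commute[OF b, of "diff_df b" n] b by simp
  qed
  have 2: "diff_df c \<otimes>\<^bsub>T\<^esub> bT {} (?\<mu> - {#c#}) = df_pow b (Suc n) \<otimes>\<^bsub>T\<^esub> (diff_df c \<otimes>\<^bsub>T\<^esub> bT {} (\<nu> - {#c#}))"
    if c: "c \<in># \<nu>" for c
  proof -
    have e: "?\<mu> - {#c#} = replicate_mset (Suc n) b + (\<nu> - {#c#})"
      using c nb by (auto intro!: multiset_eqI simp: not_in_iff)
    have nb': "b \<notin># \<nu> - {#c#}" using nb diff_sub[of \<nu> c] by auto
    show ?thesis
      unfolding e bT_replicate[OF b \<nu>B(2) nb']
      using df_pow_commute[OF b, of "diff_df c" "Suc n"] b \<nu>B[of c] c by (simp flip: Ta.BA.m_assoc)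
  qed
  have "diff_basis ({}, ?\<mu>) = (\<Oplus>\<^bsub>T\<^esub>c\<in>insert b (set_mset \<nu>). diff_df c \<otimes>\<^bsub>T\<^esub> bT {} (?\<mu> - {#c#}))"
    using diff_basis_empty[of ?\<mu>] b \<nu> by (auto simp: set_mset_replicate_mset_subset)
  also have "\<dots> = diff_df b \<otimes>\<^bsub>T\<^esub> bT {} (?\<mu> - {#b#}) \<oplus>\<^bsub>T\<^esub> (\<Oplus>\<^bsub>T\<^esub>c\<in>set_mset \<nu>. diff_df c \<otimes>\<^bsub>T\<^esub> bT {} (?\<mu> - {#c#}))"
    using nb b \<nu> 1 2 cl by (intro Ta.BA.finsum_insert) auto
  also have "(\<Oplus>\<^bsub>T\<^esub>c\<in>set_mset \<nu>. diff_df c \<otimes>\<^bsub>T\<^esub> bT {} (?\<mu> - {#c#}))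
      = (\<Oplus>\<^bsub>T\<^esub>c\<in>set_mset \<nu>. df_pow b (Suc n) \<otimes>\<^bsub>T\<^esub> (diff_df c \<otimes>\<^bsub>T\<^esub> bT {} (\<nu> - {#c#})))"
    using 2 cl b by (intro Ta.BA.finsum_cong') auto
  also have "\<dots> = df_pow b (Suc n) \<otimes>\<^bsub>T\<^esub> diff_basis ({}, \<nu>)"
    unfolding diff_basis_empty[OF \<nu>] using cl b by (intro Ta.BA.finsum_rdistr[symmetric]) auto
  finally show ?thesis unfolding 1 .
qed

lemma dx_dx: "\<lbrakk>a \<in> X; c \<in> X\<rbrakk> \<Longrightarrow> dx a \<otimes>\<^bsub>T\<^esub> dx c = \<ominus>\<^bsub>T\<^esub> (dx c \<otimes>\<^bsub>T\<^esub> dx a)"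
  using Ta.TA.gr_comm_odd[OF dx_in dx_in, of a c] by simp

lemma dx_sq: "a \<in> X \<Longrightarrow> dx a \<otimes>\<^bsub>T\<^esub> dx a = \<zero>\<^bsub>T\<^esub>"
  using Ta.TA.gr_sq[OF dx_in, of a] by simp

text \<open>The value of the integer is irrelevant later, because \<open>diffT\<close> commutes with
  integer multiples.\<close>

lemma dx_bT:
  assumes "a \<in> X" "finite S" "S \<subseteq> X" "set_mset \<nu> \<subseteq> B"
  shows "\<exists>k. dx a \<otimes>\<^bsub>T\<^esub> bT S \<nu> = (k::int) \<odot>\<^bsub>T\<^esub> bT (insert a S) \<nu>"
proof (cases "a \<in> S")
  case True
  then show ?thesis unfolding dx_def using Ta.gen1_mult[of a S \<nu> "\<one>\<^bsub>Aev\<^esub>"] assms by (intro exI[of _ 0]) simp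
next
  case False
  then show ?thesis unfolding dx_def using Ta.gen1_mult[of a S \<nu> "\<one>\<^bsub>Aev\<^esub>"] assms by auto
qed

text \<open>\<open>diff_basis_insert_min\<close> settles the case in which \<open>a\<close> precedes
  all indices of the monomial. Otherwise let \<open>m\<close> be the smallest index. If
  \<open>a\<close> is different from \<open>m\<close>, then \<open>dx m\<close> is moved to the
  front; what follows is \<open>dx a\<close> times a monomial, an integer multiple of a monomial
  whose indices all exceed \<open>m\<close>, so the rule for a smallest index applies to
  \<open>m\<close>.\<close>

lemma diffT_dx_mult:
  assumes a: "a \<in> X" and u: "u \<in> carrier T"
  shows "diffT (dx a \<otimes>\<^bsub>T\<^esub> u) = tv a \<otimes>\<^bsub>T\<^esub> u \<ominus>\<^bsub>T\<^esub> dx a \<otimes>\<^bsub>T\<^esub> diffT u"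
proof -
  have bas: "\<forall>a\<in>X. diffT (dx a \<otimes>\<^bsub>T\<^esub> bT S \<nu>) = tv a \<otimes>\<^bsub>T\<^esub> bT S \<nu> \<ominus>\<^bsub>T\<^esub> dx a \<otimes>\<^bsub>T\<^esub> diffT (bT S \<nu>)"
    if S: "finite S" "S \<subseteq> X" and \<nu>: "set_mset \<nu> \<subseteq> B" for S \<nu>
    using S
  proof (induction S rule: finite_index_induct)
    case empty
    have "diffT (dx a \<otimes>\<^bsub>T\<^esub> bT {} \<nu>) = tv a \<otimes>\<^bsub>T\<^esub> bT {} \<nu> \<ominus>\<^bsub>T\<^esub> dx a \<otimes>\<^bsub>T\<^esub> diffT (bT {} \<nu>)" if "a \<in> X" for a
      using bT_insert_min[of a "{}" \<nu>] diff_basis_insert_min[of a "{}" \<nu>] \<nu> diffT_bT[of "{}" \<nu>]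
        diffT_bT[of "{a}" \<nu>] that by simp
    then show ?case by blast
  next
    case (insert m S)
    have mS: "m \<in> X" "S \<subseteq> X" using insert by auto
    let ?w = "bT S \<nu>"
    have w: "?w \<in> carrier T" using insert mS \<nu> by simp
    have bm: "bT (insert m S) \<nu> = dx m \<otimes>\<^bsub>T\<^esub> ?w" using insert mS \<nu> by (intro bT_insert_min) auto
    have dm: "diffT (bT (insert m S) \<nu>) = tv m \<otimes>\<^bsub>T\<^esub> ?w \<ominus>\<^bsub>T\<^esub> dx m \<otimes>\<^bsub>T\<^esub> diffT ?w"
      using insert mS \<nu> diff_basis_insert_min[of m S \<nu>] by (simp add: diffT_bT)
    note IH = insert.IH[OF mS(2)]
    have tvc: "dx c \<otimes>\<^bsub>T\<^esub> (tv d \<otimes>\<^bsub>T\<^esub> z) = tv d \<otimes>\<^bsub>T\<^esub> (dx c \<otimes>\<^bsub>T\<^esub> z)" if "c \<in> X" "d \<in> X" "z \<in> carrier T" for c d z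
      using T_central[OF tv_in, of d "dx c"] that by (simp flip: Ta.BA.m_assoc)
    show ?case
    proof
      fix a assume a: "a \<in> X"
      consider "a = m" | "index_less a m" | "a \<noteq> m" "index_less m a" using index_less_total[of a m] by auto
      then show "diffT (dx a \<otimes>\<^bsub>T\<^esub> bT (insert m S) \<nu>) = tv a \<otimes>\<^bsub>T\<^esub> bT (insert m S) \<nu> \<ominus>\<^bsub>T\<^esub> dx a \<otimes>\<^bsub>T\<^esub> diffT (bT (insert m S) \<nu>)"
      proof cases
        case 1
        have z: "dx m \<otimes>\<^bsub>T\<^esub> (dx m \<otimes>\<^bsub>T\<^esub> z) = \<zero>\<^bsub>T\<^esub>" if "z \<in> carrier T" for z
          using dx_sq[OF mS(1)] mS that by (simp flip: Ta.BA.m_assoc)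
        show ?thesis unfolding 1 dm unfolding bm using w mS
          by (simp add: z Ta.BA.minus_eq Ta.BA.r_distr Ta.BA.r_minus tvc Ta.BA.r_neg)
      next
        case 2
        have l: "index_less a c" if "c \<in> insert m S" for c
          using that 2 insert.hyps(3)[of c] index_less_trans[of a m c] by auto
        have "dx a \<otimes>\<^bsub>T\<^esub> bT (insert m S) \<nu> = bT (insert a (insert m S)) \<nu>"
          using a mS insert.hyps(1) \<nu> l by (intro bT_insert_min[symmetric]) auto
        then show ?thesis
          using diff_basis_insert_min[of a "insert m S" \<nu>] a mS insert.hyps(1) \<nu> l diffT_bT by simp
      next
        case 3
        let ?z = "dx a \<otimes>\<^bsub>T\<^esub> ?w"
        obtain k :: int where k: "?z = k \<odot>\<^bsub>T\<^esub> bT (insert a S) \<nu>"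
          using dx_bT[of a S \<nu>] a mS insert.hyps(1) \<nu> by blast
        let ?y = "bT (insert a S) \<nu>"
        have y: "?y \<in> carrier T" using a mS insert.hyps(1) \<nu> by simp
        have l: "index_less m c" if "c \<in> insert a S" for c using that 3 insert.hyps(3)[of c] by auto
        have y1: "bT (insert m (insert a S)) \<nu> = dx m \<otimes>\<^bsub>T\<^esub> ?y"
          using a mS insert.hyps(1) \<nu> l by (intro bT_insert_min) auto
        have "diffT (bT (insert m (insert a S)) \<nu>) = tv m \<otimes>\<^bsub>T\<^esub> ?y \<ominus>\<^bsub>T\<^esub> dx m \<otimes>\<^bsub>T\<^esub> diffT ?y"
          using diff_basis_insert_min[of m "insert a S" \<nu>] a mS insert.hyps(1) \<nu> l
          by (simp add: diffT_bT)
        then have "diffT (dx m \<otimes>\<^bsub>T\<^esub> ?y) = tv m \<otimes>\<^bsub>T\<^esub> ?y \<ominus>\<^bsub>T\<^esub> dx m \<otimes>\<^bsub>T\<^esub> diffT ?y"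
          unfolding y1 .
        then have "diffT (dx m \<otimes>\<^bsub>T\<^esub> ?z) = tv m \<otimes>\<^bsub>T\<^esub> ?z \<ominus>\<^bsub>T\<^esub> dx m \<otimes>\<^bsub>T\<^esub> diffT ?z"
          unfolding k using y mS
          by (simp add: diffT_int_mult Ta.BA.add_pow_rdistr_int Ta.BA.minus_eq Ta.BA.int_mult_add_right Ta.BA.int_mult_minus)
        also have "diffT ?z = tv a \<otimes>\<^bsub>T\<^esub> ?w \<ominus>\<^bsub>T\<^esub> dx a \<otimes>\<^bsub>T\<^esub> diffT ?w" using IH a by blast
        finally have e: "diffT (dx m \<otimes>\<^bsub>T\<^esub> ?z) = tv m \<otimes>\<^bsub>T\<^esub> ?z \<ominus>\<^bsub>T\<^esub> dx m \<otimes>\<^bsub>T\<^esub> (tv a \<otimes>\<^bsub>T\<^esub> ?w \<ominus>\<^bsub>T\<^esub> dx a \<otimes>\<^bsub>T\<^esub> diffT ?w)" .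
        have am: "dx a \<otimes>\<^bsub>T\<^esub> (dx m \<otimes>\<^bsub>T\<^esub> z) = \<ominus>\<^bsub>T\<^esub> (dx m \<otimes>\<^bsub>T\<^esub> (dx a \<otimes>\<^bsub>T\<^esub> z))" if "z \<in> carrier T" for z
          using dx_dx[OF a mS(1)] a mS that by (simp add: Ta.BA.l_minus flip: Ta.BA.m_assoc)
        show ?thesis unfolding dm unfolding bm using w mS a
          by (simp add: am diffT_uminus e tvc Ta.BA.minus_eq Ta.BA.r_distr Ta.BA.r_minus Ta.BA.minus_add Ta.BA.a_ac)
      qed
    qed
  qed
  show ?thesis using u Ta.BA_supp_M[OF u]
  proof (induction rule: Ta.BA_induct)
    case zero
    then show ?case using a by (simp add: Ta.BA.minus_eq)
  next
    case (add p q)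
    then show ?case using a
      by (simp add: Ta.BA.r_distr diffT_add Ta.BA.minus_eq Ta.BA.minus_add Ta.BA.a_ac)
  next
    case (basis m r)
    obtain S \<nu> where m: "m = (S, \<nu>)" by (cases m)
    have c: "finite S" "S \<subseteq> X" "set_mset \<nu> \<subseteq> B" using basis by (auto simp: m)
    have e: "basis_term Aev m r = scalT r \<otimes>\<^bsub>T\<^esub> bT S \<nu>"
      unfolding scalT_eq m using basis(3) c Ta.scal_mult(1)[of r "\<one>\<^bsub>Aev\<^esub>" "(S, \<nu>)"] by simp
    have sc: "z \<otimes>\<^bsub>T\<^esub> (scalT r \<otimes>\<^bsub>T\<^esub> z') = scalT r \<otimes>\<^bsub>T\<^esub> (z \<otimes>\<^bsub>T\<^esub> z')" if "z \<in> carrier T" "z' \<in> carrier T" for z z'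
      using T_central[OF scalT_in[OF basis(3)] that(1)] that basis(3) by (simp flip: Ta.BA.m_assoc)
    have "diffT (dx a \<otimes>\<^bsub>T\<^esub> bT S \<nu>) = tv a \<otimes>\<^bsub>T\<^esub> bT S \<nu> \<ominus>\<^bsub>T\<^esub> dx a \<otimes>\<^bsub>T\<^esub> diffT (bT S \<nu>)"
      using bas[OF c] a by blast
    then show ?case unfolding e using a c basis(3)
      by (simp add: sc diffT_scal Ta.BA.minus_eq Ta.BA.r_distr Ta.BA.r_minus)
  qed
qed

lemma df_pow_0 [simp]: "df_pow b 0 = \<one>\<^bsub>T\<^esub>" by (simp add: df_pow_def Ta.TA_one)

lemma df_pow_mult: "b \<in> B \<Longrightarrow> df_pow b m \<otimes>\<^bsub>T\<^esub> df_pow b n = int ((m + n) choose m) \<odot>\<^bsub>T\<^esub> df_pow b (m + n)"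
  unfolding df_pow_def by (rule Ta.gen2_gen2)

text \<open>For a monomial without exterior part that contains \<open>b\<close> exactly k times,
  both sides are combinations of \<open>P1\<close> and \<open>P2\<close>, and the coefficients of
  \<open>P1\<close> agree by Pascal's rule. Factors \<open>dx m\<close> are then put in front one by
  one; the sign from the Leibniz rule for \<open>dx m\<close> matches the sign of moving
  \<open>dx m\<close> past the odd element \<open>diff_df b\<close>.\<close>

lemma diffT_df_mult:
  assumes b: "b \<in> B" and u: "u \<in> carrier T"
  shows "diffT (df_pow b (Suc n) \<otimes>\<^bsub>T\<^esub> u) = df_pow b n \<otimes>\<^bsub>T\<^esub> diff_df b \<otimes>\<^bsub>T\<^esub> u \<oplus>\<^bsub>T\<^esub> df_pow b (Suc n) \<otimes>\<^bsub>T\<^esub> diffT u"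
proof -
  note [simp] = b
  have dfc: "z \<otimes>\<^bsub>T\<^esub> (df_pow b j \<otimes>\<^bsub>T\<^esub> z') = df_pow b j \<otimes>\<^bsub>T\<^esub> (z \<otimes>\<^bsub>T\<^esub> z')" if "z \<in> carrier T" "z' \<in> carrier T" for z z' j
    using df_pow_commute[OF b that(1)] that by (simp flip: Ta.BA.m_assoc)
  have 0: "diffT (df_pow b (Suc n) \<otimes>\<^bsub>T\<^esub> bT {} \<nu>) = df_pow b n \<otimes>\<^bsub>T\<^esub> diff_df b \<otimes>\<^bsub>T\<^esub> bT {} \<nu> \<oplus>\<^bsub>T\<^esub> df_pow b (Suc n) \<otimes>\<^bsub>T\<^esub> diffT (bT {} \<nu>)"
    if \<nu>: "set_mset \<nu> \<subseteq> B" for \<nu>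
  proof -
    let ?k = "count \<nu> b" let ?\<nu>0 = "filter_mset (\<lambda>c. c \<noteq> b) \<nu>" let ?w = "bT {} ?\<nu>0"
    have \<nu>0: "\<nu> = replicate_mset ?k b + ?\<nu>0" by (rule multiset_eqI) auto
    have c: "set_mset ?\<nu>0 \<subseteq> B" "b \<notin># ?\<nu>0" using \<nu> by auto
    have w: "?w \<in> carrier T" "diffT ?w \<in> carrier T" using c by simp_all
    have D: "diffT (df_pow b (Suc j) \<otimes>\<^bsub>T\<^esub> ?w) = df_pow b j \<otimes>\<^bsub>T\<^esub> diff_df b \<otimes>\<^bsub>T\<^esub> ?w \<oplus>\<^bsub>T\<^esub> df_pow b (Suc j) \<otimes>\<^bsub>T\<^esub> diffT ?w" for j
      using diff_basis_replicate[OF b c, of j] bT_replicate[OF b c, of "Suc j"] c diffT_bT[of "{}" "replicate_mset (Suc j) b + ?\<nu>0"]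
        diffT_bT[of "{}" ?\<nu>0] by (simp add: subset_iff)
    have "bT {} \<nu> = df_pow b ?k \<otimes>\<^bsub>T\<^esub> ?w" using bT_replicate[OF b c, of ?k] \<nu>0 by simp
    moreover define k where "k = ?k"
    ultimately have b\<nu>: "bT {} \<nu> = df_pow b k \<otimes>\<^bsub>T\<^esub> ?w" by simp
    define P1 where "P1 = df_pow b (n + k) \<otimes>\<^bsub>T\<^esub> (diff_df b \<otimes>\<^bsub>T\<^esub> ?w)"
    define P2 where "P2 = df_pow b (Suc n + k) \<otimes>\<^bsub>T\<^esub> diffT ?w"
    have Pc: "P1 \<in> carrier T" "P2 \<in> carrier T" using w by (auto simp: P1_def P2_def)
    have m: "df_pow b i \<otimes>\<^bsub>T\<^esub> (df_pow b j \<otimes>\<^bsub>T\<^esub> z) = int ((i + j) choose i) \<odot>\<^bsub>T\<^esub> (df_pow b (i + j) \<otimes>\<^bsub>T\<^esub> z)"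
      if "z \<in> carrier T" for i j z
      using df_pow_mult[OF b, of i j] that by (simp add: Ta.BA.add_pow_ldistr_int flip: Ta.BA.m_assoc)
    have L: "diffT (df_pow b (Suc n) \<otimes>\<^bsub>T\<^esub> bT {} \<nu>) = int ((Suc n + k) choose Suc n) \<odot>\<^bsub>T\<^esub> (P1 \<oplus>\<^bsub>T\<^esub> P2)"
      unfolding b\<nu> m[OF w(1)] using w D[of "n + k"]
      by (simp add: diffT_int_mult P1_def P2_def Ta.BA.m_assoc)
    have R1: "df_pow b n \<otimes>\<^bsub>T\<^esub> diff_df b \<otimes>\<^bsub>T\<^esub> bT {} \<nu> = int ((n + k) choose n) \<odot>\<^bsub>T\<^esub> P1"
      unfolding b\<nu> using w by (simp add: Ta.BA.m_assoc dfc[of "diff_df b"] m P1_def)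
    have R2: "df_pow b (Suc n) \<otimes>\<^bsub>T\<^esub> diffT (bT {} \<nu>)
      = int ((n + k) choose Suc n) \<odot>\<^bsub>T\<^esub> P1 \<oplus>\<^bsub>T\<^esub> int ((Suc n + k) choose Suc n) \<odot>\<^bsub>T\<^esub> P2"
    proof (cases k)
      \<comment> \<open>No copy of \<open>b\<close> is left to be differentiated, in accordance with
        the binomial coefficient \<open>n choose Suc n\<close> being zero.\<close>
      case 0
      then show ?thesis unfolding b\<nu> using w Pc by (simp add: P2_def binomial_eq_0)
    next
      case (Suc j)
      have "df_pow b (Suc n) \<otimes>\<^bsub>T\<^esub> diffT (bT {} \<nu>)
        = df_pow b (Suc n) \<otimes>\<^bsub>T\<^esub> (df_pow b j \<otimes>\<^bsub>T\<^esub> (diff_df b \<otimes>\<^bsub>T\<^esub> ?w)) \<oplus>\<^bsub>T\<^esub> df_pow b (Suc n) \<otimes>\<^bsub>T\<^esub> (df_pow b (Suc j) \<otimes>\<^bsub>T\<^esub> diffT ?w)"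
        unfolding b\<nu> Suc D using w by (simp add: Ta.BA.m_assoc Ta.BA.r_distr)
      also have "df_pow b (Suc n) \<otimes>\<^bsub>T\<^esub> (df_pow b j \<otimes>\<^bsub>T\<^esub> (diff_df b \<otimes>\<^bsub>T\<^esub> ?w)) = int ((Suc n + j) choose Suc n) \<odot>\<^bsub>T\<^esub> (df_pow b (Suc n + j) \<otimes>\<^bsub>T\<^esub> (diff_df b \<otimes>\<^bsub>T\<^esub> ?w))"
        using w by (intro m) auto
      also have "df_pow b (Suc n) \<otimes>\<^bsub>T\<^esub> (df_pow b (Suc j) \<otimes>\<^bsub>T\<^esub> diffT ?w) = int ((Suc n + Suc j) choose Suc n) \<odot>\<^bsub>T\<^esub> (df_pow b (Suc n + Suc j) \<otimes>\<^bsub>T\<^esub> diffT ?w)"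
        using w by (intro m) auto
      finally show ?thesis by (simp add: P1_def P2_def Suc del: binomial_Suc_Suc)
    qed
    have "int ((Suc n + k) choose Suc n) = int ((n + k) choose n) + int ((n + k) choose Suc n)" by simp
    then show ?thesis unfolding L R1 R2
      using Pc by (simp only: Ta.BA.int_mult_add_right Ta.BA.int_mult_add_left) (simp add: Ta.BA.a_ac)
  qed
  have bas: "diffT (df_pow b (Suc n) \<otimes>\<^bsub>T\<^esub> bT S \<nu>) = df_pow b n \<otimes>\<^bsub>T\<^esub> diff_df b \<otimes>\<^bsub>T\<^esub> bT S \<nu> \<oplus>\<^bsub>T\<^esub> df_pow b (Suc n) \<otimes>\<^bsub>T\<^esub> diffT (bT S \<nu>)"
    if S: "finite S" "S \<subseteq> X" and \<nu>: "set_mset \<nu> \<subseteq> B" for S \<nu>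
    using S
  proof (induction S rule: finite_index_induct)
    case empty
    show ?case by (rule 0[OF \<nu>])
  next
    case (insert m S)
    have mS: "m \<in> X" "S \<subseteq> X" using insert by auto
    let ?w = "bT S \<nu>"
    have w: "?w \<in> carrier T" "diffT ?w \<in> carrier T" using insert mS \<nu> by simp_all
    have bm: "bT (insert m S) \<nu> = dx m \<otimes>\<^bsub>T\<^esub> ?w" using insert mS \<nu> by (intro bT_insert_min) auto
    have sw: "diff_df b \<otimes>\<^bsub>T\<^esub> (dx m \<otimes>\<^bsub>T\<^esub> z) = \<ominus>\<^bsub>T\<^esub> (dx m \<otimes>\<^bsub>T\<^esub> (diff_df b \<otimes>\<^bsub>T\<^esub> z))" if "z \<in> carrier T" for z
      using Ta.TA.gr_comm_odd[OF diff_df_in[OF b] dx_in[OF mS(1)]] mS that by (simp add: Ta.BA.l_minus flip: Ta.BA.m_assoc)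
    have "diffT (df_pow b (Suc n) \<otimes>\<^bsub>T\<^esub> bT (insert m S) \<nu>) = diffT (dx m \<otimes>\<^bsub>T\<^esub> (df_pow b (Suc n) \<otimes>\<^bsub>T\<^esub> ?w))"
      unfolding bm using w mS by (simp add: dfc)
    also have "\<dots> = tv m \<otimes>\<^bsub>T\<^esub> (df_pow b (Suc n) \<otimes>\<^bsub>T\<^esub> ?w) \<ominus>\<^bsub>T\<^esub> dx m \<otimes>\<^bsub>T\<^esub> diffT (df_pow b (Suc n) \<otimes>\<^bsub>T\<^esub> ?w)"
      using w mS by (intro diffT_dx_mult) auto
    also have "diffT (df_pow b (Suc n) \<otimes>\<^bsub>T\<^esub> ?w) = df_pow b n \<otimes>\<^bsub>T\<^esub> diff_df b \<otimes>\<^bsub>T\<^esub> ?w \<oplus>\<^bsub>T\<^esub> df_pow b (Suc n) \<otimes>\<^bsub>T\<^esub> diffT ?w"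
      by (rule insert.IH[OF mS(2)])
    finally show ?case
      unfolding bm diffT_dx_mult[OF mS(1) w(1)] using w mS
      by (simp add: Ta.BA.m_assoc Ta.BA.minus_eq Ta.BA.r_distr Ta.BA.minus_add Ta.BA.r_minus sw dfc[of "dx m"] dfc[of "tv m"] Ta.BA.a_ac)
  qed
  show ?thesis using u Ta.BA_supp_M[OF u]
  proof (induction rule: Ta.BA_induct)
    case (add p q)
    then show ?case by (simp add: Ta.BA.r_distr diffT_add Ta.BA.a_ac)
  next
    case (basis m r)
    obtain S \<nu> where m: "m = (S, \<nu>)" by (cases m)
    have c: "finite S" "S \<subseteq> X" "set_mset \<nu> \<subseteq> B" using basis by (auto simp: m)
    have e: "basis_term Aev m r = scalT r \<otimes>\<^bsub>T\<^esub> bT S \<nu>"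
      unfolding scalT_eq m using basis(3) c Ta.scal_mult(1)[of r "\<one>\<^bsub>Aev\<^esub>" "(S, \<nu>)"] by simp
    have sc: "z \<otimes>\<^bsub>T\<^esub> (scalT r \<otimes>\<^bsub>T\<^esub> z') = scalT r \<otimes>\<^bsub>T\<^esub> (z \<otimes>\<^bsub>T\<^esub> z')" if "z \<in> carrier T" "z' \<in> carrier T" for z z'
      using T_central[OF scalT_in[OF basis(3)] that(1)] that basis(3) by (simp flip: Ta.BA.m_assoc)
    show ?case unfolding e using c basis(3)
      by (simp add: sc diffT_scal bas Ta.BA.r_distr)
  qed simp
qed

lemma diffT_one: "diffT \<one>\<^bsub>T\<^esub> = \<zero>\<^bsub>T\<^esub>" by (rule diffT_gr(2)[OF Ta.TA.gr_one]) simp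

lemma diffT_dx: "a \<in> X \<Longrightarrow> diffT (dx a) = tv a"
  using diffT_dx_mult[of a "\<one>\<^bsub>T\<^esub>"] by (simp add: diffT_one Ta.BA.minus_eq)

lemma diffT_df: "b \<in> B \<Longrightarrow> diffT (df_pow b (Suc n)) = df_pow b n \<otimes>\<^bsub>T\<^esub> diff_df b"
  using diffT_df_mult[of b "\<one>\<^bsub>T\<^esub>" n] by (simp add: diffT_one)

text \<open>The left factor is built up from generators, for which the rule is known with an
  arbitrary right factor. Writing the sign as \<open>signT\<close> makes the statement additive in
  \<open>u\<close>.\<close>

lemma diffT_mult:
  assumes u: "u \<in> carrier T" and v: "v \<in> carrier T"
  shows "diffT (u \<otimes>\<^bsub>T\<^esub> v) = diffT u \<otimes>\<^bsub>T\<^esub> v \<oplus>\<^bsub>T\<^esub> signT u \<otimes>\<^bsub>T\<^esub> diffT v"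
  using u
proof (induction rule: T_induct)
  case (add p q)
  then show ?case using v
    by (simp add: Ta.BA.l_distr diffT_add additive_add[OF signT_additive] Ta.BA.a_ac)
next
  case one
  then show ?case using v signT_gr[OF Ta.TA.gr_one] by (simp add: diffT_one)
next
  case (scal r u)
  then show ?case using v signT_gr[OF scalT_in[of r]]
    by (simp add: signT_mult Ta.BA.m_assoc diffT_scal Ta.BA.r_distr)
next
  case (dx a u)
  then show ?case using v signT_gr[OF dx_in[of a]]
    by (simp add: signT_mult Ta.BA.m_assoc diffT_dx_mult Ta.BA.r_distr Ta.BA.minus_eq Ta.BA.minus_add
        Ta.BA.l_distr Ta.BA.l_minus Ta.BA.a_ac)
next
  case (df b n u)
  have s: "signT (df_pow b n) = df_pow b n" using signT_gr[OF df_pow_in[of b n]] df by simp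
  show ?case
  proof (cases n)
    case 0
    then show ?thesis using df v s by simp
  next
    case (Suc k)
    then show ?thesis using df v s
      by (simp add: signT_mult Ta.BA.m_assoc diffT_df_mult Ta.BA.r_distr Ta.BA.l_distr Ta.BA.a_ac)
  qed
qed (use v in simp_all)

end

context tate_setup
begin

section \<open>The tensor product of the model with itself\<close>

abbreviation muT where
  "muT \<equiv> \<lambda>p q. frag_of (fst p \<otimes>\<^bsub>T\<^esub> evenT (fst q), snd p \<otimes>\<^bsub>T\<^esub> snd q)
               + frag_of (fst p \<otimes>\<^bsub>T\<^esub> oddT (fst q), signT (snd p) \<otimes>\<^bsub>T\<^esub> snd q)"

sublocale TTp: tensor_prod A rightT T leftT T muT
  rewrites "tensor_ring A rightT T leftT T muT = TT"
  by (intro tensor_prod.intro Ta.BA_ring) (simp_all add: TT_def)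

lemma tensT_eq: "tensT s t = TTp.tens s t" by (simp add: tensT_def)

lemma tensT_closed [simp]: "\<lbrakk>s \<in> carrier T; t \<in> carrier T\<rbrakk> \<Longrightarrow> tensT s t \<in> carrier TT"
  unfolding tensT_eq by (rule TTp.tens_closed)

lemmas tensT_add_left = TTp.tens_add_left[folded tensT_eq]
  and tensT_add_right = TTp.tens_add_right[folded tensT_eq]
  and tensT_uminus = TTp.tens_uminus[folded tensT_eq]
  and tensT_balanced = TTp.tens_balanced[folded tensT_eq]

lemma tensT_zero [simp]:
  "t \<in> carrier T \<Longrightarrow> tensT \<zero>\<^bsub>T\<^esub> t = \<zero>\<^bsub>TT\<^esub>" "s \<in> carrier T \<Longrightarrow> tensT s \<zero>\<^bsub>T\<^esub> = \<zero>\<^bsub>TT\<^esub>"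
  unfolding tensT_eq by (rule TTp.tens_zero; assumption)+

lemma cls_muT:
  assumes "s \<in> carrier T" "t \<in> carrier T" "s' \<in> carrier T" "t' \<in> carrier T"
  shows "TTp.cls (muT (s, t) (s', t'))
    = tensT (s \<otimes>\<^bsub>T\<^esub> evenT s') (t \<otimes>\<^bsub>T\<^esub> t') \<oplus>\<^bsub>TT\<^esub> tensT (s \<otimes>\<^bsub>T\<^esub> oddT s') (signT t \<otimes>\<^bsub>T\<^esub> t')"
proof -
  have "TTp.cls (frag_of (s \<otimes>\<^bsub>T\<^esub> evenT s', t \<otimes>\<^bsub>T\<^esub> t') + frag_of (s \<otimes>\<^bsub>T\<^esub> oddT s', signT t \<otimes>\<^bsub>T\<^esub> t'))
    = tensT (s \<otimes>\<^bsub>T\<^esub> evenT s') (t \<otimes>\<^bsub>T\<^esub> t') \<oplus>\<^bsub>TT\<^esub> tensT (s \<otimes>\<^bsub>T\<^esub> oddT s') (signT t \<otimes>\<^bsub>T\<^esub> t')"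
    unfolding tensT_eq by (rule TTp.cls_add) (use assms in simp_all)
  then show ?thesis by simp
qed

lemma parity_scal:
  assumes u: "u \<in> carrier T" and z: "z \<in> grT 0"
  shows "evenT (u \<otimes>\<^bsub>T\<^esub> z) = evenT u \<otimes>\<^bsub>T\<^esub> z" "oddT (u \<otimes>\<^bsub>T\<^esub> z) = oddT u \<otimes>\<^bsub>T\<^esub> z"
proof -
  have "evenT (u \<otimes>\<^bsub>T\<^esub> z) = evenT u \<otimes>\<^bsub>T\<^esub> z \<and> oddT (u \<otimes>\<^bsub>T\<^esub> z) = oddT u \<otimes>\<^bsub>T\<^esub> z" using u
  proof (induction rule: T_gr_induct)
    case (gr n u)
    have "u \<otimes>\<^bsub>T\<^esub> z \<in> grT n" using Ta.TA.gr_mult[OF gr z] by simp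
    then show ?case using gr Ta.tgr_carrier[OF z] by (simp add: evenT_gr oddT_gr)
  qed (use Ta.tgr_carrier[OF z] in \<open>simp_all add: Ta.BA.l_distr additive_add[OF evenT_additive] additive_add[OF oddT_additive]\<close>)
  then show "evenT (u \<otimes>\<^bsub>T\<^esub> z) = evenT u \<otimes>\<^bsub>T\<^esub> z" "oddT (u \<otimes>\<^bsub>T\<^esub> z) = oddT u \<otimes>\<^bsub>T\<^esub> z" by auto
qed

lemma tensT_right_left:
  assumes "s \<in> carrier T" "t \<in> carrier T" "c \<in> carrier A"
  shows "tensT (s \<otimes>\<^bsub>T\<^esub> rightT c) t = tensT s (leftT c \<otimes>\<^bsub>T\<^esub> t)"
  using tensT_balanced assms by simp

lemma swap_right: "\<lbrakk>s \<in> carrier T; s' \<in> carrier T; c \<in> carrier A\<rbrakk> \<Longrightarrow>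
    s \<otimes>\<^bsub>T\<^esub> rightT c \<otimes>\<^bsub>T\<^esub> s' = s \<otimes>\<^bsub>T\<^esub> s' \<otimes>\<^bsub>T\<^esub> rightT c"
  using T_central[OF rightT_in, of c s'] by (simp add: Ta.BA.m_assoc)

lemma swap_left: "\<lbrakk>s \<in> carrier T; s' \<in> carrier T; c \<in> carrier A\<rbrakk> \<Longrightarrow>
    s \<otimes>\<^bsub>T\<^esub> (leftT c \<otimes>\<^bsub>T\<^esub> s') = leftT c \<otimes>\<^bsub>T\<^esub> (s \<otimes>\<^bsub>T\<^esub> s')"
  using T_central[OF leftT_in, of c s] by (simp flip: Ta.BA.m_assoc)

lemma signT_left: "\<lbrakk>t \<in> carrier T; c \<in> carrier A\<rbrakk> \<Longrightarrow> signT (leftT c \<otimes>\<^bsub>T\<^esub> t) = leftT c \<otimes>\<^bsub>T\<^esub> signT t"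
  using signT_gr[OF leftT_in, of c] by (simp add: signT_mult)

lemma signT_right: "\<lbrakk>t \<in> carrier T; c \<in> carrier A\<rbrakk> \<Longrightarrow> signT (t \<otimes>\<^bsub>T\<^esub> rightT c) = signT t \<otimes>\<^bsub>T\<^esub> rightT c"
  using signT_gr[OF rightT_in, of c] by (simp add: signT_mult)

lemma muT_right: "p \<in> carrier T \<times> carrier T \<Longrightarrow> TTp.balanced TT (\<lambda>q. TTp.cls (muT p q))"
proof (cases p)
  fix s t assume "p \<in> carrier T \<times> carrier T" and p: "p = (s, t)"
  then have st [simp]: "s \<in> carrier T" "t \<in> carrier T" by auto
  show ?thesis
    unfolding p TTp.balanced_def
  proof (intro conjI ballI)
    fix s' c t' assume a [simp]: "s' \<in> carrier T" "c \<in> carrier A" "t' \<in> carrier T"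
    have e: "s \<otimes>\<^bsub>T\<^esub> (z \<otimes>\<^bsub>T\<^esub> rightT c) = s \<otimes>\<^bsub>T\<^esub> z \<otimes>\<^bsub>T\<^esub> rightT c" if "z \<in> carrier T" for z
      using that by (simp add: Ta.BA.m_assoc)
    show "TTp.cls (muT (s, t) (s' \<otimes>\<^bsub>T\<^esub> rightT c, t')) = TTp.cls (muT (s, t) (s', leftT c \<otimes>\<^bsub>T\<^esub> t'))"
      by (subst (1 2) cls_muT) (simp_all add: parity_scal rightT_in e tensT_right_left swap_left)
  next
    fix s' s'' t' assume a [simp]: "s' \<in> carrier T" "s'' \<in> carrier T" "t' \<in> carrier T"
    show "TTp.cls (muT (s, t) (s' \<oplus>\<^bsub>T\<^esub> s'', t')) = TTp.cls (muT (s, t) (s', t')) \<oplus>\<^bsub>TT\<^esub> TTp.cls (muT (s, t) (s'', t'))"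
      by (subst (1 2 3) cls_muT)
        (simp_all add: additive_add[OF evenT_additive] additive_add[OF oddT_additive] Ta.BA.r_distr tensT_add_left TTp.TR.a_ac)
  next
    fix s' t' t'' assume a [simp]: "s' \<in> carrier T" "t' \<in> carrier T" "t'' \<in> carrier T"
    show "TTp.cls (muT (s, t) (s', t' \<oplus>\<^bsub>T\<^esub> t'')) = TTp.cls (muT (s, t) (s', t')) \<oplus>\<^bsub>TT\<^esub> TTp.cls (muT (s, t) (s', t''))"
      by (subst (1 2 3) cls_muT) (simp_all add: Ta.BA.r_distr tensT_add_right TTp.TR.a_ac)
  next
    fix s' t' assume a [simp]: "s' \<in> carrier T" "t' \<in> carrier T"
    show "TTp.cls (muT (s, t) (s', t')) \<in> carrier TT" by (subst cls_muT) simp_all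
  qed
qed

lemma muT_left: "q \<in> carrier T \<times> carrier T \<Longrightarrow> TTp.balanced TT (\<lambda>p. TTp.cls (muT p q))"
proof (cases q)
  fix s' t' assume "q \<in> carrier T \<times> carrier T" and q: "q = (s', t')"
  then have st [simp]: "s' \<in> carrier T" "t' \<in> carrier T" by auto
  show ?thesis
    unfolding q TTp.balanced_def
  proof (intro conjI ballI)
    fix s c t assume a [simp]: "s \<in> carrier T" "c \<in> carrier A" "t \<in> carrier T"
    show "TTp.cls (muT (s \<otimes>\<^bsub>T\<^esub> rightT c, t) (s', t')) = TTp.cls (muT (s, leftT c \<otimes>\<^bsub>T\<^esub> t) (s', t'))"
      by (subst (1 2) cls_muT) (simp_all add: swap_right tensT_right_left signT_left Ta.BA.m_assoc[of "leftT c"])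
  next
    fix s s2 t assume a [simp]: "s \<in> carrier T" "s2 \<in> carrier T" "t \<in> carrier T"
    show "TTp.cls (muT (s \<oplus>\<^bsub>T\<^esub> s2, t) (s', t')) = TTp.cls (muT (s, t) (s', t')) \<oplus>\<^bsub>TT\<^esub> TTp.cls (muT (s2, t) (s', t'))"
      by (subst (1 2 3) cls_muT) (simp_all add: Ta.BA.l_distr tensT_add_left TTp.TR.a_ac)
  next
    fix s t t2 assume a [simp]: "s \<in> carrier T" "t \<in> carrier T" "t2 \<in> carrier T"
    show "TTp.cls (muT (s, t \<oplus>\<^bsub>T\<^esub> t2) (s', t')) = TTp.cls (muT (s, t) (s', t')) \<oplus>\<^bsub>TT\<^esub> TTp.cls (muT (s, t2) (s', t'))"
      by (subst (1 2 3) cls_muT) (simp_all add: additive_add[OF signT_additive] Ta.BA.l_distr tensT_add_right TTp.TR.a_ac)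
  next
    fix s t assume a [simp]: "s \<in> carrier T" "t \<in> carrier T"
    show "TTp.cls (muT (s, t) (s', t')) \<in> carrier TT" by (subst cls_muT) simp_all
  qed
qed

sublocale TTa: tensor_prod_alg A rightT T leftT T muT
  rewrites "tensor_ring A rightT T leftT T muT = TT"
proof -
  show "tensor_ring A rightT T leftT T muT = TT" by (simp add: TT_def)
  show "tensor_prod_alg A rightT T leftT T muT"
    using muT_left muT_right
    by (intro tensor_prod_alg.intro tensor_prod_alg_axioms.intro TTp.tensor_prod_axioms) (simp_all add: TT_def)
qed

text \<open>The effect (-1)^(j |t|) of moving \<open>t\<close> past an element of degree
  \<open>j\<close>, expressed without the degree of \<open>t\<close>.\<close>

definition signpow where "signpow j t = (if even (j::nat) then t else signT t)"

lemma signpow_closed [simp]: "t \<in> carrier T \<Longrightarrow> signpow j t \<in> carrier T" by (simp add: signpow_def)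

lemma signpow_mult: "\<lbrakk>u \<in> carrier T; v \<in> carrier T\<rbrakk> \<Longrightarrow> signpow j (u \<otimes>\<^bsub>T\<^esub> v) = signpow j u \<otimes>\<^bsub>T\<^esub> signpow j v"
  by (simp add: signpow_def signT_mult)

lemma signpow_signpow: "u \<in> carrier T \<Longrightarrow> signpow i (signpow j u) = signpow (i + j) u"
  by (simp add: signpow_def signT_signT)

lemma signpow_one: "signpow j \<one>\<^bsub>T\<^esub> = \<one>\<^bsub>T\<^esub>"
  using signT_gr[OF Ta.TA.gr_one] by (simp add: signpow_def)

lemma signpow_gr: "t \<in> grT i \<Longrightarrow> signpow j t = (-1) ^ (i * j) \<odot>\<^bsub>T\<^esub> t"
  using Ta.tgr_carrier[of t i] by (auto simp: signpow_def signT_gr)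

lemma tensT_mult:
  assumes "s \<in> carrier T" "t \<in> carrier T" "s' \<in> grT j" "t' \<in> carrier T"
  shows "tensT s t \<otimes>\<^bsub>TT\<^esub> tensT s' t' = tensT (s \<otimes>\<^bsub>T\<^esub> s') (signpow j t \<otimes>\<^bsub>T\<^esub> t')"
proof -
  have s': "s' \<in> carrier T" using assms(3) by (rule Ta.tgr_carrier)
  have "tensT s t \<otimes>\<^bsub>TT\<^esub> tensT s' t' = tensT (s \<otimes>\<^bsub>T\<^esub> evenT s') (t \<otimes>\<^bsub>T\<^esub> t') \<oplus>\<^bsub>TT\<^esub> tensT (s \<otimes>\<^bsub>T\<^esub> oddT s') (signT t \<otimes>\<^bsub>T\<^esub> t')"
    unfolding cls_muT[OF assms(1,2) s' assms(4), symmetric] unfolding tensT_eq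
    by (rule TTa.tens_mult) (use assms s' in auto)
  also have "\<dots> = tensT (s \<otimes>\<^bsub>T\<^esub> s') (signpow j t \<otimes>\<^bsub>T\<^esub> t')"
    using assms s' by (cases "even j") (simp_all add: evenT_gr oddT_gr signpow_def)
  finally show ?thesis .
qed

lemma TT_ring: "ring TT"
proof (rule TTa.TR_ring, unfold tensT_eq[symmetric])
  \<comment> \<open>Only \<open>s'\<close> and \<open>s''\<close> are moved past other entries, so
    homogeneity is assumed for these two alone and then removed by additivity, first for
    \<open>s''\<close> and next for \<open>s'\<close>.\<close>
  have 1: "tensT s t \<otimes>\<^bsub>TT\<^esub> tensT s' t' \<otimes>\<^bsub>TT\<^esub> tensT s'' t'' = tensT s t \<otimes>\<^bsub>TT\<^esub> (tensT s' t' \<otimes>\<^bsub>TT\<^esub> tensT s'' t'')"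
    if c: "s \<in> carrier T" "t \<in> carrier T" "t' \<in> carrier T" "t'' \<in> carrier T" and g: "s' \<in> grT i" "s'' \<in> grT j"
    for s t s' t' s'' t'' i j
  proof -
    note g' = Ta.tgr_carrier[OF g(1)] Ta.tgr_carrier[OF g(2)]
    have "tensT s t \<otimes>\<^bsub>TT\<^esub> tensT s' t' \<otimes>\<^bsub>TT\<^esub> tensT s'' t''
      = tensT (s \<otimes>\<^bsub>T\<^esub> s' \<otimes>\<^bsub>T\<^esub> s'') (signpow j (signpow i t \<otimes>\<^bsub>T\<^esub> t') \<otimes>\<^bsub>T\<^esub> t'')"
      using c g g' by (simp add: tensT_mult[of _ _ s' i] tensT_mult[of _ _ s'' j])
    moreover have "tensT s t \<otimes>\<^bsub>TT\<^esub> (tensT s' t' \<otimes>\<^bsub>TT\<^esub> tensT s'' t'')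
      = tensT (s \<otimes>\<^bsub>T\<^esub> (s' \<otimes>\<^bsub>T\<^esub> s'')) (signpow (i + j) t \<otimes>\<^bsub>T\<^esub> (signpow j t' \<otimes>\<^bsub>T\<^esub> t''))"
      using c g g' Ta.TA.gr_mult[OF g] by (simp add: tensT_mult[of _ _ s'' j] tensT_mult[of _ _ "s' \<otimes>\<^bsub>T\<^esub> s''" "i + j"])
    ultimately show ?thesis
      using c g' by (simp add: signpow_mult signpow_signpow Ta.BA.m_assoc add.commute)
  qed
  have 2: "tensT s t \<otimes>\<^bsub>TT\<^esub> tensT s' t' \<otimes>\<^bsub>TT\<^esub> tensT s'' t'' = tensT s t \<otimes>\<^bsub>TT\<^esub> (tensT s' t' \<otimes>\<^bsub>TT\<^esub> tensT s'' t'')"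
    if c: "s \<in> carrier T" "t \<in> carrier T" "t' \<in> carrier T" "t'' \<in> carrier T" "s'' \<in> carrier T" and g: "s' \<in> grT i"
    for s t s' t' s'' t'' i
    using c(5)
  proof (induction rule: T_gr_induct)
    case (gr j s'')
    then show ?case using 1 c g by blast
  qed (use c Ta.tgr_carrier[OF g] in \<open>simp_all add: tensT_add_left TTa.TR_r_distr TTa.TR_mult_closed TTa.TR_r_zero\<close>)
  show "tensT s t \<otimes>\<^bsub>TT\<^esub> tensT s' t' \<otimes>\<^bsub>TT\<^esub> tensT s'' t'' = tensT s t \<otimes>\<^bsub>TT\<^esub> (tensT s' t' \<otimes>\<^bsub>TT\<^esub> tensT s'' t'')"
    if c: "s \<in> carrier T" "t \<in> carrier T" "s' \<in> carrier T" "t' \<in> carrier T" "s'' \<in> carrier T" "t'' \<in> carrier T"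
    for s t s' t' s'' t''
    using c(3)
  proof (induction rule: T_gr_induct)
    case (gr j s')
    show ?case by (rule 2[OF c(1,2,4,6,5) gr])
  qed (use c in \<open>simp_all add: tensT_add_left TTa.TR_r_distr TTa.TR_l_distr TTa.TR_mult_closed TTa.TR_r_zero TTa.TR_l_zero\<close>)
  show "tensT \<one>\<^bsub>T\<^esub> \<one>\<^bsub>T\<^esub> \<otimes>\<^bsub>TT\<^esub> tensT s t = tensT s t" if c: "s \<in> carrier T" "t \<in> carrier T" for s t
    using c(1)
  proof (induction rule: T_gr_induct)
    case (gr j s)
    then show ?case using c Ta.tgr_carrier[OF gr] by (simp add: tensT_mult[of _ _ s j] signpow_one)
  qed (use c in \<open>simp_all add: tensT_add_left TTa.TR_r_distr TTa.TR_r_zero\<close>)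
  show "tensT s t \<otimes>\<^bsub>TT\<^esub> tensT \<one>\<^bsub>T\<^esub> \<one>\<^bsub>T\<^esub> = tensT s t" if c: "s \<in> carrier T" "t \<in> carrier T" for s t
    using c by (simp add: tensT_mult[OF _ _ Ta.TA.gr_one] signpow_def)
qed

sublocale TT: ring TT by (rule TT_ring)

lemma TT_one: "\<one>\<^bsub>TT\<^esub> = tensT \<one>\<^bsub>T\<^esub> \<one>\<^bsub>T\<^esub>" unfolding tensT_eq by (rule TTa.TR_one)

lemma TT_induct [consumes 1, case_names zero add tens]:
  assumes "z \<in> carrier TT" and "Q \<zero>\<^bsub>TT\<^esub>"
    and Qa: "\<And>x y. \<lbrakk>x \<in> carrier TT; y \<in> carrier TT; Q x; Q y\<rbrakk> \<Longrightarrow> Q (x \<oplus>\<^bsub>TT\<^esub> y)"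
    and Qt: "\<And>s t i j. \<lbrakk>s \<in> grT i; t \<in> grT j\<rbrakk> \<Longrightarrow> Q (tensT s t)"
  shows "Q z"
  using assms(1)
proof (induction rule: TTp.TR_induct)
  case (tens s t)
  have "Q (tensT s t)" if s: "s \<in> grT i" for s i
    using tens(2) by (induction rule: T_gr_induct)
      (use Ta.tgr_carrier[OF s] assms(2) Qt[OF s] in \<open>simp_all add: tensT_add_right Qa\<close>)
  note 1 = this
  have "Q (tensT s t)"
    using tens(1) by (induction rule: T_gr_induct) (use tens(2) assms(2) 1 in \<open>simp_all add: tensT_add_left Qa\<close>)
  then show ?case by (simp only: tensT_eq)
qed (use assms in auto)

lemma fst_incl_closed [simp]: "s \<in> carrier T \<Longrightarrow> fst_incl s \<in> carrier TT" by (simp add: fst_incl_def)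
lemma snd_incl_closed [simp]: "t \<in> carrier T \<Longrightarrow> snd_incl t \<in> carrier TT" by (simp add: snd_incl_def)

lemma snd_incl_hom: "snd_incl \<in> ring_hom T TT"
  unfolding snd_incl_def
  by (rule ring_hom_memI) (simp_all add: tensT_mult[OF _ _ Ta.TA.gr_one] signpow_def tensT_add_right TT_one)

lemma fst_incl_hom: "fst_incl \<in> ring_hom T TT"
proof (rule ring_hom_memI)
  show "fst_incl (u \<otimes>\<^bsub>T\<^esub> v) = fst_incl u \<otimes>\<^bsub>TT\<^esub> fst_incl v" if u: "u \<in> carrier T" and v: "v \<in> carrier T" for u v
    using v
  proof (induction rule: T_gr_induct)
    case (gr j v)
    then show ?case using u Ta.tgr_carrier[OF gr]
      by (simp add: fst_incl_def tensT_mult[OF _ _ gr] signpow_one)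
  qed (use u in \<open>simp_all add: fst_incl_def tensT_add_left Ta.BA.r_distr TT.r_distr\<close>)
qed (simp_all add: fst_incl_def tensT_add_left TT_one)

lemma fst_snd: "\<lbrakk>s \<in> carrier T; t \<in> carrier T\<rbrakk> \<Longrightarrow> fst_incl s \<otimes>\<^bsub>TT\<^esub> snd_incl t = tensT s t"
  unfolding fst_incl_def snd_incl_def by (simp add: tensT_mult[OF _ _ Ta.TA.gr_one] signpow_def)

text \<open>The two inner copies of \<open>A\<close> coincide in the tensor product; they carry the
  unprimed variables of \<open>Phi_df\<close>.\<close>

lemma middle: "c \<in> carrier A \<Longrightarrow> fst_incl (rightT c) = snd_incl (leftT c)"
  using tensT_right_left[of "\<one>\<^bsub>T\<^esub>" "\<one>\<^bsub>T\<^esub>" c] by (simp add: fst_incl_def snd_incl_def)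

lemmas fst_incl_mult = ring_hom_mult[OF fst_incl_hom]
  and snd_incl_mult = ring_hom_mult[OF snd_incl_hom]
  and fst_incl_add = ring_hom_add[OF fst_incl_hom]
  and snd_incl_add = ring_hom_add[OF snd_incl_hom]
  and fst_incl_one = ring_hom_one[OF fst_incl_hom]
  and snd_incl_one = ring_hom_one[OF snd_incl_hom]

subsection \<open>The grading\<close>

lemma grTT_gens: "{tensT s t | s t i j. s \<in> grT i \<and> t \<in> grT j \<and> i + j = n} \<subseteq> carrier (add_monoid TT)"
  using Ta.tgr_carrier by auto

lemma grTT_subgroup: "subgroup (grTT n) (add_monoid TT)"
  unfolding grTT_def by (rule group.generate_is_subgroup[OF TTp.TR.a_group grTT_gens])

lemma grTT_carrier: "u \<in> grTT n \<Longrightarrow> u \<in> carrier TT"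
  using subgroup.subset[OF grTT_subgroup] by auto

lemma grTT_zero [simp]: "\<zero>\<^bsub>TT\<^esub> \<in> grTT n"
  using subgroup.one_closed[OF grTT_subgroup] by simp

lemma grTT_add: "\<lbrakk>u \<in> grTT n; v \<in> grTT n\<rbrakk> \<Longrightarrow> u \<oplus>\<^bsub>TT\<^esub> v \<in> grTT n"
  using subgroup.m_closed[OF grTT_subgroup] by simp

lemma grTT_uminus: "u \<in> grTT n \<Longrightarrow> \<ominus>\<^bsub>TT\<^esub> u \<in> grTT n"
  using subgroup.m_inv_closed[OF grTT_subgroup] by (simp add: a_inv_def)

lemma grTT_tens: "\<lbrakk>s \<in> grT i; t \<in> grT j\<rbrakk> \<Longrightarrow> tensT s t \<in> grTT (i + j)"
  unfolding grTT_def by (rule generate.incl) blast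

lemma grTT_induct [consumes 1, case_names zero add tens]:
  assumes u: "u \<in> grTT n" and Q0: "Q \<zero>\<^bsub>TT\<^esub>"
    and Qa: "\<And>u v. \<lbrakk>u \<in> grTT n; v \<in> grTT n; Q u; Q v\<rbrakk> \<Longrightarrow> Q (u \<oplus>\<^bsub>TT\<^esub> v)"
    and Qt: "\<And>s t i j. \<lbrakk>s \<in> grT i; t \<in> grT j; n = i + j\<rbrakk> \<Longrightarrow> Q (tensT s t)"
  shows "Q u"
  using u unfolding grTT_def
proof (induction rule: generate.induct)
  case one
  then show ?case using Q0 by simp
next
  case (incl h)
  then show ?case using Qt by blast
next
  case (inv h)
  then obtain s t i j where h: "h = tensT s t" "s \<in> grT i" "t \<in> grT j" "i + j = n" by blast
  have "inv\<^bsub>add_monoid TT\<^esub> h = tensT (\<ominus>\<^bsub>T\<^esub> s) t"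
    unfolding h(1) using tensT_uminus(1)[of s t] Ta.tgr_carrier[OF h(2)] Ta.tgr_carrier[OF h(3)] by (simp add: a_inv_def)
  then show ?case using Qt[OF Ta.tgr_uminus[OF h(2)] h(3)] h(4) by simp
next
  case (eng h1 h2)
  then show ?case using Qa[of h1 h2] by (simp add: grTT_def)
qed

lemma fst_incl_in: "s \<in> grT n \<Longrightarrow> fst_incl s \<in> grTT n"
  unfolding fst_incl_def using grTT_tens[OF _ Ta.TA.gr_one] by simp

lemma snd_incl_in: "s \<in> grT n \<Longrightarrow> snd_incl s \<in> grTT n"
  unfolding snd_incl_def using grTT_tens[OF Ta.TA.gr_one] by simp

lemma tensT_int_mult:
  "\<lbrakk>s \<in> carrier T; t \<in> carrier T\<rbrakk> \<Longrightarrow> tensT ((k::int) \<odot>\<^bsub>T\<^esub> s) t = k \<odot>\<^bsub>TT\<^esub> tensT s t"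
  "\<lbrakk>s \<in> carrier T; t \<in> carrier T\<rbrakk> \<Longrightarrow> tensT s ((k::int) \<odot>\<^bsub>T\<^esub> t) = k \<odot>\<^bsub>TT\<^esub> tensT s t"
  unfolding tensT_eq
  using additive_int_mult[OF Ta.BA_abelian_group TTp.TR_abelian TTp.tens_additive_left, of t s k]
    additive_int_mult[OF Ta.BA_abelian_group TTp.TR_abelian TTp.tens_additive_right, of s t k] by auto

lemma tensT_mult_gr:
  assumes "s \<in> carrier T" "t \<in> grT i" "s' \<in> grT j" "t' \<in> carrier T"
  shows "tensT s t \<otimes>\<^bsub>TT\<^esub> tensT s' t' = (-1) ^ (i * j) \<odot>\<^bsub>TT\<^esub> tensT (s \<otimes>\<^bsub>T\<^esub> s') (t \<otimes>\<^bsub>T\<^esub> t')"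
  using assms Ta.tgr_carrier[OF assms(2)] Ta.tgr_carrier[OF assms(3)]
  by (simp add: tensT_mult signpow_gr Ta.BA.add_pow_ldistr_int tensT_int_mult)

lemma TT_graded: "graded_comm TT grTT"
proof (intro graded_comm.intro graded_comm_axioms.intro TT_ring)
  have int_in: "(-1) ^ k \<odot>\<^bsub>TT\<^esub> u \<in> grTT n" if "u \<in> grTT n" for u n and k :: nat
    using that grTT_carrier[OF that] grTT_uminus[OF that] by (cases "even k") auto
  show "\<one>\<^bsub>TT\<^esub> \<in> grTT 0" unfolding TT_one using grTT_tens[OF Ta.TA.gr_one Ta.TA.gr_one] by simp
  show "u \<otimes>\<^bsub>TT\<^esub> v \<in> grTT (i + j)" if u: "u \<in> grTT i" and v: "v \<in> grTT j" for u v i j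
    using u
  proof (induction rule: grTT_induct)
    case (tens s t a b)
    show ?case using v
    proof (induction rule: grTT_induct)
      case (tens s' t' a' b')
      note st = \<open>s \<in> grT a\<close> \<open>t \<in> grT b\<close>
      have "tensT (s \<otimes>\<^bsub>T\<^esub> s') (t \<otimes>\<^bsub>T\<^esub> t') \<in> grTT (i + j)"
        using grTT_tens[OF Ta.TA.gr_mult[OF st(1) tens(1)] Ta.TA.gr_mult[OF st(2) tens(2)]] tens(3) \<open>i = a + b\<close>
        by (simp add: ac_simps)
      then show ?case
        using st tens Ta.tgr_carrier by (simp add: tensT_mult_gr[of s t b s' a' t'] int_in)
    qed (use tens Ta.tgr_carrier grTT_carrier in \<open>auto simp: TT.r_distr intro: grTT_add\<close>)
  qed (use grTT_carrier[OF v] grTT_carrier in \<open>auto simp: TT.l_distr intro: grTT_add\<close>)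
  show comm: "u \<otimes>\<^bsub>TT\<^esub> v = (-1) ^ (i * j) \<odot>\<^bsub>TT\<^esub> (v \<otimes>\<^bsub>TT\<^esub> u)" if u: "u \<in> grTT i" and v: "v \<in> grTT j" for u v i j
    using u
  proof (induction rule: grTT_induct)
    case (tens s t a b)
    show ?case using v
    proof (induction rule: grTT_induct)
      case (tens s' t' a' b')
      note st = \<open>s \<in> grT a\<close> \<open>t \<in> grT b\<close>
      note [simp] = Ta.tgr_carrier[OF st(1)] Ta.tgr_carrier[OF st(2)] Ta.tgr_carrier[OF tens(1)] Ta.tgr_carrier[OF tens(2)]
      let ?m = "tensT (s' \<otimes>\<^bsub>T\<^esub> s) (t' \<otimes>\<^bsub>T\<^esub> t)"
      have "tensT s t \<otimes>\<^bsub>TT\<^esub> tensT s' t' = (-1) ^ (b * a') \<odot>\<^bsub>TT\<^esub> tensT (s \<otimes>\<^bsub>T\<^esub> s') (t \<otimes>\<^bsub>T\<^esub> t')"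
        using st tens by (simp add: tensT_mult_gr[of s t b s' a' t'])
      also have "tensT (s \<otimes>\<^bsub>T\<^esub> s') (t \<otimes>\<^bsub>T\<^esub> t') = ((-1) ^ (a * a') * (-1) ^ (b * b')) \<odot>\<^bsub>TT\<^esub> ?m"
        unfolding Ta.TA.gr_comm[OF st(1) tens(1)] Ta.TA.gr_comm[OF st(2) tens(2)]
        by (simp add: tensT_int_mult mult.commute flip: TTp.TR.int_mult_mult)
      finally have 1: "tensT s t \<otimes>\<^bsub>TT\<^esub> tensT s' t' = ((-1) ^ (b * a') * ((-1) ^ (a * a') * (-1) ^ (b * b'))) \<odot>\<^bsub>TT\<^esub> ?m"
        by (simp add: TTp.TR.int_mult_mult)
      have 2: "tensT s' t' \<otimes>\<^bsub>TT\<^esub> tensT s t = (-1) ^ (b' * a) \<odot>\<^bsub>TT\<^esub> ?m"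
        using st tens by (simp add: tensT_mult_gr[of s' t' b' s a t])
      \<comment> \<open>Modulo 2, (a + b)(a' + b') + a b' reduces to a a' + b a' + b b'.\<close>
      have "(-1::int) ^ (b * a') * ((-1) ^ (a * a') * (-1) ^ (b * b')) = (-1) ^ (i * j) * (-1) ^ (b' * a)"
        unfolding tens(3) \<open>i = a + b\<close> by (auto simp: minus_one_power_iff)
      then show ?case unfolding 1 2 by (simp add: TTp.TR.int_mult_mult)
    qed (use tens Ta.tgr_carrier grTT_carrier in \<open>auto simp: TT.r_distr TT.l_distr TTp.TR.int_mult_add_right\<close>)
  qed (use grTT_carrier[OF v] grTT_carrier in \<open>auto simp: TT.l_distr TT.r_distr TTp.TR.int_mult_add_right\<close>)
  show "u \<otimes>\<^bsub>TT\<^esub> u = \<zero>\<^bsub>TT\<^esub>" if u: "u \<in> grTT i" and i: "odd i" for u i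
    using u
  proof (induction rule: grTT_induct)
    case (add u v)
    note [simp] = grTT_carrier[OF add(1)] grTT_carrier[OF add(2)]
    have c: "u \<otimes>\<^bsub>TT\<^esub> v = \<ominus>\<^bsub>TT\<^esub> (v \<otimes>\<^bsub>TT\<^esub> u)" using comm[OF add(1,2)] i by (simp add: uminus_power_if)
    have "(u \<oplus>\<^bsub>TT\<^esub> v) \<otimes>\<^bsub>TT\<^esub> (u \<oplus>\<^bsub>TT\<^esub> v) = u \<otimes>\<^bsub>TT\<^esub> u \<oplus>\<^bsub>TT\<^esub> v \<otimes>\<^bsub>TT\<^esub> v \<oplus>\<^bsub>TT\<^esub> (u \<otimes>\<^bsub>TT\<^esub> v \<oplus>\<^bsub>TT\<^esub> v \<otimes>\<^bsub>TT\<^esub> u)"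
      by (simp add: TT.l_distr TT.r_distr TTp.TR.a_ac)
    then show ?case unfolding c using add by (simp add: TTp.TR.l_neg)
  next
    case (tens s t a b)
    note [simp] = Ta.tgr_carrier[OF tens(1)] Ta.tgr_carrier[OF tens(2)]
    \<comment> \<open>The total degree is odd, so one of the two entries is odd and has square
      zero.\<close>
    have "s \<otimes>\<^bsub>T\<^esub> s = \<zero>\<^bsub>T\<^esub> \<or> t \<otimes>\<^bsub>T\<^esub> t = \<zero>\<^bsub>T\<^esub>"
      using Ta.TA.gr_sq[OF tens(1)] Ta.TA.gr_sq[OF tens(2)] tens(3) i by auto
    then show ?case using tens by (auto simp: tensT_mult_gr[of s t b s a t])
  qed simp
qed (auto simp: grTT_carrier grTT_add grTT_uminus)

sublocale TTg: graded_comm TT grTT by (rule TT_graded)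

end

text \<open>A new element enters with all its copies, so that \<open>bT_replicate\<close> and
  \<open>ymon_replicate\<close> apply without binomial coefficients.\<close>

lemma mset_replicate_induct [case_names empty add]:
  assumes "P {#}" and step: "\<And>b n \<nu>. \<lbrakk>b \<notin># \<nu>; P \<nu>\<rbrakk> \<Longrightarrow> P (replicate_mset n b + \<nu>)"
  shows "P \<nu>"
proof -
  have "finite D \<Longrightarrow> set_mset \<nu> = D \<Longrightarrow> P \<nu>" for D
  proof (induction D arbitrary: \<nu> rule: finite_induct)
    case (insert b D)
    let ?\<nu> = "filter_mset (\<lambda>c. c \<noteq> b) \<nu>"
    have \<nu>: "\<nu> = replicate_mset (count \<nu> b) b + ?\<nu>" by (rule multiset_eqI) auto
    have "set_mset ?\<nu> = D" using insert by auto
    then have "P (replicate_mset (count \<nu> b) b + ?\<nu>)" using insert.IH by (intro step) auto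
    then show ?case using \<nu> by simp
  qed (use assms in simp)
  then show ?thesis by blast
qed

section \<open>Combinations of monomials with coefficients of degree zero\<close>

context tate_target
begin

lemma ymon_empty [simp]: "ymon {#} = \<one>" by (simp add: ymon_def)

lemma ymon_replicate:
  assumes "b \<in> B" "set_mset \<nu> \<subseteq> B" "b \<notin># \<nu>"
  shows "ymon (replicate_mset n b + \<nu>) = y b n \<otimes> ymon \<nu>"
proof -
  have r: "ymon (replicate_mset n b) = y b n"
    using tmon_y[OF assms(1), of n] ymon_closed[of "replicate_mset n b"] assms(1) by (simp add: tmon_def)
  have "ymon (replicate_mset n b) \<otimes> ymon \<nu> = int (multichoose (replicate_mset n b) \<nu>) \<odot> ymon (replicate_mset n b + \<nu>)"
    using assms by (intro ymon_mult) auto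
  moreover have "multichoose (replicate_mset n b) \<nu> = 1" using assms(3) by (intro multichoose_disjoint) auto
  moreover have "ymon (replicate_mset n b + \<nu>) \<in> carrier S" using assms by (intro ymon_closed) auto
  ultimately show ?thesis by (simp add: r)
qed

text \<open>This is the form in which \<open>divided_powers_exist\<close> asks for generation by the
  monomials.\<close>

definition in_span where
  "in_span n u \<longleftrightarrow> (\<exists>F r. finite F \<and> F \<subseteq> tate_monomials X B \<and>
      (\<forall>m\<in>F. tate_degree m = n \<and> r m \<in> gr 0) \<and> u = (\<Oplus>m\<in>F. r m \<otimes> tmon m))"

lemma in_span_zero: "in_span n \<zero>"
  unfolding in_span_def by (rule exI[of _ "{}"]) simp

lemma in_span_single: "\<lbrakk>m \<in> tate_monomials X B; tate_degree m = n; r \<in> gr 0\<rbrakk> \<Longrightarrow> in_span n (r \<otimes> tmon m)"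
  unfolding in_span_def
  by (rule exI[of _ "{m}"], rule exI[of _ "\<lambda>_. r"]) (use gr_carrier tmon_closed in auto)

lemma in_span_add:
  assumes "in_span n u" "in_span n v"
  shows "in_span n (u \<oplus> v)"
proof -
  obtain F r where F: "finite F" "F \<subseteq> tate_monomials X B" "\<And>m. m \<in> F \<Longrightarrow> tate_degree m = n"
      "\<And>m. m \<in> F \<Longrightarrow> r m \<in> gr 0" "u = (\<Oplus>m\<in>F. r m \<otimes> tmon m)"
    using assms(1) unfolding in_span_def by blast
  obtain F' r' where F': "finite F'" "F' \<subseteq> tate_monomials X B" "\<And>m. m \<in> F' \<Longrightarrow> tate_degree m = n"
      "\<And>m. m \<in> F' \<Longrightarrow> r' m \<in> gr 0" "v = (\<Oplus>m\<in>F'. r' m \<otimes> tmon m)"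
    using assms(2) unfolding in_span_def by blast
  let ?q = "\<lambda>m. if m \<in> F then r m else \<zero>" and ?q' = "\<lambda>m. if m \<in> F' then r' m else \<zero>"
  have q0: "?q m \<in> gr 0" "?q' m \<in> gr 0" for m using F(4)[of m] F'(4)[of m] by simp_all
  have qc: "?q m \<in> carrier S" "?q' m \<in> carrier S" for m using q0 gr_carrier by blast+
  have tm: "tmon m \<in> carrier S" if "m \<in> F \<union> F'" for m using that F(2) F'(2) by (intro tmon_closed) blast
  have pc: "?q m \<otimes> tmon m \<in> carrier S" "?q' m \<otimes> tmon m \<in> carrier S" if "m \<in> F \<union> F'" for m
    using qc tm[OF that] by (blast intro: m_closed)+
  have u: "u = (\<Oplus>m\<in>F \<union> F'. ?q m \<otimes> tmon m)"
  proof -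
    have "u = (\<Oplus>m\<in>F. ?q m \<otimes> tmon m)"
      unfolding F(5) proof (rule finsum_cong'[OF refl])
        show "r m \<otimes> tmon m = ?q m \<otimes> tmon m" if "m \<in> F" for m using that by simp
      qed (use pc(1) in \<open>blast intro: Pi_I\<close>)
    also have "\<dots> = (\<Oplus>m\<in>F \<union> F'. ?q m \<otimes> tmon m)"
    proof (rule finsum_mono_neutral)
      show "?q m \<otimes> tmon m = \<zero>" if m: "m \<in> F \<union> F' - F" for m
      proof -
        have "tmon m \<in> carrier S" using m by (blast intro: tm)
        then show ?thesis using m by simp
      qed
    qed (use F(1) F'(1) pc(1) in \<open>blast intro: Pi_I\<close>)+
    finally show ?thesis .
  qed
  have v: "v = (\<Oplus>m\<in>F \<union> F'. ?q' m \<otimes> tmon m)"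
  proof -
    have "v = (\<Oplus>m\<in>F'. ?q' m \<otimes> tmon m)"
      unfolding F'(5) proof (rule finsum_cong'[OF refl])
        show "r' m \<otimes> tmon m = ?q' m \<otimes> tmon m" if "m \<in> F'" for m using that by simp
      qed (use pc(2) in \<open>blast intro: Pi_I\<close>)
    also have "\<dots> = (\<Oplus>m\<in>F \<union> F'. ?q' m \<otimes> tmon m)"
    proof (rule finsum_mono_neutral)
      show "?q' m \<otimes> tmon m = \<zero>" if m: "m \<in> F \<union> F' - F'" for m
      proof -
        have "tmon m \<in> carrier S" using m by (blast intro: tm)
        then show ?thesis using m by simp
      qed
    qed (use F(1) F'(1) pc(2) in \<open>blast intro: Pi_I\<close>)+
    finally show ?thesis .
  qed
  have "u \<oplus> v = (\<Oplus>m\<in>F \<union> F'. ?q m \<otimes> tmon m \<oplus> ?q' m \<otimes> tmon m)"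
    unfolding u v using pc by (intro finsum_addf[symmetric] Pi_I) blast+
  also have "\<dots> = (\<Oplus>m\<in>F \<union> F'. (?q m \<oplus> ?q' m) \<otimes> tmon m)"
  proof (rule finsum_cong'[OF refl])
    show "?q m \<otimes> tmon m \<oplus> ?q' m \<otimes> tmon m = (?q m \<oplus> ?q' m) \<otimes> tmon m" if "m \<in> F \<union> F'" for m
      by (rule l_distr[OF qc tm[OF that], symmetric])
  qed (use qc tm in \<open>blast intro: Pi_I m_closed a_closed\<close>)
  finally have e: "u \<oplus> v = (\<Oplus>m\<in>F \<union> F'. (?q m \<oplus> ?q' m) \<otimes> tmon m)" .
  show ?thesis
    unfolding in_span_def
  proof (intro exI conjI)
    show "u \<oplus> v = (\<Oplus>m\<in>F \<union> F'. (?q m \<oplus> ?q' m) \<otimes> tmon m)" by (rule e)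
    show "\<forall>m\<in>F \<union> F'. tate_degree m = n \<and> ?q m \<oplus> ?q' m \<in> gr 0" using F(3) F'(3) gr_add q0 by blast
  qed (use F F' in auto)
qed

end

context tate_setup
begin

section \<open>Divided powers on \<open>T\<close>\<close>

lemma T_target: "tate_target T grT X B dx df_pow"
  by (intro tate_target.intro Ta.TA_graded tate_target_axioms.intro) (simp_all add: dx_in[simplified] df_pow_in df_pow_mult)

interpretation Tt: tate_target T grT X B dx df_pow by (rule T_target)

lemma bT_split:
  "\<lbrakk>finite S; S \<subseteq> X; set_mset \<nu> \<subseteq> B\<rbrakk> \<Longrightarrow> bT S \<nu> = bT S {#} \<otimes>\<^bsub>T\<^esub> bT {} \<nu>"
  by (subst Ta.bt_mult) (auto simp: tate_coeff_eq)

text \<open>With \<open>dx\<close> and \<open>df_pow\<close> as images of the generators, the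
  monomials of the universal property are the basis elements, so statements about the basis become
  statements about \<open>tmon\<close>.\<close>

lemma tmon_T:
  assumes "finite S" "S \<subseteq> X" "set_mset \<nu> \<subseteq> B"
  shows "Tt.tmon (S, \<nu>) = bT S \<nu>"
proof -
  have 1: "ext_prod T dx S = bT S {#}" using assms(1,2)
  proof (induction S rule: finite_index_induct)
    case empty
    then show ?case by (simp add: Ta.TA_one)
  next
    case (insert a S)
    then show ?case by (simp add: ext_prod_insert bT_insert_min)
  qed
  have 2: "Tt.ymon \<nu> = bT {} \<nu>" using assms(3)
  proof (induction \<nu> rule: mset_replicate_induct)
    case empty
    then show ?case by (simp add: Ta.TA_one)
  next
    case (add b n \<nu>)
    show ?case
    proof (cases "n = 0")
      case False
      then have "b \<in> B" "set_mset \<nu> \<subseteq> B" using add by auto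
      then show ?thesis using add by (simp add: Tt.ymon_replicate bT_replicate)
    qed (use add in simp)
  qed
  show ?thesis using bT_split[OF assms] by (simp add: Tt.tmon_def 1 2)
qed

lemma tmon_T': "m \<in> tate_monomials X B \<Longrightarrow> Tt.tmon m = basis_term Aev m \<one>\<^bsub>Aev\<^esub>"
  using tmon_T[of "fst m" "snd m"] by (cases m) simp

lemma grT_0: "u \<in> grT 0 \<Longrightarrow> u = scalT (u ({}, {#}))"
proof
  fix m :: "'x set \<times> 'b multiset" assume u: "u \<in> grT 0"
  have "u m = \<zero>\<^bsub>Aev\<^esub>" if "m \<noteq> ({}, {#})"
  proof (rule ccontr)
    assume n: "u m \<noteq> \<zero>\<^bsub>Aev\<^esub>"
    then have "tate_degree m = 0" using u unfolding grT_def coeff_support_def by blast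
    moreover have "m \<in> tate_monomials X B" using n Ta.BA_outside[OF Ta.tgr_carrier[OF u]] by blast
    ultimately show False using that by (cases m) (auto simp: tate_degree_def)
  qed
  then show "u m = scalT (u ({}, {#})) m" by (simp add: scalT_eq Ta.bt_apply)
qed

lemma scalT_bT: "\<lbrakk>m \<in> tate_monomials X B; r \<in> carrier Aev\<rbrakk> \<Longrightarrow> scalT r \<otimes>\<^bsub>T\<^esub> basis_term Aev m \<one>\<^bsub>Aev\<^esub> = basis_term Aev m r"
  unfolding scalT_eq by (simp add: Ta.scal_mult(1))

text \<open>By \<open>grT_0\<close> the elements of degree zero are the scalars, so generation and
  freeness over \<open>grT 0\<close> are the expansion in the basis over \<open>Aev\<close>.\<close>

lemma tate_divided_powers_exist: "\<exists>\<gamma>. tate_divided_powers \<gamma>"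
proof (rule Tt.divided_powers_exist)
  fix n u assume u: "u \<in> grT n"
  have uc: "u \<in> carrier T" by (rule Ta.tgr_carrier[OF u])
  let ?F = "coeff_support Aev u"
  have M: "m \<in> tate_monomials X B" if "m \<in> ?F" for m using that Ta.BA_supp_M[OF uc] by blast
  have "u = (\<Oplus>\<^bsub>T\<^esub>m\<in>?F. basis_term Aev m (u m))" by (rule Ta.BA_decomp[OF uc])
  also have "\<dots> = (\<Oplus>\<^bsub>T\<^esub>m\<in>?F. scalT (u m) \<otimes>\<^bsub>T\<^esub> Tt.tmon m)"
  proof (intro Ta.BA.finsum_cong')
    fix m assume m: "m \<in> ?F"
    then show "basis_term Aev m (u m) = scalT (u m) \<otimes>\<^bsub>T\<^esub> Tt.tmon m"
      using M[OF m] scalT_bT[OF M[OF m] Ta.BA_coeff_closed[OF uc]] tmon_T'[OF M[OF m]] by (simp only:)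
    next
    show "(\<lambda>m. scalT (u m) \<otimes>\<^bsub>T\<^esub> Tt.tmon m) \<in> ?F \<rightarrow> carrier T"
      by (intro Pi_I Ta.BA.m_closed Tt.tmon_closed M scalT_closed Ta.BA_coeff_closed[OF uc])
  qed simp_all
  finally have e: "u = (\<Oplus>\<^bsub>T\<^esub>m\<in>?F. scalT (u m) \<otimes>\<^bsub>T\<^esub> Tt.tmon m)" .
  show "\<exists>F r. finite F \<and> F \<subseteq> tate_monomials X B \<and>
      (\<forall>m\<in>F. tate_degree m = n \<and> r m \<in> grT 0) \<and> u = (\<Oplus>\<^bsub>T\<^esub>m\<in>F. r m \<otimes>\<^bsub>T\<^esub> Tt.tmon m)"
  proof (intro exI conjI)
    show "finite ?F" using uc unfolding Ta.BA_carrier[of u] by blast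
    show "?F \<subseteq> tate_monomials X B" by (rule Ta.BA_supp_M[OF uc])
    show "\<forall>m\<in>?F. tate_degree m = n \<and> scalT (u m) \<in> grT 0" using u scalT_in[OF Ta.BA_coeff_closed[OF uc]] unfolding grT_def[of n] by blast
  qed (rule e)
next
  fix F and r :: "'x set \<times> 'b multiset \<Rightarrow> _"
  assume F: "finite F" "F \<subseteq> tate_monomials X B" "\<forall>m\<in>F. r m \<in> grT 0" "(\<Oplus>\<^bsub>T\<^esub>m\<in>F. r m \<otimes>\<^bsub>T\<^esub> Tt.tmon m) = \<zero>\<^bsub>T\<^esub>"
  have cl: "r m \<otimes>\<^bsub>T\<^esub> Tt.tmon m \<in> carrier T" if "m \<in> F" for m
    using F that Tt.tmon_closed[of m] Ta.tgr_carrier[of "r m"] by blast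
  have rm: "r m \<otimes>\<^bsub>T\<^esub> Tt.tmon m = basis_term Aev m (r m ({}, {#}))" if "m \<in> F" for m
  proof -
    have m: "m \<in> tate_monomials X B" using F that by blast
    have r: "r m \<in> grT 0" using F that by blast
    have "Tt.tmon m = basis_term Aev m \<one>\<^bsub>Aev\<^esub>" by (rule tmon_T'[OF m])
    then show ?thesis
      using scalT_bT[OF m Ta.BA_coeff_closed[OF Ta.tgr_carrier[OF r]], of "({}, {#})"] grT_0[OF r] by simp
  qed
  show "\<forall>m\<in>F. r m = \<zero>\<^bsub>T\<^esub>"
  proof
    fix m0 assume m0: "m0 \<in> F"
    have rc: "r m ({}, {#}) \<in> carrier Aev" if "m \<in> F" for m
      using F that Ta.tgr_carrier[of "r m"] Ta.BA_coeff_closed by blast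
    have "\<zero>\<^bsub>Aev\<^esub> = (\<Oplus>\<^bsub>T\<^esub>m\<in>F. r m \<otimes>\<^bsub>T\<^esub> Tt.tmon m) m0" unfolding F(4) by (simp add: Ta.BA_zero_apply)
    also have "\<dots> = (\<Oplus>\<^bsub>Aev\<^esub>m\<in>F. (r m \<otimes>\<^bsub>T\<^esub> Tt.tmon m) m0)" using cl by (intro Ta.BA_finsum_apply) auto
    also have "\<dots> = (r m0 \<otimes>\<^bsub>T\<^esub> Tt.tmon m0) m0"
      using F(1) m0 rc by (intro abelian_group.finsum_delta[OF Aev.is_abelian_group]) (simp_all add: rm Ta.bt_apply)
    finally have "r m0 ({}, {#}) = \<zero>\<^bsub>Aev\<^esub>" using m0 by (simp add: rm Ta.bt_apply)
    then show "r m0 = \<zero>\<^bsub>T\<^esub>" using grT_0[of "r m0"] F(3) m0 by (simp add: scalT_eq)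
  qed
next
  fix \<gamma> assume "divided_powers T grT \<gamma>" "\<And>b n. b \<in> B \<Longrightarrow> \<gamma> n (df_pow b 1) = df_pow b n"
  then show ?thesis unfolding tate_divided_powers_def df_eq by blast
qed

lemma dpT_tate: "tate_divided_powers dpT"
  unfolding dpT_def by (rule someI_ex[OF tate_divided_powers_exist])

lemma dpT: "divided_powers T grT dpT" and dpT_df: "b \<in> B \<Longrightarrow> dpT n (df b) = df_pow b n"
  using dpT_tate by (simp_all add: tate_divided_powers_def)

lemma dp_homI:
  assumes S: "graded_comm S gr" and \<delta>: "divided_powers S gr \<delta>"
    and h: "h \<in> ring_hom T S" "\<And>n. h ` grT n \<subseteq> gr n"
    and df: "\<And>b n. b \<in> B \<Longrightarrow> h (df_pow b n) = \<delta> n (h (df b))"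
  shows "divided_power_hom T grT dpT S gr \<delta> h"
  using Ta.divided_power_homI[OF dpT _ S \<delta> h] dpT_df df unfolding df_eq unfolding df_pow_def by blast

section \<open>Divided powers on the tensor product\<close>

text \<open>Together with \<open>yTT\<close> this views the tensor product as an algebra generated
  over its degree zero part by two copies of the generators, so that the existence theorem proved
  for one Tate algebra applies to it.\<close>

definition gTT where "gTT = case_sum (\<lambda>a. fst_incl (dx a)) (\<lambda>a. snd_incl (dx a))"
definition yTT where "yTT = case_sum (\<lambda>b n. fst_incl (df_pow b n)) (\<lambda>b n. snd_incl (df_pow b n))"

lemma incl_int_mult:
  "s \<in> carrier T \<Longrightarrow> fst_incl ((k::int) \<odot>\<^bsub>T\<^esub> s) = k \<odot>\<^bsub>TT\<^esub> fst_incl s"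
  "s \<in> carrier T \<Longrightarrow> snd_incl ((k::int) \<odot>\<^bsub>T\<^esub> s) = k \<odot>\<^bsub>TT\<^esub> snd_incl s"
  by (simp_all add: fst_incl_def snd_incl_def tensT_int_mult)

lemma TT_target: "tate_target TT grTT (X <+> X) (B <+> B) gTT yTT"
proof (intro tate_target.intro TT_graded tate_target_axioms.intro)
  show "gTT a \<in> grTT 1" if "a \<in> X <+> X" for a
    using that fst_incl_in[OF dx_in] snd_incl_in[OF dx_in] by (auto simp: gTT_def)
  show "yTT b n \<in> grTT (2 * n)" if "b \<in> B <+> B" for b n
    using that fst_incl_in[OF df_pow_in] snd_incl_in[OF df_pow_in] by (auto simp: yTT_def)
  show "yTT b 0 = \<one>\<^bsub>TT\<^esub>" if "b \<in> B <+> B" for b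
    using that by (auto simp: yTT_def fst_incl_one snd_incl_one)
  show "yTT b m \<otimes>\<^bsub>TT\<^esub> yTT b n = int ((m + n) choose m) \<odot>\<^bsub>TT\<^esub> yTT b (m + n)" if "b \<in> B <+> B" for b m n
    using that
    by (auto simp: yTT_def df_pow_mult incl_int_mult fst_incl_mult[symmetric] snd_incl_mult[symmetric])
qed

interpretation TTt: tate_target TT grTT "X <+> X" "B <+> B" gTT yTT by (rule TT_target)

text \<open>The order on \<open>X + X\<close> is unrelated to the one on \<open>X\<close>, so a monomial of the tensor product is a tensor
  of monomials only up to sign.\<close>

definition upto_sign where "upto_sign u v \<longleftrightarrow> u = v \<or> u = \<ominus>\<^bsub>TT\<^esub> v"

lemma upto_sign_refl: "upto_sign u u" by (simp add: upto_sign_def)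

lemma upto_sign_trans: "\<lbrakk>upto_sign u v; upto_sign v w; w \<in> carrier TT\<rbrakk> \<Longrightarrow> upto_sign u w"
  by (auto simp: upto_sign_def TTp.TR.minus_minus)

lemma upto_sign_sym: "\<lbrakk>upto_sign u v; v \<in> carrier TT\<rbrakk> \<Longrightarrow> upto_sign v u"
  by (auto simp: upto_sign_def TTp.TR.minus_minus)

lemma upto_sign_pow: "v \<in> carrier TT \<Longrightarrow> upto_sign ((-1) ^ k \<odot>\<^bsub>TT\<^esub> v) v"
  by (cases "even k") (auto simp: upto_sign_def)

lemma upto_sign_mult:
  "\<lbrakk>upto_sign u v; upto_sign u' v'; v \<in> carrier TT; v' \<in> carrier TT\<rbrakk> \<Longrightarrow> upto_sign (u \<otimes>\<^bsub>TT\<^esub> u') (v \<otimes>\<^bsub>TT\<^esub> v')"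
  by (auto simp: upto_sign_def TT.l_minus TT.r_minus TTp.TR.minus_minus)

lemma ext_gTT_Inl: "\<lbrakk>finite S; S \<subseteq> X\<rbrakk> \<Longrightarrow> upto_sign (ext_prod TT gTT (Inl ` S)) (fst_incl (bT S {#}))"
proof (induction S rule: finite_index_induct)
  case empty
  then show ?case by (simp add: Ta.TA_one[symmetric] fst_incl_one upto_sign_refl)
next
  case (insert a S)
  have c: "a \<in> X" "S \<subseteq> X" "finite S" "a \<notin> S" using insert by auto
  have c': "Inl a \<in> X <+> X" "finite (Inl ` S)" "Inl ` S \<subseteq> X <+> X" "Inl a \<notin> Inl ` S" using c by auto
  have e: "ext_prod TT gTT (insert (Inl a) (Inl ` S)) \<in> carrier TT"
    by (rule TTt.ext_g_closed) (use c' in auto)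
  have g: "gTT (Inl a) \<otimes>\<^bsub>TT\<^esub> ext_prod TT gTT (Inl ` S)
      = (-1) ^ card {d \<in> Inl ` S. index_less d (Inl a :: 'x + 'x)} \<odot>\<^bsub>TT\<^esub> ext_prod TT gTT (insert (Inl a) (Inl ` S))"
    using TTt.g_ext_mult[OF c'(1-3)] by (simp only: if_not_P[OF c'(4)])
  have "upto_sign (gTT (Inl a) \<otimes>\<^bsub>TT\<^esub> ext_prod TT gTT (Inl ` S)) (ext_prod TT gTT (insert (Inl a) (Inl ` S)))"
    unfolding g by (rule upto_sign_pow[OF e])
  then have 1: "upto_sign (ext_prod TT gTT (insert (Inl a) (Inl ` S))) (gTT (Inl a) \<otimes>\<^bsub>TT\<^esub> ext_prod TT gTT (Inl ` S))"
    using e by (rule upto_sign_sym)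
  have 2: "upto_sign (gTT (Inl a) \<otimes>\<^bsub>TT\<^esub> ext_prod TT gTT (Inl ` S)) (fst_incl (dx a) \<otimes>\<^bsub>TT\<^esub> fst_incl (bT S {#}))"
    using c insert.IH by (intro upto_sign_mult) (auto simp: gTT_def upto_sign_refl)
  have "upto_sign (ext_prod TT gTT (insert (Inl a) (Inl ` S))) (fst_incl (dx a) \<otimes>\<^bsub>TT\<^esub> fst_incl (bT S {#}))"
    by (rule upto_sign_trans[OF 1 2]) (use c in simp)
  also have "fst_incl (dx a) \<otimes>\<^bsub>TT\<^esub> fst_incl (bT S {#}) = fst_incl (bT (insert a S) {#})"
    using c insert.hyps(3) by (simp add: bT_insert_min fst_incl_mult)
  finally show ?case by simp
qed

lemma ext_gTT_Inr: "\<lbrakk>finite S; S \<subseteq> X\<rbrakk> \<Longrightarrow> upto_sign (ext_prod TT gTT (Inr ` S)) (snd_incl (bT S {#}))"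
proof (induction S rule: finite_index_induct)
  case empty
  then show ?case by (simp add: Ta.TA_one[symmetric] snd_incl_one upto_sign_refl)
next
  case (insert a S)
  have c: "a \<in> X" "S \<subseteq> X" "finite S" "a \<notin> S" using insert by auto
  have c': "Inr a \<in> X <+> X" "finite (Inr ` S)" "Inr ` S \<subseteq> X <+> X" "Inr a \<notin> Inr ` S" using c by auto
  have e: "ext_prod TT gTT (insert (Inr a) (Inr ` S)) \<in> carrier TT"
    by (rule TTt.ext_g_closed) (use c' in auto)
  have g: "gTT (Inr a) \<otimes>\<^bsub>TT\<^esub> ext_prod TT gTT (Inr ` S)
      = (-1) ^ card {d \<in> Inr ` S. index_less d (Inr a :: 'x + 'x)} \<odot>\<^bsub>TT\<^esub> ext_prod TT gTT (insert (Inr a) (Inr ` S))"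
    using TTt.g_ext_mult[OF c'(1-3)] by (simp only: if_not_P[OF c'(4)])
  have "upto_sign (gTT (Inr a) \<otimes>\<^bsub>TT\<^esub> ext_prod TT gTT (Inr ` S)) (ext_prod TT gTT (insert (Inr a) (Inr ` S)))"
    unfolding g by (rule upto_sign_pow[OF e])
  then have 1: "upto_sign (ext_prod TT gTT (insert (Inr a) (Inr ` S))) (gTT (Inr a) \<otimes>\<^bsub>TT\<^esub> ext_prod TT gTT (Inr ` S))"
    using e by (rule upto_sign_sym)
  have 2: "upto_sign (gTT (Inr a) \<otimes>\<^bsub>TT\<^esub> ext_prod TT gTT (Inr ` S)) (snd_incl (dx a) \<otimes>\<^bsub>TT\<^esub> snd_incl (bT S {#}))"
    using c insert.IH by (intro upto_sign_mult) (auto simp: gTT_def upto_sign_refl)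
  have "upto_sign (ext_prod TT gTT (insert (Inr a) (Inr ` S))) (snd_incl (dx a) \<otimes>\<^bsub>TT\<^esub> snd_incl (bT S {#}))"
    by (rule upto_sign_trans[OF 1 2]) (use c in simp)
  also have "snd_incl (dx a) \<otimes>\<^bsub>TT\<^esub> snd_incl (bT S {#}) = snd_incl (bT (insert a S) {#})"
    using c insert.hyps(3) by (simp add: bT_insert_min snd_incl_mult)
  finally show ?case by simp
qed

lemma ymon_Inl: "set_mset \<nu> \<subseteq> B \<Longrightarrow> TTt.ymon (image_mset Inl \<nu>) = fst_incl (bT {} \<nu>)"
proof (induction \<nu> rule: mset_replicate_induct)
  case empty
  then show ?case by (simp add: Ta.TA_one[symmetric] fst_incl_one)
next
  case (add b n \<nu>)
  show ?case
  proof (cases "n = 0")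
    case False
    then have "b \<in> B" "set_mset \<nu> \<subseteq> B" using add by auto
    moreover from this have "TTt.ymon (replicate_mset n (Inl b) + image_mset Inl \<nu>) = yTT (Inl b) n \<otimes>\<^bsub>TT\<^esub> TTt.ymon (image_mset Inl \<nu>)"
      using add by (intro TTt.ymon_replicate) auto
    ultimately show ?thesis using add by (simp add: yTT_def bT_replicate fst_incl_mult)
  qed (use add in simp)
qed

lemma ymon_Inr: "set_mset \<nu> \<subseteq> B \<Longrightarrow> TTt.ymon (image_mset Inr \<nu>) = snd_incl (bT {} \<nu>)"
proof (induction \<nu> rule: mset_replicate_induct)
  case empty
  then show ?case by (simp add: Ta.TA_one[symmetric] snd_incl_one)
next
  case (add b n \<nu>)
  show ?case
  proof (cases "n = 0")
    case False
    then have "b \<in> B" "set_mset \<nu> \<subseteq> B" using add by auto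
    moreover from this have "TTt.ymon (replicate_mset n (Inr b) + image_mset Inr \<nu>) = yTT (Inr b) n \<otimes>\<^bsub>TT\<^esub> TTt.ymon (image_mset Inr \<nu>)"
      using add by (intro TTt.ymon_replicate) auto
    ultimately show ?thesis using add by (simp add: yTT_def bT_replicate snd_incl_mult)
  qed (use add in simp)
qed

definition join_mon :: "'x set \<times> 'b multiset \<Rightarrow> 'x set \<times> 'b multiset \<Rightarrow> ('x + 'x) set \<times> ('b + 'b) multiset" where
  "join_mon m m' = (Inl ` fst m \<union> Inr ` fst m', image_mset Inl (snd m) + image_mset Inr (snd m'))"

lemma join_mon_in:
  "\<lbrakk>m \<in> tate_monomials X B; m' \<in> tate_monomials X B\<rbrakk> \<Longrightarrow> join_mon m m' \<in> tate_monomials (X <+> X) (B <+> B)"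
  by (auto simp: join_mon_def)

lemma join_mon_surj:
  assumes "m \<in> tate_monomials (X <+> X) (B <+> B)"
  obtains m1 m2 where "m1 \<in> tate_monomials X B" "m2 \<in> tate_monomials X B" "m = join_mon m1 m2"
proof -
  obtain S \<nu> where m: "m = (S, \<nu>)" by (cases m)
  have S: "finite S" "S \<subseteq> X <+> X" and \<nu>: "set_mset \<nu> \<subseteq> B <+> B" using assms by (auto simp: m)
  have "\<exists>\<nu>1 \<nu>2. set_mset \<nu>1 \<subseteq> B \<and> set_mset \<nu>2 \<subseteq> B \<and> \<nu> = image_mset Inl \<nu>1 + image_mset Inr \<nu>2"
    using \<nu>
  proof (induction \<nu>)
    case (add c \<nu>)
    then obtain \<nu>1 \<nu>2 where n: "set_mset \<nu>1 \<subseteq> B" "set_mset \<nu>2 \<subseteq> B" "\<nu> = image_mset Inl \<nu>1 + image_mset Inr \<nu>2"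
      by auto
    show ?case
    proof (cases c)
      case (Inl b)
      then show ?thesis using n add.prems by (intro exI[of _ "add_mset b \<nu>1"] exI[of _ \<nu>2]) auto
    next
      case (Inr b)
      then show ?thesis using n add.prems by (intro exI[of _ \<nu>1] exI[of _ "add_mset b \<nu>2"]) auto
    qed
  qed simp
  then obtain \<nu>1 \<nu>2 where n: "set_mset \<nu>1 \<subseteq> B" "set_mset \<nu>2 \<subseteq> B" "\<nu> = image_mset Inl \<nu>1 + image_mset Inr \<nu>2"
    by blast
  have fin: "finite (Inl -` S)" "finite (Inr -` S)" using S(1) by (auto intro!: finite_vimageI)
  have "S = Inl ` (Inl -` S) \<union> Inr ` (Inr -` S)"
  proof
    show "S \<subseteq> Inl ` (Inl -` S) \<union> Inr ` (Inr -` S)"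
    proof
      fix z assume "z \<in> S" then show "z \<in> Inl ` (Inl -` S) \<union> Inr ` (Inr -` S)" by (cases z) auto
    qed
  qed auto
  then have "m = join_mon (Inl -` S, \<nu>1) (Inr -` S, \<nu>2)" by (simp add: join_mon_def m n(3))
  moreover have "Inl -` S \<subseteq> X" "Inr -` S \<subseteq> X" using S(2) by auto
  ultimately show thesis using that n fin by auto
qed

lemma tate_degree_join:
  assumes "m1 \<in> tate_monomials X B" "m2 \<in> tate_monomials X B"
  shows "tate_degree (join_mon m1 m2) = tate_degree m1 + tate_degree m2"
proof -
  have "card (Inl ` fst m1 \<union> Inr ` fst m2) = card (Inl ` fst m1 :: ('x + 'x) set) + card (Inr ` fst m2 :: ('x + 'x) set)"
    using assms by (intro card_Un_disjoint) auto
  then show ?thesis by (simp add: tate_degree_def join_mon_def card_image)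
qed

lemma tmon_join:
  assumes m1: "m1 \<in> tate_monomials X B" and m2: "m2 \<in> tate_monomials X B"
  shows "upto_sign (TTt.tmon (join_mon m1 m2)) (tensT (basis_term Aev m1 \<one>\<^bsub>Aev\<^esub>) (basis_term Aev m2 \<one>\<^bsub>Aev\<^esub>))"
proof -
  obtain S1 \<nu>1 S2 \<nu>2 where m: "m1 = (S1, \<nu>1)" "m2 = (S2, \<nu>2)" by (cases m1, cases m2)
  have c: "finite S1" "S1 \<subseteq> X" "set_mset \<nu>1 \<subseteq> B" "finite S2" "S2 \<subseteq> X" "set_mset \<nu>2 \<subseteq> B"
    using m1 m2 by (auto simp: m)
  let ?E1 = "ext_prod TT gTT (Inl ` S1)" and ?E2 = "ext_prod TT gTT (Inr ` S2)"
  let ?E = "ext_prod TT gTT (Inl ` S1 \<union> Inr ` S2)"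
  have Ec: "?E1 \<in> carrier TT" "?E2 \<in> carrier TT" "?E \<in> carrier TT"
    using c by (auto intro!: TTt.ext_g_closed)
  have "?E1 \<otimes>\<^bsub>TT\<^esub> ?E2 = (-1) ^ inversions (Inl ` S1) (Inr ` S2) \<odot>\<^bsub>TT\<^esub> ?E"
  proof -
    have d: "Inl ` S1 \<inter> Inr ` S2 = {}" by auto
    have "finite (Inl ` S1)" "Inl ` S1 \<subseteq> X <+> X" "finite (Inr ` S2)" "Inr ` S2 \<subseteq> X <+> X" using c by auto
    from TTt.ext_g_mult[OF this] show ?thesis by (simp only: d if_True simp_thms)
  qed
  then have 1: "upto_sign ?E (?E1 \<otimes>\<^bsub>TT\<^esub> ?E2)" using upto_sign_sym[OF upto_sign_pow Ec(3)] Ec by simp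
  have 2: "upto_sign (?E1 \<otimes>\<^bsub>TT\<^esub> ?E2) (fst_incl (bT S1 {#}) \<otimes>\<^bsub>TT\<^esub> snd_incl (bT S2 {#}))"
    using c ext_gTT_Inl ext_gTT_Inr by (intro upto_sign_mult) auto
  have 3: "upto_sign ?E (fst_incl (bT S1 {#}) \<otimes>\<^bsub>TT\<^esub> snd_incl (bT S2 {#}))"
    using upto_sign_trans[OF 1 2] c by simp
  have y: "TTt.ymon (image_mset Inl \<nu>1 + image_mset Inr \<nu>2) = fst_incl (bT {} \<nu>1) \<otimes>\<^bsub>TT\<^esub> snd_incl (bT {} \<nu>2)"
  proof -
    have "TTt.ymon (image_mset Inl \<nu>1) \<otimes>\<^bsub>TT\<^esub> TTt.ymon (image_mset Inr \<nu>2)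
      = int (multichoose (image_mset Inl \<nu>1) (image_mset Inr \<nu>2)) \<odot>\<^bsub>TT\<^esub> TTt.ymon (image_mset Inl \<nu>1 + image_mset Inr \<nu>2)"
      using c by (intro TTt.ymon_mult) auto
    moreover have "multichoose (image_mset Inl \<nu>1) (image_mset Inr \<nu>2 :: ('b + 'b) multiset) = 1"
      by (rule multichoose_disjoint) auto
    moreover have "TTt.ymon (image_mset Inl \<nu>1 + image_mset Inr \<nu>2) \<in> carrier TT"
      using c by (intro TTt.ymon_closed) auto
    ultimately show ?thesis using c by (simp add: ymon_Inl ymon_Inr)
  qed
  have "upto_sign (?E \<otimes>\<^bsub>TT\<^esub> (fst_incl (bT {} \<nu>1) \<otimes>\<^bsub>TT\<^esub> snd_incl (bT {} \<nu>2)))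
     (fst_incl (bT S1 {#}) \<otimes>\<^bsub>TT\<^esub> snd_incl (bT S2 {#}) \<otimes>\<^bsub>TT\<^esub> (fst_incl (bT {} \<nu>1) \<otimes>\<^bsub>TT\<^esub> snd_incl (bT {} \<nu>2)))"
    using 3 c by (intro upto_sign_mult) (auto simp: upto_sign_refl)
  \<comment> \<open>The divided power monomial of the first factor has even degree, so it passes the
    exterior monomial of the second factor without a sign.\<close>
  also have "fst_incl (bT S1 {#}) \<otimes>\<^bsub>TT\<^esub> snd_incl (bT S2 {#}) \<otimes>\<^bsub>TT\<^esub> (fst_incl (bT {} \<nu>1) \<otimes>\<^bsub>TT\<^esub> snd_incl (bT {} \<nu>2))
    = tensT (bT S1 {#} \<otimes>\<^bsub>T\<^esub> bT {} \<nu>1) (bT S2 {#} \<otimes>\<^bsub>T\<^esub> bT {} \<nu>2)"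
    using c tensT_mult[OF _ _ bT_in[of "{}" \<nu>1], of "bT S1 {#}" "bT S2 {#}" "bT {} \<nu>2"]
    by (simp add: fst_snd signpow_def tate_degree_def)
  finally show ?thesis using bT_split[OF c(1-3)] bT_split[OF c(4-6)] by (simp add: TTt.tmon_def join_mon_def m y)
qed

text \<open>The coefficient at \<open>m1 \<otimes> m2\<close>, as an element of the degree zero part \<open>A\<^sup>e\<^sup>v \<otimes>\<^sub>A A\<^sup>e\<^sup>v\<close>.\<close>

definition coeffTT where
  "coeffTT m1 m2 = add_lift TT (\<lambda>p. tensT (scalT (fst p m1)) (scalT (snd p m2)))"

text \<open>Taking a coefficient is linear over \<open>Aev\<close>, so the action of
  \<open>A\<close> in the middle passes through both coefficient maps and is balanced in the
  target.\<close>

lemma coeffTT_balanced: "TTp.balanced TT (\<lambda>p. tensT (scalT (fst p m1)) (scalT (snd p m2)))"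
  unfolding TTp.balanced_def fst_conv snd_conv
proof (intro conjI ballI)
  fix s c t assume a: "s \<in> carrier T" "c \<in> carrier A" "t \<in> carrier T"
  have "s \<otimes>\<^bsub>T\<^esub> rightT c = scalT (tensA \<one>\<^bsub>A\<^esub> c) \<otimes>\<^bsub>T\<^esub> s"
    using T_central[OF rightT_in, of c s] a by (simp add: rightT_def)
  then have "(s \<otimes>\<^bsub>T\<^esub> rightT c) m1 = tensA \<one>\<^bsub>A\<^esub> c \<otimes>\<^bsub>Aev\<^esub> s m1" using a by (simp add: scalT_coeff)
  then have 1: "scalT ((s \<otimes>\<^bsub>T\<^esub> rightT c) m1) = scalT (s m1) \<otimes>\<^bsub>T\<^esub> rightT c"
    using a T_central[OF rightT_in, of c "scalT (s m1)"] by (simp add: ring_hom_mult[OF scalT_hom] rightT_def)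
  have "(leftT c \<otimes>\<^bsub>T\<^esub> t) m2 = tensA c \<one>\<^bsub>A\<^esub> \<otimes>\<^bsub>Aev\<^esub> t m2" using a by (simp add: leftT_def scalT_coeff)
  then have 2: "scalT ((leftT c \<otimes>\<^bsub>T\<^esub> t) m2) = leftT c \<otimes>\<^bsub>T\<^esub> scalT (t m2)"
    using a by (simp add: ring_hom_mult[OF scalT_hom] leftT_def)
  show "tensT (scalT ((s \<otimes>\<^bsub>T\<^esub> rightT c) m1)) (scalT (t m2)) = tensT (scalT (s m1)) (scalT ((leftT c \<otimes>\<^bsub>T\<^esub> t) m2))"
    unfolding 1 2 using a by (intro tensT_right_left) auto
qed (simp_all add: Ta.BA_add_apply[of _ _ m1] Ta.BA_add_apply[of _ _ m2] ring_hom_add[OF scalT_hom] tensT_add_left tensT_add_right)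

lemma coeffTT_additive: "coeffTT m1 m2 \<in> hom (add_monoid TT) (add_monoid TT)"
  unfolding coeffTT_def by (rule TTp.tensor_lift_hom[OF TTp.TR_abelian coeffTT_balanced])

lemma coeffTT_tensT: "\<lbrakk>s \<in> carrier T; t \<in> carrier T\<rbrakk> \<Longrightarrow> coeffTT m1 m2 (tensT s t) = tensT (scalT (s m1)) (scalT (t m2))"
  unfolding coeffTT_def tensT_eq[of s t] by (simp add: TTp.tensor_lift_tens[OF TTp.TR_abelian coeffTT_balanced])

lemma grTT_0_basis:
  assumes s: "s \<in> grT 0" "t \<in> grT 0" and m: "m1 \<in> tate_monomials X B" "m2 \<in> tate_monomials X B"
  shows "tensT s t \<otimes>\<^bsub>TT\<^esub> tensT (basis_term Aev m1 \<one>\<^bsub>Aev\<^esub>) (basis_term Aev m2 \<one>\<^bsub>Aev\<^esub>)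
    = tensT (basis_term Aev m1 (s ({}, {#}))) (basis_term Aev m2 (t ({}, {#})))"
proof -
  note [simp] = Ta.tgr_carrier[OF s(1)] Ta.tgr_carrier[OF s(2)]
  have b: "basis_term Aev m1 \<one>\<^bsub>Aev\<^esub> \<in> grT (tate_degree m1)" using m by (intro Ta.tgr_bt) auto
  have c: "basis_term Aev m1 \<one>\<^bsub>Aev\<^esub> \<in> carrier T" "basis_term Aev m2 \<one>\<^bsub>Aev\<^esub> \<in> carrier T" using m by auto
  have "s \<otimes>\<^bsub>T\<^esub> basis_term Aev m1 \<one>\<^bsub>Aev\<^esub> = basis_term Aev m1 (s ({}, {#}))"
    "t \<otimes>\<^bsub>T\<^esub> basis_term Aev m2 \<one>\<^bsub>Aev\<^esub> = basis_term Aev m2 (t ({}, {#}))"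
    using scalT_bT[OF m(1), of "s ({}, {#})"] scalT_bT[OF m(2), of "t ({}, {#})"] grT_0[OF s(1)] grT_0[OF s(2)] by simp_all
  then show ?thesis using tensT_mult_gr[OF _ s(2) b c(2), of s] m by simp
qed

lemma coeffTT_basis:
  assumes \<rho>: "\<rho> \<in> grTT 0" and m: "m1' \<in> tate_monomials X B" "m2' \<in> tate_monomials X B"
  shows "coeffTT m1 m2 (\<rho> \<otimes>\<^bsub>TT\<^esub> tensT (basis_term Aev m1' \<one>\<^bsub>Aev\<^esub>) (basis_term Aev m2' \<one>\<^bsub>Aev\<^esub>))
    = (if m1 = m1' \<and> m2 = m2' then \<rho> else \<zero>\<^bsub>TT\<^esub>)"
  using \<rho>
proof (induction rule: grTT_induct)
  case zero
  then show ?case using m additive_zero[OF TTp.TR_abelian TTp.TR_abelian coeffTT_additive] by simp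
next
  case (add u v)
  then show ?case using m grTT_carrier[OF add(1)] grTT_carrier[OF add(2)]
    by (auto simp: TT.l_distr additive_add[OF coeffTT_additive])
next
  case (tens s t i j)
  then have st: "s \<in> grT 0" "t \<in> grT 0" by auto
  note [simp] = Ta.tgr_carrier[OF st(1)] Ta.tgr_carrier[OF st(2)]
  have sc: "tensT (scalT (s ({}, {#}))) (scalT (t ({}, {#}))) = tensT s t"
    using grT_0[OF st(1)] grT_0[OF st(2)] by simp
  have z: "scalT \<zero>\<^bsub>Aev\<^esub> = \<zero>\<^bsub>T\<^esub>" by (simp add: scalT_eq)
  show ?case
    unfolding grTT_0_basis[OF st m] using m
    by (simp add: coeffTT_tensT Ta.bt_apply z sc)
qed

lemma coeffTT_tmon:
  assumes \<rho>: "\<rho> \<in> grTT 0" and m: "m1' \<in> tate_monomials X B" "m2' \<in> tate_monomials X B"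
  shows "upto_sign (coeffTT m1 m2 (\<rho> \<otimes>\<^bsub>TT\<^esub> TTt.tmon (join_mon m1' m2'))) (if m1 = m1' \<and> m2 = m2' then \<rho> else \<zero>\<^bsub>TT\<^esub>)"
proof -
  let ?b = "tensT (basis_term Aev m1' \<one>\<^bsub>Aev\<^esub>) (basis_term Aev m2' \<one>\<^bsub>Aev\<^esub>)"
  have b: "?b \<in> carrier TT" using m by simp
  have r: "\<rho> \<in> carrier TT" by (rule grTT_carrier[OF \<rho>])
  have "TTt.tmon (join_mon m1' m2') = ?b \<or> TTt.tmon (join_mon m1' m2') = \<ominus>\<^bsub>TT\<^esub> ?b"
    using tmon_join[OF m] by (simp add: upto_sign_def)
  then have "coeffTT m1 m2 (\<rho> \<otimes>\<^bsub>TT\<^esub> TTt.tmon (join_mon m1' m2')) = coeffTT m1 m2 (\<rho> \<otimes>\<^bsub>TT\<^esub> ?b)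
      \<or> coeffTT m1 m2 (\<rho> \<otimes>\<^bsub>TT\<^esub> TTt.tmon (join_mon m1' m2')) = \<ominus>\<^bsub>TT\<^esub> coeffTT m1 m2 (\<rho> \<otimes>\<^bsub>TT\<^esub> ?b)"
    using b r by (auto simp: TT.r_minus additive_uminus[OF TTp.TR_abelian TTp.TR_abelian coeffTT_additive])
  then show ?thesis unfolding coeffTT_basis[OF \<rho> m] by (simp add: upto_sign_def)
qed

text \<open>The coefficient map at a monomial kills all other terms of the relation and returns the
  coefficient of that monomial up to a sign, which is enough to see that it is zero.\<close>

lemma TT_free:
  assumes F: "finite F" "F \<subseteq> tate_monomials (X <+> X) (B <+> B)" "\<forall>m\<in>F. r m \<in> grTT 0"
    "(\<Oplus>\<^bsub>TT\<^esub>m\<in>F. r m \<otimes>\<^bsub>TT\<^esub> TTt.tmon m) = \<zero>\<^bsub>TT\<^esub>"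
  shows "\<forall>m\<in>F. r m = \<zero>\<^bsub>TT\<^esub>"
proof
  fix m0 assume m0: "m0 \<in> F"
  have cl: "r m \<otimes>\<^bsub>TT\<^esub> TTt.tmon m \<in> carrier TT" if "m \<in> F" for m
    using F that TTt.tmon_closed[of m] grTT_carrier[of "r m"] by blast
  obtain m1 m2 where m12: "m1 \<in> tate_monomials X B" "m2 \<in> tate_monomials X B" "m0 = join_mon m1 m2"
    by (rule join_mon_surj[of m0]) (use F m0 in blast)
  have other: "coeffTT m1 m2 (r m \<otimes>\<^bsub>TT\<^esub> TTt.tmon m) = \<zero>\<^bsub>TT\<^esub>" if m: "m \<in> F" "m \<noteq> m0" for m
  proof -
    obtain m1' m2' where m': "m1' \<in> tate_monomials X B" "m2' \<in> tate_monomials X B" "m = join_mon m1' m2'"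
      by (rule join_mon_surj[of m]) (use F m in blast)
    have "\<not> (m1 = m1' \<and> m2 = m2')" using m m' m12 by blast
    then show ?thesis using coeffTT_tmon[OF _ m'(1,2), of "r m" m1 m2] F(3) m(1) m'(3) by (auto simp: upto_sign_def)
  qed
  have "\<zero>\<^bsub>TT\<^esub> = coeffTT m1 m2 (\<Oplus>\<^bsub>TT\<^esub>m\<in>F. r m \<otimes>\<^bsub>TT\<^esub> TTt.tmon m)"
    unfolding F(4) using additive_zero[OF TTp.TR_abelian TTp.TR_abelian coeffTT_additive] by simp
  also have "\<dots> = (\<Oplus>\<^bsub>TT\<^esub>m\<in>F. coeffTT m1 m2 (r m \<otimes>\<^bsub>TT\<^esub> TTt.tmon m))"
    using cl by (intro additive_finsum[OF TTp.TR_abelian TTp.TR_abelian coeffTT_additive]) auto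
  also have "\<dots> = coeffTT m1 m2 (r m0 \<otimes>\<^bsub>TT\<^esub> TTt.tmon m0)"
    using F(1) m0 cl other additive_closed[OF coeffTT_additive] by (intro TTp.TR.finsum_delta) auto
  finally have "upto_sign \<zero>\<^bsub>TT\<^esub> (r m0)" using coeffTT_tmon[OF _ m12(1,2), of "r m0" m1 m2] F(3) m0 m12(3) by simp
  then have "upto_sign (r m0) \<zero>\<^bsub>TT\<^esub>" using upto_sign_sym F(3) m0 grTT_carrier by blast
  then show "r m0 = \<zero>\<^bsub>TT\<^esub>" by (auto simp: upto_sign_def)
qed

lemma TT_span: assumes u: "u \<in> grTT n" shows "TTt.in_span n u"
  using u
proof (induction rule: grTT_induct)
  case (tens s t i j)
  have bas: "TTt.in_span n (tensT (basis_term Aev m1 p) (basis_term Aev m2 q))"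
    if m: "m1 \<in> tate_monomials X B" "m2 \<in> tate_monomials X B" and pq: "p \<in> carrier Aev" "q \<in> carrier Aev"
      and d: "tate_degree m1 = i" "tate_degree m2 = j" for m1 m2 p q
  proof -
    let ?b = "tensT (basis_term Aev m1 \<one>\<^bsub>Aev\<^esub>) (basis_term Aev m2 \<one>\<^bsub>Aev\<^esub>)" and ?t = "TTt.tmon (join_mon m1 m2)"
    have b: "?b \<in> carrier TT" using m by simp
    let ?r = "tensT (scalT p) (scalT q)"
    have r0: "?r \<in> grTT 0" using grTT_tens[OF scalT_in[OF pq(1)] scalT_in[OF pq(2)]] by simp
    have e: "tensT (basis_term Aev m1 p) (basis_term Aev m2 q) = ?r \<otimes>\<^bsub>TT\<^esub> ?b"
      using grTT_0_basis[OF scalT_in[OF pq(1)] scalT_in[OF pq(2)] m] by (simp add: scalT_eq Ta.bt_apply)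
    have J: "join_mon m1 m2 \<in> tate_monomials (X <+> X) (B <+> B)" "tate_degree (join_mon m1 m2) = n"
      using join_mon_in[OF m] tate_degree_join[OF m] d tens(3) by auto
    \<comment> \<open>The sign between the tensor of monomials and the monomial of the tensor
      product is absorbed into the coefficient.\<close>
    have "?b = ?t \<or> ?b = \<ominus>\<^bsub>TT\<^esub> ?t" using upto_sign_sym[OF tmon_join[OF m] b] by (simp add: upto_sign_def)
    then have "?r \<otimes>\<^bsub>TT\<^esub> ?b = ?r \<otimes>\<^bsub>TT\<^esub> ?t \<or> ?r \<otimes>\<^bsub>TT\<^esub> ?b = (\<ominus>\<^bsub>TT\<^esub> ?r) \<otimes>\<^bsub>TT\<^esub> ?t"
      using grTT_carrier[OF r0] TTt.tmon_closed[OF J(1)] by (auto simp: TT.l_minus TT.r_minus)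
    then show ?thesis unfolding e using TTt.in_span_single[OF J r0] TTt.in_span_single[OF J grTT_uminus[OF r0]] by auto
  qed
  have 1: "TTt.in_span n (tensT (basis_term Aev m1 p) t)"
    if m: "m1 \<in> tate_monomials X B" "p \<in> carrier Aev" "tate_degree m1 = i" for m1 p
    using tens(2)
  proof (induction rule: Ta.tgr_induct)
    case (add u v)
    then show ?case using m by (simp add: tensT_add_right TTt.in_span_add)
  qed (use m bas TTt.in_span_zero in auto)
  show ?case using tens(1)
  proof (induction rule: Ta.tgr_induct)
    case (add u v)
    then show ?case using Ta.tgr_carrier[OF tens(2)] by (simp add: tensT_add_left TTt.in_span_add)
  qed (use 1 TTt.in_span_zero Ta.tgr_carrier[OF tens(2)] in auto)
qed (auto simp: TTt.in_span_zero TTt.in_span_add)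

text \<open>By \<open>dp_homI\<close> an inclusion preserves divided powers once it does so on the
  \<open>df b\<close>, where the values are prescribed through \<open>yTT\<close>.\<close>

lemma tensor_divided_powers_exist: "\<exists>\<gamma>. tensor_divided_powers \<gamma>"
proof (rule TTt.divided_powers_exist[OF TT_span[unfolded TTt.in_span_def] TT_free])
  fix \<gamma> assume \<gamma>: "divided_powers TT grTT \<gamma>" "\<And>b n. b \<in> B <+> B \<Longrightarrow> \<gamma> n (yTT b 1) = yTT b n"
  have "divided_power_hom T grT dpT TT grTT \<gamma> fst_incl"
    using \<gamma>(2)[OF InlI] by (intro dp_homI TT_graded \<gamma> fst_incl_hom) (auto simp: fst_incl_in yTT_def df_eq)
  moreover have "divided_power_hom T grT dpT TT grTT \<gamma> snd_incl"
    using \<gamma>(2)[OF InrI] by (intro dp_homI TT_graded \<gamma> snd_incl_hom) (auto simp: snd_incl_in yTT_def df_eq)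
  ultimately show "\<exists>\<gamma>. tensor_divided_powers \<gamma>" using \<gamma>(1) unfolding tensor_divided_powers_def by blast
qed

lemma dpTT_tensor: "tensor_divided_powers dpTT"
  unfolding dpTT_def by (rule someI_ex[OF tensor_divided_powers_exist])

lemma dpTT: "divided_powers TT grTT dpTT"
  and dpTT_fst: "divided_power_hom T grT dpT TT grTT dpTT fst_incl"
  and dpTT_snd: "divided_power_hom T grT dpT TT grTT dpTT snd_incl"
  using dpTT_tensor by (simp_all add: tensor_divided_powers_def)

lemma dpTT_fst_df: "b \<in> B \<Longrightarrow> dpTT n (fst_incl (df b)) = fst_incl (df_pow b n)"
  and dpTT_snd_df: "b \<in> B \<Longrightarrow> dpTT n (snd_incl (df b)) = snd_incl (df_pow b n)"
proof -
  assume b: "b \<in> B"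
  have d: "df b \<in> grT (2 * 1)" using df_in[OF b] by simp
  have "fst_incl (dpT n (df b)) = dpTT n (fst_incl (df b))" "snd_incl (dpT n (df b)) = dpTT n (snd_incl (df b))"
    using dpTT_fst dpTT_snd d unfolding divided_power_hom_def by (metis zero_less_one)+
  then show "dpTT n (fst_incl (df b)) = fst_incl (df_pow b n)" "dpTT n (snd_incl (df b)) = snd_incl (df_pow b n)"
    using dpT_df[OF b] by simp_all
qed

end

section \<open>Derivatives of words\<close>

text \<open>The rearrangement behind the induction step of \<open>diffTT_corr\<close>:
  \<open>q\<close> cancels on the left-hand side and \<open>k\<close> on the right-hand
  side.\<close>

lemma (in abelian_group) cancel_identity:
  assumes "p \<in> carrier G" "q \<in> carrier G" "r \<in> carrier G" "s \<in> carrier G" "t \<in> carrier G" "v \<in> carrier G" "k \<in> carrier G"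
  shows "(p \<ominus> q) \<ominus> (r \<ominus> s) \<oplus> (t \<oplus> q \<ominus> v) = (s \<oplus> t) \<oplus> (k \<oplus> p) \<ominus> ((r \<oplus> k) \<oplus> v)"
proof -
  have "(p \<ominus> q) \<ominus> (r \<ominus> s) \<oplus> (t \<oplus> q \<ominus> v) = (p \<oplus> (s \<oplus> (t \<oplus> (\<ominus> r \<oplus> \<ominus> v)))) \<oplus> (q \<oplus> \<ominus> q)"
    by (simp only: a_minus_def minus_add minus_minus a_ac assms a_closed a_inv_closed)
  moreover have "(s \<oplus> t) \<oplus> (k \<oplus> p) \<ominus> ((r \<oplus> k) \<oplus> v) = (p \<oplus> (s \<oplus> (t \<oplus> (\<ominus> r \<oplus> \<ominus> v)))) \<oplus> (k \<oplus> \<ominus> k)"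
    by (simp only: a_minus_def minus_add minus_minus a_ac assms a_closed a_inv_closed)
  ultimately show ?thesis using assms by (simp add: r_neg)
qed

lemma (in abelian_group) add_minus_cancel: "\<lbrakk>x \<in> carrier G; y \<in> carrier G\<rbrakk> \<Longrightarrow> x \<oplus> y \<ominus> x = y"
  by (simp add: a_minus_def a_comm[of x y] a_assoc r_neg)

context ring
begin

text \<open>A noncommutative derivative of the word: letters before the differentiated one are
  evaluated by \<open>x\<close>, those after it by \<open>y\<close>. With x', dx and x'' it is the
  inner sum of \<open>diff_df\<close>.\<close>

definition word_deriv where
  "word_deriv x d y w =
    (\<Oplus>\<kappa>\<in>{..<length w}. word_prod R x (take \<kappa> w) \<otimes> d (w ! \<kappa>) \<otimes> word_prod R y (drop (Suc \<kappa>) w))"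

text \<open>Two letters are differentiated, the first by \<open>d\<close> and the second by
  \<open>e\<close>, with a third evaluation between them; this is the shape of the term subtracted
  in \<open>Phi_df\<close>. The later position is the outer index, as in that definition.\<close>

definition word_deriv2 where
  "word_deriv2 x d y e z w =
    (\<Oplus>l\<in>{..<length w}. \<Oplus>\<kappa>\<in>{..<l}. word_prod R x (take \<kappa> w) \<otimes> d (w ! \<kappa>) \<otimes>
        word_prod R y (take (l - Suc \<kappa>) (drop (Suc \<kappa>) w)) \<otimes> e (w ! l) \<otimes> word_prod R z (drop (Suc l) w))"

lemma word_prod_Nil [simp]: "word_prod R x [] = \<one>"
  and word_prod_Cons [simp]: "word_prod R x (a # w) = x a \<otimes> word_prod R x w"
  by (simp_all add: word_prod_def)

lemma word_prod_in: "(\<And>a. a \<in> set w \<Longrightarrow> x a \<in> carrier R) \<Longrightarrow> word_prod R x w \<in> carrier R"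
  by (induction w) auto

lemma word_deriv_Nil [simp]: "word_deriv x d y [] = \<zero>"
  and word_deriv2_Nil [simp]: "word_deriv2 x d y e z [] = \<zero>"
  by (simp_all add: word_deriv_def word_deriv2_def)

lemma finsum_lessThan_Suc_shift:
  assumes "\<And>i. i \<le> n \<Longrightarrow> f i \<in> carrier R"
  shows "(\<Oplus>i\<in>{..<Suc n}. f i) = f 0 \<oplus> (\<Oplus>i\<in>{..<n}. f (Suc i))"
  using assms
proof (induction n)
  case (Suc n)
  have "(\<Oplus>i\<in>{..<Suc (Suc n)}. f i) = f (Suc n) \<oplus> (\<Oplus>i\<in>{..<Suc n}. f i)"
    using Suc.prems by (subst lessThan_Suc[of "Suc n"], subst finsum_insert) auto
  also have "(\<Oplus>i\<in>{..<Suc n}. f i) = f 0 \<oplus> (\<Oplus>i\<in>{..<n}. f (Suc i))" using Suc by simp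
  also have "f (Suc n) \<oplus> (f 0 \<oplus> (\<Oplus>i\<in>{..<n}. f (Suc i))) = f 0 \<oplus> (f (Suc n) \<oplus> (\<Oplus>i\<in>{..<n}. f (Suc i)))"
    using Suc.prems by (intro a_lcomm finsum_closed) auto
  also have "f (Suc n) \<oplus> (\<Oplus>i\<in>{..<n}. f (Suc i)) = (\<Oplus>i\<in>{..<Suc n}. f (Suc i))"
    using Suc.prems by (subst lessThan_Suc[of n], subst finsum_insert) auto
  finally show ?case .
qed (simp add: lessThan_Suc)

context
  fixes W :: "'x set" and x d y :: "'x \<Rightarrow> 'a"
  assumes x: "\<And>a. a \<in> W \<Longrightarrow> x a \<in> carrier R" and d: "\<And>a. a \<in> W \<Longrightarrow> d a \<in> carrier R"
    and y: "\<And>a. a \<in> W \<Longrightarrow> y a \<in> carrier R"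
begin

lemma word_deriv_term:
  assumes "set w \<subseteq> W" "\<kappa> < length w"
  shows "word_prod R x (take \<kappa> w) \<in> carrier R" "d (w ! \<kappa>) \<in> carrier R"
    "word_prod R y (drop (Suc \<kappa>) w) \<in> carrier R"
  using assms set_take_subset[of \<kappa> w] set_drop_subset[of "Suc \<kappa>" w] nth_mem[OF assms(2)]
  by (auto intro!: word_prod_in x d y)

lemma word_deriv_closed: "set w \<subseteq> W \<Longrightarrow> word_deriv x d y w \<in> carrier R"
  unfolding word_deriv_def using word_deriv_term by (intro finsum_closed) auto

text \<open>Either the first letter is differentiated or a later one is; this recursion replaces the
  manipulation of positions in all inductions along a word.\<close>

lemma word_deriv_Cons:
  assumes a: "a \<in> W" and w: "set w \<subseteq> W"
  shows "word_deriv x d y (a # w) = d a \<otimes> word_prod R y w \<oplus> x a \<otimes> word_deriv x d y w"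
proof -
  have aw: "set (a # w) \<subseteq> W" using a w by simp
  let ?f = "\<lambda>w \<kappa>. word_prod R x (take \<kappa> w) \<otimes> d (w ! \<kappa>) \<otimes> word_prod R y (drop (Suc \<kappa>) w)"
  have "word_deriv x d y (a # w) = ?f (a # w) 0 \<oplus> (\<Oplus>\<kappa>\<in>{..<length w}. ?f (a # w) (Suc \<kappa>))"
    unfolding word_deriv_def list.size(4) add_0_right add_Suc_right
    using word_deriv_term[OF aw] by (intro finsum_lessThan_Suc_shift) (simp del: take_Suc_Cons drop_Suc_Cons nth_Cons_Suc)
  also have "?f (a # w) 0 = d a \<otimes> word_prod R y w" using d[OF a] by simp
  also have "(\<Oplus>\<kappa>\<in>{..<length w}. ?f (a # w) (Suc \<kappa>)) = (\<Oplus>\<kappa>\<in>{..<length w}. x a \<otimes> ?f w \<kappa>)"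
    using word_deriv_term[OF w] x[OF a] by (intro finsum_cong') (auto simp: m_assoc)
  also have "\<dots> = x a \<otimes> word_deriv x d y w"
    unfolding word_deriv_def using word_deriv_term[OF w] x[OF a] by (intro finsum_rdistr[symmetric]) auto
  finally show ?thesis .
qed

context
  fixes e z :: "'x \<Rightarrow> 'a"
  assumes e: "\<And>a. a \<in> W \<Longrightarrow> e a \<in> carrier R" and z: "\<And>a. a \<in> W \<Longrightarrow> z a \<in> carrier R"
begin

lemma word_deriv2_term:
  assumes w: "set w \<subseteq> W" and "l < length w" "\<kappa> < l"
  shows "word_prod R x (take \<kappa> w) \<in> carrier R" "d (w ! \<kappa>) \<in> carrier R"
    "word_prod R y (take (l - Suc \<kappa>) (drop (Suc \<kappa>) w)) \<in> carrier R" "e (w ! l) \<in> carrier R"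
    "word_prod R z (drop (Suc l) w) \<in> carrier R"
proof -
  have "set (take \<kappa> w) \<subseteq> W" "w ! \<kappa> \<in> W" "set (take (l - Suc \<kappa>) (drop (Suc \<kappa>) w)) \<subseteq> W" "w ! l \<in> W"
    "set (drop (Suc l) w) \<subseteq> W"
    using w assms(2,3) set_take_subset[of \<kappa> w] set_drop_subset[of "Suc l" w] nth_mem[of \<kappa> w] nth_mem[of l w]
      set_take_subset[of "l - Suc \<kappa>" "drop (Suc \<kappa>) w"] set_drop_subset[of "Suc \<kappa>" w] by auto
  then show "word_prod R x (take \<kappa> w) \<in> carrier R" "d (w ! \<kappa>) \<in> carrier R"
    "word_prod R y (take (l - Suc \<kappa>) (drop (Suc \<kappa>) w)) \<in> carrier R" "e (w ! l) \<in> carrier R"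
    "word_prod R z (drop (Suc l) w) \<in> carrier R"
    by (auto intro!: word_prod_in x d y e z)
qed

lemma word_deriv2_closed: "set w \<subseteq> W \<Longrightarrow> word_deriv2 x d y e z w \<in> carrier R"
  unfolding word_deriv2_def using word_deriv2_term by (intro finsum_closed Pi_I m_closed) auto

end

end

text \<open>If the first letter is the earlier of the two differentiated ones, a single derivative
  of the rest remains, with \<open>y\<close> in the role of the left evaluation. Otherwise the
  letter stays in front as \<open>x a\<close>.\<close>

lemma word_deriv2_Cons:
  fixes W :: "'x set"
  assumes x: "\<And>a. a \<in> W \<Longrightarrow> x a \<in> carrier R" and d: "\<And>a. a \<in> W \<Longrightarrow> d a \<in> carrier R"
    and y: "\<And>a. a \<in> W \<Longrightarrow> y a \<in> carrier R" and e: "\<And>a. a \<in> W \<Longrightarrow> e a \<in> carrier R"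
    and z: "\<And>a. a \<in> W \<Longrightarrow> z a \<in> carrier R" and a: "a \<in> W" and w: "set w \<subseteq> W"
  shows "word_deriv2 x d y e z (a # w) = d a \<otimes> word_deriv y e z w \<oplus> x a \<otimes> word_deriv2 x d y e z w"
proof -
  have aw: "set (a # w) \<subseteq> W" using a w by simp
  let ?f = "\<lambda>w l \<kappa>. word_prod R x (take \<kappa> w) \<otimes> d (w ! \<kappa>) \<otimes>
        word_prod R y (take (l - Suc \<kappa>) (drop (Suc \<kappa>) w)) \<otimes> e (w ! l) \<otimes> word_prod R z (drop (Suc l) w)"
  let ?g = "\<lambda>l. word_prod R y (take l w) \<otimes> e (w ! l) \<otimes> word_prod R z (drop (Suc l) w)"
  have fc: "?f w l \<kappa> \<in> carrier R" if "set w \<subseteq> W" "l < length w" "\<kappa> < l" for w l \<kappa>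
    using word_deriv2_term[where W = W and x = x and d = d and y = y and e = e and z = z, OF x d y e z that]
    by (intro m_closed)
  have gc: "?g l \<in> carrier R" if "l < length w" for l
    using word_deriv_term[where W = W and x = y and d = e and y = z, OF y e z w that] by (intro m_closed)
  have s: "(\<Oplus>\<kappa>\<in>{..<Suc l}. ?f (a # w) (Suc l) \<kappa>) = d a \<otimes> ?g l \<oplus> x a \<otimes> (\<Oplus>\<kappa>\<in>{..<l}. ?f w l \<kappa>)"
    if l: "l < length w" for l
  proof -
    have "(\<Oplus>\<kappa>\<in>{..<Suc l}. ?f (a # w) (Suc l) \<kappa>) = ?f (a # w) (Suc l) 0 \<oplus> (\<Oplus>\<kappa>\<in>{..<l}. ?f (a # w) (Suc l) (Suc \<kappa>))"
    proof (rule finsum_lessThan_Suc_shift)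
      fix \<kappa> assume "\<kappa> \<le> l" then show "?f (a # w) (Suc l) \<kappa> \<in> carrier R" using l by (intro fc[OF aw]) auto
    qed
    also have "?f (a # w) (Suc l) 0 = d a \<otimes> ?g l"
      using word_deriv_term[where W = W and x = y and d = e and y = z, OF y e z w l] d[OF a] by (simp add: m_assoc)
    also have "(\<Oplus>\<kappa>\<in>{..<l}. ?f (a # w) (Suc l) (Suc \<kappa>)) = (\<Oplus>\<kappa>\<in>{..<l}. x a \<otimes> ?f w l \<kappa>)"
    proof (intro finsum_cong' refl Pi_I)
      fix \<kappa> assume "\<kappa> \<in> {..<l}"
      then have k: "\<kappa> < l" by simp
      show "?f (a # w) (Suc l) (Suc \<kappa>) = x a \<otimes> ?f w l \<kappa>"
        using word_deriv2_term[where W = W and x = x and d = d and y = y and e = e and z = z, OF x d y e z w l k] x[OF a]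
        by (simp add: m_assoc)
      show "x a \<otimes> ?f w l \<kappa> \<in> carrier R" by (rule m_closed[OF x[OF a] fc[OF w l k]])
    qed
    also have "\<dots> = x a \<otimes> (\<Oplus>\<kappa>\<in>{..<l}. ?f w l \<kappa>)"
      using fc[OF w l] x[OF a] by (intro finsum_rdistr[symmetric]) auto
    finally show ?thesis .
  qed
  have sc: "(\<Oplus>\<kappa>\<in>{..<l}. ?f w l \<kappa>) \<in> carrier R" if "l < length w" for l
    using fc[OF w that] by (intro finsum_closed) auto
  \<comment> \<open>The later differentiated position cannot be the first letter: its inner sum is
    empty.\<close>
  have "word_deriv2 x d y e z (a # w) = (\<Oplus>\<kappa>\<in>{..<0}. ?f (a # w) 0 \<kappa>) \<oplus>
      (\<Oplus>l\<in>{..<length w}. \<Oplus>\<kappa>\<in>{..<Suc l}. ?f (a # w) (Suc l) \<kappa>)"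
    unfolding word_deriv2_def list.size(4) add_0_right add_Suc_right
  proof (intro finsum_lessThan_Suc_shift finsum_closed Pi_I)
    fix l \<kappa> assume "l \<le> length w" "\<kappa> \<in> {..<l}"
    then show "?f (a # w) l \<kappa> \<in> carrier R" by (intro fc[OF aw]) auto
  qed
  also have "(\<Oplus>\<kappa>\<in>{..<0::nat}. ?f (a # w) 0 \<kappa>) = \<zero>" by simp
  also have "(\<Oplus>l\<in>{..<length w}. \<Oplus>\<kappa>\<in>{..<Suc l}. ?f (a # w) (Suc l) \<kappa>)
      = (\<Oplus>l\<in>{..<length w}. d a \<otimes> ?g l \<oplus> x a \<otimes> (\<Oplus>\<kappa>\<in>{..<l}. ?f w l \<kappa>))"
    using gc sc d[OF a] x[OF a] s by (intro finsum_cong' Pi_I) (simp_all del: take_Suc_Cons drop_Suc_Cons nth_Cons_Suc)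
  also have "\<dots> = (\<Oplus>l\<in>{..<length w}. d a \<otimes> ?g l) \<oplus> (\<Oplus>l\<in>{..<length w}. x a \<otimes> (\<Oplus>\<kappa>\<in>{..<l}. ?f w l \<kappa>))"
    by (rule finsum_addf; rule Pi_I) (use gc sc d[OF a] x[OF a] in \<open>simp_all add: m_closed del: m_assoc\<close>)
  also have "(\<Oplus>l\<in>{..<length w}. d a \<otimes> ?g l) = d a \<otimes> word_deriv y e z w"
    unfolding word_deriv_def using gc d[OF a] by (intro finsum_rdistr[symmetric] Pi_I) simp_all
  also have "(\<Oplus>l\<in>{..<length w}. x a \<otimes> (\<Oplus>\<kappa>\<in>{..<l}. ?f w l \<kappa>)) = x a \<otimes> word_deriv2 x d y e z w"
    unfolding word_deriv2_def using sc x[OF a] by (intro finsum_rdistr[symmetric] Pi_I) simp_all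
  finally show ?thesis
    using word_deriv_closed[where W = W and x = y and d = e and y = z, OF y e z w]
      word_deriv2_closed[where W = W and x = x and d = d and y = y and e = e and z = z, OF x d y e z w] d[OF a] x[OF a]
    by simp
qed

end

lemma ring_hom_word_prod:
  assumes "ring R" "ring S" and h: "h \<in> ring_hom R S"
    and x: "\<And>a. a \<in> set w \<Longrightarrow> x a \<in> carrier R" and hx: "\<And>a. a \<in> set w \<Longrightarrow> h (x a) = x' a"
  shows "h (word_prod R x w) = word_prod S x' w"
proof -
  interpret R: ring R by fact
  interpret S: ring S by fact
  show ?thesis using x hx
  proof (induction w)
    case (Cons a w)
    then show ?case using R.word_prod_in[of w x] by (simp add: ring_hom_mult[OF h])
  qed (simp add: ring_hom_one[OF h])
qed

lemma ring_hom_word_deriv: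
  assumes "ring R" "ring S" and h: "h \<in> ring_hom R S"
    and R: "\<And>a. a \<in> set w \<Longrightarrow> x a \<in> carrier R" "\<And>a. a \<in> set w \<Longrightarrow> d a \<in> carrier R" "\<And>a. a \<in> set w \<Longrightarrow> y a \<in> carrier R"
    and hx: "\<And>a. a \<in> set w \<Longrightarrow> h (x a) = x' a" and hd: "\<And>a. a \<in> set w \<Longrightarrow> h (d a) = d' a"
    and hy: "\<And>a. a \<in> set w \<Longrightarrow> h (y a) = y' a"
  shows "h (ring.word_deriv R x d y w) = ring.word_deriv S x' d' y' w"
proof -
  interpret R: ring R by fact
  interpret S: ring S by fact
  note c = ring_hom_closed[OF h]
  show ?thesis using R hx hd hy
  proof (induction w)
    case (Cons a w)
    have 1: "R.word_deriv x d y (a # w) = d a \<otimes>\<^bsub>R\<^esub> word_prod R y w \<oplus>\<^bsub>R\<^esub> x a \<otimes>\<^bsub>R\<^esub> R.word_deriv x d y w"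
      by (rule R.word_deriv_Cons[where W = "set (a # w)"]) (use Cons.prems in auto)
    have 2: "S.word_deriv x' d' y' (a # w) = d' a \<otimes>\<^bsub>S\<^esub> word_prod S y' w \<oplus>\<^bsub>S\<^esub> x' a \<otimes>\<^bsub>S\<^esub> S.word_deriv x' d' y' w"
      by (rule S.word_deriv_Cons[where W = "set (a # w)"])
        (use Cons.prems c in \<open>auto simp: Cons.prems(4-6)[symmetric]\<close>)
    have 3: "R.word_deriv x d y w \<in> carrier R"
      by (rule R.word_deriv_closed[where W = "set w"]) (use Cons.prems in auto)
    have 4: "word_prod R y w \<in> carrier R" by (rule R.word_prod_in) (use Cons.prems in auto)
    have 5: "h (word_prod R y w) = word_prod S y' w"
      by (rule ring_hom_word_prod[OF assms(1-3)]) (use Cons.prems in auto)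
    have 6: "h (R.word_deriv x d y w) = S.word_deriv x' d' y' w" by (rule Cons.IH) (use Cons.prems in auto)
    have 7: "x a \<in> carrier R" "d a \<in> carrier R" "h (x a) = x' a" "h (d a) = d' a" using Cons.prems by auto
    show ?case unfolding 1 2 using 3 4 5 6 7 by (simp add: ring_hom_add[OF h] ring_hom_mult[OF h])
  qed (simp add: additive_zero[OF R.abelian_group_axioms S.abelian_group_axioms ring_hom_additive[OF h]])
qed

context tate_setup
begin

section \<open>The differential of the tensor product\<close>

lemma TT_even_central: assumes u: "u \<in> grTT i" "even i" and z: "z \<in> carrier TT"
  shows "u \<otimes>\<^bsub>TT\<^esub> z = z \<otimes>\<^bsub>TT\<^esub> u"
  using z
proof (induction rule: TT_induct)
  case (tens s t j k)
  then show ?case using TTg.gr_comm_even[OF u(1) grTT_tens[OF tens]] u(2) by blast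
qed (use grTT_carrier[OF u(1)] in \<open>simp_all add: TT.l_distr TT.r_distr\<close>)

lemma diffT_right: "\<lbrakk>s \<in> carrier T; c \<in> carrier A\<rbrakk> \<Longrightarrow> diffT (s \<otimes>\<^bsub>T\<^esub> rightT c) = diffT s \<otimes>\<^bsub>T\<^esub> rightT c"
  using T_central[OF rightT_in, of c s] T_central[OF rightT_in, of c "diffT s"] diffT_scal[of "tensA \<one>\<^bsub>A\<^esub> c" s]
  by (simp add: rightT_def)

lemma diffT_left: "\<lbrakk>s \<in> carrier T; c \<in> carrier A\<rbrakk> \<Longrightarrow> diffT (leftT c \<otimes>\<^bsub>T\<^esub> s) = leftT c \<otimes>\<^bsub>T\<^esub> diffT s"
  using diffT_scal[of "tensA c \<one>\<^bsub>A\<^esub>" s] by (simp add: leftT_def)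

lemma diffTT_balanced:
  "TTp.balanced TT (\<lambda>p. tensT (diffT (fst p)) (snd p) \<oplus>\<^bsub>TT\<^esub> tensT (signT (fst p)) (diffT (snd p)))"
  unfolding TTp.balanced_def fst_conv snd_conv
  by (simp add: diffT_right diffT_left signT_right tensT_right_left diffT_add additive_add[OF signT_additive]
      tensT_add_left tensT_add_right TTp.TR.a_ac)

lemma diffTT_eq:
  "diffTT = add_lift TT (\<lambda>p. tensT (diffT (fst p)) (snd p) \<oplus>\<^bsub>TT\<^esub> tensT (signT (fst p)) (diffT (snd p)))"
  unfolding diffTT_def add_lift_def ..

lemma diffTT_additive: "diffTT \<in> hom (add_monoid TT) (add_monoid TT)"
  unfolding diffTT_eq by (rule TTp.tensor_lift_hom[OF TTp.TR_abelian diffTT_balanced])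

lemmas diffTT_closed [simp] = additive_closed[OF diffTT_additive]
lemmas diffTT_add = additive_add[OF diffTT_additive]
lemmas diffTT_zero [simp] = additive_zero[OF TTp.TR_abelian TTp.TR_abelian diffTT_additive]
lemmas diffTT_minus = additive_minus[OF TTp.TR_abelian TTp.TR_abelian diffTT_additive]
lemmas diffTT_finsum = additive_finsum[OF TTp.TR_abelian TTp.TR_abelian diffTT_additive]

lemma diffTT_tensT: "\<lbrakk>s \<in> carrier T; t \<in> carrier T\<rbrakk> \<Longrightarrow>
    diffTT (tensT s t) = tensT (diffT s) t \<oplus>\<^bsub>TT\<^esub> tensT (signT s) (diffT t)"
  unfolding diffTT_eq tensT_eq[of s t] by (simp add: TTp.tensor_lift_tens[OF TTp.TR_abelian diffTT_balanced])

lemma signT_one [simp]: "signT \<one>\<^bsub>T\<^esub> = \<one>\<^bsub>T\<^esub>" using signT_gr[OF Ta.TA.gr_one] by simp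

lemma diffTT_fst: "s \<in> carrier T \<Longrightarrow> diffTT (fst_incl s) = fst_incl (diffT s)"
  and diffTT_snd: "s \<in> carrier T \<Longrightarrow> diffTT (snd_incl s) = snd_incl (diffT s)"
  by (simp_all add: fst_incl_def snd_incl_def diffTT_tensT diffT_one)

text \<open>The differential changes the parity and hence anticommutes with the involution. Degree
  zero is separate because of truncated subtraction; there both sides vanish.\<close>

lemma signT_diffT: "u \<in> carrier T \<Longrightarrow> signT (diffT u) = \<ominus>\<^bsub>T\<^esub> diffT (signT u)"
proof (induction rule: T_gr_induct)
  case (add u v)
  then show ?case by (simp add: diffT_add additive_add[OF signT_additive] Ta.BA.minus_add)
next
  case (gr n u)
  note d = diffT_gr[OF gr] and uc = Ta.tgr_carrier[OF gr]
  show ?case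
  proof (cases "n = 0")
    case True
    then show ?thesis using d(2) signT_gr[OF gr] by simp
  next
    case False
    then show ?thesis using signT_gr[OF d(1)] signT_gr[OF gr] uc by (simp add: diffT_uminus Ta.BA.minus_minus)
  qed
qed simp

text \<open>For homogeneous \<open>x\<close> the element \<open>x'\<close> is \<open>(-1)\<^bsup>|x|\<^esup> x\<close>; without reference to a degree the condition
  passes to sums and products.\<close>

definition leibniz where
  "leibniz x x' \<longleftrightarrow> x \<in> carrier TT \<and> x' \<in> carrier TT \<and>
    (\<forall>z\<in>carrier TT. diffTT (x \<otimes>\<^bsub>TT\<^esub> z) = diffTT x \<otimes>\<^bsub>TT\<^esub> z \<oplus>\<^bsub>TT\<^esub> x' \<otimes>\<^bsub>TT\<^esub> diffTT z)"

lemma leibniz_add: "\<lbrakk>leibniz x x'; leibniz y y'\<rbrakk> \<Longrightarrow> leibniz (x \<oplus>\<^bsub>TT\<^esub> y) (x' \<oplus>\<^bsub>TT\<^esub> y')"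
  by (simp add: leibniz_def TT.l_distr diffTT_add TTp.TR.a_ac)

lemma leibniz_mult:
  assumes "leibniz x x'" "leibniz y y'" shows "leibniz (x \<otimes>\<^bsub>TT\<^esub> y) (x' \<otimes>\<^bsub>TT\<^esub> y')"
proof -
  note [simp] = assms[unfolded leibniz_def, THEN conjunct1] assms[unfolded leibniz_def, THEN conjunct2, THEN conjunct1]
    and L = assms[unfolded leibniz_def, THEN conjunct2, THEN conjunct2, rule_format]
  have "diffTT (x \<otimes>\<^bsub>TT\<^esub> y \<otimes>\<^bsub>TT\<^esub> z) = diffTT (x \<otimes>\<^bsub>TT\<^esub> y) \<otimes>\<^bsub>TT\<^esub> z \<oplus>\<^bsub>TT\<^esub> x' \<otimes>\<^bsub>TT\<^esub> y' \<otimes>\<^bsub>TT\<^esub> diffTT z"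
    if "z \<in> carrier TT" for z
    using that by (simp add: TT.m_assoc L TT.l_distr TT.r_distr TTp.TR.a_assoc)
  then show ?thesis by (simp add: leibniz_def)
qed

lemma leibniz_fst: assumes s: "s \<in> carrier T" shows "leibniz (fst_incl s) (fst_incl (signT s))"
proof -
  have "diffTT (fst_incl s \<otimes>\<^bsub>TT\<^esub> z) = diffTT (fst_incl s) \<otimes>\<^bsub>TT\<^esub> z \<oplus>\<^bsub>TT\<^esub> fst_incl (signT s) \<otimes>\<^bsub>TT\<^esub> diffTT z"
    if "z \<in> carrier TT" for z
    using that
  proof (induction rule: TT_induct)
    case (tens s' t' i j)
    note c = Ta.tgr_carrier[OF tens(1)] Ta.tgr_carrier[OF tens(2)]
    have f: "fst_incl u \<otimes>\<^bsub>TT\<^esub> tensT p q = tensT (u \<otimes>\<^bsub>T\<^esub> p) q" if "u \<in> carrier T" "p \<in> carrier T" "q \<in> carrier T" for u p q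
      using that fst_snd[of "u \<otimes>\<^bsub>T\<^esub> p" q] fst_snd[of p q] by (simp add: fst_incl_mult TT.m_assoc)
    show ?case using s c
      by (simp add: diffTT_fst f diffTT_tensT diffT_mult signT_mult tensT_add_left TT.r_distr TTp.TR.a_assoc)
  qed (use s in \<open>simp_all add: TT.r_distr diffTT_add TTp.TR.a_ac\<close>)
  then show ?thesis using s by (simp add: leibniz_def)
qed

lemma leibniz_snd: assumes t: "t \<in> carrier T" shows "leibniz (snd_incl t) (snd_incl (signT t))"
proof -
  have "diffTT (snd_incl t \<otimes>\<^bsub>TT\<^esub> z) = diffTT (snd_incl t) \<otimes>\<^bsub>TT\<^esub> z \<oplus>\<^bsub>TT\<^esub> snd_incl (signT t) \<otimes>\<^bsub>TT\<^esub> diffTT z"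
    if "z \<in> carrier TT" for z
    using that
  proof (induction rule: TT_induct)
    case (tens s' t' i j)
    note c = Ta.tgr_carrier[OF tens(1)] Ta.tgr_carrier[OF tens(2)]
    have f: "snd_incl u \<otimes>\<^bsub>TT\<^esub> tensT p q = tensT p (signpow k u \<otimes>\<^bsub>T\<^esub> q)"
      if "u \<in> carrier T" "p \<in> grT k" "q \<in> carrier T" for u p q k
      using that tensT_mult[of "\<one>\<^bsub>T\<^esub>" u p k q] Ta.tgr_carrier[OF that(2)] by (simp add: snd_incl_def)
    \<comment> \<open>The degree of \<open>diffT s'\<close> is one less than that of
      \<open>s'\<close>, which compensates the involution on \<open>t\<close>. For i = 0 the
      subtraction is truncated, but then \<open>diffT s'\<close> is zero.\<close>
    have 1: "snd_incl (signT t) \<otimes>\<^bsub>TT\<^esub> tensT (diffT s') t' = tensT (diffT s') (signpow i t \<otimes>\<^bsub>T\<^esub> t')"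
    proof (cases "i = 0")
      case True
      then show ?thesis using diffT_gr(2)[OF tens(1)] c t by simp
    next
      case False
      then have "signpow (i - 1) (signT t) = signpow i t" using t by (simp add: signpow_def signT_signT)
      then show ?thesis using f[OF _ diffT_gr(1)[OF tens(1)] c(2), of "signT t"] t by simp
    qed
    have 2: "snd_incl (signT t) \<otimes>\<^bsub>TT\<^esub> tensT (signT s') (diffT t') = tensT (signT s') (signpow i (signT t) \<otimes>\<^bsub>T\<^esub> diffT t')"
      using f[OF _ signT_in[OF tens(1)], of "signT t" "diffT t'"] c t by simp
    \<comment> \<open>The sign of \<open>signT s'\<close> cancels the one from the anticommutation
      of \<open>diffT\<close> with the involution.\<close>
    have 3: "tensT (signT s') (diffT (signpow i t) \<otimes>\<^bsub>T\<^esub> t') = tensT s' (signpow i (diffT t) \<otimes>\<^bsub>T\<^esub> t')"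
      using signT_gr[OF tens(1)] c t signT_diffT[OF t]
      by (simp add: signpow_def tensT_uminus Ta.BA.l_minus Ta.BA.minus_minus)
    have 4: "signT (signpow i t) = signpow i (signT t)" by (simp add: signpow_def)
    show ?case using t c f[OF t tens(1) c(2)] f[OF _ tens(1) c(2), of "diffT t"] 1 2 3 4
      by (simp add: diffTT_snd diffTT_tensT diffT_mult tensT_add_right TT.r_distr TTp.TR.a_ac)
  qed (use t in \<open>simp_all add: TT.r_distr diffTT_add TTp.TR.a_ac\<close>)
  then show ?thesis using t by (simp add: leibniz_def)
qed

lemma leibniz_gr: "u \<in> grTT n \<Longrightarrow> leibniz u (if even n then u else \<ominus>\<^bsub>TT\<^esub> u)"
proof (induction rule: grTT_induct)
  case zero
  then show ?case by (simp add: leibniz_def)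
next
  case (add u v)
  then show ?case using leibniz_add[OF add(3,4)] grTT_carrier[OF add(1)] grTT_carrier[OF add(2)]
    by (auto simp: TTp.TR.minus_add)
next
  case (tens s t i j)
  note c = Ta.tgr_carrier[OF tens(1)] Ta.tgr_carrier[OF tens(2)]
  have "leibniz (tensT s t) (tensT (signT s) (signT t))"
    using leibniz_mult[OF leibniz_fst[OF c(1)] leibniz_snd[OF c(2)]] c by (simp add: fst_snd)
  moreover have "tensT (signT s) (signT t) = (if even n then tensT s t else \<ominus>\<^bsub>TT\<^esub> tensT s t)"
    using c signT_gr[OF tens(1)] signT_gr[OF tens(2)] tens(3) by (auto simp: tensT_uminus TTp.TR.minus_minus)
  ultimately show ?case by simp
qed

lemma diffTT_mult_even:
  "\<lbrakk>u \<in> grTT n; even n; z \<in> carrier TT\<rbrakk> \<Longrightarrow> diffTT (u \<otimes>\<^bsub>TT\<^esub> z) = diffTT u \<otimes>\<^bsub>TT\<^esub> z \<oplus>\<^bsub>TT\<^esub> u \<otimes>\<^bsub>TT\<^esub> diffTT z"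
  using leibniz_gr[of u n] by (simp add: leibniz_def)

lemma diffTT_mult_odd:
  "\<lbrakk>u \<in> grTT n; odd n; z \<in> carrier TT\<rbrakk> \<Longrightarrow> diffTT (u \<otimes>\<^bsub>TT\<^esub> z) = diffTT u \<otimes>\<^bsub>TT\<^esub> z \<ominus>\<^bsub>TT\<^esub> u \<otimes>\<^bsub>TT\<^esub> diffTT z"
  using leibniz_gr[of u n] grTT_carrier[of u n] by (simp add: leibniz_def TT.l_minus a_minus_def)

end

context tate_setup
begin

section \<open>The values on the generators\<close>

lemma T_ring: "ring T" by (rule Ta.BA.ring_axioms)

abbreviation xL where "xL a \<equiv> leftT (varA a)"
abbreviation xR where "xR a \<equiv> rightT (varA a)"
abbreviation wd where "wd w \<equiv> ring.word_deriv T xL dx xR w"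
abbreviation corr where
  "corr w \<equiv> ring.word_deriv2 TT (\<lambda>a. fst_incl (xL a)) (\<lambda>a. fst_incl (dx a)) (\<lambda>a. fst_incl (xR a))
      (\<lambda>a. snd_incl (dx a)) (\<lambda>a. snd_incl (xR a)) w"

lemma wd_Cons: "\<lbrakk>a \<in> X; set w \<subseteq> X\<rbrakk> \<Longrightarrow> wd (a # w) = dx a \<otimes>\<^bsub>T\<^esub> word_prod T xR w \<oplus>\<^bsub>T\<^esub> xL a \<otimes>\<^bsub>T\<^esub> wd w"
  by (rule ring.word_deriv_Cons[OF T_ring, where W = X]) auto

lemma word_T_in:
  assumes "set w \<subseteq> X"
  shows "word_prod T xL w \<in> grT 0" "word_prod T xR w \<in> grT 0" "wd w \<in> grT 1"
proof -
  show p: "word_prod T xL w \<in> grT 0" "word_prod T xR w \<in> grT 0"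
    using assms by (auto intro!: word_prod_closed leftT_in rightT_in)
  show "wd w \<in> grT 1" using assms
  proof (induction w)
    case Nil
    then show ?case by (simp add: ring.word_deriv_Nil[OF T_ring])
  next
    case (Cons a w)
    then have a: "a \<in> X" and w: "set w \<subseteq> X" by auto
    have "word_prod T xR w \<in> grT 0" using w by (auto intro!: word_prod_closed rightT_in)
    then have 1: "dx a \<otimes>\<^bsub>T\<^esub> word_prod T xR w \<in> grT (1 + 0)" by (rule Ta.TA.gr_mult[OF dx_in[OF a]])
    have "xL a \<otimes>\<^bsub>T\<^esub> wd w \<in> grT (0 + 1)" by (rule Ta.TA.gr_mult[OF leftT_in[OF varA_closed[OF a]] Cons.IH[OF w]])
    then show ?case unfolding wd_Cons[OF a w] using 1 by (simp add: Ta.tgr_add)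
  qed
qed

lemmas word_T_closed = word_T_in[THEN Ta.tgr_carrier]

lemma diffT_0: "u \<in> grT 0 \<Longrightarrow> diffT u = \<zero>\<^bsub>T\<^esub>" by (rule diffT_gr(2)) auto

text \<open>The sum telescopes letter by letter: (x'' - x') w'' + x' (w'' - w') = x'' w'' - x'
  w'.\<close>

lemma diffT_wd: "set w \<subseteq> X \<Longrightarrow> diffT (wd w) = word_prod T xR w \<ominus>\<^bsub>T\<^esub> word_prod T xL w"
proof (induction w)
  case Nil
  then show ?case by (simp add: ring.word_deriv_Nil[OF T_ring] Ta.BA.word_prod_Nil a_minus_def Ta.BA.r_neg)
next
  case (Cons a w)
  then have a: "a \<in> X" and w: "set w \<subseteq> X" by auto
  note c = word_T_closed[OF w]
  have "diffT (wd (a # w)) = (xR a \<ominus>\<^bsub>T\<^esub> xL a) \<otimes>\<^bsub>T\<^esub> word_prod T xR w \<oplus>\<^bsub>T\<^esub> xL a \<otimes>\<^bsub>T\<^esub> (word_prod T xR w \<ominus>\<^bsub>T\<^esub> word_prod T xL w)"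
    unfolding wd_Cons[OF a w] using a c diffT_0[OF word_T_in(2)[OF w]] Cons.IH[OF w]
    by (simp add: diffT_add diffT_dx_mult diffT_left tv_def a_minus_def)
  also have "\<dots> = xR a \<otimes>\<^bsub>T\<^esub> word_prod T xR w \<ominus>\<^bsub>T\<^esub> xL a \<otimes>\<^bsub>T\<^esub> word_prod T xL w"
    using a c by (simp add: a_minus_def Ta.BA.l_distr Ta.BA.r_distr Ta.BA.l_minus Ta.BA.r_minus Ta.BA.a_assoc Ta.BA.r_neg1)
  finally show ?case by (simp add: Ta.BA.word_prod_Cons)
qed

lemma diff_df_word:
  assumes b: "b \<in> B"
  shows "diff_df b = (\<Oplus>\<^bsub>T\<^esub>w\<in>words b. leftT (scalA (\<alpha> b w)) \<otimes>\<^bsub>T\<^esub> wd w)"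
  unfolding diff_df_def
proof (rule Ta.BA.finsum_cong'[OF refl])
  show "(\<lambda>w. leftT (scalA (\<alpha> b w)) \<otimes>\<^bsub>T\<^esub> wd w) \<in> words b \<rightarrow> carrier T"
    using words_set[OF b] \<alpha>_closed[OF b] word_T_closed(3) by auto
  fix w assume w: "w \<in> words b"
  note W = words_set[OF b w]
  have c: "leftT (scalA (\<alpha> b w)) \<in> carrier T" using \<alpha>_closed[OF b] by simp
  have t: "word_prod T xL (take \<kappa> w) \<in> carrier T" "dx (w ! \<kappa>) \<in> carrier T" "word_prod T xR (drop (Suc \<kappa>) w) \<in> carrier T"
    if "\<kappa> < length w" for \<kappa>
    using ring.word_deriv_term[OF T_ring, where W = X and x = xL and d = dx and y = xR, OF _ _ _ W that] by auto
  show "(\<Oplus>\<^bsub>T\<^esub>\<kappa>\<in>{..<length w}. leftT (scalA (\<alpha> b w)) \<otimes>\<^bsub>T\<^esub> word_prod T xL (take \<kappa> w) \<otimes>\<^bsub>T\<^esub> dx (w ! \<kappa>) \<otimes>\<^bsub>T\<^esub>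
      word_prod T xR (drop (Suc \<kappa>) w)) = leftT (scalA (\<alpha> b w)) \<otimes>\<^bsub>T\<^esub> wd w"
    unfolding ring.word_deriv_def[OF T_ring] using c t
    by (subst Ta.BA.finsum_rdistr) (auto simp: Ta.BA.m_assoc intro!: Ta.BA.finsum_cong')
qed

lemma incl_zero [simp]: "fst_incl \<zero>\<^bsub>T\<^esub> = \<zero>\<^bsub>TT\<^esub>" "snd_incl \<zero>\<^bsub>T\<^esub> = \<zero>\<^bsub>TT\<^esub>"
  by (simp_all add: fst_incl_def snd_incl_def)

lemma diffT_df_1: "b \<in> B \<Longrightarrow> diffT (df b) = diff_df b"
  using diffT_df[of b 0] by (simp add: df_eq)

lemma snd_wd: "set w \<subseteq> X \<Longrightarrow>
    ring.word_deriv TT (\<lambda>a. fst_incl (xR a)) (\<lambda>a. snd_incl (dx a)) (\<lambda>a. snd_incl (xR a)) w = snd_incl (wd w)"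
  by (rule ring_hom_word_deriv[OF T_ring TT_ring snd_incl_hom, symmetric]) (auto simp: middle subset_iff)

text \<open>If \<open>a\<close> is the earlier differentiated letter, everything to its right lies
  in the second factor: the variables between the two letters belong to the middle copy of
  \<open>A\<close> and are the left variables there.\<close>

lemma corr_Cons:
  assumes "a \<in> X" "set w \<subseteq> X"
  shows "corr (a # w) = tensT (dx a) (wd w) \<oplus>\<^bsub>TT\<^esub> fst_incl (xL a) \<otimes>\<^bsub>TT\<^esub> corr w"
proof -
  have "corr (a # w) = fst_incl (dx a) \<otimes>\<^bsub>TT\<^esub>
      ring.word_deriv TT (\<lambda>a. fst_incl (xR a)) (\<lambda>a. snd_incl (dx a)) (\<lambda>a. snd_incl (xR a)) w \<oplus>\<^bsub>TT\<^esub> fst_incl (xL a) \<otimes>\<^bsub>TT\<^esub> corr w"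
    by (rule ring.word_deriv2_Cons[OF TT_ring, where W = X]) (use assms in auto)
  then show ?thesis unfolding snd_wd[OF assms(2)] using assms word_T_closed(3)[OF assms(2)] by (simp add: fst_snd)
qed

lemma corr_closed: "set w \<subseteq> X \<Longrightarrow> corr w \<in> carrier TT"
  by (rule ring.word_deriv2_closed[OF TT_ring, where W = X]) auto

lemma Phi_df_word:
  assumes b: "b \<in> B"
  shows "Phi_df b = fst_incl (df b) \<oplus>\<^bsub>TT\<^esub> snd_incl (df b) \<ominus>\<^bsub>TT\<^esub>
    (\<Oplus>\<^bsub>TT\<^esub>w\<in>words b. fst_incl (leftT (scalA (\<alpha> b w))) \<otimes>\<^bsub>TT\<^esub> corr w)"
proof -
  have "(\<Oplus>\<^bsub>TT\<^esub>l\<in>{..<length w}. \<Oplus>\<^bsub>TT\<^esub>\<kappa>\<in>{..<l}.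
        fst_incl (leftT (scalA (\<alpha> b w))) \<otimes>\<^bsub>TT\<^esub> word_prod TT (\<lambda>a. fst_incl (xL a)) (take \<kappa> w) \<otimes>\<^bsub>TT\<^esub>
        fst_incl (dx (w ! \<kappa>)) \<otimes>\<^bsub>TT\<^esub> word_prod TT (\<lambda>a. fst_incl (xR a)) (take (l - Suc \<kappa>) (drop (Suc \<kappa>) w)) \<otimes>\<^bsub>TT\<^esub>
        snd_incl (dx (w ! l)) \<otimes>\<^bsub>TT\<^esub> word_prod TT (\<lambda>a. snd_incl (xR a)) (drop (Suc l) w))
      = fst_incl (leftT (scalA (\<alpha> b w))) \<otimes>\<^bsub>TT\<^esub> corr w" if w: "w \<in> words b" for w
  proof -
    let ?c = "fst_incl (leftT (scalA (\<alpha> b w)))"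
    let ?t = "\<lambda>l \<kappa>. word_prod TT (\<lambda>a. fst_incl (xL a)) (take \<kappa> w) \<otimes>\<^bsub>TT\<^esub>
        fst_incl (dx (w ! \<kappa>)) \<otimes>\<^bsub>TT\<^esub> word_prod TT (\<lambda>a. fst_incl (xR a)) (take (l - Suc \<kappa>) (drop (Suc \<kappa>) w)) \<otimes>\<^bsub>TT\<^esub>
        snd_incl (dx (w ! l)) \<otimes>\<^bsub>TT\<^esub> word_prod TT (\<lambda>a. snd_incl (xR a)) (drop (Suc l) w)"
    note W = words_set[OF b w]
    have c: "?c \<in> carrier TT" using \<alpha>_closed[OF b] by simp
    note tt = ring.word_deriv2_term[OF TT_ring, where W = X and x = "\<lambda>a. fst_incl (xL a)" and d = "\<lambda>a. fst_incl (dx a)"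
        and y = "\<lambda>a. fst_incl (xR a)" and e = "\<lambda>a. snd_incl (dx a)" and z = "\<lambda>a. snd_incl (xR a)", OF _ _ _ _ _ W]
    have t: "word_prod TT (\<lambda>a. fst_incl (xL a)) (take \<kappa> w) \<in> carrier TT" "fst_incl (dx (w ! \<kappa>)) \<in> carrier TT"
      "word_prod TT (\<lambda>a. fst_incl (xR a)) (take (l - Suc \<kappa>) (drop (Suc \<kappa>) w)) \<in> carrier TT"
      "snd_incl (dx (w ! l)) \<in> carrier TT" "word_prod TT (\<lambda>a. snd_incl (xR a)) (drop (Suc l) w) \<in> carrier TT"
      if "l < length w" "\<kappa> < l" for l \<kappa>
      using tt[OF _ _ _ _ _ that] by auto
    have tc: "?t l \<kappa> \<in> carrier TT" if "l < length w" "\<kappa> < l" for l \<kappa>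
      using t[OF that] by (intro TT.m_closed)
    have sc: "(\<Oplus>\<^bsub>TT\<^esub>\<kappa>\<in>{..<l}. ?t l \<kappa>) \<in> carrier TT" if "l < length w" for l
      using tc[OF that] by (intro TTp.TR.finsum_closed) auto
    have "(\<Oplus>\<^bsub>TT\<^esub>l\<in>{..<length w}. \<Oplus>\<^bsub>TT\<^esub>\<kappa>\<in>{..<l}. ?c \<otimes>\<^bsub>TT\<^esub> word_prod TT (\<lambda>a. fst_incl (xL a)) (take \<kappa> w) \<otimes>\<^bsub>TT\<^esub>
        fst_incl (dx (w ! \<kappa>)) \<otimes>\<^bsub>TT\<^esub> word_prod TT (\<lambda>a. fst_incl (xR a)) (take (l - Suc \<kappa>) (drop (Suc \<kappa>) w)) \<otimes>\<^bsub>TT\<^esub>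
        snd_incl (dx (w ! l)) \<otimes>\<^bsub>TT\<^esub> word_prod TT (\<lambda>a. snd_incl (xR a)) (drop (Suc l) w))
      = (\<Oplus>\<^bsub>TT\<^esub>l\<in>{..<length w}. ?c \<otimes>\<^bsub>TT\<^esub> (\<Oplus>\<^bsub>TT\<^esub>\<kappa>\<in>{..<l}. ?t l \<kappa>))"
    proof (intro TTp.TR.finsum_cong' refl Pi_I TT.m_closed c)
      fix l assume "l \<in> {..<length w}"
      then have l: "l < length w" by simp
      show "(\<Oplus>\<^bsub>TT\<^esub>\<kappa>\<in>{..<l}. ?t l \<kappa>) \<in> carrier TT" by (rule sc[OF l])
      have "?c \<otimes>\<^bsub>TT\<^esub> (\<Oplus>\<^bsub>TT\<^esub>\<kappa>\<in>{..<l}. ?t l \<kappa>) = (\<Oplus>\<^bsub>TT\<^esub>\<kappa>\<in>{..<l}. ?c \<otimes>\<^bsub>TT\<^esub> ?t l \<kappa>)"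
        using tc[OF l] c by (intro TT.finsum_rdistr) auto
      also have "\<dots> = (\<Oplus>\<^bsub>TT\<^esub>\<kappa>\<in>{..<l}. ?c \<otimes>\<^bsub>TT\<^esub> word_prod TT (\<lambda>a. fst_incl (xL a)) (take \<kappa> w) \<otimes>\<^bsub>TT\<^esub>
        fst_incl (dx (w ! \<kappa>)) \<otimes>\<^bsub>TT\<^esub> word_prod TT (\<lambda>a. fst_incl (xR a)) (take (l - Suc \<kappa>) (drop (Suc \<kappa>) w)) \<otimes>\<^bsub>TT\<^esub>
        snd_incl (dx (w ! l)) \<otimes>\<^bsub>TT\<^esub> word_prod TT (\<lambda>a. snd_incl (xR a)) (drop (Suc l) w))"
        using t[OF l] c by (intro TTp.TR.finsum_cong' refl) (auto simp: TT.m_assoc)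
      finally show "(\<Oplus>\<^bsub>TT\<^esub>\<kappa>\<in>{..<l}. ?c \<otimes>\<^bsub>TT\<^esub> word_prod TT (\<lambda>a. fst_incl (xL a)) (take \<kappa> w) \<otimes>\<^bsub>TT\<^esub>
        fst_incl (dx (w ! \<kappa>)) \<otimes>\<^bsub>TT\<^esub> word_prod TT (\<lambda>a. fst_incl (xR a)) (take (l - Suc \<kappa>) (drop (Suc \<kappa>) w)) \<otimes>\<^bsub>TT\<^esub>
        snd_incl (dx (w ! l)) \<otimes>\<^bsub>TT\<^esub> word_prod TT (\<lambda>a. snd_incl (xR a)) (drop (Suc l) w))
        = ?c \<otimes>\<^bsub>TT\<^esub> (\<Oplus>\<^bsub>TT\<^esub>\<kappa>\<in>{..<l}. ?t l \<kappa>)" by (rule sym)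
    qed
    also have "\<dots> = ?c \<otimes>\<^bsub>TT\<^esub> corr w"
      unfolding ring.word_deriv2_def[OF TT_ring] using sc c by (intro TT.finsum_rdistr[symmetric]) auto
    finally show ?thesis .
  qed
  then have "(\<Oplus>\<^bsub>TT\<^esub>w\<in>words b. \<Oplus>\<^bsub>TT\<^esub>l\<in>{..<length w}. \<Oplus>\<^bsub>TT\<^esub>\<kappa>\<in>{..<l}.
        fst_incl (leftT (scalA (\<alpha> b w))) \<otimes>\<^bsub>TT\<^esub> word_prod TT (\<lambda>a. fst_incl (xL a)) (take \<kappa> w) \<otimes>\<^bsub>TT\<^esub>
        fst_incl (dx (w ! \<kappa>)) \<otimes>\<^bsub>TT\<^esub> word_prod TT (\<lambda>a. fst_incl (xR a)) (take (l - Suc \<kappa>) (drop (Suc \<kappa>) w)) \<otimes>\<^bsub>TT\<^esub>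
        snd_incl (dx (w ! l)) \<otimes>\<^bsub>TT\<^esub> word_prod TT (\<lambda>a. snd_incl (xR a)) (drop (Suc l) w))
      = (\<Oplus>\<^bsub>TT\<^esub>w\<in>words b. fst_incl (leftT (scalA (\<alpha> b w))) \<otimes>\<^bsub>TT\<^esub> corr w)"
    using corr_closed[OF words_set[OF b]] \<alpha>_closed[OF b] by (intro TTp.TR.finsum_cong' refl Pi_I TT.m_closed) auto
  then show ?thesis unfolding Phi_df_def by simp
qed

text \<open>The shape of the subtracted term of \<open>Phi_df\<close> as far as divided powers and
  counits are concerned. Each generating summand has zero divided powers from order 2 on, and sums
  are controlled by the addition formula.\<close>

inductive odd_sum where
  odd_sum_zero: "odd_sum \<zero>\<^bsub>TT\<^esub>"
| odd_sum_add: "\<lbrakk>odd_sum u; odd_sum v\<rbrakk> \<Longrightarrow> odd_sum (u \<oplus>\<^bsub>TT\<^esub> v)"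
| odd_sum_tens: "\<lbrakk>s \<in> grT 1; t \<in> grT 1\<rbrakk> \<Longrightarrow> odd_sum (tensT s t)"

lemma odd_sum_in: "odd_sum u \<Longrightarrow> u \<in> grTT 2"
proof (induction rule: odd_sum.induct)
  case (odd_sum_tens s t)
  then show ?case using grTT_tens[of s 1 t 1] by (simp add: numeral_2_eq_2)
qed (simp_all add: grTT_add)

lemma odd_sum_uminus: "odd_sum u \<Longrightarrow> odd_sum (\<ominus>\<^bsub>TT\<^esub> u)"
proof (induction rule: odd_sum.induct)
  case (odd_sum_add u v)
  then show ?case using odd_sum_in[THEN grTT_carrier] by (simp add: TTp.TR.minus_add odd_sum.intros)
next
  case (odd_sum_tens s t)
  have "\<ominus>\<^bsub>TT\<^esub> tensT s t = tensT (\<ominus>\<^bsub>T\<^esub> s) t"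
    using tensT_uminus(1)[of s t] odd_sum_tens[THEN Ta.tgr_carrier] by simp
  then show ?case using odd_sum.odd_sum_tens[OF Ta.tgr_uminus[OF odd_sum_tens(1)] odd_sum_tens(2)] by simp
qed (simp add: odd_sum_zero)

lemma odd_sum_scale: assumes c: "c \<in> grT 0" shows "odd_sum u \<Longrightarrow> odd_sum (fst_incl c \<otimes>\<^bsub>TT\<^esub> u)"
proof (induction rule: odd_sum.induct)
  case odd_sum_zero
  then show ?case using Ta.tgr_carrier[OF c] by (simp add: odd_sum.odd_sum_zero)
next
  case (odd_sum_add u v)
  then show ?case using odd_sum_in[THEN grTT_carrier] Ta.tgr_carrier[OF c] by (simp add: TT.r_distr odd_sum.intros)
next
  case (odd_sum_tens s t)
  note cl = odd_sum_tens[THEN Ta.tgr_carrier] Ta.tgr_carrier[OF c]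
  have "fst_incl c \<otimes>\<^bsub>TT\<^esub> tensT s t = tensT (c \<otimes>\<^bsub>T\<^esub> s) t"
    using cl fst_snd[of "c \<otimes>\<^bsub>T\<^esub> s" t] fst_snd[of s t] by (simp add: fst_incl_mult TT.m_assoc)
  moreover have "c \<otimes>\<^bsub>T\<^esub> s \<in> grT 1" using Ta.TA.gr_mult[OF c odd_sum_tens(1)] by simp
  ultimately show ?case using odd_sum_tens(2) by (simp add: odd_sum.odd_sum_tens)
qed

lemma odd_sum_finsum: "finite F \<Longrightarrow> (\<And>i. i \<in> F \<Longrightarrow> odd_sum (f i)) \<Longrightarrow> odd_sum (\<Oplus>\<^bsub>TT\<^esub>i\<in>F. f i)"
proof (induction F rule: finite_induct)
  case (insert i F)
  then have "f \<in> F \<rightarrow> carrier TT" "f i \<in> carrier TT" using odd_sum_in[THEN grTT_carrier] by auto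
  then show ?case using insert by (simp add: odd_sum_add)
qed (simp add: odd_sum_zero)

lemma odd_sum_corr: "set w \<subseteq> X \<Longrightarrow> odd_sum (corr w)"
proof (induction w)
  case Nil
  then show ?case by (simp add: ring.word_deriv2_Nil[OF TT_ring] odd_sum_zero)
next
  case (Cons a w)
  then have a: "a \<in> X" and w: "set w \<subseteq> X" by auto
  show ?case unfolding corr_Cons[OF a w]
    by (intro odd_sum_add odd_sum_tens dx_in[OF a] word_T_in(3)[OF w] odd_sum_scale leftT_in varA_closed[OF a] Cons.IH[OF w])
qed

lemma Phi_df_odd_sum:
  assumes b: "b \<in> B"
  obtains q where "odd_sum q" "Phi_df b = fst_incl (df b) \<oplus>\<^bsub>TT\<^esub> snd_incl (df b) \<oplus>\<^bsub>TT\<^esub> q"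
proof
  show "odd_sum (\<ominus>\<^bsub>TT\<^esub> (\<Oplus>\<^bsub>TT\<^esub>w\<in>words b. fst_incl (leftT (scalA (\<alpha> b w))) \<otimes>\<^bsub>TT\<^esub> corr w))"
    using words_finite[OF b] words_set[OF b] \<alpha>_closed[OF b]
    by (intro odd_sum_uminus odd_sum_finsum odd_sum_scale odd_sum_corr leftT_in) auto
qed (simp add: Phi_df_word[OF b] a_minus_def)

lemma incl_df_in: "b \<in> B \<Longrightarrow> fst_incl (df b) \<in> grTT 2" "b \<in> B \<Longrightarrow> snd_incl (df b) \<in> grTT 2"
  by (simp_all add: fst_incl_in snd_incl_in df_in)

lemma Phi_df_in: "b \<in> B \<Longrightarrow> Phi_df b \<in> grTT 2"
  by (rule Phi_df_odd_sum[of b]) (simp_all add: grTT_add incl_df_in odd_sum_in)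

section \<open>The boundary of \<open>Phi_df\<close>\<close>

text \<open>The image of \<open>wd w\<close> under \<Phi>: x' before the differentiated letter, x''
  after it, and the sum of the two copies of \<open>dx\<close> at that letter.\<close>

abbreviation wdTT where
  "wdTT w \<equiv> ring.word_deriv TT (\<lambda>a. fst_incl (xL a)) (\<lambda>a. fst_incl (dx a) \<oplus>\<^bsub>TT\<^esub> snd_incl (dx a)) (\<lambda>a. snd_incl (xR a)) w"

lemma wdTT_closed: "set w \<subseteq> X \<Longrightarrow> wdTT w \<in> carrier TT"
  by (rule ring.word_deriv_closed[OF TT_ring, where W = X]) auto

lemma snd_word_prod: "set w \<subseteq> X \<Longrightarrow> word_prod TT (\<lambda>a. snd_incl (xR a)) w = snd_incl (word_prod T xR w)"
  by (rule ring_hom_word_prod[OF T_ring TT_ring snd_incl_hom, symmetric]) auto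

lemma wdTT_Cons:
  assumes "a \<in> X" "set w \<subseteq> X"
  shows "wdTT (a # w) = (fst_incl (dx a) \<oplus>\<^bsub>TT\<^esub> snd_incl (dx a)) \<otimes>\<^bsub>TT\<^esub> snd_incl (word_prod T xR w) \<oplus>\<^bsub>TT\<^esub> fst_incl (xL a) \<otimes>\<^bsub>TT\<^esub> wdTT w"
  unfolding snd_word_prod[OF assms(2), symmetric]
  by (rule ring.word_deriv_Cons[OF TT_ring, where W = X]) (use assms in auto)

lemma middle_word: assumes "set w \<subseteq> X" shows "fst_incl (word_prod T xR w) = snd_incl (word_prod T xL w)"
proof -
  have "fst_incl (word_prod T xR w) = word_prod TT (\<lambda>a. fst_incl (xR a)) w"
    by (rule ring_hom_word_prod[OF T_ring TT_ring fst_incl_hom]) (use assms in auto)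
  moreover have "snd_incl (word_prod T xL w) = word_prod TT (\<lambda>a. fst_incl (xR a)) w"
    by (rule ring_hom_word_prod[OF T_ring TT_ring snd_incl_hom]) (use assms in \<open>auto simp: middle subset_iff\<close>)
  ultimately show ?thesis by simp
qed

text \<open>The correction compensates for the middle variables: its boundary is the defect between
  differentiating in each factor separately and differentiating with the sum of the two
  \<open>dx\<close>. In the induction step the term x' times the derivative in the second factor
  occurs twice with opposite signs and cancels.\<close>

lemma diffTT_corr: "set w \<subseteq> X \<Longrightarrow> diffTT (corr w) = fst_incl (wd w) \<oplus>\<^bsub>TT\<^esub> snd_incl (wd w) \<ominus>\<^bsub>TT\<^esub> wdTT w"
proof (induction w)
  case Nil
  show ?case
    by (simp add: ring.word_deriv2_Nil[OF TT_ring] ring.word_deriv_Nil[OF TT_ring] ring.word_deriv_Nil[OF T_ring]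
        fst_incl_def snd_incl_def a_minus_def)
next
  case (Cons a w)
  then have a: "a \<in> X" and w: "set w \<subseteq> X" by auto
  note c = word_T_closed[OF w] wdTT_closed[OF w] corr_closed[OF w]
  have v: "varA a \<in> carrier A" using a by simp
  \<comment> \<open>\<open>?L\<close> and \<open>?M\<close> are the first letter evaluated in x' and
    in the middle variable; \<open>?R\<close> and \<open>?N\<close> are the rest of the word in x''
    and in the middle variable.\<close>
  let ?L = "fst_incl (xL a)" and ?M = "snd_incl (xL a)" and ?d = "fst_incl (dx a)" and ?e = "snd_incl (dx a)"
  let ?R = "snd_incl (word_prod T xR w)" and ?N = "snd_incl (word_prod T xL w)"
  have L0: "?L \<in> grTT 0" "diffTT ?L = \<zero>\<^bsub>TT\<^esub>"
    using fst_incl_in[OF leftT_in[OF v]] diffT_0[OF leftT_in[OF v]] v by (simp_all add: diffTT_fst)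
  have d: "?d \<in> grTT 1" by (rule fst_incl_in[OF dx_in[OF a]])
  have t: "fst_incl (tv a) = ?M \<ominus>\<^bsub>TT\<^esub> ?L"
    using v unfolding tv_def
    by (simp add: additive_minus[OF Ta.BA_abelian_group TTp.TR_abelian ring_hom_additive[OF fst_incl_hom]] middle)
  have 1: "diffTT (tensT (dx a) (wd w)) = (?M \<ominus>\<^bsub>TT\<^esub> ?L) \<otimes>\<^bsub>TT\<^esub> snd_incl (wd w) \<ominus>\<^bsub>TT\<^esub> ?d \<otimes>\<^bsub>TT\<^esub> (?R \<ominus>\<^bsub>TT\<^esub> ?N)"
    using diffTT_mult_odd[OF d _ snd_incl_closed[OF c(3)]] a c(1-3) fst_snd[of "dx a" "wd w"] t diffT_wd[OF w]
    by (simp add: diffTT_fst diffTT_snd diffT_dx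
        additive_minus[OF Ta.BA_abelian_group TTp.TR_abelian ring_hom_additive[OF snd_incl_hom]])
  have 2: "diffTT (?L \<otimes>\<^bsub>TT\<^esub> corr w) = ?L \<otimes>\<^bsub>TT\<^esub> (fst_incl (wd w) \<oplus>\<^bsub>TT\<^esub> snd_incl (wd w) \<ominus>\<^bsub>TT\<^esub> wdTT w)"
    using diffTT_mult_even[OF L0(1) _ c(5)] L0(2) c v Cons.IH[OF w] by simp
  have "diffTT (corr (a # w)) = (?M \<ominus>\<^bsub>TT\<^esub> ?L) \<otimes>\<^bsub>TT\<^esub> snd_incl (wd w) \<ominus>\<^bsub>TT\<^esub> ?d \<otimes>\<^bsub>TT\<^esub> (?R \<ominus>\<^bsub>TT\<^esub> ?N)
      \<oplus>\<^bsub>TT\<^esub> ?L \<otimes>\<^bsub>TT\<^esub> (fst_incl (wd w) \<oplus>\<^bsub>TT\<^esub> snd_incl (wd w) \<ominus>\<^bsub>TT\<^esub> wdTT w)"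
    unfolding corr_Cons[OF a w] using a v c 1 2 by (simp add: diffTT_add)
  also have "\<dots> = (?M \<otimes>\<^bsub>TT\<^esub> snd_incl (wd w) \<ominus>\<^bsub>TT\<^esub> ?L \<otimes>\<^bsub>TT\<^esub> snd_incl (wd w)) \<ominus>\<^bsub>TT\<^esub> (?d \<otimes>\<^bsub>TT\<^esub> ?R \<ominus>\<^bsub>TT\<^esub> ?d \<otimes>\<^bsub>TT\<^esub> ?N)
      \<oplus>\<^bsub>TT\<^esub> (?L \<otimes>\<^bsub>TT\<^esub> fst_incl (wd w) \<oplus>\<^bsub>TT\<^esub> ?L \<otimes>\<^bsub>TT\<^esub> snd_incl (wd w) \<ominus>\<^bsub>TT\<^esub> ?L \<otimes>\<^bsub>TT\<^esub> wdTT w)"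
    using a v c by (simp add: a_minus_def TT.l_distr TT.r_distr TT.l_minus TT.r_minus)
  also have "\<dots> = (?d \<otimes>\<^bsub>TT\<^esub> ?N \<oplus>\<^bsub>TT\<^esub> ?L \<otimes>\<^bsub>TT\<^esub> fst_incl (wd w)) \<oplus>\<^bsub>TT\<^esub> (?e \<otimes>\<^bsub>TT\<^esub> ?R \<oplus>\<^bsub>TT\<^esub> ?M \<otimes>\<^bsub>TT\<^esub> snd_incl (wd w))
      \<ominus>\<^bsub>TT\<^esub> ((?d \<otimes>\<^bsub>TT\<^esub> ?R \<oplus>\<^bsub>TT\<^esub> ?e \<otimes>\<^bsub>TT\<^esub> ?R) \<oplus>\<^bsub>TT\<^esub> ?L \<otimes>\<^bsub>TT\<^esub> wdTT w)"
    by (rule TTp.TR.cancel_identity) (use a v c in simp_all)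
  also have "\<dots> = fst_incl (wd (a # w)) \<oplus>\<^bsub>TT\<^esub> snd_incl (wd (a # w)) \<ominus>\<^bsub>TT\<^esub> wdTT (a # w)"
    unfolding wdTT_Cons[OF a w] wd_Cons[OF a w] using a v c
    by (simp add: fst_incl_add fst_incl_mult snd_incl_add snd_incl_mult middle_word[OF w] TT.l_distr)
  finally show ?case .
qed

lemma diffTT_Phi_df:
  assumes b: "b \<in> B"
  shows "diffTT (Phi_df b) = (\<Oplus>\<^bsub>TT\<^esub>w\<in>words b. fst_incl (leftT (scalA (\<alpha> b w))) \<otimes>\<^bsub>TT\<^esub> wdTT w)"
proof -
  let ?c = "\<lambda>w. fst_incl (leftT (scalA (\<alpha> b w)))"
  have k: "scalA (\<alpha> b w) \<in> carrier A" for w using \<alpha>_closed[OF b] by simp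
  have c: "?c w \<in> carrier TT" for w using k by simp
  have W: "wd w \<in> carrier T" "wdTT w \<in> carrier TT" "corr w \<in> carrier TT" if "w \<in> words b" for w
    using word_T_closed(3) wdTT_closed corr_closed words_set[OF b that] by auto
  have F: "diffTT (fst_incl (df b)) = (\<Oplus>\<^bsub>TT\<^esub>w\<in>words b. ?c w \<otimes>\<^bsub>TT\<^esub> fst_incl (wd w))"
  proof -
    have "diffTT (fst_incl (df b)) = (\<Oplus>\<^bsub>TT\<^esub>w\<in>words b. fst_incl (leftT (scalA (\<alpha> b w)) \<otimes>\<^bsub>T\<^esub> wd w))"
      unfolding diffTT_fst[OF df_closed[OF b]] diffT_df_1[OF b] diff_df_word[OF b] using k W
      by (intro additive_finsum[OF Ta.BA_abelian_group TTp.TR_abelian ring_hom_additive[OF fst_incl_hom]]) auto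
    also have "\<dots> = (\<Oplus>\<^bsub>TT\<^esub>w\<in>words b. ?c w \<otimes>\<^bsub>TT\<^esub> fst_incl (wd w))"
      using k W c by (intro TTp.TR.finsum_cong') (auto simp: fst_incl_mult)
    finally show ?thesis .
  qed
  \<comment> \<open>The coefficient comes from \<open>K\<close>, so it can be moved from the second
    factor through the middle copy of \<open>A\<close> to the first factor.\<close>
  have sc: "snd_incl (leftT (scalA (\<alpha> b w))) = ?c w" for w
  proof -
    have "snd_incl (leftT (scalA (\<alpha> b w))) = fst_incl (rightT (scalA (\<alpha> b w)))" by (rule middle[OF k, symmetric])
    then show ?thesis by (simp add: leftT_scalA[OF \<alpha>_closed[OF b], of w])
  qed
  have G: "diffTT (snd_incl (df b)) = (\<Oplus>\<^bsub>TT\<^esub>w\<in>words b. ?c w \<otimes>\<^bsub>TT\<^esub> snd_incl (wd w))"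
  proof -
    have "diffTT (snd_incl (df b)) = (\<Oplus>\<^bsub>TT\<^esub>w\<in>words b. snd_incl (leftT (scalA (\<alpha> b w)) \<otimes>\<^bsub>T\<^esub> wd w))"
      unfolding diffTT_snd[OF df_closed[OF b]] diffT_df_1[OF b] diff_df_word[OF b] using k W
      by (intro additive_finsum[OF Ta.BA_abelian_group TTp.TR_abelian ring_hom_additive[OF snd_incl_hom]]) auto
    also have "\<dots> = (\<Oplus>\<^bsub>TT\<^esub>w\<in>words b. ?c w \<otimes>\<^bsub>TT\<^esub> snd_incl (wd w))"
      using k W c by (intro TTp.TR.finsum_cong') (auto simp: snd_incl_mult sc)
    finally show ?thesis .
  qed
  have H: "?c w \<otimes>\<^bsub>TT\<^esub> fst_incl (wd w) \<oplus>\<^bsub>TT\<^esub> ?c w \<otimes>\<^bsub>TT\<^esub> snd_incl (wd w) = diffTT (?c w \<otimes>\<^bsub>TT\<^esub> corr w) \<oplus>\<^bsub>TT\<^esub> ?c w \<otimes>\<^bsub>TT\<^esub> wdTT w"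
    if w: "w \<in> words b" for w
  proof -
    have z: "diffTT (?c w) = \<zero>\<^bsub>TT\<^esub>" using k diffT_0[OF leftT_in[OF k]] by (simp add: diffTT_fst)
    have "diffTT (?c w \<otimes>\<^bsub>TT\<^esub> corr w) = ?c w \<otimes>\<^bsub>TT\<^esub> (fst_incl (wd w) \<oplus>\<^bsub>TT\<^esub> snd_incl (wd w) \<ominus>\<^bsub>TT\<^esub> wdTT w)"
      using diffTT_mult_even[OF fst_incl_in[OF leftT_in[OF k]] _ W(3)[OF w]] z diffTT_corr[OF words_set[OF b w]] W[OF w] c
      by simp
    then have "diffTT (?c w \<otimes>\<^bsub>TT\<^esub> corr w) \<oplus>\<^bsub>TT\<^esub> ?c w \<otimes>\<^bsub>TT\<^esub> wdTT w
        = ?c w \<otimes>\<^bsub>TT\<^esub> (fst_incl (wd w) \<oplus>\<^bsub>TT\<^esub> snd_incl (wd w) \<ominus>\<^bsub>TT\<^esub> wdTT w \<oplus>\<^bsub>TT\<^esub> wdTT w)"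
      using W[OF w] c by (simp add: TT.r_distr)
    also have "fst_incl (wd w) \<oplus>\<^bsub>TT\<^esub> snd_incl (wd w) \<ominus>\<^bsub>TT\<^esub> wdTT w \<oplus>\<^bsub>TT\<^esub> wdTT w = fst_incl (wd w) \<oplus>\<^bsub>TT\<^esub> snd_incl (wd w)"
      using W[OF w] by (simp add: a_minus_def TTp.TR.a_assoc TTp.TR.l_neg)
    finally show ?thesis using W[OF w] c by (simp add: TT.r_distr)
  qed
  let ?S = "\<Oplus>\<^bsub>TT\<^esub>w\<in>words b. ?c w \<otimes>\<^bsub>TT\<^esub> corr w" and ?D = "\<Oplus>\<^bsub>TT\<^esub>w\<in>words b. ?c w \<otimes>\<^bsub>TT\<^esub> wdTT w"
  have S: "?S \<in> carrier TT" "?D \<in> carrier TT" using W c by (auto intro!: TTp.TR.finsum_closed)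
  have "diffTT (fst_incl (df b)) \<oplus>\<^bsub>TT\<^esub> diffTT (snd_incl (df b))
      = (\<Oplus>\<^bsub>TT\<^esub>w\<in>words b. ?c w \<otimes>\<^bsub>TT\<^esub> fst_incl (wd w) \<oplus>\<^bsub>TT\<^esub> ?c w \<otimes>\<^bsub>TT\<^esub> snd_incl (wd w))"
    unfolding F G using W c by (intro TTp.TR.finsum_addf[symmetric]) auto
  also have "\<dots> = (\<Oplus>\<^bsub>TT\<^esub>w\<in>words b. diffTT (?c w \<otimes>\<^bsub>TT\<^esub> corr w) \<oplus>\<^bsub>TT\<^esub> ?c w \<otimes>\<^bsub>TT\<^esub> wdTT w)"
    using W c H by (intro TTp.TR.finsum_cong') auto
  also have "\<dots> = (\<Oplus>\<^bsub>TT\<^esub>w\<in>words b. diffTT (?c w \<otimes>\<^bsub>TT\<^esub> corr w)) \<oplus>\<^bsub>TT\<^esub> ?D"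
    using W c by (intro TTp.TR.finsum_addf) auto
  also have "(\<Oplus>\<^bsub>TT\<^esub>w\<in>words b. diffTT (?c w \<otimes>\<^bsub>TT\<^esub> corr w)) = diffTT ?S"
    using W c by (intro diffTT_finsum[symmetric]) auto
  finally have e: "diffTT (fst_incl (df b)) \<oplus>\<^bsub>TT\<^esub> diffTT (snd_incl (df b)) = diffTT ?S \<oplus>\<^bsub>TT\<^esub> ?D" .
  have "diffTT (Phi_df b) = diffTT (fst_incl (df b)) \<oplus>\<^bsub>TT\<^esub> diffTT (snd_incl (df b)) \<ominus>\<^bsub>TT\<^esub> diffTT ?S"
    unfolding Phi_df_word[OF b] using b S by (simp add: diffTT_add diffTT_minus)
  also have "\<dots> = ?D" unfolding e using S by (intro TTp.TR.add_minus_cancel) simp_all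
  finally show ?thesis .
qed

end

context tate_setup
begin

section \<open>Existence and uniqueness of \<open>\<Phi>\<close>\<close>

lemma dpTT_in: "u \<in> grTT 2 \<Longrightarrow> dpTT n u \<in> grTT (2 * n)"
  and dpTT_0: "u \<in> grTT 2 \<Longrightarrow> dpTT 0 u = \<one>\<^bsub>TT\<^esub>"
  and dpTT_1: "u \<in> grTT 2 \<Longrightarrow> dpTT (Suc 0) u = u"
  and dpTT_mult: "u \<in> grTT 2 \<Longrightarrow> dpTT m u \<otimes>\<^bsub>TT\<^esub> dpTT n u = int ((m + n) choose m) \<odot>\<^bsub>TT\<^esub> dpTT (m + n) u"
  and dpTT_add: "\<lbrakk>u \<in> grTT 2; v \<in> grTT 2\<rbrakk> \<Longrightarrow>
    dpTT n (u \<oplus>\<^bsub>TT\<^esub> v) = (\<Oplus>\<^bsub>TT\<^esub>j\<in>{..n}. dpTT j u \<otimes>\<^bsub>TT\<^esub> dpTT (n - j) v)"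
  using divided_powers_in[OF dpTT, of 1 u n] divided_powers_0[OF dpTT, of 1 u] divided_powers_1[OF dpTT, of 1 u]
    divided_powers_mult[OF dpTT, of 1 u m n] divided_powers_add[OF dpTT, of 1 u v n]
  by (simp_all add: TTp.TR.int_mult_nat)

lemma dpTT_closed [simp]: "u \<in> grTT 2 \<Longrightarrow> dpTT n u \<in> carrier TT"
  by (rule grTT_carrier[OF dpTT_in])

lemma dpTT_odd: "\<lbrakk>s \<in> grT 1; t \<in> grT 1; n \<ge> 2\<rbrakk> \<Longrightarrow> dpTT n (tensT s t) = \<zero>\<^bsub>TT\<^esub>"
  using divided_powers_odd[OF dpTT, of "fst_incl s" 0 "snd_incl t" 0 n] fst_incl_in[of s 1] snd_incl_in[of t 1]
  by (simp add: fst_snd Ta.tgr_carrier)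

lemma outer_balanced: "Ae.balanced TT (\<lambda>p. tensT (leftT (fst p)) (rightT (snd p)))"
  unfolding Ae.balanced_def fst_conv snd_conv
proof (intro conjI ballI)
  fix a k c assume a: "a \<in> carrier A" "k \<in> carrier K" "c \<in> carrier A"
  then show "tensT (leftT (a \<otimes>\<^bsub>A\<^esub> scalA k)) (rightT c) = tensT (leftT a) (rightT (scalA k \<otimes>\<^bsub>A\<^esub> c))"
    using tensT_right_left[of "leftT a" "rightT c" "scalA k"]
    by (simp add: ring_hom_mult[OF leftT_hom] ring_hom_mult[OF rightT_hom] leftT_scalA)
qed (simp_all add: ring_hom_add[OF leftT_hom] ring_hom_add[OF rightT_hom] tensT_add_left tensT_add_right)

lemma outer_eq: "outer = add_lift TT (\<lambda>p. tensT (leftT (fst p)) (rightT (snd p)))"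
  unfolding outer_def add_lift_def ..

lemma outer_additive: "outer \<in> hom (add_monoid Aev) (add_monoid TT)"
  unfolding outer_eq by (rule Ae.tensor_lift_hom[OF TTp.TR_abelian outer_balanced])

lemma outer_tensA: "\<lbrakk>a \<in> carrier A; c \<in> carrier A\<rbrakk> \<Longrightarrow> outer (tensA a c) = tensT (leftT a) (rightT c)"
  unfolding outer_eq tensA_eq by (simp add: Ae.tensor_lift_tens[OF TTp.TR_abelian outer_balanced])

lemmas outer_closed [simp] = additive_closed[OF outer_additive]
lemmas outer_add = additive_add[OF outer_additive]
lemmas outer_zero [simp] = additive_zero[OF Aev.is_abelian_group TTp.TR_abelian outer_additive]

lemma outer_hom: "outer \<in> ring_hom Aev TT"
proof (rule ring_hom_memI)
  show "outer \<one>\<^bsub>Aev\<^esub> = \<one>\<^bsub>TT\<^esub>"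
    by (simp add: Aev_one outer_tensA ring_hom_one[OF leftT_hom] ring_hom_one[OF rightT_hom] TT_one)
  show "outer (x \<otimes>\<^bsub>Aev\<^esub> y) = outer x \<otimes>\<^bsub>TT\<^esub> outer y" if x: "x \<in> carrier Aev" and y: "y \<in> carrier Aev" for x y
  proof -
    have 1: "outer (tensA a c \<otimes>\<^bsub>Aev\<^esub> y) = outer (tensA a c) \<otimes>\<^bsub>TT\<^esub> outer y" if ac: "a \<in> carrier A" "c \<in> carrier A" for a c
      using y
    proof (induction rule: Aev_induct)
      case (tens a' c')
      then show ?case using ac tensT_mult[OF _ _ leftT_in, of "leftT a" "rightT c" a' "rightT c'"]
        by (simp add: tensA_mult outer_tensA ring_hom_mult[OF leftT_hom] ring_hom_mult[OF rightT_hom] signpow_def)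
    qed (use ac in \<open>simp_all add: Aev.r_distr TT.r_distr outer_add\<close>)
    show ?thesis using x
      by (induction rule: Aev_induct) (use y 1 in \<open>simp_all add: Aev.l_distr TT.l_distr outer_add\<close>)
  qed
qed (simp_all add: outer_add)

lemma outer_in: "r \<in> carrier Aev \<Longrightarrow> outer r \<in> grTT 0"
proof (induction rule: Aev_induct)
  case (tens a c)
  then show ?case using grTT_tens[OF leftT_in rightT_in, of a c] by (simp add: outer_tensA)
qed (simp_all add: outer_add grTT_add)

lemma diffTT_outer: "r \<in> carrier Aev \<Longrightarrow> diffTT (outer r) = \<zero>\<^bsub>TT\<^esub>"
  by (induction rule: Aev_induct) (simp_all add: outer_add diffTT_add outer_tensA diffTT_tensT diffT_0 leftT_in rightT_in)

context
  fixes \<Phi> assumes \<Phi>: "is_Phi \<Phi>"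
begin

lemma Phi_hom: "\<Phi> \<in> ring_hom T TT"
  and Phi_in: "u \<in> grT n \<Longrightarrow> \<Phi> u \<in> grTT n"
  and Phi_scalT_tensA: "\<lbrakk>a \<in> carrier A; c \<in> carrier A\<rbrakk> \<Longrightarrow> \<Phi> (scalT (tensA a c)) = tensT (leftT a) (rightT c)"
  and Phi_dx: "x \<in> X \<Longrightarrow> \<Phi> (dx x) = fst_incl (dx x) \<oplus>\<^bsub>TT\<^esub> snd_incl (dx x)"
  using \<Phi> by (auto simp: is_Phi_def divided_power_hom_def)

lemmas Phi_closed [simp] = ring_hom_closed[OF Phi_hom]
lemmas Phi_add = ring_hom_add[OF Phi_hom]
lemmas Phi_mult = ring_hom_mult[OF Phi_hom]
lemmas Phi_one = ring_hom_one[OF Phi_hom]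
lemmas Phi_zero [simp] = additive_zero[OF Ta.BA_abelian_group TTp.TR_abelian ring_hom_additive[OF Phi_hom]]
lemmas Phi_minus = additive_minus[OF Ta.BA_abelian_group TTp.TR_abelian ring_hom_additive[OF Phi_hom]]

text \<open>\<open>is_Phi\<close> prescribes only the value at \<open>df b\<close>; the values at
  its divided powers are forced because \<Phi> preserves them.\<close>

lemma Phi_df_pow:
  assumes b: "b \<in> B" shows "\<Phi> (df_pow b n) = dpTT n (Phi_df b)"
proof -
  have "\<Phi> (dpT n (df b)) = dpTT n (\<Phi> (df b))"
    using \<Phi> df_in[OF b] unfolding is_Phi_def divided_power_hom_def
    by (metis mult.right_neutral zero_less_one)
  then show ?thesis using \<Phi> b by (simp add: dpT_df is_Phi_def)
qed

lemma Phi_scalT: "r \<in> carrier Aev \<Longrightarrow> \<Phi> (scalT r) = outer r"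
  by (induction rule: Aev_induct)
    (simp_all add: Phi_scalT_tensA outer_tensA outer_add ring_hom_add[OF scalT_hom] Phi_add
      additive_zero[OF Aev.is_abelian_group Ta.BA_abelian_group ring_hom_additive[OF scalT_hom]])

lemma Phi_leftT: "a \<in> carrier A \<Longrightarrow> \<Phi> (leftT a) = fst_incl (leftT a)"
  and Phi_rightT: "a \<in> carrier A \<Longrightarrow> \<Phi> (rightT a) = snd_incl (rightT a)"
  using Phi_scalT_tensA[of a "\<one>\<^bsub>A\<^esub>"] Phi_scalT_tensA[of "\<one>\<^bsub>A\<^esub>" a]
  by (simp_all add: leftT_def[of a] rightT_def[of a] ring_hom_one[OF leftT_hom] ring_hom_one[OF rightT_hom] fst_incl_def snd_incl_def)

lemma Phi_diff_df: assumes b: "b \<in> B" shows "\<Phi> (diff_df b) = diffTT (Phi_df b)"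
proof -
  have k: "scalA (\<alpha> b w) \<in> carrier A" for w using \<alpha>_closed[OF b] by simp
  have W: "wd w \<in> carrier T" if "w \<in> words b" for w
    using word_T_closed(3) words_set[OF b that] by blast
  have wd: "\<Phi> (wd w) = wdTT w" if w: "w \<in> words b" for w
    by (rule ring_hom_word_deriv[OF T_ring TT_ring Phi_hom])
      (use words_set[OF b w] in \<open>auto simp: Phi_leftT Phi_rightT Phi_dx subset_iff\<close>)
  have "\<Phi> (diff_df b) = (\<Oplus>\<^bsub>TT\<^esub>w\<in>words b. \<Phi> (leftT (scalA (\<alpha> b w)) \<otimes>\<^bsub>T\<^esub> wd w))"
    unfolding diff_df_word[OF b] using k W
    by (intro additive_finsum[OF Ta.BA_abelian_group TTp.TR_abelian ring_hom_additive[OF Phi_hom]]) auto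
  also have "\<dots> = diffTT (Phi_df b)"
    unfolding diffTT_Phi_df[OF b] using k W wd wdTT_closed words_set[OF b]
    by (intro TTp.TR.finsum_cong') (auto simp: Phi_mult Phi_leftT)
  finally show ?thesis .
qed

end

lemma Phi_unique:
  assumes \<Phi>: "is_Phi \<Phi>" and \<Psi>: "is_Phi \<Psi>" and u: "u \<in> carrier T" shows "\<Phi> u = \<Psi> u"
  using u
  by (induction rule: T_induct)
    (simp_all add: Phi_zero[OF \<Phi>] Phi_zero[OF \<Psi>] Phi_add[OF \<Phi>] Phi_add[OF \<Psi>] Phi_one[OF \<Phi>] Phi_one[OF \<Psi>]
      Phi_mult[OF \<Phi>] Phi_mult[OF \<Psi>] Phi_scalT[OF \<Phi>] Phi_scalT[OF \<Psi>] Phi_dx[OF \<Phi>] Phi_dx[OF \<Psi>]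
      Phi_df_pow[OF \<Phi>] Phi_df_pow[OF \<Psi>])

text \<open>The divided powers of \<open>Phi_df b\<close> are taken as the sequence
  \<open>y b\<close> in the universal property. Compatibility with all divided powers then follows
  from the generators by \<open>dp_homI\<close>.\<close>

lemma Phi_exists: "\<exists>\<Phi>. \<Phi> \<in> extensional (carrier T) \<and> is_Phi \<Phi>"
proof -
  let ?g = "\<lambda>a. fst_incl (dx a) \<oplus>\<^bsub>TT\<^esub> snd_incl (dx a)" and ?y = "\<lambda>b n. dpTT n (Phi_df b)"
  interpret P: tate_target TT grTT X B ?g ?y
    by (intro tate_target.intro TT_graded tate_target_axioms.intro)
      (simp_all add: grTT_add fst_incl_in[OF dx_in, simplified] snd_incl_in[OF dx_in, simplified] dpTT_in dpTT_0 dpTT_mult Phi_df_in)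
  obtain h where h: "h \<in> ring_hom T TT"
      "\<And>m r. \<lbrakk>m \<in> tate_monomials X B; r \<in> carrier Aev\<rbrakk> \<Longrightarrow> h (basis_term Aev m r) = outer r \<otimes>\<^bsub>TT\<^esub> P.tmon m"
      "\<And>n. h ` tate_alg.tgr Aev X B n \<subseteq> grTT n"
    by (rule P.tate_lift[OF Aev_cring outer_hom outer_in, folded T_def], assumption) (rule that; blast)
  have tgr: "tate_alg.tgr Aev X B n = grT n" for n
    unfolding tate_alg.tgr_def[OF tate_alg.intro[OF Aev_cring]] grT_def T_def ..
  \<comment> \<open>Uniqueness as a function requires fixed values off the carrier; the restriction
    is the extensional representative.\<close>
  let ?h = "restrict h (carrier T)"
  have hom: "?h \<in> ring_hom T TT"
    using h(1) by (auto simp: ring_hom_def Pi_iff)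
  have gr: "?h ` grT n \<subseteq> grTT n" for n
    using h(3)[of n, unfolded tgr] Ta.tgr_carrier[of _ n] by auto
  have o: "outer \<one>\<^bsub>Aev\<^esub> = \<one>\<^bsub>TT\<^esub>" by (rule ring_hom_one[OF outer_hom])
  have scal: "?h (scalT r) = outer r" if "r \<in> carrier Aev" for r
    using that h(2)[of "({}, {#})" r] by (simp add: scalT_eq[symmetric])
  have dx: "?h (dx a) = ?g a" if "a \<in> X" for a
    using that h(2)[of "({a}, {#})" "\<one>\<^bsub>Aev\<^esub>"] by (simp add: dx_def[symmetric] P.tmon_g o)
  have df: "?h (df_pow b n) = dpTT n (Phi_df b)" if "b \<in> B" for b n
  proof -
    have "h (df_pow b n) = outer \<one>\<^bsub>Aev\<^esub> \<otimes>\<^bsub>TT\<^esub> P.tmon ({}, replicate_mset n b)"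
      unfolding df_pow_def using that by (intro h(2)) auto
    then show ?thesis using that by (simp add: P.tmon_y o Phi_df_in)
  qed
  have df1: "?h (df b) = Phi_df b" if "b \<in> B" for b
    using df[OF that, of 1] dpTT_1[OF Phi_df_in[OF that]] that by (simp add: df_eq)
  have "divided_power_hom T grT dpT TT grTT dpTT ?h"
    by (rule dp_homI[OF TT_graded dpTT hom gr]) (simp only: df df1)
  then have "is_Phi ?h" unfolding is_Phi_def using scal dx df1 by (simp add: outer_tensA)
  then show ?thesis by blast
qed

section \<open>Compatibility with the differentials\<close>

text \<open>Compatibility of the differential with the divided powers of one element. It suffices to
  have it for the summands of \<open>Phi_df b\<close> and to know that it passes to sums.\<close>

definition dp_deriv where
  "dp_deriv u \<longleftrightarrow> u \<in> grTT 2 \<and> (\<forall>n. diffTT (dpTT (Suc n) u) = dpTT n u \<otimes>\<^bsub>TT\<^esub> diffTT u)"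

text \<open>The addition formula and the Leibniz rule give two convolution sums. One loses its term
  at j = 0 and the other its last term, because the boundary of one is zero; after the shift each is
  the n-th divided power of the sum times one of the two boundaries.\<close>

lemma dp_deriv_add:
  assumes "dp_deriv u" "dp_deriv v" shows "dp_deriv (u \<oplus>\<^bsub>TT\<^esub> v)"
proof -
  have u: "u \<in> grTT 2" and v: "v \<in> grTT 2"
    and du: "\<And>n. diffTT (dpTT (Suc n) u) = dpTT n u \<otimes>\<^bsub>TT\<^esub> diffTT u"
    and dv: "\<And>n. diffTT (dpTT (Suc n) v) = dpTT n v \<otimes>\<^bsub>TT\<^esub> diffTT v"
    using assms by (auto simp: dp_deriv_def)
  note [simp] = u v grTT_carrier[OF u] grTT_carrier[OF v]
  have one: "diffTT \<one>\<^bsub>TT\<^esub> = \<zero>\<^bsub>TT\<^esub>"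
    using diffTT_fst[of "\<one>\<^bsub>T\<^esub>"] by (simp add: fst_incl_one diffT_one)
  have "diffTT (dpTT (Suc n) (u \<oplus>\<^bsub>TT\<^esub> v)) = dpTT n (u \<oplus>\<^bsub>TT\<^esub> v) \<otimes>\<^bsub>TT\<^esub> diffTT (u \<oplus>\<^bsub>TT\<^esub> v)" for n
  proof -
    let ?p = "\<lambda>j. dpTT j u" and ?q = "\<lambda>j. dpTT j v"
    have "diffTT (dpTT (Suc n) (u \<oplus>\<^bsub>TT\<^esub> v)) = (\<Oplus>\<^bsub>TT\<^esub>j\<in>{..Suc n}. diffTT (?p j \<otimes>\<^bsub>TT\<^esub> ?q (Suc n - j)))"
      unfolding dpTT_add[OF u v] by (intro diffTT_finsum) auto
    also have "\<dots> = (\<Oplus>\<^bsub>TT\<^esub>j\<in>{..Suc n}. diffTT (?p j) \<otimes>\<^bsub>TT\<^esub> ?q (Suc n - j) \<oplus>\<^bsub>TT\<^esub> ?p j \<otimes>\<^bsub>TT\<^esub> diffTT (?q (Suc n - j)))"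
    proof (intro TTp.TR.finsum_cong' refl)
      show "diffTT (?p j \<otimes>\<^bsub>TT\<^esub> ?q (Suc n - j)) = diffTT (?p j) \<otimes>\<^bsub>TT\<^esub> ?q (Suc n - j) \<oplus>\<^bsub>TT\<^esub> ?p j \<otimes>\<^bsub>TT\<^esub> diffTT (?q (Suc n - j))" for j
        by (rule diffTT_mult_even[OF dpTT_in]) simp_all
    qed auto
    also have "\<dots> = (\<Oplus>\<^bsub>TT\<^esub>j\<in>{..Suc n}. diffTT (?p j) \<otimes>\<^bsub>TT\<^esub> ?q (Suc n - j))
        \<oplus>\<^bsub>TT\<^esub> (\<Oplus>\<^bsub>TT\<^esub>j\<in>{..Suc n}. ?p j \<otimes>\<^bsub>TT\<^esub> diffTT (?q (Suc n - j)))"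
      by (intro TTp.TR.finsum_addf) auto
    also have "(\<Oplus>\<^bsub>TT\<^esub>j\<in>{..Suc n}. diffTT (?p j) \<otimes>\<^bsub>TT\<^esub> ?q (Suc n - j)) = dpTT n (u \<oplus>\<^bsub>TT\<^esub> v) \<otimes>\<^bsub>TT\<^esub> diffTT u"
    proof -
      have "(\<Oplus>\<^bsub>TT\<^esub>j\<in>{..Suc n}. diffTT (?p j) \<otimes>\<^bsub>TT\<^esub> ?q (Suc n - j)) = (\<Oplus>\<^bsub>TT\<^esub>j\<in>{..n}. diffTT (?p (Suc j)) \<otimes>\<^bsub>TT\<^esub> ?q (n - j))"
        by (subst TTp.TR.finsum_Suc2) (auto simp: dpTT_0 one)
      also have "\<dots> = (\<Oplus>\<^bsub>TT\<^esub>j\<in>{..n}. (?p j \<otimes>\<^bsub>TT\<^esub> ?q (n - j)) \<otimes>\<^bsub>TT\<^esub> diffTT u)"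
      proof (intro TTp.TR.finsum_cong' refl)
        fix j
        have "diffTT u \<otimes>\<^bsub>TT\<^esub> ?q (n - j) = ?q (n - j) \<otimes>\<^bsub>TT\<^esub> diffTT u"
          by (rule TT_even_central[OF dpTT_in, symmetric]) auto
        then show "diffTT (?p (Suc j)) \<otimes>\<^bsub>TT\<^esub> ?q (n - j) = (?p j \<otimes>\<^bsub>TT\<^esub> ?q (n - j)) \<otimes>\<^bsub>TT\<^esub> diffTT u"
          by (simp add: du TT.m_assoc)
      qed auto
      also have "\<dots> = dpTT n (u \<oplus>\<^bsub>TT\<^esub> v) \<otimes>\<^bsub>TT\<^esub> diffTT u"
        unfolding dpTT_add[OF u v] by (intro TT.finsum_ldistr[symmetric]) auto
      finally show ?thesis .
    qed
    also have "(\<Oplus>\<^bsub>TT\<^esub>j\<in>{..Suc n}. ?p j \<otimes>\<^bsub>TT\<^esub> diffTT (?q (Suc n - j))) = dpTT n (u \<oplus>\<^bsub>TT\<^esub> v) \<otimes>\<^bsub>TT\<^esub> diffTT v"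
    proof -
      have "(\<Oplus>\<^bsub>TT\<^esub>j\<in>{..Suc n}. ?p j \<otimes>\<^bsub>TT\<^esub> diffTT (?q (Suc n - j))) = (\<Oplus>\<^bsub>TT\<^esub>j\<in>{..n}. ?p j \<otimes>\<^bsub>TT\<^esub> diffTT (?q (Suc n - j)))"
        by (subst TTp.TR.finsum_Suc) (auto simp: dpTT_0 one)
      also have "\<dots> = (\<Oplus>\<^bsub>TT\<^esub>j\<in>{..n}. (?p j \<otimes>\<^bsub>TT\<^esub> ?q (n - j)) \<otimes>\<^bsub>TT\<^esub> diffTT v)"
        by (intro TTp.TR.finsum_cong') (auto simp: Suc_diff_le dv TT.m_assoc)
      also have "\<dots> = dpTT n (u \<oplus>\<^bsub>TT\<^esub> v) \<otimes>\<^bsub>TT\<^esub> diffTT v"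
        unfolding dpTT_add[OF u v] by (intro TT.finsum_ldistr[symmetric]) auto
      finally show ?thesis .
    qed
    finally show ?thesis by (simp add: diffTT_add TT.r_distr grTT_add)
  qed
  then show ?thesis by (simp add: dp_deriv_def grTT_add)
qed

lemma dpTT_zero: "dpTT (Suc n) \<zero>\<^bsub>TT\<^esub> = \<zero>\<^bsub>TT\<^esub>"
  by (rule TTg.divided_powers_zero[OF dpTT]) simp

text \<open>The second divided power is zero, so at n = 1 the rule demands that the tensor times its
  own boundary vanish. It does: one part of that product contains \<open>t\<close> twice, and the
  other contains \<open>s\<close> twice.\<close>

lemma dp_deriv_tens: assumes s: "s \<in> grT 1" and t: "t \<in> grT 1" shows "dp_deriv (tensT s t)"
proof -
  note c [simp] = Ta.tgr_carrier[OF s] Ta.tgr_carrier[OF t]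
  have y: "tensT s t \<in> grTT 2" using grTT_tens[OF s t] by (simp add: numeral_2_eq_2)
  have sq: "s \<otimes>\<^bsub>T\<^esub> s = \<zero>\<^bsub>T\<^esub>" "t \<otimes>\<^bsub>T\<^esub> t = \<zero>\<^bsub>T\<^esub>" using Ta.TA.gr_sq[OF s] Ta.TA.gr_sq[OF t] by simp_all
  have z: "tensT s t \<otimes>\<^bsub>TT\<^esub> diffTT (tensT s t) = \<zero>\<^bsub>TT\<^esub>"
  proof -
    have "diffT s \<in> grT 0" using diffT_gr(1)[OF s] by simp
    then have "tensT s t \<otimes>\<^bsub>TT\<^esub> tensT (diffT s) t = \<zero>\<^bsub>TT\<^esub>"
      using tensT_mult[of s t "diffT s" 0 t] sq by (simp add: signpow_def)
    moreover have "tensT s t \<otimes>\<^bsub>TT\<^esub> tensT (signT s) (diffT t) = \<zero>\<^bsub>TT\<^esub>"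
      using tensT_mult[OF _ _ signT_in[OF s], of s t "diffT t"] sq signT_gr[OF s] by (simp add: Ta.BA.r_minus)
    ultimately show ?thesis by (simp add: diffTT_tensT TT.r_distr)
  qed
  have "diffTT (dpTT (Suc n) (tensT s t)) = dpTT n (tensT s t) \<otimes>\<^bsub>TT\<^esub> diffTT (tensT s t)" for n
  proof (cases "n = 0")
    case False
    then have "dpTT (Suc n) (tensT s t) = \<zero>\<^bsub>TT\<^esub>" by (intro dpTT_odd[OF s t]) simp
    moreover have "dpTT n (tensT s t) \<otimes>\<^bsub>TT\<^esub> diffTT (tensT s t) = \<zero>\<^bsub>TT\<^esub>"
    proof (cases "n = 1")
      case True
      then show ?thesis using z dpTT_1[OF y] by simp
    next
      case n: False
      then have "dpTT n (tensT s t) = \<zero>\<^bsub>TT\<^esub>" using \<open>n \<noteq> 0\<close> by (intro dpTT_odd[OF s t]) simp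
      then show ?thesis by simp
    qed
    ultimately show ?thesis by simp
  qed (simp add: dpTT_1[OF y] dpTT_0[OF y])
  then show ?thesis using y by (simp add: dp_deriv_def)
qed

lemma dp_deriv_odd_sum: "odd_sum u \<Longrightarrow> dp_deriv u"
  by (induction rule: odd_sum.induct)
    (simp_all add: dp_deriv_add dp_deriv_tens[unfolded One_nat_def] dp_deriv_def[of "\<zero>\<^bsub>TT\<^esub>"] dpTT_zero)

lemma dp_deriv_df: assumes b: "b \<in> B" shows "dp_deriv (fst_incl (df b))" "dp_deriv (snd_incl (df b))"
  using b incl_df_in[OF b]
  by (simp_all add: dp_deriv_def dpTT_fst_df dpTT_snd_df diffTT_fst diffTT_snd diffT_df diffT_df_1 fst_incl_mult snd_incl_mult)

lemma dp_deriv_Phi_df: "b \<in> B \<Longrightarrow> dp_deriv (Phi_df b)"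
  by (rule Phi_df_odd_sum[of b]) (simp_all add: dp_deriv_add dp_deriv_df dp_deriv_odd_sum)

lemma Phi_diffT:
  assumes \<Phi>: "is_Phi \<Phi>" and u: "u \<in> carrier T" shows "\<Phi> (diffT u) = diffTT (\<Phi> u)"
  using u
proof (induction rule: T_induct)
  case one
  then show ?case using diffTT_fst[of "\<one>\<^bsub>T\<^esub>"] by (simp add: Phi_zero[OF \<Phi>] Phi_one[OF \<Phi>] fst_incl_one diffT_one)
next
  case (scal r u)
  then show ?case using diffTT_mult_even[OF outer_in, of r "\<Phi> u"] Phi_closed[OF \<Phi>]
    by (simp add: diffT_scal Phi_mult[OF \<Phi>] Phi_scalT[OF \<Phi>] diffTT_outer)
next
  case (dx a u)
  have v: "varA a \<in> carrier A" using dx by simp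
  have g: "fst_incl (dx a) \<oplus>\<^bsub>TT\<^esub> snd_incl (dx a) \<in> grTT 1"
    using dx by (intro grTT_add fst_incl_in snd_incl_in dx_in)
  \<comment> \<open>The middle variable cancels: (x - x') + (x'' - x) = x'' - x'.\<close>
  have "diffTT (fst_incl (dx a) \<oplus>\<^bsub>TT\<^esub> snd_incl (dx a)) = \<Phi> (tv a)"
  proof -
    have "diffTT (fst_incl (dx a) \<oplus>\<^bsub>TT\<^esub> snd_incl (dx a)) = snd_incl (xL a) \<ominus>\<^bsub>TT\<^esub> fst_incl (xL a) \<oplus>\<^bsub>TT\<^esub> (snd_incl (xR a) \<ominus>\<^bsub>TT\<^esub> snd_incl (xL a))"
      using dx v by (simp add: diffTT_add diffTT_fst diffTT_snd diffT_dx tv_def middle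
          additive_minus[OF Ta.BA_abelian_group TTp.TR_abelian ring_hom_additive[OF fst_incl_hom]]
          additive_minus[OF Ta.BA_abelian_group TTp.TR_abelian ring_hom_additive[OF snd_incl_hom]])
    also have "\<dots> = snd_incl (xL a) \<oplus>\<^bsub>TT\<^esub> (snd_incl (xR a) \<ominus>\<^bsub>TT\<^esub> fst_incl (xL a)) \<ominus>\<^bsub>TT\<^esub> snd_incl (xL a)"
      using v by (simp add: a_minus_def TTp.TR.a_ac)
    also have "\<dots> = snd_incl (xR a) \<ominus>\<^bsub>TT\<^esub> fst_incl (xL a)"
      using v by (intro TTp.TR.add_minus_cancel) simp_all
    also have "\<dots> = \<Phi> (tv a)" using v by (simp add: tv_def Phi_minus[OF \<Phi>] Phi_leftT[OF \<Phi>] Phi_rightT[OF \<Phi>])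
    finally show ?thesis .
  qed
  then show ?case using dx diffTT_mult_odd[OF g, of "\<Phi> u"] Phi_closed[OF \<Phi>]
    by (simp add: diffT_dx_mult Phi_minus[OF \<Phi>] Phi_mult[OF \<Phi>] Phi_dx[OF \<Phi>])
next
  case (df b n u)
  show ?case
  proof (cases n)
    case (Suc k)
    note D = dp_deriv_Phi_df[OF df(1), unfolded dp_deriv_def, THEN conjunct2, rule_format]
    have "\<Phi> (diffT (df_pow b n \<otimes>\<^bsub>T\<^esub> u)) = dpTT k (Phi_df b) \<otimes>\<^bsub>TT\<^esub> diffTT (Phi_df b) \<otimes>\<^bsub>TT\<^esub> \<Phi> u \<oplus>\<^bsub>TT\<^esub> dpTT n (Phi_df b) \<otimes>\<^bsub>TT\<^esub> diffTT (\<Phi> u)"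
      using df unfolding Suc by (simp add: diffT_df_mult Phi_add[OF \<Phi>] Phi_mult[OF \<Phi>] Phi_df_pow[OF \<Phi>] Phi_diff_df[OF \<Phi>])
    also have "\<dots> = diffTT (dpTT n (Phi_df b) \<otimes>\<^bsub>TT\<^esub> \<Phi> u)"
      using diffTT_mult_even[OF dpTT_in[OF Phi_df_in[OF df(1)]], of n "\<Phi> u"] Phi_closed[OF \<Phi> df(2)] D[of k] unfolding Suc by simp
    finally show ?thesis using df by (simp add: Phi_mult[OF \<Phi>] Phi_df_pow[OF \<Phi>])
  qed (use df in simp)
qed (simp_all add: Phi_zero[OF \<Phi>] Phi_add[OF \<Phi>] Phi_closed[OF \<Phi>] diffT_add diffTT_add)

section \<open>The counit\<close>

text \<open>Both counits are covered at once: \<open>i\<close> includes the factor whose positive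
  part \<open>E\<close> kills, \<open>j\<close> the one on which \<open>E\<close> is the identity.
  By the addition formula a summand whose positive divided powers are killed may be dropped inside a
  divided power (\<open>E_sum\<close>). This removes first the correction and then the copy of
  \<open>df b\<close> under \<open>i\<close>.\<close>

lemma counit_identity:
  assumes \<Phi>: "is_Phi \<Phi>" and u: "u \<in> carrier T" and E: "E \<in> ring_hom TT T"
    and ij: "(i, j) = (fst_incl, snd_incl) \<or> (i, j) = (snd_incl, fst_incl)"
    and i: "\<And>n s. \<lbrakk>s \<in> grT n; n > 0\<rbrakk> \<Longrightarrow> E (i s) = \<zero>\<^bsub>T\<^esub>" and j: "\<And>s. s \<in> carrier T \<Longrightarrow> E (j s) = s"
    and outer: "\<And>a c. \<lbrakk>a \<in> carrier A; c \<in> carrier A\<rbrakk> \<Longrightarrow> E (tensT (leftT a) (rightT c)) = leftT a \<otimes>\<^bsub>T\<^esub> rightT c"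
  shows "E (\<Phi> u) = u"
proof -
  have E0: "E \<zero>\<^bsub>TT\<^esub> = \<zero>\<^bsub>T\<^esub>" by (rule additive_zero[OF TTp.TR_abelian Ta.BA_abelian_group ring_hom_additive[OF E]])
  note Ec [simp] = ring_hom_closed[OF E]
  have E_outer: "E (outer r) = scalT r" if "r \<in> carrier Aev" for r
    using that by (induction rule: Aev_induct)
      (simp_all add: outer_tensA outer scalT_tensA outer_add ring_hom_add[OF scalT_hom] ring_hom_add[OF E] E0
        additive_zero[OF Aev.is_abelian_group Ta.BA_abelian_group ring_hom_additive[OF scalT_hom]])
  have E_sum: "E (dpTT n (y \<oplus>\<^bsub>TT\<^esub> z)) = E (dpTT n z)"
    if y: "y \<in> grTT 2" "\<And>n. n > 0 \<Longrightarrow> E (dpTT n y) = \<zero>\<^bsub>T\<^esub>" and z: "z \<in> grTT 2" for n y z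
  proof -
    have "E (dpTT n (y \<oplus>\<^bsub>TT\<^esub> z)) = (\<Oplus>\<^bsub>T\<^esub>k\<in>{..n}. E (dpTT k y \<otimes>\<^bsub>TT\<^esub> dpTT (n - k) z))"
      unfolding dpTT_add[OF y(1) z] using y z
      by (intro additive_finsum[OF TTp.TR_abelian Ta.BA_abelian_group ring_hom_additive[OF E]]) auto
    also have "\<dots> = E (dpTT 0 y \<otimes>\<^bsub>TT\<^esub> dpTT (n - 0) z)"
      using y z by (intro Ta.BA.finsum_delta) (auto simp: ring_hom_mult[OF E])
    finally show ?thesis using y z by (simp add: dpTT_0)
  qed
  have tens: "E (tensT s t) = \<zero>\<^bsub>T\<^esub>" if s: "s \<in> grT 1" and t: "t \<in> grT 1" for s t
    using that Ta.tgr_carrier[OF s] Ta.tgr_carrier[OF t] i[OF s] i[OF t] ij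
    by (auto simp: fst_snd[symmetric] ring_hom_mult[OF E])
  have odd: "E (dpTT n q) = \<zero>\<^bsub>T\<^esub>" if "odd_sum q" "n > 0" for q n
    using that
  proof (induction arbitrary: n rule: odd_sum.induct)
    case odd_sum_zero
    then show ?case using dpTT_zero[of "n - 1"] E0 by simp
  next
    case (odd_sum_add y z)
    then show ?case using E_sum[of y z n] odd_sum_in by simp
  next
    case (odd_sum_tens s t)
    have y: "tensT s t \<in> grTT 2" using grTT_tens[OF odd_sum_tens(1,2)] by (simp add: numeral_2_eq_2)
    show ?case
    proof (cases "n = 1")
      case True
      then show ?thesis using tens[OF odd_sum_tens(1,2)] dpTT_1[OF y] by simp
    next
      case False
      then have "dpTT n (tensT s t) = \<zero>\<^bsub>TT\<^esub>" using odd_sum_tens by (intro dpTT_odd) auto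
      then show ?thesis using E0 by simp
    qed
  qed
  have E_dx: "E (fst_incl (dx a)) \<oplus>\<^bsub>T\<^esub> E (snd_incl (dx a)) = dx a" if "a \<in> X" for a
    using that ij i[OF dx_in[OF that]] j[of "dx a"] by auto
  have E_df: "E (dpTT n (Phi_df b)) = df_pow b n" if b: "b \<in> B" for b n
  proof (rule Phi_df_odd_sum[OF b])
    fix q assume q: "odd_sum q" "Phi_df b = fst_incl (df b) \<oplus>\<^bsub>TT\<^esub> snd_incl (df b) \<oplus>\<^bsub>TT\<^esub> q"
    have ij_in: "i (df b) \<in> grTT 2" "j (df b) \<in> grTT 2" using ij incl_df_in[OF b] by auto
    have dp: "dpTT n (i (df b)) = i (df_pow b n)" "dpTT n (j (df b)) = j (df_pow b n)" for n
      using ij b by (auto simp: dpTT_fst_df dpTT_snd_df)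
    have iz: "E (dpTT n (i (df b))) = \<zero>\<^bsub>T\<^esub>" if "n > 0" for n
      unfolding dp using that by (intro i[OF df_pow_in[OF b]]) simp
    have "Phi_df b = q \<oplus>\<^bsub>TT\<^esub> (i (df b) \<oplus>\<^bsub>TT\<^esub> j (df b))"
      using ij grTT_carrier[OF odd_sum_in[OF q(1)]] b unfolding q(2) by (auto simp: TTp.TR.a_ac)
    then show ?thesis
      using E_sum[OF odd_sum_in[OF q(1)] odd[OF q(1)], of "i (df b) \<oplus>\<^bsub>TT\<^esub> j (df b)" n] E_sum[OF ij_in(1) iz ij_in(2), of n]
        ij_in grTT_add[OF ij_in] b by (simp add: dp j)
  qed
  show ?thesis using u
    by (induction rule: T_induct)
      (simp_all add: Phi_zero[OF \<Phi>] Phi_add[OF \<Phi>] Phi_one[OF \<Phi>] Phi_mult[OF \<Phi>] Phi_scalT[OF \<Phi>] Phi_dx[OF \<Phi>]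
        Phi_df_pow[OF \<Phi>] Phi_closed[OF \<Phi>] Phi_df_in E0 E_outer E_dx E_df ring_hom_add[OF E] ring_hom_mult[OF E] ring_hom_one[OF E])
qed

lemma aug_left_balanced: "TTp.balanced T (\<lambda>p. leftT (augT (fst p)) \<otimes>\<^bsub>T\<^esub> snd p)"
  and aug_right_balanced: "TTp.balanced T (\<lambda>p. fst p \<otimes>\<^bsub>T\<^esub> rightT (augT (snd p)))"
  unfolding TTp.balanced_def fst_conv snd_conv
  by (auto simp: additive_add[OF augT_additive] ring_hom_add[OF leftT_hom] ring_hom_add[OF rightT_hom] ring_hom_mult[OF leftT_hom]
      ring_hom_mult[OF rightT_hom] Ta.BA.l_distr Ta.BA.r_distr Ta.BA.m_assoc augT_mult augT_left augT_right)

lemma aug_left_eq: "aug_left = add_lift T (\<lambda>p. leftT (augT (fst p)) \<otimes>\<^bsub>T\<^esub> snd p)"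
  and aug_right_eq: "aug_right = add_lift T (\<lambda>p. fst p \<otimes>\<^bsub>T\<^esub> rightT (augT (snd p)))"
  by (simp_all add: aug_left_def aug_right_def add_lift_def)

lemma aug_left_additive: "aug_left \<in> hom (add_monoid TT) (add_monoid T)"
  unfolding aug_left_eq by (rule TTp.tensor_lift_hom[OF Ta.BA_abelian_group aug_left_balanced])

lemma aug_right_additive: "aug_right \<in> hom (add_monoid TT) (add_monoid T)"
  unfolding aug_right_eq by (rule TTp.tensor_lift_hom[OF Ta.BA_abelian_group aug_right_balanced])

lemma aug_left_tensT: "\<lbrakk>s \<in> carrier T; t \<in> carrier T\<rbrakk> \<Longrightarrow> aug_left (tensT s t) = leftT (augT s) \<otimes>\<^bsub>T\<^esub> t"
  unfolding aug_left_eq tensT_eq by (simp add: TTp.tensor_lift_tens[OF Ta.BA_abelian_group aug_left_balanced])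

lemma aug_right_tensT: "\<lbrakk>s \<in> carrier T; t \<in> carrier T\<rbrakk> \<Longrightarrow> aug_right (tensT s t) = s \<otimes>\<^bsub>T\<^esub> rightT (augT t)"
  unfolding aug_right_eq tensT_eq by (simp add: TTp.tensor_lift_tens[OF Ta.BA_abelian_group aug_right_balanced])

lemma leftT_zero [simp]: "leftT \<zero>\<^bsub>A\<^esub> = \<zero>\<^bsub>T\<^esub>" and rightT_zero [simp]: "rightT \<zero>\<^bsub>A\<^esub> = \<zero>\<^bsub>T\<^esub>"
  using additive_zero[OF A.is_abelian_group Ta.BA_abelian_group ring_hom_additive[OF leftT_hom]]
    additive_zero[OF A.is_abelian_group Ta.BA_abelian_group ring_hom_additive[OF rightT_hom]] by simp_all

text \<open>The involution acts by -1 only in odd degrees, where the augmentation is zero. This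
  absorbs the signs in the product of the tensor square.\<close>

lemma augT_signT: "t \<in> carrier T \<Longrightarrow> augT (signT t) = augT t"
proof (induction rule: T_gr_induct)
  case (gr n t)
  then show ?case using augT_pos[OF gr] augT_pos[OF signT_in[OF gr]] signT_gr[OF gr] by (cases "n = 0") simp_all
qed (simp_all add: additive_add[OF signT_additive] additive_add[OF augT_additive])

lemma augT_signpow: "t \<in> carrier T \<Longrightarrow> augT (signpow k t) = augT t"
  by (simp add: signpow_def augT_signT)

text \<open>On tensors of homogeneous elements the product has an explicit sign; multiplicativity is
  checked there and extended additively in each factor.\<close>

lemma additive_ring_homI:
  assumes h: "h \<in> hom (add_monoid TT) (add_monoid T)" and one: "h \<one>\<^bsub>TT\<^esub> = \<one>\<^bsub>T\<^esub>"
    and tens: "\<And>s t s' t' i j i' j'. \<lbrakk>s \<in> grT i; t \<in> grT j; s' \<in> grT i'; t' \<in> grT j'\<rbrakk> \<Longrightarrow>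
      h (tensT s t \<otimes>\<^bsub>TT\<^esub> tensT s' t') = h (tensT s t) \<otimes>\<^bsub>T\<^esub> h (tensT s' t')"
  shows "h \<in> ring_hom TT T"
proof (rule ring_hom_memI)
  note hc [simp] = additive_closed[OF h] and ha = additive_add[OF h]
    and hz [simp] = additive_zero[OF TTp.TR_abelian Ta.BA_abelian_group h]
  show "h (y \<otimes>\<^bsub>TT\<^esub> z) = h y \<otimes>\<^bsub>T\<^esub> h z" if y: "y \<in> carrier TT" and z: "z \<in> carrier TT" for y z
  proof -
    have 1: "h (tensT s t \<otimes>\<^bsub>TT\<^esub> z) = h (tensT s t) \<otimes>\<^bsub>T\<^esub> h z" if st: "s \<in> grT i" "t \<in> grT j" for s t i j
      using z
      by (induction rule: TT_induct)
        (use st[THEN Ta.tgr_carrier] tens[OF st] in \<open>simp_all add: TT.r_distr Ta.BA.r_distr ha\<close>)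
    show ?thesis using y
      by (induction rule: TT_induct) (use z 1 in \<open>simp_all add: TT.l_distr Ta.BA.l_distr ha\<close>)
  qed
qed (simp_all add: one additive_closed[OF h] additive_add[OF h])

lemma aug_left_hom: "aug_left \<in> ring_hom TT T"
proof (rule additive_ring_homI[OF aug_left_additive])
  show "aug_left \<one>\<^bsub>TT\<^esub> = \<one>\<^bsub>T\<^esub>" by (simp add: TT_one aug_left_tensT augT_one ring_hom_one[OF leftT_hom])
  fix s t s' t' i j i' j' assume st: "s \<in> grT i" "t \<in> grT j" "s' \<in> grT i'" "t' \<in> grT j'"
  note c [simp] = st[THEN Ta.tgr_carrier]
  have "aug_left (tensT s t \<otimes>\<^bsub>TT\<^esub> tensT s' t') = leftT (augT s) \<otimes>\<^bsub>T\<^esub> leftT (augT s') \<otimes>\<^bsub>T\<^esub> (signpow i' t \<otimes>\<^bsub>T\<^esub> t')"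
    by (simp add: tensT_mult[OF _ _ st(3)] aug_left_tensT augT_mult ring_hom_mult[OF leftT_hom])
  also have "\<dots> = leftT (augT s) \<otimes>\<^bsub>T\<^esub> t \<otimes>\<^bsub>T\<^esub> (leftT (augT s') \<otimes>\<^bsub>T\<^esub> t')"
  \<comment> \<open>In degree zero no sign arises. In positive degree the augmentation of
    \<open>s'\<close> is zero, so both sides vanish.\<close>
  proof (cases "i' = 0")
    case True
    have "leftT (augT s') \<otimes>\<^bsub>T\<^esub> (t \<otimes>\<^bsub>T\<^esub> t') = t \<otimes>\<^bsub>T\<^esub> (leftT (augT s') \<otimes>\<^bsub>T\<^esub> t')"
      using T_central[OF leftT_in, of "augT s'" t] by (simp flip: Ta.BA.m_assoc)
    then show ?thesis using True by (simp add: signpow_def Ta.BA.m_assoc)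
  qed (use augT_pos[OF st(3)] in simp)
  finally show "aug_left (tensT s t \<otimes>\<^bsub>TT\<^esub> tensT s' t') = aug_left (tensT s t) \<otimes>\<^bsub>T\<^esub> aug_left (tensT s' t')"
    by (simp add: aug_left_tensT)
qed

lemma aug_right_hom: "aug_right \<in> ring_hom TT T"
proof (rule additive_ring_homI[OF aug_right_additive])
  show "aug_right \<one>\<^bsub>TT\<^esub> = \<one>\<^bsub>T\<^esub>" by (simp add: TT_one aug_right_tensT augT_one ring_hom_one[OF rightT_hom])
  fix s t s' t' i j i' j' assume st: "s \<in> grT i" "t \<in> grT j" "s' \<in> grT i'" "t' \<in> grT j'"
  note c [simp] = st[THEN Ta.tgr_carrier]
  have "aug_right (tensT s t \<otimes>\<^bsub>TT\<^esub> tensT s' t') = s \<otimes>\<^bsub>T\<^esub> s' \<otimes>\<^bsub>T\<^esub> (rightT (augT t) \<otimes>\<^bsub>T\<^esub> rightT (augT t'))"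
    by (simp add: tensT_mult[OF _ _ st(3)] aug_right_tensT augT_mult augT_signpow ring_hom_mult[OF rightT_hom])
  also have "\<dots> = s \<otimes>\<^bsub>T\<^esub> rightT (augT t) \<otimes>\<^bsub>T\<^esub> (s' \<otimes>\<^bsub>T\<^esub> rightT (augT t'))"
  proof -
    have "s' \<otimes>\<^bsub>T\<^esub> (rightT (augT t) \<otimes>\<^bsub>T\<^esub> rightT (augT t')) = rightT (augT t) \<otimes>\<^bsub>T\<^esub> (s' \<otimes>\<^bsub>T\<^esub> rightT (augT t'))"
      using T_central[OF rightT_in, of "augT t" s'] by (simp flip: Ta.BA.m_assoc)
    then show ?thesis by (simp add: Ta.BA.m_assoc)
  qed
  finally show "aug_right (tensT s t \<otimes>\<^bsub>TT\<^esub> tensT s' t') = aug_right (tensT s t) \<otimes>\<^bsub>T\<^esub> aug_right (tensT s' t')"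
    by (simp add: aug_right_tensT)
qed

lemma aug_left_Phi: "\<lbrakk>is_Phi \<Phi>; u \<in> carrier T\<rbrakk> \<Longrightarrow> aug_left (\<Phi> u) = u"
  by (rule counit_identity[OF _ _ aug_left_hom, where i = fst_incl and j = snd_incl])
    (auto simp: fst_incl_def snd_incl_def aug_left_tensT augT_one augT_left augT_pos ring_hom_one[OF leftT_hom] Ta.tgr_carrier)

lemma aug_right_Phi: "\<lbrakk>is_Phi \<Phi>; u \<in> carrier T\<rbrakk> \<Longrightarrow> aug_right (\<Phi> u) = u"
  by (rule counit_identity[OF _ _ aug_right_hom, where i = snd_incl and j = fst_incl])
    (auto simp: fst_incl_def snd_incl_def aug_right_tensT augT_one augT_right augT_pos ring_hom_one[OF rightT_hom] Ta.tgr_carrier)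

lemma counital: "is_Phi \<Phi> \<Longrightarrow> counital_diagonal_approximation \<Phi>"
  unfolding counital_diagonal_approximation_def
  by (auto simp: Phi_closed Phi_add Phi_mult Phi_scalT Phi_in Phi_diffT aug_left_Phi aug_right_Phi)

lemma Phi_ex1: "\<exists>!\<Phi>. \<Phi> \<in> extensional (carrier T) \<and> is_Phi \<Phi>"
proof (rule ex_ex1I[OF Phi_exists])
  fix \<Phi> \<Psi> assume h: "\<Phi> \<in> extensional (carrier T) \<and> is_Phi \<Phi>" "\<Psi> \<in> extensional (carrier T) \<and> is_Phi \<Psi>"
  show "\<Phi> = \<Psi>"
    by (rule extensionalityI[OF h(1)[THEN conjunct1] h(2)[THEN conjunct1]])
      (rule Phi_unique[OF h(1)[THEN conjunct2] h(2)[THEN conjunct2]])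
qed

end

theorem proposition5p4:
  fixes K :: "('k, 'm) ring_scheme" and X :: "'x set" and I :: "('x multiset \<Rightarrow> 'k) set"
    and B :: "'b set" and f :: "'b \<Rightarrow> 'x multiset \<Rightarrow> 'k" and \<alpha> :: "'b \<Rightarrow> 'x list \<Rightarrow> 'k"
  assumes "cring K"
    and "ideal I (mpoly_ring K X)"
    and "\<forall>b\<in>B. f b \<in> I"
    and "classes_generate_conormal (mpoly_ring K X) I (f ` B)"
    and "\<forall>b\<in>B. range (\<alpha> b) \<subseteq> carrier K \<and> finite (tate_data.words K \<alpha> b) \<and> tate_data.words K \<alpha> b \<subseteq> lists X"
    and "\<forall>b\<in>B. f b = tate_data.presented_poly K X \<alpha> b"
  shows "(\<exists>!\<Phi>. \<Phi> \<in> extensional (carrier (tate_data.T K X I B)) \<and> tate_data.is_Phi K X I B \<alpha> \<Phi>)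
       \<and> (\<forall>\<Phi>. tate_data.is_Phi K X I B \<alpha> \<Phi>
            \<longrightarrow> tate_data.counital_diagonal_approximation K X I B \<alpha> \<Phi>)"
proof -
  interpret tate_setup K X I B \<alpha>
    by (rule tate_setup.intro) (use assms(1,2,5) in \<open>auto simp: image_subset_iff\<close>)
  show ?thesis using Phi_ex1 counital by blast
qed

end
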